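(* In the conditionally-missing-completely-at-random (CMCAR) setting described in the context, suppose that $\mathbf{P}^{(t+1)}=f_t(\widehat{\mathbf{\Sigma}}_t)$ for all $t\ge1$, where the $f_t$ are bounded, in the sense that there is a constant $\alpha$ so that for all $i,j$ and all $t$, $p_{ij}^{(t)}\ge\alpha>0$ almost surely. Suppose also that $\mathbf{x}$ satisfies the sub-Gaussian assumption stated in the context, that $n\ge3$, and that $N\ge e^2$, where $N=\sum_{t=1}^TN_t$. Then $$\mathbb{E}\left[\Vert\widehat{\mathbf{\Sigma}}_T-\mathbf{\Sigma}\Vert^2\right]^{1/2}\le\tilde C\,\Vert\mathbf{\Sigma}\Vert\sqrt{\log(n+1)}\left[\sqrt{\frac{8e\log(n)}{N}\varepsilon_1}+\frac{4e^2\log(n)L}{N}\varepsilon_2\right],$$ where $\tilde C$ is a universal constant, $L^2=\sum_{t=1}^T\log^2(N_t)$, and $\varepsilon_1,\varepsilon_2$ are given by $$\varepsilon_1=\mathbb{E}\left[\frac1N\sum_{t=1}^T\mathrm{r}_{\min}(\mathbf{\Sigma},\mathbf{P}^{(t)})N_t\right],\qquad \varepsilon_2^2=\mathbb{E}\left[\frac1{L^2}\sum_{t=1}^T\mathrm{r}_2^2(\mathbf{\Sigma},\mathbf{P}^{(t)})\log^2(N_t)\right].$$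
   Context: Notation: $[T]=\{1,\dots,T\}$; $\odot$ is the entrywise (Hadamard) product; $\Vert\cdot\Vert$ is the Euclidean norm on vectors and the operator norm (largest singular value) on matrices; $\log$ is the natural logarithm; $L$ and $\varepsilon_2$ denote nonnegative square roots. CMCAR setting: $\mathbf{x}$ is a zero-mean random vector in $\mathbb{R}^n$ with covariance matrix $\mathbf{\Sigma}=\mathbb{E}[\mathbf{x}\mathbf{x}^\top]=(\Sigma_{ij})\neq0$. At each time $t=1,2,\dots$ there are $N_t$ (a positive integer) observed vectors $\mathbf{y}^{(t,k)}=\boldsymbol\delta^{(t,k)}\odot\mathbf{x}^{(t,k)}$, $k\in[N_t]$, forming the columns of the $n\times N_t$ matrix $\mathbf{Y}_t$, where $\boldsymbol\delta^{(t,k)}\in\{0,1\}^n$. It is assumed that: (1) The complete data $\mathbf{x}^{(t,k)}$, over all $t$ and $k$, are i.i.d. copies of $\mathbf{x}$; the $\mathbf{x}^{(t,k)}$ at time $t$ are independent of the past observations $\{\mathbf{Y}_\tau:\tau<t\}$. (2) The sampling probabilities $p^{(t)}_{ij}=\mathbb{P}(\delta^{(t,k)}_i=1,\delta^{(t,k)}_j=1\mid\mathbf{Y}_\tau:\tau<t)$ are functions of the previous observations $\mathbf{Y}_{t-1},\dots,\mathbf{Y}_1$. (3) Conditioned on $\{\mathbf{Y}_\tau:\tau<t\}$, the vectors $\mathbf{y}^{(t,1)},\dots,\mathbf{y}^{(t,N_t)}$ are i.i.d. (4) Conditioned on $\{\mathbf{Y}_\tau:\tau<t\}$, the vectors $\boldsymbol\delta^{(t,1)},\dots,\boldsymbol\delta^{(t,N_t)}$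 are i.i.d. and independent of the $\mathbf{x}^{(t,k)}$. All $p^{(t)}_{ij}$ are positive. $\mathbf{P}_t=\mathbf{P}^{(t)}=(p^{(t)}_{ij})$, and $\mathbf{\Gamma}_t$ is its entrywise inverse, $(\mathbf{\Gamma}_t)_{ij}=1/p^{(t)}_{ij}$. Set $\mathbf{Z}_t=\mathbf{Y}_t\mathbf{Y}_t^\top\odot\mathbf{\Gamma}_t$ and define the estimator $$\widehat{\mathbf{\Sigma}}_T=\frac{\sum_{t=1}^T\mathbf{Z}_t}{\sum_{t=1}^TN_t}.$$ Scaled effective ranks: for $\mathbf{P}=(p_{ij})$ with positive entries, $$\mathrm{r}_{\min}(\mathbf{\Sigma},\mathbf{P})=\frac1{\Vert\mathbf{\Sigma}\Vert}\max_{j\in[n]}\sum_{i=1}^n\frac{\Sigma_{ii}}{p_{ij}},\qquad\mathrm{r}_2(\mathbf{\Sigma},\mathbf{P})=\frac1{\Vert\mathbf{\Sigma}\Vert}\Big(\sum_{i,j=1}^n\frac{\Sigma_{ii}\Sigma_{jj}}{p_{ij}^2}\Big)^{1/2}.$$ Sub-Gaussian norm: for a real random variable $z$, $\Vert z\Vert_{\Psi_2}=\inf\{u>0:\mathbb{E}[\exp(|z|^2/u^2)]\le2\}$. A random vector $\mathbf{z}$ is sub-Gaussian if $\sup_{\Vert\mathbf{u}\Vert=1}\Vert\mathbf{u}^\top\mathbf{z}\Vert_{\Psi_2}<\infty$. Sub-Gaussian assumption on $\mathbf{x}$: (i) $\mathbf{x}$ is a sub-Gaussian vector; therefore there is a constant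 $c$ with $\mathbb{E}[|\mathbf{u}^\top\mathbf{x}|^r]^{1/r}\le c\Vert\mathbf{u}^\top\mathbf{x}\Vert_{\Psi_2}\sqrt r$ for every unit vector $\mathbf{u}\in\mathbb{R}^n$ and every $r\ge1$. (ii) There is a constant $c_0>0$ such that $c_0\Vert\mathbf{u}^\top\mathbf{x}\Vert_{\Psi_2}^2\le\mathbb{E}(\mathbf{u}^\top\mathbf{x})^2$ for all $\mathbf{u}\in\mathbb{R}^n$.
   Formalization: Every batch size N_t (t ≤ T) is assumed at least 2, as the bound fails or ε_2 is undefined with single-sample batches; C̃ depends on the sub-Gaussian constant c_0 (necessarily), and is formally chosen per underlying sample-space type, which is immaterial by passing to laws. *)

theory Defs
  imports "HOL-Probability.Probability"
begin

text \<open>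
  The dimension \<open>n\<close> has to be quantified inside the statement (the constant must not depend on it),
  so vectors are functions \<open>nat \<Rightarrow> real\<close> and matrices functions \<open>nat \<Rightarrow> nat \<Rightarrow> real\<close>, of which only
  the entries with indices in \<open>{..<n}\<close> matter. Coordinates and the samples inside a batch are
  numbered from 0; batches (times) are numbered from 1.
\<close>

type_synonym rmat = "nat \<Rightarrow> nat \<Rightarrow> real"

abbreviation vec_borel :: "nat \<Rightarrow> (nat \<Rightarrow> real) measure" where
  "vec_borel n \<equiv> Pi\<^sub>M {..<n} (\<lambda>_. borel)"

definition inner_vec :: "nat \<Rightarrow> (nat \<Rightarrow> real) \<Rightarrow> (nat \<Rightarrow> real) \<Rightarrow> real" where
  "inner_vec n u v = (\<Sum>i<n. u i * v i)"

definition op_norm :: "nat \<Rightarrow> rmat \<Rightarrow> real" where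
  "op_norm n A = Sup {L2_set (\<lambda>i. \<Sum>j<n. A i j * u j) {..<n} | u. L2_set u {..<n} = 1}"

definition r_min :: "nat \<Rightarrow> rmat \<Rightarrow> rmat \<Rightarrow> real" where
  "r_min n S P = (1 / op_norm n S) * Max ((\<lambda>j. \<Sum>i<n. S i i / P i j) ` {..<n})"

definition r_two :: "nat \<Rightarrow> rmat \<Rightarrow> rmat \<Rightarrow> real" where
  "r_two n S P = (1 / op_norm n S) * sqrt (\<Sum>i<n. \<Sum>j<n. S i i * S j j / (P i j)\<^sup>2)"


text \<open>
  The Orlicz norm takes values in \<open>ennreal\<close>: the expectation is a Lebesgue integral that may be
  infinite, and the infimum of the empty set is \<open>\<infinity>\<close>.
\<close>

definition psi2_norm :: "'w measure \<Rightarrow> ('w \<Rightarrow> real) \<Rightarrow> ennreal" where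
  "psi2_norm M z =
     (INF u\<in>{u::real. 0 < u \<and> (\<integral>\<^sup>+\<omega>. ennreal (exp (\<bar>z \<omega>\<bar>\<^sup>2 / u\<^sup>2)) \<partial>M) \<le> 2}. ennreal u)"

definition sub_gaussian_vec :: "'w measure \<Rightarrow> nat \<Rightarrow> ('w \<Rightarrow> nat \<Rightarrow> real) \<Rightarrow> bool" where
  "sub_gaussian_vec M n z \<longleftrightarrow>
     (SUP u\<in>{u. L2_set u {..<n} = 1}. psi2_norm M (\<lambda>\<omega>. inner_vec n u (z \<omega>))) < \<infinity>"

definition sub_gaussian_assm ::
    "'w measure \<Rightarrow> nat \<Rightarrow> ('w \<Rightarrow> nat \<Rightarrow> real) \<Rightarrow> real \<Rightarrow> bool" where
  "sub_gaussian_assm M n x c\<^sub>0 \<longleftrightarrow>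
     sub_gaussian_vec M n x \<and>
     (\<forall>u. ennreal c\<^sub>0 * (psi2_norm M (\<lambda>\<omega>. inner_vec n u (x \<omega>)))\<^sup>2
            \<le> ennreal (\<integral>\<omega>. (inner_vec n u (x \<omega>))\<^sup>2 \<partial>M))"

definition cov_mat :: "'w measure \<Rightarrow> ('w \<Rightarrow> nat \<Rightarrow> real) \<Rightarrow> rmat" where
  "cov_mat M x = (\<lambda>i j. \<integral>\<omega>. x \<omega> i * x \<omega> j \<partial>M)"


definition gen_sigma ::
    "'w measure \<Rightarrow> 'b measure \<Rightarrow> 'i set \<Rightarrow> ('i \<Rightarrow> 'w \<Rightarrow> 'b) \<Rightarrow> 'w measure" where
  "gen_sigma M S I Z = sigma (space M) {Z i -` B \<inter> space M | i B. i \<in> I \<and> B \<in> sets S}"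

definition cond_pr :: "'w measure \<Rightarrow> 'w measure \<Rightarrow> 'w set \<Rightarrow> 'w \<Rightarrow> real" where
  "cond_pr M F A = real_cond_exp M F (indicator A)"

definition cond_indep_vars ::
    "'w measure \<Rightarrow> 'w measure \<Rightarrow> 'b measure \<Rightarrow> ('i \<Rightarrow> 'w \<Rightarrow> 'b) \<Rightarrow> 'i set \<Rightarrow> bool" where
  "cond_indep_vars M F S Z I \<longleftrightarrow>
     (\<forall>J B. J \<subseteq> I \<longrightarrow> finite J \<longrightarrow> (\<forall>j\<in>J. B j \<in> sets S) \<longrightarrow>
        (AE \<omega> in M. cond_pr M F {\<omega>'\<in>space M. \<forall>j\<in>J. Z j \<omega>' \<in> B j} \<omega>
                     = (\<Prod>j\<in>J. cond_pr M F {\<omega>'\<in>space M. Z j \<omega>' \<in> B j} \<omega>)))"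

definition cond_iid_vars ::
    "'w measure \<Rightarrow> 'w measure \<Rightarrow> 'b measure \<Rightarrow> ('i \<Rightarrow> 'w \<Rightarrow> 'b) \<Rightarrow> 'i set \<Rightarrow> bool" where
  "cond_iid_vars M F S Z I \<longleftrightarrow>
     cond_indep_vars M F S Z I \<and>
     (\<forall>i\<in>I. \<forall>j\<in>I. \<forall>B\<in>sets S.
        (AE \<omega> in M. cond_pr M F {\<omega>'\<in>space M. Z i \<omega>' \<in> B} \<omega>
                     = cond_pr M F {\<omega>'\<in>space M. Z j \<omega>' \<in> B} \<omega>))"

definition cond_indep_sigma :: "'w measure \<Rightarrow> 'w measure \<Rightarrow> 'w measure \<Rightarrow> 'w measure \<Rightarrow> bool" where
  "cond_indep_sigma M F G H \<longleftrightarrow>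
     (\<forall>A\<in>sets G. \<forall>B\<in>sets H.
        (AE \<omega> in M. cond_pr M F (A \<inter> B) \<omega> = cond_pr M F A \<omega> * cond_pr M F B \<omega>))"


definition observed ::
    "nat \<Rightarrow> (nat \<Rightarrow> nat \<Rightarrow> 'w \<Rightarrow> nat \<Rightarrow> real) \<Rightarrow> (nat \<Rightarrow> nat \<Rightarrow> 'w \<Rightarrow> nat \<Rightarrow> real)
       \<Rightarrow> nat \<Rightarrow> nat \<Rightarrow> 'w \<Rightarrow> nat \<Rightarrow> real" where
  "observed n \<delta> X t k \<omega> = (\<lambda>i\<in>{..<n}. \<delta> t k \<omega> i * X t k \<omega> i)"

definition past ::
    "'w measure \<Rightarrow> nat \<Rightarrow> (nat \<Rightarrow> nat) \<Rightarrow> (nat \<Rightarrow> nat \<Rightarrow> 'w \<Rightarrow> nat \<Rightarrow> real) \<Rightarrow> nat \<Rightarrow> 'w measure" where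
  "past M n N Y t =
     gen_sigma M (vec_borel n) {(\<tau>, k). 1 \<le> \<tau> \<and> \<tau> < t \<and> k < N \<tau>} (\<lambda>(\<tau>, k). Y \<tau> k)"

text \<open>
  Entries outside the \<open>n \<times> n\<close> block are set to 0, so that a function of the estimator cannot extract
  any information beyond the genuine matrix entries.
\<close>

definition Z_mat ::
    "nat \<Rightarrow> (nat \<Rightarrow> nat) \<Rightarrow> (nat \<Rightarrow> nat \<Rightarrow> 'w \<Rightarrow> nat \<Rightarrow> real) \<Rightarrow> (nat \<Rightarrow> 'w \<Rightarrow> rmat)
       \<Rightarrow> nat \<Rightarrow> 'w \<Rightarrow> rmat" where
  "Z_mat n N Y P t \<omega> = (\<lambda>i j. if i < n \<and> j < n
     then (\<Sum>k<N t. Y t k \<omega> i * Y t k \<omega> j) * (1 / P t \<omega> i j) else 0)"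

definition cov_est ::
    "nat \<Rightarrow> (nat \<Rightarrow> nat) \<Rightarrow> (nat \<Rightarrow> nat \<Rightarrow> 'w \<Rightarrow> nat \<Rightarrow> real) \<Rightarrow> (nat \<Rightarrow> 'w \<Rightarrow> rmat)
       \<Rightarrow> nat \<Rightarrow> 'w \<Rightarrow> rmat" where
  "cov_est n N Y P T \<omega> = (\<lambda>i j. (\<Sum>t=1..T. Z_mat n N Y P t \<omega> i j) / real (\<Sum>t=1..T. N t))"

text \<open>
  \<open>X t k\<close> are the complete data, \<open>\<delta> t k\<close> the masks and \<open>P t \<omega> i j\<close> the conditional sampling
  probabilities. That \<open>P t\<close> is a function of the previous observations is expressed by measurability
  with respect to the \<open>\<sigma>\<close>-algebra they generate; at time 1 this \<open>\<sigma>\<close>-algebra is trivial.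
\<close>

locale cmcar = prob_space M for M :: "'w measure" +
  fixes n :: nat
    and N :: "nat \<Rightarrow> nat"
    and x :: "'w \<Rightarrow> nat \<Rightarrow> real"
    and X :: "nat \<Rightarrow> nat \<Rightarrow> 'w \<Rightarrow> nat \<Rightarrow> real"
    and \<delta> :: "nat \<Rightarrow> nat \<Rightarrow> 'w \<Rightarrow> nat \<Rightarrow> real"
    and P :: "nat \<Rightarrow> 'w \<Rightarrow> rmat"
  assumes N_pos: "\<And>t. 1 \<le> t \<Longrightarrow> 1 \<le> N t"
    and x_rv: "random_variable (vec_borel n) x"
    and x_square_integrable: "\<And>i. i < n \<Longrightarrow> integrable M (\<lambda>\<omega>. (x \<omega> i)\<^sup>2)"
    and x_mean_zero: "\<And>i. i < n \<Longrightarrow> expectation (\<lambda>\<omega>. x \<omega> i) = 0"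
    and cov_nonzero: "\<exists>i<n. \<exists>j<n. cov_mat M x i j \<noteq> 0"
    and X_rv: "\<And>t k. 1 \<le> t \<Longrightarrow> k < N t \<Longrightarrow> random_variable (vec_borel n) (X t k)"
    and mask_rv: "\<And>t k. 1 \<le> t \<Longrightarrow> k < N t \<Longrightarrow> random_variable (vec_borel n) (\<delta> t k)"
    and mask_01: "\<And>t k \<omega> i. 1 \<le> t \<Longrightarrow> k < N t \<Longrightarrow> \<omega> \<in> space M \<Longrightarrow> i < n \<Longrightarrow> \<delta> t k \<omega> i \<in> {0, 1}"
    and X_indep: "indep_vars (\<lambda>_. vec_borel n) (\<lambda>(t, k). X t k) {(t, k). 1 \<le> t \<and> k < N t}"
    and X_copy: "\<And>t k. 1 \<le> t \<Longrightarrow> k < N t \<Longrightarrow>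
       distr M (vec_borel n) (X t k) = distr M (vec_borel n) x"
    and X_indep_past: "\<And>t. 1 \<le> t \<Longrightarrow>
       indep_set (sets (gen_sigma M (vec_borel n) {..<N t} (X t)))
                 (sets (past M n N (observed n \<delta> X) t))"
    and P_past_measurable: "\<And>t i j. 1 \<le> t \<Longrightarrow> i < n \<Longrightarrow> j < n \<Longrightarrow>
       (\<lambda>\<omega>. P t \<omega> i j) \<in> borel_measurable (past M n N (observed n \<delta> X) t)"
    and P_cond_prob: "\<And>t k i j. 1 \<le> t \<Longrightarrow> k < N t \<Longrightarrow> i < n \<Longrightarrow> j < n \<Longrightarrow>
       (AE \<omega> in M. P t \<omega> i j = cond_pr M (past M n N (observed n \<delta> X) t)
          {\<omega>'\<in>space M. \<delta> t k \<omega>' i = 1 \<and> \<delta> t k \<omega>' j = 1} \<omega>)"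
    and P_pos: "\<And>t i j. 1 \<le> t \<Longrightarrow> i < n \<Longrightarrow> j < n \<Longrightarrow> (AE \<omega> in M. 0 < P t \<omega> i j)"
    and Y_cond_iid: "\<And>t. 1 \<le> t \<Longrightarrow>
       cond_iid_vars M (past M n N (observed n \<delta> X) t) (vec_borel n) (observed n \<delta> X t) {..<N t}"
    and mask_cond_iid: "\<And>t. 1 \<le> t \<Longrightarrow>
       cond_iid_vars M (past M n N (observed n \<delta> X) t) (vec_borel n) (\<delta> t) {..<N t}"
    and mask_cond_indep_X: "\<And>t. 1 \<le> t \<Longrightarrow>
       cond_indep_sigma M (past M n N (observed n \<delta> X) t)
         (gen_sigma M (vec_borel n) {..<N t} (\<delta> t))
         (gen_sigma M (vec_borel n) {..<N t} (X t))"

definition eps_one :: "'w measure \<Rightarrow> nat \<Rightarrow> (nat \<Rightarrow> nat) \<Rightarrow> rmat \<Rightarrow> (nat \<Rightarrow> 'w \<Rightarrow> rmat) \<Rightarrow> nat \<Rightarrow> real" where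
  "eps_one M n N S P T =
     (\<integral>\<omega>. (1 / real (\<Sum>t=1..T. N t)) * (\<Sum>t=1..T. r_min n S (P t \<omega>) * real (N t)) \<partial>M)"

definition L_log :: "(nat \<Rightarrow> nat) \<Rightarrow> nat \<Rightarrow> real" where
  "L_log N T = sqrt (\<Sum>t=1..T. (ln (real (N t)))\<^sup>2)"

definition eps_two :: "'w measure \<Rightarrow> nat \<Rightarrow> (nat \<Rightarrow> nat) \<Rightarrow> rmat \<Rightarrow> (nat \<Rightarrow> 'w \<Rightarrow> rmat) \<Rightarrow> nat \<Rightarrow> real" where
  "eps_two M n N S P T =
     sqrt (\<integral>\<omega>. (1 / (L_log N T)\<^sup>2) *
                (\<Sum>t=1..T. (r_two n S (P t \<omega>))\<^sup>2 * (ln (real (N t)))\<^sup>2) \<partial>M)"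

end

theory Submission
  imports Defs
begin

text \<open>Write the estimation error as \<open>(1 / N) \<Sum>\<^sub>t D\<^sub>t\<close>, where \<open>D\<^sub>t\<close> is the sum over the batch \<open>t\<close> of the centred matrices
  \<open>y y\<^sup>T \<odot> \<Gamma>\<^sub>t - \<Sigma>\<close>. The \<open>D\<^sub>t\<close> are martingale differences, and the squared Schatten norm of order
  \<open>2 m\<close> with \<open>m \<approx> log n\<close> is equivalent to the squared operator norm and \<open>O(log n)\<close>-smooth, so that
  \<open>E \<parallel>\<Sum>\<^sub>t D\<^sub>t\<parallel>\<^sup>2 \<le> C log n \<Sum>\<^sub>t E \<parallel>D\<^sub>t\<parallel>\<^sup>2\<close>. Inside a batch the observations are exchangeable given the past, and
  exchanging the \<open>k\<close>-th observations of the two halves of the batch produces random signs without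
  an independent copy. Applied to \<open>D\<^sub>t\<close> and then to the sum of squares, the matrix Khintchine inequality
  (proved by the moment method) gives \<open>E \<parallel>D\<^sub>t\<parallel>\<^sup>2 \<le> C (log n \<cdot> N\<^sub>t V + log\<^sup>2 n \<cdot> E max\<^sub>k \<parallel>y\<^sub>k y\<^sub>k\<^sup>T \<odot> \<Gamma>\<^sub>t\<parallel>\<^sup>2)\<close>. The variance \<open>V\<close> is
  controlled by \<open>r\<^sub>m\<^sub>i\<^sub>n\<close>, as it only involves the pairwise sampling probabilities, and the maximum by
  \<open>r\<^sub>2\<close> and the exponential moments of the data.\<close>

section \<open>Trace inequalities for symmetric matrices\<close>

text \<open>Two obstacles shape the proof. Conditional independence given the past is only an almost
  sure identity between conditional probabilities of events, and the probability space need not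
  carry independent copies or random signs; permutations of the batch supply both, the second half
  serving as the copy of the first. Moreover only the pairwise sampling probabilities are known,
  while the variance of an observation contains triple products of masks. Integrating the data
  first, with past and masks frozen, and bounding fourth moments of fixed linear forms removes the
  third mask and cancels one of the two inverse probabilities; so \<open>1 / p\<close> and not its
  square enters r_min.

  The logarithms: one ln n stands in front and comes from the smoothness of the Schatten norm, one
  from the first use of Khintchine, and a further one in front of the maximum from the second use.
  The constants depend on \<open>c\<^sub>0\<close> alone; \<alpha> enters through the boundedness of
  the inverse probabilities, and batches of size at least 2 keep \<open>ln N\<^sub>t\<close> away
  from 0, so that additive constants can be absorbed.\<close>

text \<open>Since \<open>n\<close> is a variable, there is no type of \<open>n \<times> n\<close> matrices. Linear endomorphisms of the space
  of sequences form one unital algebra containing all of them as blocks; \<open>pres n\<close> singles out those that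
  preserve the first \<open>n\<close> coordinates, on which the entries multiply as matrices.\<close>

typedef endo = "{f :: (nat \<Rightarrow> real) \<Rightarrow> nat \<Rightarrow> real.
    (\<forall>u v. f (\<lambda>i. u i + v i) = (\<lambda>i. f u i + f v i)) \<and> (\<forall>c u. f (\<lambda>i. c * u i) = (\<lambda>i. c * f u i))}"
  morphisms app Endo
  by (rule exI[of _ "\<lambda>u. u"]) auto

section \<open>The algebra of linear endomorphisms\<close>

setup_lifting type_definition_endo

instantiation endo :: real_algebra_1
begin

lift_definition zero_endo :: endo is "\<lambda>u i. 0" by simp
lift_definition one_endo :: endo is "\<lambda>u. u" by simp
lift_definition plus_endo :: "endo \<Rightarrow> endo \<Rightarrow> endo" is "\<lambda>f g u i. f u i + g u i"
  by (auto simp: fun_eq_iff algebra_simps)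
lift_definition minus_endo :: "endo \<Rightarrow> endo \<Rightarrow> endo" is "\<lambda>f g u i. f u i - g u i"
  by (auto simp: fun_eq_iff algebra_simps)
lift_definition uminus_endo :: "endo \<Rightarrow> endo" is "\<lambda>f u i. - f u i"
  by (auto simp: fun_eq_iff algebra_simps)
lift_definition times_endo :: "endo \<Rightarrow> endo \<Rightarrow> endo" is "\<lambda>f g u. f (g u)"
  by auto
lift_definition scaleR_endo :: "real \<Rightarrow> endo \<Rightarrow> endo" is "\<lambda>c f u i. c * f u i"
  by (auto simp: fun_eq_iff algebra_simps)

lemma endo_eqI: "(\<And>u i. app f u i = app g u i) \<Longrightarrow> f = g"
  by (metis app_inject ext)

lemmas app_simps = zero_endo.rep_eq one_endo.rep_eq plus_endo.rep_eq minus_endo.rep_eq uminus_endo.rep_eq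
  times_endo.rep_eq scaleR_endo.rep_eq

lemma app_linear:
  "app f (\<lambda>i. u i + v i) i = app f u i + app f v i"
  "app f (\<lambda>i. c * u i) i = c * app f u i"
  using app[of f] by auto

instance
proof
  have "app 0 (\<lambda>_. 1) 0 \<noteq> app 1 (\<lambda>_. 1) 0"
    by (simp add: app_simps)
  then show "(0::endo) \<noteq> 1" by metis
qed (rule endo_eqI; simp add: app_simps app_linear algebra_simps; fail)+

end

section \<open>Entries, block-preserving maps, trace and transposition\<close>

definition ent :: "endo \<Rightarrow> rmat" where
  "ent f i j = app f (\<lambda>k. if k = j then 1 else 0) i"

text \<open>Requires only that the first \<open>n\<close> coordinates span an invariant subspace.
  Demanding zero entries outside the block would exclude the unit \<open>1\<close>, and with it the
  powers \<open>f ^ 0\<close>.\<close>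

definition pres :: "nat \<Rightarrow> endo \<Rightarrow> bool" where
  "pres n f \<longleftrightarrow> (\<forall>j<n. \<forall>i\<ge>n. ent f i j = 0)"

definition tr :: "nat \<Rightarrow> endo \<Rightarrow> real" where
  "tr n f = (\<Sum>i<n. ent f i i)"

text \<open>Transposition of the blocks as a relation, so that no transposition map on endomorphisms
  is needed; \<open>adj n X X\<close> says that the block of \<open>X\<close> is symmetric.\<close>

definition adj :: "nat \<Rightarrow> endo \<Rightarrow> endo \<Rightarrow> bool" where
  "adj n f g \<longleftrightarrow> pres n f \<and> pres n g \<and> (\<forall>i<n. \<forall>j<n. ent f i j = ent g j i)"

definition emb :: "nat \<Rightarrow> rmat \<Rightarrow> endo" where
  "emb n A = Endo (\<lambda>v i. if i < n then \<Sum>j<n. A i j * v j else 0)"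

lemma ent_simps [simp]:
  "ent 0 i j = 0" "ent (f + g) i j = ent f i j + ent g i j" "ent (f - g) i j = ent f i j - ent g i j"
  "ent (- f) i j = - ent f i j" "ent (c *\<^sub>R f) i j = c * ent f i j" "ent 1 i j = (if i = j then 1 else 0)"
  by (simp_all add: ent_def zero_endo.rep_eq plus_endo.rep_eq minus_endo.rep_eq uminus_endo.rep_eq
      scaleR_endo.rep_eq one_endo.rep_eq)

lemma ent_sum [simp]: "ent (\<Sum>k\<in>K. f k) i j = (\<Sum>k\<in>K. ent (f k) i j)"
  by (induction K rule: infinite_finite_induct) auto

lemma app_emb: "app (emb n A) v i = (if i < n then \<Sum>j<n. A i j * v j else 0)"
proof -
  have "app (emb n A) = (\<lambda>v i. if i < n then \<Sum>j<n. A i j * v j else 0)"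
    unfolding emb_def
    by (rule Endo_inverse) (auto simp: fun_eq_iff sum.distrib sum_distrib_left ring_distribs mult.left_commute)
  then show ?thesis by simp
qed

lemma emb_simps:
  "emb n (\<lambda>i j. A i j + B i j) = emb n A + emb n B" "emb n (\<lambda>i j. c * A i j) = c *\<^sub>R emb n A"
  "emb n (\<lambda>i j. 0) = 0"
  by (rule endo_eqI; simp add: app_simps app_emb sum.distrib sum_distrib_left ring_distribs mult.assoc)+

lemma emb_sum: "emb n (\<lambda>i j. \<Sum>k\<in>K. f k i j) = (\<Sum>k\<in>K. emb n (f k))"
  by (induction K rule: infinite_finite_induct) (simp_all add: emb_simps)

lemma ent_emb: "ent (emb n A) i j = (if i < n \<and> j < n then A i j else 0)"
proof -
  have "(\<Sum>k<n. A i k * (if k = j then 1 else 0)) = (if j < n then A i j else 0)"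
    by (simp add: if_distrib[of "times _"] sum.delta cong: if_cong)
  then show ?thesis by (simp add: ent_def app_emb)
qed

lemma app_sum: "app f (\<lambda>i. \<Sum>k\<in>K. c k * v k i) i = (\<Sum>k\<in>K. c k * app f (v k) i)"
proof -
  have zero: "app f (\<lambda>i. 0) i = 0" for i
    using app_linear(2)[of f 0 "\<lambda>i. 0"] by simp
  show ?thesis
  proof (induction K rule: infinite_finite_induct)
    case (insert k K)
    have "app f (\<lambda>i. \<Sum>k\<in>insert k K. c k * v k i) i = app f (\<lambda>i. c k * v k i + (\<Sum>k\<in>K. c k * v k i)) i"
      using insert.hyps by simp
    also have "\<dots> = c k * app f (v k) i + (\<Sum>k\<in>K. c k * app f (v k) i)"
      by (simp only: app_linear(1)[of f "\<lambda>i. c k * v k i"] app_linear(2) insert.IH)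
    finally show ?case using insert.hyps by simp
  qed (simp_all add: zero)
qed

text \<open>Column \<open>j\<close> of \<open>g\<close> is a combination of the first
  \<open>n\<close> unit vectors because \<open>g\<close> preserves the block; linearity of
  \<open>f\<close> does the rest.\<close>

lemma ent_mult:
  assumes "pres n g" "j < n"
  shows "ent (f * g) i j = (\<Sum>k<n. ent f i k * ent g k j)"
proof -
  have "app g (\<lambda>k. if k = j then 1 else 0) i = (\<Sum>k<n. ent g k j * (if i = k then 1 else 0))" for i
    unfolding ent_def[symmetric] using assms
    by (cases "i < n") (auto simp: pres_def if_distrib[of "times _"] sum.delta' cong: if_cong)
  then have "app g (\<lambda>k. if k = j then 1 else 0) = (\<lambda>i. \<Sum>k<n. ent g k j * (if i = k then 1 else 0))"
    by blast
  then have "ent (f * g) i j = app f (\<lambda>i. \<Sum>k<n. ent g k j * (if i = k then 1 else 0)) i"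
    by (simp only: ent_def[of "f * g"] times_endo.rep_eq)
  also have "\<dots> = (\<Sum>k<n. ent g k j * ent f i k)"
    unfolding app_sum ent_def[of f] ..
  finally show ?thesis by (simp only: mult.commute)
qed

lemma pres_intros [intro, simp]:
  "pres n 0" "pres n 1" "pres n (emb n A)"
  "pres n f \<Longrightarrow> pres n g \<Longrightarrow> pres n (f + g)" "pres n f \<Longrightarrow> pres n g \<Longrightarrow> pres n (f - g)"
  "pres n f \<Longrightarrow> pres n (c *\<^sub>R f)"
  by (auto simp: pres_def ent_emb)

lemma pres_mult [intro, simp]: "pres n f \<Longrightarrow> pres n g \<Longrightarrow> pres n (f * g)"
  unfolding pres_def[of n "f * g"] by (auto simp: ent_mult) (auto simp: pres_def)

lemma pres_sum [intro, simp]: "(\<And>k. k \<in> K \<Longrightarrow> pres n (f k)) \<Longrightarrow> pres n (\<Sum>k\<in>K. f k)"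
  by (induction K rule: infinite_finite_induct) auto

lemma pres_power [intro, simp]: "pres n f \<Longrightarrow> pres n (f ^ k)"
  by (induction k) auto

lemma tr_simps [simp]: "tr n (f + g) = tr n f + tr n g" "tr n (f - g) = tr n f - tr n g"
  "tr n (c *\<^sub>R f) = c * tr n f" "tr n 1 = real n" "tr n 0 = 0"
  by (simp_all add: tr_def sum.distrib sum_subtractf sum_distrib_left)

lemma tr_sum [simp]: "tr n (\<Sum>k\<in>K. h k) = (\<Sum>k\<in>K. tr n (h k))"
  by (induction K rule: infinite_finite_induct) auto

lemma tr_mult: "pres n g \<Longrightarrow> tr n (f * g) = (\<Sum>i<n. \<Sum>j<n. ent f i j * ent g j i)"
  by (simp add: tr_def ent_mult)

lemma tr_commute: "pres n f \<Longrightarrow> pres n g \<Longrightarrow> tr n (f * g) = tr n (g * f)"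
  by (simp add: tr_mult) (subst sum.swap, simp add: mult.commute)

lemma adj_pres: "adj n f g \<Longrightarrow> pres n f" "adj n f g \<Longrightarrow> pres n g"
  by (auto simp: adj_def)

lemma adj_mult: "adj n f f' \<Longrightarrow> adj n g g' \<Longrightarrow> adj n (f * g) (g' * f')"
  by (auto simp: adj_def ent_mult intro!: sum.cong)

lemma adj_simps: "adj n 1 1" "adj n f f' \<Longrightarrow> adj n g g' \<Longrightarrow> adj n (f + g) (f' + g')"
   "adj n f f' \<Longrightarrow> adj n g g' \<Longrightarrow> adj n (f - g) (f' - g')"
   "adj n f f' \<Longrightarrow> adj n (c *\<^sub>R f) (c *\<^sub>R f')"
  by (auto simp: adj_def)

lemma adj_power: "adj n f f \<Longrightarrow> adj n (f ^ k) (f ^ k)"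
  by (induction k) (auto simp: adj_simps power_commutes dest: adj_mult)

text \<open>The trace of \<open>f' * g\<close> is the Frobenius inner product of the blocks of
  \<open>f\<close> and \<open>g\<close>. Positivity, AM-GM and Cauchy-Schwarz for traces below are
  those of this inner product.\<close>

lemma tr_adj_eq: "adj n f f' \<Longrightarrow> adj n g g' \<Longrightarrow> tr n (f' * g) = (\<Sum>i<n. \<Sum>j<n. ent f j i * ent g j i)"
  by (simp add: tr_mult adj_pres) (auto simp: adj_def intro!: sum.cong)

lemma tr_adj_nonneg: "adj n f f' \<Longrightarrow> 0 \<le> tr n (f' * f)"
  by (simp add: tr_adj_eq sum_nonneg)

lemma tr_adj_AMGM:
  assumes "adj n f f'" "adj n g g'"
  shows "2 * tr n (f' * g) \<le> tr n (f' * f) + tr n (g' * g)"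
proof -
  have "2 * tr n (f' * g) = (\<Sum>i<n. \<Sum>j<n. 2 * (ent f j i * ent g j i))"
    by (simp add: tr_adj_eq[OF assms] sum_distrib_left)
  also have "\<dots> \<le> (\<Sum>i<n. \<Sum>j<n. ent f j i * ent f j i + ent g j i * ent g j i)"
    by (intro sum_mono) (use sum_squares_bound in \<open>simp add: power2_eq_square mult.assoc\<close>)
  finally show ?thesis
    by (simp add: tr_adj_eq[OF assms(1,1)] tr_adj_eq[OF assms(2,2)] sum.distrib)
qed

lemma tr_adj_CS:
  assumes "adj n f f'" "adj n g g'"
  shows "(tr n (f' * g))\<^sup>2 \<le> tr n (f' * f) * tr n (g' * g)"
  unfolding tr_adj_eq[OF assms] tr_adj_eq[OF assms(1,1)] tr_adj_eq[OF assms(2,2)] sum.cartesian_product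
  using Cauchy_Schwarz_ineq_sum[of "\<lambda>(i, j). ent f j i" "\<lambda>(i, j). ent g j i" "{..<n} \<times> {..<n}"]
  by (simp add: case_prod_unfold power2_eq_square)

text \<open>Take the leftmost even index where the maximum over even indices is attained. In the
  interior its left neighbour would be strictly smaller, against midpoint convexity, so it is an
  endpoint. Any \<open>s\<close> is the midpoint of two even indices, namely
  \<open>2 * (s div 2)\<close> and \<open>2 * (s - s div 2)\<close>.\<close>

lemma convex_seq_le_ends:
  fixes g :: "nat \<Rightarrow> real"
  assumes mid: "\<And>i j. i \<le> r \<Longrightarrow> j \<le> r \<Longrightarrow> 2 * g (i + j) \<le> g (2 * i) + g (2 * j)" and "s \<le> 2 * r"
  shows "g s \<le> max (g 0) (g (2 * r))"
proof -
  define m where "m = Max ((\<lambda>i. g (2 * i)) ` {..r})"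
  define i0 where "i0 = (LEAST i. i \<le> r \<and> g (2 * i) = m)"
  have "m \<in> (\<lambda>i. g (2 * i)) ` {..r}" unfolding m_def by (rule Max_in) auto
  then have ex: "\<exists>i. i \<le> r \<and> g (2 * i) = m" by auto
  have i0: "i0 \<le> r" "g (2 * i0) = m" using LeastI_ex[OF ex] by (auto simp: i0_def)
  have le: "g (2 * i) \<le> m" if "i \<le> r" for i using that unfolding m_def by (intro Max_ge) auto
  have "i0 = 0 \<or> i0 = r"
  proof (rule ccontr)
    assume "\<not> ?thesis"
    then have a: "0 < i0" "i0 < r" using i0 by auto
    have "2 * g (2 * i0) \<le> g (2 * (i0 - 1)) + g (2 * (i0 + 1))"
      using mid[of "i0 - 1" "i0 + 1"] a by (simp add: mult_2[of i0])
    moreover have "g (2 * (i0 - 1)) \<noteq> m"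
      using not_less_Least[of "i0 - 1" "\<lambda>i. i \<le> r \<and> g (2 * i) = m"] a by (auto simp: i0_def[symmetric])
    moreover have "g (2 * (i0 - 1)) \<le> m" "g (2 * (i0 + 1)) \<le> m" using a by (auto intro!: le simp del: mult_Suc_right)
    ultimately show False using i0(2) by linarith
  qed
  then have m: "m \<le> max (g 0) (g (2 * r))" using i0 by auto
  have "2 * g (s div 2 + (s - s div 2)) \<le> g (2 * (s div 2)) + g (2 * (s - s div 2))"
    using assms(2) by (intro mid) auto
  moreover have "g (2 * (s div 2)) \<le> m" "g (2 * (s - s div 2)) \<le> m" using assms(2) by (auto intro!: le)
  ultimately have "g s \<le> m" by simp
  with m show ?thesis by simp
qed

text \<open>The sequence \<open>tr (A X\<^sup>s A Y\<^sup>q\<^sup>-\<^sup>s)\<close> is midpoint convex by Cauchy-Schwarz; this replaces the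
  spectral theorem.\<close>

lemma tr_interpolation:
  assumes A: "adj n A A" and X: "adj n X X" and Y: "adj n Y Y" and "even q" "s \<le> q"
  shows "tr n (A * X ^ s * A * Y ^ (q - s)) \<le> tr n (A * A * X ^ q) + tr n (A * A * Y ^ q)"
proof -
  obtain r where q: "q = 2 * r" using \<open>even q\<close> by auto
  define g where "g s = tr n (A * X ^ s * A * Y ^ (2 * r - s))" for s
  note pr = adj_pres[OF A] adj_pres[OF X] adj_pres[OF Y]
  have adjs: "adj n (X ^ i * A * Y ^ (r - i)) (Y ^ (r - i) * A * X ^ i)" for i
    using adj_mult[OF adj_mult[OF adj_power[OF X, of i] A] adj_power[OF Y, of "r - i"]]
    by (simp add: mult.assoc)
  have inner: "tr n ((Y ^ (r - i) * A * X ^ i) * (X ^ j * A * Y ^ (r - j))) = g (i + j)"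
    if "i \<le> r" "j \<le> r" for i j
  proof -
    have "tr n ((Y ^ (r - i) * A * X ^ i) * (X ^ j * A * Y ^ (r - j)))
        = tr n (Y ^ (r - i) * (A * X ^ (i + j) * A * Y ^ (r - j)))"
      by (simp add: mult.assoc power_add)
    also have "\<dots> = tr n (A * X ^ (i + j) * A * Y ^ (r - j) * Y ^ (r - i))"
      by (rule tr_commute) (use pr in auto)
    also have "\<dots> = g (i + j)"
    proof -
      have "2 * r - (i + j) = (r - j) + (r - i)" using that by auto
      then show ?thesis by (simp add: g_def mult.assoc power_add)
    qed
    finally show ?thesis .
  qed
  have "2 * g (i + j) \<le> g (2 * i) + g (2 * j)" if "i \<le> r" "j \<le> r" for i j
    using tr_adj_AMGM[OF adjs adjs, of i j]
    unfolding inner[OF that] inner[OF that(1,1)] inner[OF that(2,2)] by (simp only: mult_2)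
  then have gs: "g s \<le> max (g 0) (g (2 * r))"
    by (rule convex_seq_le_ends) (use \<open>s \<le> q\<close> q in auto)
  have nn: "0 \<le> g (i + i)" if "i \<le> r" for i
    using tr_adj_nonneg[OF adjs, of i] that by (simp only: inner)
  have "0 \<le> g 0" "0 \<le> g (2 * r)"
    using nn[of 0] nn[of r] by (simp_all only: mult_2 add_0 le_refl zero_le)
  with gs have "g s \<le> g 0 + g (2 * r)" by simp
  moreover have "g 0 = tr n (A * A * Y ^ q)" by (simp add: g_def q)
  moreover have "g (2 * r) = tr n (A * A * X ^ q)"
  proof -
    have "g (2 * r) = tr n (A * X ^ q * A)" by (simp add: g_def q)
    also have "\<dots> = tr n (A * (A * X ^ q))" by (rule tr_commute) (use pr in auto)
    finally show ?thesis by (simp only: mult.assoc)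
  qed
  moreover have "g s = tr n (A * X ^ s * A * Y ^ (q - s))" by (simp only: g_def q)
  ultimately show ?thesis by linarith
qed

text \<open>Interpolation of \<open>a m\<close> between \<open>a 0\<close> and
  \<open>a (Suc m)\<close>, without logarithms so that zeros are allowed. Raising log-convexity to
  the power \<open>Suc m\<close> and inserting the induction hypothesis leaves a common factor
  \<open>a (Suc m) ^ m\<close> that cancels.\<close>

lemma log_convex_power_le:
  fixes a :: "nat \<Rightarrow> real"
  assumes nn: "\<And>k. 0 \<le> a k" and lc: "\<And>k. (a (Suc k))\<^sup>2 \<le> a k * a (Suc (Suc k))"
  shows "a m ^ Suc m \<le> a 0 * a (Suc m) ^ m"
proof (induction m)
  case (Suc m)
  show ?case
  proof (cases "a (Suc m) = 0")
    case False
    then have pos: "a (Suc m) > 0" using nn[of "Suc m"] by simp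
    have "a (Suc m) ^ (2 * Suc m) \<le> (a m * a (Suc (Suc m))) ^ Suc m"
      unfolding power_mult by (intro power_mono lc) simp
    also have "\<dots> \<le> a 0 * a (Suc m) ^ m * a (Suc (Suc m)) ^ Suc m"
      unfolding power_mult_distrib by (intro mult_right_mono Suc.IH) (simp add: nn)
    also have "a (Suc m) ^ (2 * Suc m) = a (Suc m) ^ Suc (Suc m) * a (Suc m) ^ m"
      by (simp add: power_add[symmetric] mult_2)
    finally have "a (Suc m) ^ Suc (Suc m) * a (Suc m) ^ m
       \<le> (a 0 * a (Suc (Suc m)) ^ Suc m) * a (Suc m) ^ m" by (simp only: mult_ac)
    then show ?thesis using pos by (simp only: mult_le_cancel_right_pos zero_less_power)
  qed (simp add: nn)
qed simp

text \<open>The counterpart that interpolates \<open>a 1\<close>: the ratios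
  \<open>a (Suc k) / a k\<close> increase, so each is at least \<open>a 1 / a 0\<close>;
  \<open>ratio\<close> states this without division.\<close>

lemma log_convex_power_le':
  fixes a :: "nat \<Rightarrow> real"
  assumes nn: "\<And>k. 0 \<le> a k" and lc: "\<And>k. (a (Suc k))\<^sup>2 \<le> a k * a (Suc (Suc k))"
  shows "a 1 ^ Suc m \<le> a 0 ^ m * a (Suc m)"
proof (induction m)
  case (Suc m)
  have ratio: "a 1 * a k \<le> a 0 * a (Suc k)" for k
  proof (induction k)
    case (Suc k)
    show ?case
    proof (cases "a k = 0")
      case True
      then show ?thesis using lc[of k] nn by simp
    next
      case False
      have "a 1 * a (Suc k) * a k \<le> a 0 * (a (Suc k))\<^sup>2"
        using mult_right_mono[OF Suc.IH nn[of "Suc k"]] by (simp add: power2_eq_square mult_ac)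
      also have "\<dots> \<le> a 0 * (a k * a (Suc (Suc k)))" by (intro mult_left_mono lc nn)
      finally show ?thesis using False nn[of k] by (simp add: mult_ac)
    qed
  qed simp
  have "a 1 ^ Suc (Suc m) \<le> a 1 * (a 0 ^ m * a (Suc m))"
    using mult_left_mono[OF Suc.IH nn[of 1]] by simp
  also have "\<dots> \<le> a 0 ^ m * (a 0 * a (Suc (Suc m)))"
    using mult_left_mono[OF ratio[of "Suc m"], of "a 0 ^ m"] nn by (simp add: mult_ac)
  finally show ?case by (simp add: mult_ac)
qed simp

text \<open>The Frobenius product of \<open>X ^ i * E\<close> and \<open>X ^ j * E\<close> depends
  on \<open>i + j\<close> only, so Cauchy-Schwarz is log-convexity of the even moments.\<close>

lemma tr_power_log_convex:
  assumes X: "adj n X X" and E: "adj n E E'"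
  shows "0 \<le> tr n (E' * X ^ (2 * k) * E)"
    and "(tr n (E' * X ^ (2 * Suc k) * E))\<^sup>2 \<le> tr n (E' * X ^ (2 * k) * E) * tr n (E' * X ^ (2 * Suc (Suc k)) * E)"
proof -
  have adjs: "adj n (X ^ i * E) (E' * X ^ i)" for i by (rule adj_mult[OF adj_power[OF X] E])
  have inner: "tr n ((E' * X ^ i) * (X ^ j * E)) = tr n (E' * X ^ (i + j) * E)" for i j
    by (simp add: mult.assoc power_add)
  show "0 \<le> tr n (E' * X ^ (2 * k) * E)" using tr_adj_nonneg[OF adjs, of k] by (simp only: inner mult_2)
  show "(tr n (E' * X ^ (2 * Suc k) * E))\<^sup>2 \<le> tr n (E' * X ^ (2 * k) * E) * tr n (E' * X ^ (2 * Suc (Suc k)) * E)"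
  proof -
    have "k + Suc (Suc k) = 2 * Suc k" "k + k = 2 * k" "Suc (Suc k) + Suc (Suc k) = 2 * Suc (Suc k)" by auto
    then show ?thesis using tr_adj_CS[OF adjs adjs, of k "Suc (Suc k)"] by (simp only: inner)
  qed
qed

text \<open>Monotonicity of normalized Schatten norms; the factor \<open>real n\<close> is the trace
  of \<open>X ^ 0\<close>.\<close>

lemma tr_power_mono:
  assumes "adj n X X"
  shows "tr n (X ^ (2 * m)) ^ Suc m \<le> real n * tr n (X ^ (2 * Suc m)) ^ m"
  using log_convex_power_le[of "\<lambda>k. tr n (X ^ (2 * k))" m]
    tr_power_log_convex[OF assms adj_simps(1)] by simp

text \<open>Noncommutative Leibniz rule: \<open>H\<close> is inserted at every position of the
  product. It is formulated for entries, so that real derivatives suffice and \<open>endo\<close>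
  needs no topology.\<close>

lemma has_derivative_ent_power:
  assumes "pres n A" "pres n H" "j < n"
  shows "((\<lambda>s. ent ((A + s *\<^sub>R H) ^ k) i j) has_real_derivative
     ent (\<Sum>l<k. (A + s *\<^sub>R H) ^ l * H * (A + s *\<^sub>R H) ^ (k - 1 - l)) i j) (at s)"
proof (induction k arbitrary: i)
  case (Suc k)
  have B: "pres n (A + s *\<^sub>R H)" for s using assms by auto
  let ?B = "A + s *\<^sub>R H"
  let ?D = "\<Sum>l<k. ?B ^ l * H * ?B ^ (k - 1 - l)"
  have "((\<lambda>s. \<Sum>q<n. ent (A + s *\<^sub>R H) i q * ent ((A + s *\<^sub>R H) ^ k) q j) has_real_derivative
     (\<Sum>q<n. ent H i q * ent (?B ^ k) q j + ent ?B i q * ent ?D q j)) (at s)"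
    unfolding ent_simps(2,5)
    by (rule DERIV_sum) (auto intro!: derivative_eq_intros Suc.IH)
  also have "(\<Sum>q<n. ent H i q * ent (?B ^ k) q j + ent ?B i q * ent ?D q j) = ent (H * ?B ^ k + ?B * ?D) i j"
    using assms B by (subst ent_simps(2), subst (1 2) ent_mult[where n = n]) (auto simp: sum.distrib)
  also have "H * ?B ^ k + ?B * ?D = (\<Sum>l<Suc k. ?B ^ l * H * ?B ^ (Suc k - 1 - l))"
    unfolding sum.lessThan_Suc_shift by (simp add: sum_distrib_left mult.assoc)
  also have "(\<lambda>s. \<Sum>q<n. ent (A + s *\<^sub>R H) i q * ent ((A + s *\<^sub>R H) ^ k) q j) = (\<lambda>s. ent ((A + s *\<^sub>R H) ^ Suc k) i j)"
    using assms B by (subst power_Suc, subst ent_mult[where n = n]) auto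
  finally show ?case .
qed simp

text \<open>Under the trace the \<open>k\<close> insertions of \<open>H\<close> agree by
  cyclicity.\<close>

lemma has_derivative_tr_power:
  assumes "pres n A" "pres n H"
  shows "((\<lambda>s. tr n ((A + s *\<^sub>R H) ^ k)) has_real_derivative
     real k * tr n (H * (A + s *\<^sub>R H) ^ (k - 1))) (at s)"
proof -
  let ?B = "A + s *\<^sub>R H"
  have B: "pres n ?B" using assms by auto
  have "((\<lambda>s. tr n ((A + s *\<^sub>R H) ^ k)) has_real_derivative
     (\<Sum>i<n. ent (\<Sum>l<k. ?B ^ l * H * ?B ^ (k - 1 - l)) i i)) (at s)"
    unfolding tr_def by (intro DERIV_sum has_derivative_ent_power) (use assms in auto)
  also have "(\<Sum>i<n. ent (\<Sum>l<k. ?B ^ l * H * ?B ^ (k - 1 - l)) i i) = (\<Sum>l<k. tr n (?B ^ l * (H * ?B ^ (k - 1 - l))))"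
    unfolding tr_def[symmetric] by (simp add: mult.assoc)
  also have "\<dots> = (\<Sum>l<k. tr n (H * ?B ^ (k - 1)))"
  proof (rule sum.cong)
    fix l assume "l \<in> {..<k}"
    then have "(k - 1 - l) + l = k - 1" by auto
    then have "H * ?B ^ (k - 1 - l) * ?B ^ l = H * ?B ^ (k - 1)" by (simp add: mult.assoc power_add[symmetric])
    then show "tr n (?B ^ l * (H * ?B ^ (k - 1 - l))) = tr n (H * ?B ^ (k - 1))"
      using tr_commute[of n "?B ^ l" "H * ?B ^ (k - 1 - l)"] assms B by simp
  qed simp
  finally show ?thesis by simp
qed

text \<open>With two factors \<open>H\<close> cyclicity no longer merges the terms; the mixed
  products that remain are those bounded by \<open>tr_interpolation\<close>.\<close>

lemma has_derivative_tr_mult_power: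
  assumes "pres n A" "pres n H"
  shows "((\<lambda>s. tr n (H * (A + s *\<^sub>R H) ^ k)) has_real_derivative
     (\<Sum>l<k. tr n (H * (A + s *\<^sub>R H) ^ l * H * (A + s *\<^sub>R H) ^ (k - 1 - l)))) (at s)"
proof -
  let ?B = "A + s *\<^sub>R H"
  let ?D = "\<Sum>l<k. ?B ^ l * H * ?B ^ (k - 1 - l)"
  have B: "pres n (A + s *\<^sub>R H)" for s using assms by auto
  have "((\<lambda>s. \<Sum>i<n. \<Sum>j<n. ent H i j * ent ((A + s *\<^sub>R H) ^ k) j i) has_real_derivative
     (\<Sum>i<n. \<Sum>j<n. ent H i j * ent ?D j i)) (at s)"
    using assms by (intro DERIV_sum DERIV_cmult has_derivative_ent_power) auto
  also have "(\<Sum>i<n. \<Sum>j<n. ent H i j * ent ?D j i) = tr n (H * ?D)"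
    using assms B by (intro tr_mult[symmetric]) auto
  also have "\<dots> = (\<Sum>l<k. tr n (H * ?B ^ l * H * ?B ^ (k - 1 - l)))"
    by (simp add: sum_distrib_left mult.assoc)
  finally show ?thesis
    using assms B by (simp add: tr_mult)
qed

section \<open>The operator norm\<close>

definition mv :: "nat \<Rightarrow> rmat \<Rightarrow> (nat \<Rightarrow> real) \<Rightarrow> nat \<Rightarrow> real" where
  "mv n A u = (\<lambda>i. \<Sum>j<n. A i j * u j)"

definition bil :: "nat \<Rightarrow> rmat \<Rightarrow> (nat \<Rightarrow> real) \<Rightarrow> (nat \<Rightarrow> real) \<Rightarrow> real" where
  "bil n A u v = (\<Sum>i<n. \<Sum>j<n. A i j * (u i * v j))"

lemma bil_eq: "bil n A u v = (\<Sum>i<n. u i * mv n A v i)"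
  by (simp add: bil_def mv_def sum_distrib_left mult.left_commute mult.assoc)

lemma L2_set_CS: "\<bar>\<Sum>i\<in>K. f i * g i\<bar> \<le> L2_set f K * L2_set g K"
proof -
  have "\<bar>\<Sum>i\<in>K. f i * g i\<bar> \<le> (\<Sum>i\<in>K. \<bar>f i\<bar> * \<bar>g i\<bar>)"
    by (rule order_trans[OF sum_abs]) (simp add: abs_mult)
  also have "\<dots> \<le> L2_set f K * L2_set g K" by (rule L2_set_mult_ineq)
  finally show ?thesis .
qed

lemma L2_set_sq: "finite K \<Longrightarrow> (L2_set f K)\<^sup>2 = (\<Sum>i\<in>K. (f i)\<^sup>2)"
  by (simp add: L2_set_def sum_nonneg)

lemma L2_set_mv_le: "L2_set (mv n A u) {..<n} \<le> sqrt (\<Sum>i<n. \<Sum>j<n. (A i j)\<^sup>2) * L2_set u {..<n}"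
proof (rule power2_le_imp_le)
  have "(mv n A u i)\<^sup>2 \<le> (\<Sum>j<n. (A i j)\<^sup>2) * (\<Sum>j<n. (u j)\<^sup>2)" for i
    unfolding mv_def by (rule Cauchy_Schwarz_ineq_sum)
  then show "(L2_set (mv n A u) {..<n})\<^sup>2 \<le> (sqrt (\<Sum>i<n. \<Sum>j<n. (A i j)\<^sup>2) * L2_set u {..<n})\<^sup>2"
    by (simp add: L2_set_sq power_mult_distrib sum_nonneg sum_distrib_right sum_mono)
qed (simp add: sum_nonneg)

lemma L2_set_mv_le_unit:
  "L2_set u {..<n} = 1 \<Longrightarrow> L2_set (mv n A u) {..<n} \<le> sqrt (\<Sum>i<n. \<Sum>j<n. (A i j)\<^sup>2)"
  using L2_set_mv_le[of n A u] by simp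

lemma mv_scale: "mv n A (\<lambda>i. c * u i) = (\<lambda>i. c * mv n A u i)"
  by (simp add: mv_def sum_distrib_left mult.left_commute)

lemma mv_zero: "\<forall>i<n. u i = 0 \<Longrightarrow> mv n A u = (\<lambda>i. 0)"
  by (simp add: mv_def)

lemma op_norm_eq: "op_norm n A = (SUP u\<in>{u. L2_set u {..<n} = 1}. L2_set (mv n A u) {..<n})"
  unfolding op_norm_def mv_def by (rule arg_cong[where f = Sup]) auto

lemma op_norm_bdd: "bdd_above ((\<lambda>u. L2_set (mv n A u) {..<n}) ` {u. L2_set u {..<n} = 1})"
  by (rule bdd_aboveI2[where M = "sqrt (\<Sum>i<n. \<Sum>j<n. (A i j)\<^sup>2)"]) (use L2_set_mv_le_unit in blast)

lemma L2_set_unit: "(j::nat) < n \<Longrightarrow> L2_set (\<lambda>i. if i = j then 1 else 0) {..<n} = 1"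
  unfolding L2_set_def by (subst sum.remove[of _ j]) (auto intro!: sum.neutral)

lemma op_norm_bound: "L2_set (mv n A u) {..<n} \<le> op_norm n A * L2_set u {..<n}"
proof (cases "L2_set u {..<n} = 0")
  case True
  then have "mv n A u = (\<lambda>i. 0)" by (intro mv_zero) (simp add: L2_set_eq_0_iff)
  then show ?thesis using True by (simp add: L2_set_def)
next
  case False
  let ?a = "L2_set u {..<n}"
  have a: "?a > 0" using False by (simp add: less_le)
  have "L2_set (\<lambda>i. (1 / ?a) * u i) {..<n} = (1 / ?a) * ?a"
    using a by (intro L2_set_right_distrib[symmetric]) simp
  then have "L2_set (mv n A (\<lambda>i. (1 / ?a) * u i)) {..<n} \<le> op_norm n A"
    unfolding op_norm_eq using a by (intro cSUP_upper op_norm_bdd) simp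
  also have "L2_set (mv n A (\<lambda>i. (1 / ?a) * u i)) {..<n} = (1 / ?a) * L2_set (mv n A u) {..<n}"
    unfolding mv_scale using a by (intro L2_set_right_distrib[symmetric]) simp
  finally show ?thesis using a by (simp add: field_simps)
qed

lemma op_norm_least:
  assumes "0 < n" "\<And>u. L2_set u {..<n} = 1 \<Longrightarrow> L2_set (mv n A u) {..<n} \<le> c"
  shows "op_norm n A \<le> c"
  unfolding op_norm_eq using assms L2_set_unit[OF \<open>0 < n\<close>] by (intro cSUP_least) auto

lemma op_norm_nonneg: "0 < n \<Longrightarrow> 0 \<le> op_norm n A"
  using op_norm_bound[of n A "\<lambda>i. if i = 0 then 1 else 0"] L2_set_unit[of 0 n] L2_set_nonneg
  by (metis mult.right_neutral order_trans)

lemma op_norm_le_frob: "0 < n \<Longrightarrow> op_norm n A \<le> sqrt (\<Sum>i<n. \<Sum>j<n. (A i j)\<^sup>2)"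
  by (rule op_norm_least) (auto intro: L2_set_mv_le_unit)

lemma op_norm_sq_le_frob: "0 < n \<Longrightarrow> (op_norm n A)\<^sup>2 \<le> (\<Sum>i<n. \<Sum>j<n. (A i j)\<^sup>2)"
  using power_mono[OF op_norm_le_frob op_norm_nonneg, of n A 2] by (simp add: sum_nonneg)

lemma op_norm_cong: "(\<And>i j. i < n \<Longrightarrow> j < n \<Longrightarrow> A i j = B i j) \<Longrightarrow> op_norm n A = op_norm n B"
  unfolding op_norm_eq by (intro SUP_cong L2_set_cong refl) (simp add: mv_def)

lemma bil_le_op_norm: "\<bar>bil n A u v\<bar> \<le> op_norm n A * L2_set u {..<n} * L2_set v {..<n}"
proof -
  have "\<bar>bil n A u v\<bar> \<le> L2_set u {..<n} * L2_set (mv n A v) {..<n}"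
    unfolding bil_eq by (rule L2_set_CS)
  also have "\<dots> \<le> L2_set u {..<n} * (op_norm n A * L2_set v {..<n})"
    by (intro mult_left_mono op_norm_bound) simp
  finally show ?thesis by (simp add: mult_ac)
qed

lemma op_norm_leI_bil:
  assumes "0 < n" "\<And>u v. bil n A u v \<le> c * L2_set u {..<n} * L2_set v {..<n}"
  shows "op_norm n A \<le> c"
proof (rule op_norm_least[OF \<open>0 < n\<close>])
  fix u assume u: "L2_set u {..<n} = 1"
  let ?w = "mv n A u"
  have "L2_set ?w {..<n} * L2_set ?w {..<n} = bil n A ?w u"
    using L2_set_sq[of "{..<n}" ?w] by (simp add: bil_eq power2_eq_square)
  also have "\<dots> \<le> c * L2_set ?w {..<n}" using assms(2)[of ?w u] u by simp
  finally have "L2_set ?w {..<n} = 0 \<or> L2_set ?w {..<n} \<le> c"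
    using L2_set_nonneg[of ?w "{..<n}"] by (metis mult_le_cancel_right less_le)
  \<comment> \<open>Covers the case where \<open>mv n A u\<close> vanishes and cannot be divided by;
    testing with a unit vector and its negative bounds a number and its opposite by
    \<open>c\<close>.\<close>
  moreover have "0 \<le> c"
    using assms(2)[of "\<lambda>i. if i = 0 then 1 else 0" "\<lambda>i. if i = 0 then 1 else 0"]
      assms(2)[of "\<lambda>i. - (if i = 0 then 1 else 0)" "\<lambda>i. if i = 0 then 1 else 0"]
      L2_set_unit[OF \<open>0 < n\<close>] L2_set_right_distrib[of "- 1" "\<lambda>i. if i = 0 then 1 else 0" "{..<n}"]
    by (simp add: bil_def sum_negf L2_set_def)
  ultimately show "L2_set ?w {..<n} \<le> c" by auto
qed

lemma bil_add: "bil n (\<lambda>i j. A i j + B i j) u v = bil n A u v + bil n B u v"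
  by (simp add: bil_def algebra_simps sum.distrib)

lemma bil_diff: "bil n (\<lambda>i j. A i j - B i j) u v = bil n A u v - bil n B u v"
  by (simp add: bil_def algebra_simps sum_subtractf)

lemma op_norm_triangle: "0 < n \<Longrightarrow> op_norm n (\<lambda>i j. A i j + B i j) \<le> op_norm n A + op_norm n B"
proof (rule op_norm_leI_bil)
  fix u v
  show "bil n (\<lambda>i j. A i j + B i j) u v \<le> (op_norm n A + op_norm n B) * L2_set u {..<n} * L2_set v {..<n}"
    using bil_le_op_norm[of n A u v] bil_le_op_norm[of n B u v] unfolding bil_add ring_distribs by linarith
qed

lemma op_norm_scale: "0 \<le> c \<Longrightarrow> op_norm n (\<lambda>i j. c * A i j) \<le> c * op_norm n A" if "0 < n"
proof (rule op_norm_leI_bil[OF that])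
  fix u v assume "0 \<le> c"
  have "bil n (\<lambda>i j. c * A i j) u v = c * bil n A u v"
    by (simp add: bil_def sum_distrib_left mult.assoc)
  also have "\<dots> \<le> c * (op_norm n A * L2_set u {..<n} * L2_set v {..<n})"
    using bil_le_op_norm[of n A u v] \<open>0 \<le> c\<close> by (intro mult_left_mono) auto
  finally show "bil n (\<lambda>i j. c * A i j) u v \<le> c * op_norm n A * L2_set u {..<n} * L2_set v {..<n}"
    by (simp add: mult.assoc)
qed

text \<open>Countably many vectors suffice to test the operator norm, hence its measurability and bounds that
  hold almost surely for each pair of vectors.\<close>

definition rvec :: "rat list \<Rightarrow> nat \<Rightarrow> real" where
  "rvec xs i = (if i < length xs then of_rat (xs ! i) else 0)"

lemma rvec_approx: "\<exists>xs. \<forall>i<n. (\<lambda>k. rvec (xs k) i) \<longlonglongrightarrow> u i"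
proof -
  have "\<exists>q. u i < of_rat q \<and> of_rat q < u i + 1 / Suc k" for i k
    using of_rat_dense[of "u i" "u i + 1 / Suc k"] by auto
  then obtain q where q: "\<And>i k. u i < of_rat (q i k) \<and> of_rat (q i k) < u i + 1 / Suc k" by metis
  define xs where "xs k = map (\<lambda>i. q i k) [0..<n]" for k
  have "(\<lambda>k. rvec (xs k) i) \<longlonglongrightarrow> u i" if "i < n" for i
  proof (rule real_tendsto_sandwich[where f = "\<lambda>_. u i" and h = "\<lambda>k. u i + 1 / real (Suc k)"])
    have "(\<lambda>k. u i + 1 / real (Suc k)) \<longlonglongrightarrow> u i + 0"
      by (intro tendsto_add tendsto_const LIMSEQ_Suc lim_1_over_n)
    then show "(\<lambda>k. u i + 1 / real (Suc k)) \<longlonglongrightarrow> u i" by simp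
  qed (use that q[of i] in \<open>auto simp: rvec_def xs_def less_imp_le\<close>)
  then show ?thesis by blast
qed

lemma op_norm_leI_rvec:
  assumes "0 < n" and le: "\<And>xs ys. bil n A (rvec xs) (rvec ys) \<le> c * L2_set (rvec xs) {..<n} * L2_set (rvec ys) {..<n}"
  shows "op_norm n A \<le> c"
proof (rule op_norm_leI_bil[OF \<open>0 < n\<close>])
  fix u v :: "nat \<Rightarrow> real"
  obtain xs ys where xs: "\<And>i. i < n \<Longrightarrow> (\<lambda>k. rvec (xs k) i) \<longlonglongrightarrow> u i"
    and ys: "\<And>i. i < n \<Longrightarrow> (\<lambda>k. rvec (ys k) i) \<longlonglongrightarrow> v i"
    using rvec_approx by metis
  have "(\<lambda>k. bil n A (rvec (xs k)) (rvec (ys k))) \<longlonglongrightarrow> bil n A u v"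
    unfolding bil_def by (intro tendsto_sum tendsto_mult tendsto_const xs ys) auto
  moreover have "(\<lambda>k. c * L2_set (rvec (xs k)) {..<n} * L2_set (rvec (ys k)) {..<n})
      \<longlonglongrightarrow> c * L2_set u {..<n} * L2_set v {..<n}"
    unfolding L2_set_def by (intro tendsto_sum tendsto_mult tendsto_const tendsto_real_sqrt tendsto_power xs ys) auto
  ultimately show "bil n A u v \<le> c * L2_set u {..<n} * L2_set v {..<n}"
    using le by (intro LIMSEQ_le) auto
qed

lemma op_norm_le_iff_rvec:
  assumes "0 < n"
  shows "op_norm n A \<le> c \<longleftrightarrow>
    (\<forall>xs ys. bil n A (rvec xs) (rvec ys) \<le> c * L2_set (rvec xs) {..<n} * L2_set (rvec ys) {..<n})"
proof (intro iffI allI)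
  fix xs ys assume c: "op_norm n A \<le> c"
  have "bil n A (rvec xs) (rvec ys) \<le> op_norm n A * (L2_set (rvec xs) {..<n} * L2_set (rvec ys) {..<n})"
    using bil_le_op_norm[of n A "rvec xs" "rvec ys"] by (simp add: mult.assoc)
  also have "\<dots> \<le> c * (L2_set (rvec xs) {..<n} * L2_set (rvec ys) {..<n})"
    using c by (intro mult_right_mono) auto
  finally show "bil n A (rvec xs) (rvec ys) \<le> c * L2_set (rvec xs) {..<n} * L2_set (rvec ys) {..<n}"
    by (simp add: mult.assoc)
qed (use assms op_norm_leI_rvec in blast)

lemma op_norm_measurable [measurable (raw)]:
  assumes "0 < n" "\<And>i j. i < n \<Longrightarrow> j < n \<Longrightarrow> (\<lambda>w. A w i j) \<in> borel_measurable M"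
  shows "(\<lambda>w. op_norm n (A w)) \<in> borel_measurable M"
proof (rule borel_measurable_iff_le[THEN iffD2], intro allI)
  fix c
  have [measurable]: "(\<lambda>w. bil n (A w) u v) \<in> borel_measurable M" for u v
    unfolding bil_def using assms(2) by (intro borel_measurable_sum borel_measurable_times) auto
  show "{w \<in> space M. op_norm n (A w) \<le> c} \<in> sets M"
    unfolding op_norm_le_iff_rvec[OF assms(1)] by measurable
qed

section \<open>Symmetric matrices: operator norm and traces of powers\<close>

definition symm :: "nat \<Rightarrow> rmat \<Rightarrow> bool" where
  "symm n A \<longleftrightarrow> (\<forall>i<n. \<forall>j<n. A i j = A j i)"

lemma adj_emb: "symm n A \<Longrightarrow> adj n (emb n A) (emb n A)"
  by (auto simp: adj_def symm_def ent_emb)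

lemma mv_ent_power:
  assumes "i < n"
  shows "mv n (ent (emb n A ^ k)) u i = (mv n A ^^ k) u i"
  using assms
proof (induction k arbitrary: i)
  case 0
  then show ?case by (simp add: mv_def if_distrib[of "\<lambda>x. x * _"] sum.delta cong: if_cong)
next
  case (Suc k)
  have "mv n (ent (emb n A ^ Suc k)) u i = (\<Sum>j<n. (\<Sum>l<n. A i l * ent (emb n A ^ k) l j) * u j)"
    unfolding mv_def by (intro sum.cong refl) (simp add: ent_mult[where n = n] ent_emb Suc.prems)
  also have "\<dots> = (\<Sum>l<n. A i l * mv n (ent (emb n A ^ k)) u l)"
    by (simp add: mv_def sum_distrib_left sum_distrib_right mult.assoc) (rule sum.swap)
  also have "\<dots> = (\<Sum>l<n. A i l * (mv n A ^^ k) u l)" using Suc.IH by simp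
  finally show ?case unfolding funpow.simps o_apply mv_def[of n A "(mv n A ^^ k) u"] .
qed

lemma L2_set_mv_power: "L2_set ((mv n A ^^ k) u) {..<n} \<le> op_norm n A ^ k * L2_set u {..<n}" if "0 < n"
proof (induction k)
  case (Suc k)
  have "L2_set ((mv n A ^^ Suc k) u) {..<n} \<le> op_norm n A * L2_set ((mv n A ^^ k) u) {..<n}"
    using op_norm_bound[of n A "(mv n A ^^ k) u"] by simp
  also have "\<dots> \<le> op_norm n A * (op_norm n A ^ k * L2_set u {..<n})"
    by (intro mult_left_mono Suc.IH op_norm_nonneg that)
  finally show ?case by (simp add: mult.assoc)
qed simp

lemma ent_power_eq: "i < n \<Longrightarrow> j < n \<Longrightarrow> ent (emb n A ^ k) i j = (mv n A ^^ k) (\<lambda>l. if l = j then 1 else 0) i"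
  by (subst mv_ent_power[symmetric]) (simp_all add: mv_def if_distrib[of "times _"] sum.delta cong: if_cong)

lemma tr_power_eq:
  assumes "symm n A"
  shows "tr n (emb n A ^ (2 * m)) = (\<Sum>j<n. (L2_set ((mv n A ^^ m) (\<lambda>l. if l = j then 1 else 0)) {..<n})\<^sup>2)"
proof -
  have "tr n (emb n A ^ (2 * m)) = tr n (emb n A ^ m * emb n A ^ m)"
    by (simp add: power_add[symmetric] mult_2)
  also have "\<dots> = (\<Sum>i<n. \<Sum>j<n. (ent (emb n A ^ m) j i)\<^sup>2)"
    using tr_adj_eq[OF adj_power[OF adj_emb[OF assms]] adj_power[OF adj_emb[OF assms]]] by (simp add: power2_eq_square)
  finally show ?thesis by (simp add: L2_set_sq ent_power_eq)
qed

lemma abs_ent_power_le: "0 < n \<Longrightarrow> i < n \<Longrightarrow> j < n \<Longrightarrow> \<bar>ent (emb n A ^ k) i j\<bar> \<le> op_norm n A ^ k"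
proof -
  assume *: "0 < n" "i < n" "j < n"
  let ?w = "(mv n A ^^ k) (\<lambda>l. if l = j then 1 else 0)"
  have "\<bar>?w i\<bar> \<le> L2_set (\<lambda>i. \<bar>?w i\<bar>) {..<n}" by (rule member_le_L2_set) (use * in auto)
  also have "\<dots> \<le> op_norm n A ^ k"
    using L2_set_mv_power[OF *(1), where A = A and k = k and u = "\<lambda>l. if l = j then 1 else 0"] L2_set_unit[OF *(3)] by (simp add: L2_set_def)
  finally show ?thesis using * by (simp add: ent_power_eq)
qed

lemma mv_symm:
  assumes "symm n A"
  shows "(\<Sum>i<n. mv n A u i * v i) = (\<Sum>i<n. u i * mv n A v i)"
proof -
  have "(\<Sum>i<n. mv n A u i * v i) = (\<Sum>i<n. \<Sum>j<n. A j i * u j * v i)"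
    unfolding mv_def sum_distrib_right using assms by (intro sum.cong) (auto simp: symm_def)
  also have "\<dots> = (\<Sum>j<n. \<Sum>i<n. A j i * u j * v i)" by (rule sum.swap)
  finally show ?thesis by (simp add: mv_def sum_distrib_left mult_ac)
qed

text \<open>Holds without eigenvalues: for a unit vector \<open>u\<close> and symmetric
  \<open>A\<close> the squared norms of \<open>A^k u\<close> form a log-convex sequence starting at
  1, so the \<open>2 * m\<close>-th power of the norm of \<open>A u\<close> is at most the squared
  norm of \<open>A^m u\<close>. This is at most the squared Frobenius norm of \<open>A^m\<close>,
  which is the trace.\<close>

lemma op_norm_power_le_tr:
  assumes "0 < n" "symm n A" "0 < m"
  shows "op_norm n A ^ (2 * m) \<le> tr n (emb n A ^ (2 * m))"
proof -
  define t where "t = tr n (emb n A ^ (2 * m))"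
  obtain m' where m: "m = Suc m'" using \<open>0 < m\<close> by (cases m) auto
  have t0: "0 \<le> t" unfolding t_def tr_power_eq[OF assms(2)] by (simp add: sum_nonneg)
  have "op_norm n A \<le> root (2 * m) t"
  proof (rule op_norm_least[OF assms(1)])
    fix u assume u: "L2_set u {..<n} = 1"
    define w where "w k = (mv n A ^^ k) u" for k
    define a where "a k = (\<Sum>i<n. (w k i)\<^sup>2)" for k
    have wS: "w (Suc k) = mv n A (w k)" for k by (simp add: w_def)
    have lc: "(a (Suc k))\<^sup>2 \<le> a k * a (Suc (Suc k))" for k
    proof -
      have "a (Suc k) = (\<Sum>i<n. w k i * w (Suc (Suc k)) i)"
        unfolding a_def wS power2_eq_square by (rule mv_symm[OF assms(2)])
      then show ?thesis unfolding a_def by (simp only: Cauchy_Schwarz_ineq_sum)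
    qed
    have "a 0 = 1" using L2_set_sq[of "{..<n}" u] u by (simp add: a_def w_def)
    then have "a 1 ^ m \<le> a m"
      using log_convex_power_le'[of a m'] lc by (simp add: a_def sum_nonneg m)
    also have "a m \<le> t"
    proof -
      have "a m = (L2_set (mv n (ent (emb n A ^ m)) u) {..<n})\<^sup>2"
        by (simp add: a_def L2_set_sq w_def mv_ent_power)
      also have "\<dots> \<le> (sqrt (\<Sum>i<n. \<Sum>j<n. (ent (emb n A ^ m) i j)\<^sup>2))\<^sup>2"
        using L2_set_mv_le[of n "ent (emb n A ^ m)" u] u by (intro power_mono) auto
      also have "\<dots> = (\<Sum>j<n. \<Sum>i<n. (ent (emb n A ^ m) i j)\<^sup>2)"
        by (subst sum.swap) (simp add: sum_nonneg)
      also have "\<dots> = t" unfolding t_def tr_power_eq[OF assms(2)] by (simp add: L2_set_sq ent_power_eq)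
      finally show ?thesis .
    qed
    finally have "(L2_set (mv n A u) {..<n}) ^ (2 * m) \<le> t"
      by (simp add: power_mult L2_set_sq a_def w_def)
    then have "root (2 * m) ((L2_set (mv n A u) {..<n}) ^ (2 * m)) \<le> root (2 * m) t"
      using \<open>0 < m\<close> by simp
    then show "L2_set (mv n A u) {..<n} \<le> root (2 * m) t" using \<open>0 < m\<close> by (simp add: real_root_power_cancel)
  qed
  then have "op_norm n A ^ (2 * m) \<le> root (2 * m) t ^ (2 * m)"
    by (intro power_mono op_norm_nonneg assms)
  then show ?thesis using t0 \<open>0 < m\<close> by (simp add: t_def)
qed

text \<open>The hypothesis says that the sum of the \<open>(A k)^2\<close> is at most
  \<open>c\<close> times the identity as a quadratic form, phrased with vectors to avoid an order on
  matrices. The trace is the sum of this form over the vectors \<open>X^r e_j\<close>.\<close>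

lemma tr_square_power_le:
  assumes A: "\<And>k. k \<in> I \<Longrightarrow> symm n (A k)" and X: "symm n X"
    and c: "\<And>u. L2_set u {..<n} = 1 \<Longrightarrow> (\<Sum>k\<in>I. (L2_set (mv n (A k) u) {..<n})\<^sup>2) \<le> c"
  shows "(\<Sum>k\<in>I. tr n (emb n (A k) * emb n (A k) * emb n X ^ (2 * r))) \<le> c * tr n (emb n X ^ (2 * r))"
proof -
  have c': "(\<Sum>k\<in>I. (L2_set (mv n (A k) u) {..<n})\<^sup>2) \<le> c * (L2_set u {..<n})\<^sup>2" for u
  proof (cases "L2_set u {..<n} = 0")
    case True
    then have "mv n (A k) u = (\<lambda>i. 0)" for k by (intro mv_zero) (simp add: L2_set_eq_0_iff)
    then show ?thesis using True by (simp add: L2_set_def)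
  next
    case False
    let ?a = "L2_set u {..<n}"
    have a: "?a > 0" using False by (simp add: less_le)
    have "L2_set (\<lambda>i. (1 / ?a) * u i) {..<n} = (1 / ?a) * ?a"
      using a by (intro L2_set_right_distrib[symmetric]) simp
    then have "(\<Sum>k\<in>I. (L2_set (mv n (A k) (\<lambda>i. (1 / ?a) * u i)) {..<n})\<^sup>2) \<le> c" using a by (intro c) simp
    moreover have "L2_set (mv n (A k) (\<lambda>i. (1 / ?a) * u i)) {..<n} = (1 / ?a) * L2_set (mv n (A k) u) {..<n}" for k
      unfolding mv_scale using a by (intro L2_set_right_distrib[symmetric]) simp
    ultimately have "(\<Sum>k\<in>I. (L2_set (mv n (A k) u) {..<n})\<^sup>2) / ?a\<^sup>2 \<le> c"
      by (simp only: power_mult_distrib power_divide sum_divide_distrib) simp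
    then show ?thesis using a by (simp add: divide_le_eq)
  qed
  define w where "w j = (mv n X ^^ r) (\<lambda>l. if l = j then 1 else 0)" for j
  have eq: "tr n (emb n (A k) * emb n (A k) * emb n X ^ (2 * r)) = (\<Sum>j<n. (L2_set (mv n (A k) (w j)) {..<n})\<^sup>2)"
    if k: "k \<in> I" for k
  proof -
    let ?a = "emb n (A k)" and ?x = "emb n X ^ r"
    have ax: "adj n (?a * ?x) (?x * ?a)" by (intro adj_mult adj_power adj_emb A X k)
    have "tr n (?a * ?a * emb n X ^ (2 * r)) = tr n ((?a * ?a * ?x) * ?x)"
      by (simp only: mult_2 power_add mult.assoc)
    also have "\<dots> = tr n (?x * (?a * ?a * ?x))" by (rule tr_commute) auto
    also have "\<dots> = tr n ((?x * ?a) * (?a * ?x))" by (simp only: mult.assoc)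
    also have "\<dots> = (\<Sum>j<n. \<Sum>i<n. (ent (?a * ?x) i j)\<^sup>2)"
      using tr_adj_eq[OF ax ax] by (simp add: power2_eq_square)
    also have "\<dots> = (\<Sum>j<n. \<Sum>i<n. (mv n (A k) (w j) i)\<^sup>2)"
      by (intro sum.cong refl) (simp add: ent_mult[where n = n] ent_emb ent_power_eq w_def mv_def)
    finally show ?thesis by (simp add: L2_set_sq)
  qed
  have "(\<Sum>k\<in>I. tr n (emb n (A k) * emb n (A k) * emb n X ^ (2 * r)))
      = (\<Sum>j<n. \<Sum>k\<in>I. (L2_set (mv n (A k) (w j)) {..<n})\<^sup>2)"
    by (simp add: eq) (rule sum.swap)
  also have "\<dots> \<le> (\<Sum>j<n. c * (L2_set (w j) {..<n})\<^sup>2)" by (intro sum_mono c')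
  also have "\<dots> = c * tr n (emb n X ^ (2 * r))"
    by (simp add: tr_power_eq[OF X] w_def sum_distrib_left)
  finally show ?thesis .
qed

section \<open>Matrix Khintchine inequality and smoothness\<close>

text \<open>Telescoping sum that changes one factor \<open>x\<close> into \<open>y\<close> at a
  time.\<close>

lemma nc_power_diff:
  fixes x y :: "'a :: ring_1"
  shows "x ^ Suc q - y ^ Suc q = (\<Sum>s\<le>q. x ^ s * (x - y) * y ^ (q - s))"
proof (induction q)
  case (Suc q)
  have "x ^ Suc (Suc q) - y ^ Suc (Suc q) = (x - y) * y ^ Suc q + x * (x ^ Suc q - y ^ Suc q)"
    by (simp add: algebra_simps)
  also have "x * (x ^ Suc q - y ^ Suc q) = (\<Sum>s\<le>q. x ^ Suc s * (x - y) * y ^ (Suc q - Suc s))"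
    unfolding Suc.IH by (simp add: sum_distrib_left mult.assoc)
  finally show ?case by (subst sum.atMost_Suc_shift) simp
qed simp

text \<open>Pairs the sign patterns that differ exactly in the sign of \<open>k\<close>.\<close>

lemma sum_Pow_split:
  assumes "finite I" "k \<in> I"
  shows "(\<Sum>E\<in>Pow I. g E) = (\<Sum>E\<in>Pow (I - {k}). g E + g (insert k E))"
proof -
  have "Pow I = Pow (I - {k}) \<union> insert k ` Pow (I - {k})"
    using Pow_insert[of k "I - {k}"] assms by (simp add: insert_absorb)
  moreover have "Pow (I - {k}) \<inter> insert k ` Pow (I - {k}) = {}" by auto
  moreover have "inj_on (insert k) (Pow (I - {k}))" by (auto simp: inj_on_def)
  ultimately show ?thesis
    using assms by (simp add: sum.union_disjoint sum.reindex sum.distrib)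
qed

text \<open>A sign vector is encoded by the set \<open>E\<close> of indices with sign -1. Averaging
  over Rademacher signs is then a finite sum over \<open>Pow I\<close> and needs no probability
  space.\<close>

definition flip :: "nat set \<Rightarrow> nat \<Rightarrow> real" where
  "flip E k = (if k \<in> E then - 1 else 1)"

lemma symm_signed_sum: "(\<And>k. k \<in> I \<Longrightarrow> symm n (A k)) \<Longrightarrow> symm n (\<lambda>i j. \<Sum>k\<in>I. flip E k * A k i j)"
  by (auto simp: symm_def intro!: sum.cong)

text \<open>Discrete integration by parts. One factor of the power is expanded into the
  \<open>a k\<close>; pairing the patterns \<open>E\<close> and \<open>insert k E\<close> leaves a
  difference of odd powers, which telescopes into \<open>2 * m + 1\<close> products with two factors
  \<open>a k\<close>. Interpolation brings these factors together, and
  \<open>tr_square_power_le\<close> replaces the sum of the \<open>a k * a k\<close> by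
  \<open>c\<close>.\<close>

lemma khintchine_trace_step:
  assumes I: "finite I" and A: "\<And>k. k \<in> I \<Longrightarrow> symm n (A k)"
    and c: "\<And>u. L2_set u {..<n} = 1 \<Longrightarrow> (\<Sum>k\<in>I. (L2_set (mv n (A k) u) {..<n})\<^sup>2) \<le> c"
  defines "S \<equiv> \<lambda>m. \<Sum>E\<in>Pow I. tr n (emb n (\<lambda>i j. \<Sum>k\<in>I. flip E k * A k i j) ^ (2 * m))"
  shows "S (Suc m) \<le> (2 * (2 * real m + 1)) * c * S m"
proof -
  define X where "X E = (\<lambda>i j. \<Sum>k\<in>I. flip E k * A k i j)" for E
  define x where "x E = emb n (X E)" for E
  define a where "a k = emb n (A k)" for k
  define q where "q = 2 * m"
  have xE: "x E = (\<Sum>k\<in>I. flip E k *\<^sub>R a k)" for E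
    unfolding x_def X_def a_def emb_sum emb_simps ..
  have adjx: "adj n (x E) (x E)" for E
    unfolding x_def X_def by (intro adj_emb symm_signed_sum A)
  have adja: "adj n (a k) (a k)" if "k \<in> I" for k
    unfolding a_def by (intro adj_emb A that)
  have pr [simp]: "pres n (x E)" "pres n (a k)" for E k by (simp_all add: x_def a_def)
  define T where "T k E = tr n (a k * a k * x E ^ q)" for k E
  have step: "(\<Sum>E\<in>Pow I. flip E k * tr n (a k * x E ^ Suc q)) \<le> 2 * (real q + 1) * (\<Sum>E\<in>Pow I. T k E)"
    if k: "k \<in> I" for k
  proof -
    have le: "tr n (a k * x E ^ Suc q) - tr n (a k * x (insert k E) ^ Suc q)
        \<le> 2 * (real q + 1) * (T k E + T k (insert k E))" if E: "E \<in> Pow (I - {k})" for E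
    proof -
      let ?y = "x (insert k E)"
      have "flip E l *\<^sub>R a l - flip (insert k E) l *\<^sub>R a l = (if l = k then 2 *\<^sub>R a k else 0)" for l
        using E by (auto simp: flip_def scaleR_2)
      \<comment> \<open>Flipping the sign of \<open>k\<close> changes only the \<open>k\<close>-th
        summand, from \<open>a k\<close> to its negative; hence the factor 2 in the
        constant.\<close>
      then have d: "x E - ?y = 2 *\<^sub>R a k"
        unfolding xE sum_subtractf[symmetric] using I k by (simp add: sum.delta)
      have "tr n (a k * x E ^ Suc q) - tr n (a k * ?y ^ Suc q) = tr n (a k * (x E ^ Suc q - ?y ^ Suc q))"
        by (simp only: right_diff_distrib tr_simps)
      also have "\<dots> = (\<Sum>s\<le>q. 2 * tr n (a k * x E ^ s * a k * ?y ^ (q - s)))"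
        unfolding nc_power_diff d by (simp add: sum_distrib_left mult.assoc)
      \<comment> \<open>The exponent \<open>q = 2 * m\<close> is even as
        \<open>tr_interpolation\<close> requires; the two end terms belong to the two patterns, so
        summing over all pairs gives back a sum over \<open>Pow I\<close>.\<close>
      also have "\<dots> \<le> (\<Sum>s\<le>q. 2 * (T k E + T k (insert k E)))"
        unfolding T_def by (intro sum_mono mult_left_mono tr_interpolation adjx adja k) (auto simp: q_def)
      finally show ?thesis by (simp add: algebra_simps)
    qed
    have "(\<Sum>E\<in>Pow I. flip E k * tr n (a k * x E ^ Suc q))
       = (\<Sum>E\<in>Pow (I - {k}). tr n (a k * x E ^ Suc q) - tr n (a k * x (insert k E) ^ Suc q))"
      unfolding sum_Pow_split[OF I k] by (intro sum.cong) (auto simp: flip_def)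
    also have "\<dots> \<le> (\<Sum>E\<in>Pow (I - {k}). 2 * (real q + 1) * (T k E + T k (insert k E)))"
      by (intro sum_mono le)
    finally show ?thesis by (simp add: sum_Pow_split[OF I k] sum_distrib_left)
  qed
  have exp: "tr n (x E ^ (2 * Suc m)) = (\<Sum>k\<in>I. flip E k * tr n (a k * x E ^ Suc q))" for E
  proof -
    have "x E ^ (2 * Suc m) = (\<Sum>k\<in>I. flip E k *\<^sub>R a k) * x E ^ Suc q"
      by (simp add: xE[symmetric] q_def)
    then show ?thesis by (simp add: sum_distrib_right)
  qed
  have "S (Suc m) = (\<Sum>E\<in>Pow I. tr n (x E ^ (2 * Suc m)))" by (simp only: S_def x_def X_def)
  also have "\<dots> = (\<Sum>k\<in>I. \<Sum>E\<in>Pow I. flip E k * tr n (a k * x E ^ Suc q))"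
    unfolding exp by (rule sum.swap)
  also have "\<dots> \<le> (\<Sum>k\<in>I. 2 * (real q + 1) * (\<Sum>E\<in>Pow I. T k E))" by (intro sum_mono step)
  also have "\<dots> = 2 * (real q + 1) * (\<Sum>E\<in>Pow I. \<Sum>k\<in>I. T k E)"
    unfolding sum_distrib_left[symmetric] by (subst sum.swap) simp
  also have "\<dots> \<le> 2 * (real q + 1) * (\<Sum>E\<in>Pow I. c * tr n (x E ^ q))"
    unfolding T_def q_def a_def x_def X_def
    by (intro mult_left_mono sum_mono tr_square_power_le symm_signed_sum A c) auto
  finally show ?thesis by (simp add: S_def x_def X_def q_def sum_distrib_left mult_ac)
qed

text \<open>With this exponent the trace exceeds the power of the operator norm by at most the
  factor \<open>n \<le> exp 1 ^ m\<close>, which costs a constant after the \<open>m\<close>-th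
  root. Rounding up costs at most a factor 2 because \<open>n \<ge> 3\<close> gives
  \<open>ln n \<ge> 1\<close>.\<close>

lemma exponent_props:
  assumes "3 \<le> n"
  defines "m \<equiv> nat \<lceil>ln (real n)\<rceil>"
  shows "1 \<le> ln (real n)" "0 < m" "real n \<le> exp 1 ^ m" "real m \<le> 2 * ln (real n)"
proof -
  have "exp 1 \<le> real n" using assms exp_le by linarith
  then show ln1: "1 \<le> ln (real n)" using assms by (subst ln_ge_iff) auto
  then have "1 \<le> \<lceil>ln (real n)\<rceil>" by linarith
  then have m: "real m = real_of_int \<lceil>ln (real n)\<rceil>" "0 < m" unfolding m_def by auto
  then show "0 < m" by simp
  have mm: "ln (real n) \<le> real m" "real m \<le> ln (real n) + 1" using m by linarith+
  then show "real m \<le> 2 * ln (real n)" using ln1 by linarith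
  have "real n = exp (ln (real n))" using assms by simp
  also have "\<dots> \<le> exp (real m)" using mm by simp
  also have "\<dots> = exp 1 ^ m" by (simp add: exp_of_nat_mult[symmetric])
  finally show "real n \<le> exp 1 ^ m" .
qed

text \<open>Linear substitute for Jensen's inequality: it turns a bound on the moment of order
  \<open>Suc m\<close> into a bound on the mean, and loses a factor 2 when \<open>L ^ Suc m\<close>
  is the size of that moment.\<close>

lemma le_split_power:
  assumes "(0::real) < L" "0 \<le> x"
  shows "x \<le> L + x ^ Suc m / L ^ m"
proof (cases "x \<le> L")
  case False
  then have "L ^ m \<le> x ^ m" using assms by (intro power_mono) auto
  then have "x * L ^ m \<le> x * x ^ m" using assms by (intro mult_left_mono) auto
  then have "x \<le> x ^ Suc m / L ^ m" using assms by (simp add: le_divide_eq)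
  then show ?thesis using assms by simp
qed (use assms in \<open>auto intro: add_increasing2\<close>)

theorem matrix_khintchine:
  assumes n: "3 \<le> n" and I: "finite I" and A: "\<And>k. k \<in> I \<Longrightarrow> symm n (A k)"
    and c: "\<And>u. L2_set u {..<n} = 1 \<Longrightarrow> (\<Sum>k\<in>I. (L2_set (mv n (A k) u) {..<n})\<^sup>2) \<le> c"
  shows "(\<Sum>E\<in>Pow I. (op_norm n (\<lambda>i j. \<Sum>k\<in>I. flip E k * A k i j))\<^sup>2) \<le> 2 ^ card I * (48 * ln (real n) * c)"
proof (cases "c > 0")
  case True
  define m where "m = nat \<lceil>ln (real n)\<rceil>"
  note m = exponent_props[OF n, folded m_def]
  define X where "X E = (\<lambda>i j. \<Sum>k\<in>I. flip E k * A k i j)" for E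
  define S where "S m = (\<Sum>E\<in>Pow I. tr n (emb n (X E) ^ (2 * m)))" for m
  define b where "b = 4 * real m * c"
  have b: "b > 0" using m True by (simp add: b_def)
  \<comment> \<open>For \<open>l < m\<close> the factor \<open>2 * (2 * real l + 1) * c\<close> of
    one step is at most \<open>b\<close>; \<open>S 0\<close> is the trace of the identity times the
    number of patterns.\<close>
  have "l \<le> m \<Longrightarrow> S l \<le> b ^ l * (real n * 2 ^ card I)" for l
  proof (induction l)
    case 0
    show ?case using I by (simp add: S_def card_Pow)
  next
    case (Suc l)
    have "0 \<le> S l" unfolding S_def
      using tr_power_eq[OF symm_signed_sum[where I = I and A = A, OF A]] by (auto intro!: sum_nonneg simp: X_def)
    have "S (Suc l) \<le> (2 * (2 * real l + 1)) * c * S l"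
      using khintchine_trace_step[OF I A c] by (simp add: S_def X_def)
    also have "\<dots> \<le> b * S l" unfolding b_def
      using Suc.prems True \<open>0 \<le> S l\<close> by (intro mult_right_mono) auto
    also have "\<dots> \<le> b * (b ^ l * (real n * 2 ^ card I))"
      using Suc b by (intro mult_left_mono) auto
    finally show ?case by (simp add: mult.assoc)
  qed
  from this[of m] have "S m \<le> b ^ m * (real n * 2 ^ card I)" by simp
  also have "\<dots> \<le> b ^ m * (exp 1 ^ m * 2 ^ card I)"
    using m b by (intro mult_left_mono mult_right_mono) auto
  finally have Sm: "S m \<le> (b * exp 1) ^ m * 2 ^ card I" by (simp add: power_mult_distrib mult.assoc)
  \<comment> \<open>The dimension has become a factor \<open>exp 1\<close> per power. With this
    \<open>L\<close> both terms of \<open>le_split_power\<close> average to at most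
    \<open>L\<close>, and \<open>2 * L = 8 * exp 1 * m * c \<le> 48 * ln n * c\<close>.\<close>
  define L where "L = b * exp 1"
  have L: "L > 0" using b by (simp add: L_def)
  obtain m' where m': "m = Suc m'" using m by (cases m) auto
  have "(op_norm n (X E))\<^sup>2 \<le> L + tr n (emb n (X E) ^ (2 * m)) / L ^ m'" for E
  proof -
    have "(op_norm n (X E))\<^sup>2 \<le> L + ((op_norm n (X E))\<^sup>2) ^ m / L ^ m'"
      unfolding m' using L by (intro le_split_power) auto
    also have "((op_norm n (X E))\<^sup>2) ^ m \<le> tr n (emb n (X E) ^ (2 * m))"
      unfolding power_mult[symmetric]
      by (rule op_norm_power_le_tr) (use n m in \<open>auto simp: X_def intro!: symm_signed_sum A\<close>)
    finally show ?thesis using L by (simp add: divide_right_mono)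
  qed
  then have "(\<Sum>E\<in>Pow I. (op_norm n (X E))\<^sup>2) \<le> (\<Sum>E\<in>Pow I. L + tr n (emb n (X E) ^ (2 * m)) / L ^ m')"
    by (rule sum_mono)
  also have "\<dots> = 2 ^ card I * L + S m / L ^ m'"
    using I by (simp add: sum.distrib S_def card_Pow sum_divide_distrib)
  also have "S m / L ^ m' \<le> L ^ m * 2 ^ card I / L ^ m'"
    using Sm L by (intro divide_right_mono) (auto simp: L_def)
  also have "L ^ m * 2 ^ card I / L ^ m' = 2 ^ card I * L" using L by (simp add: m')
  also have "2 ^ card I * L + 2 ^ card I * L = 2 ^ card I * (8 * exp 1 * real m * c)" by (simp add: L_def b_def)
  also have "\<dots> \<le> 2 ^ card I * (48 * ln (real n) * c)"
  proof (intro mult_left_mono mult_right_mono)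
    have "exp 1 * real m \<le> 3 * (2 * ln (real n))" using m exp_le by (intro mult_mono) auto
    then show "8 * exp 1 * real m \<le> 48 * ln (real n)" by (simp add: mult.commute)
  qed (use True in auto)
  finally show ?thesis by (simp add: X_def)
next
  \<comment> \<open>A sum of squares is at most \<open>c\<close>, so \<open>c = 0\<close> and every
    \<open>A k\<close> vanishes on unit vectors. The case is separate because \<open>L\<close> has
    to be positive above.\<close>
  case False
  let ?e = "\<lambda>i::nat. if i = 0 then 1 else 0 :: real"
  have "c = 0" using c[OF L2_set_unit[of 0]] n sum_nonneg[of I "\<lambda>k. (L2_set (mv n (A k) ?e) {..<n})\<^sup>2"] False by fastforce
  have zero: "mv n (A k) u i = 0" if "k \<in> I" "L2_set u {..<n} = 1" "i < n" for k u i
  proof -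
    have "(\<Sum>k\<in>I. (L2_set (mv n (A k) u) {..<n})\<^sup>2) = 0"
      using c[OF that(2)] \<open>c = 0\<close> by (intro antisym sum_nonneg) auto
    then show ?thesis using that I by (simp add: sum_nonneg_eq_0_iff L2_set_eq_0_iff)
  qed
  have "mv n (\<lambda>i j. \<Sum>k\<in>I. flip E k * A k i j) u i = 0" if "L2_set u {..<n} = 1" "i < n" for E u i
  proof -
    have "mv n (\<lambda>i j. \<Sum>k\<in>I. flip E k * A k i j) u i = (\<Sum>k\<in>I. flip E k * mv n (A k) u i)"
      unfolding mv_def sum_distrib_right sum_distrib_left by (subst sum.swap) (simp add: mult.assoc)
    then show ?thesis using zero that by simp
  qed
  then have "op_norm n (\<lambda>i j. \<Sum>k\<in>I. flip E k * A k i j) \<le> 0" for E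
    using n by (intro op_norm_least) (auto simp: L2_set_def)
  then have "op_norm n (\<lambda>i j. \<Sum>k\<in>I. flip E k * A k i j) = 0" for E
    using op_norm_nonneg[of n] n by (meson antisym less_le_trans zero_less_numeral)
  then show ?thesis by (simp add: \<open>c = 0\<close>)
qed

text \<open>The squared Schatten norm of order \<open>2 * m\<close>, regularized:
  \<open>\<kappa> > 0\<close> keeps the base of the power positive, so that the function is smooth
  at the zero matrix too.\<close>

definition smooth_fn :: "nat \<Rightarrow> nat \<Rightarrow> real \<Rightarrow> rmat \<Rightarrow> real" where
  "smooth_fn n m \<kappa> A = (tr n (emb n A ^ (2 * m)) + \<kappa>) powr (1 / real m)"

text \<open>The gradient with respect to the entries: the derivative in direction \<open>H\<close>
  is the sum of the products with \<open>H i j\<close>, hence the transposed entry. The factor 2 is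
  \<open>2 * m\<close> times \<open>1 / m\<close>.\<close>

definition smooth_grad :: "nat \<Rightarrow> nat \<Rightarrow> real \<Rightarrow> rmat \<Rightarrow> rmat" where
  "smooth_grad n m \<kappa> A i j =
     2 * (tr n (emb n A ^ (2 * m)) + \<kappa>) powr (1 / real m - 1) * ent (emb n A ^ (2 * m - 1)) j i"

lemma tr_even_power_nonneg: "symm n A \<Longrightarrow> 0 \<le> tr n (emb n A ^ (2 * m))"
  by (simp add: tr_power_eq sum_nonneg)

text \<open>Interpolation with both ends equal to \<open>B\<close> moves the two factors
  \<open>H\<close> together, and \<open>tr_power_mono\<close> compares the exponents
  \<open>2 * m - 2\<close> and \<open>2 * m\<close> at the cost of the \<open>m\<close>-th root of
  \<open>n\<close>, at most 3. The constant is \<open>24 = 8 * 3\<close>, as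
  \<open>2 * (2 * m - 1) \<le> 8 * ln n\<close>.\<close>

lemma tr_second_derivative_le:
  assumes n: "3 \<le> n" and B: "symm n B" and H: "symm n H" and \<kappa>: "0 < \<kappa>"
  defines "m \<equiv> nat \<lceil>ln (real n)\<rceil>"
  shows "(\<Sum>l<2 * m - 1. tr n (emb n H * emb n B ^ l * emb n H * emb n B ^ (2 * m - 2 - l)))
     \<le> 24 * ln (real n) * (op_norm n H)\<^sup>2 * (tr n (emb n B ^ (2 * m)) + \<kappa>) powr (1 - 1 / real m)"
proof -
  note m = exponent_props[OF n, folded m_def]
  define t where "t = tr n (emb n B ^ (2 * m)) + \<kappa>"
  have t: "t > 0" "tr n (emb n B ^ (2 * m)) \<le> t" using tr_even_power_nonneg[OF B, of m] \<kappa> by (auto simp: t_def)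
  obtain m' where m': "m = Suc m'" using m by (cases m) auto
  define b where "b = tr n (emb n B ^ (2 * m'))"
  have b0: "0 \<le> b" unfolding b_def by (rule tr_even_power_nonneg[OF B])
  have "b \<le> 3 * t powr (1 - 1 / real m)"
  proof -
    have "b ^ m \<le> real n * tr n (emb n B ^ (2 * m)) ^ m'"
      using tr_power_mono[OF adj_emb[OF B], of m'] by (simp only: b_def m')
    also have "\<dots> \<le> exp 1 ^ m * t ^ m'"
      using m t tr_even_power_nonneg[OF B] by (intro mult_mono power_mono) auto
    also have "t ^ m' = (t powr (1 - 1 / real m)) ^ m"
    proof -
      have "(1 - 1 / real m) * real m = real m'" by (simp add: m' field_simps)
      then show ?thesis using t by (simp add: powr_realpow[symmetric] powr_powr)
    qed
    finally have "b ^ m \<le> (exp 1 * t powr (1 - 1 / real m)) ^ m" by (simp add: power_mult_distrib)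
    then have "b \<le> exp 1 * t powr (1 - 1 / real m)"
      using b0 m by (subst (asm) power_mono_iff) auto
    also have "\<dots> \<le> 3 * t powr (1 - 1 / real m)" by (intro mult_right_mono exp_le) auto
    finally show ?thesis .
  qed
  have HH: "tr n (emb n H * emb n H * emb n B ^ (2 * m')) \<le> (op_norm n H)\<^sup>2 * b"
  proof -
    have "(L2_set (mv n H u) {..<n})\<^sup>2 \<le> (op_norm n H)\<^sup>2" if "L2_set u {..<n} = 1" for u
      using op_norm_bound[of n H u] that by (intro power_mono) auto
    then show ?thesis
      using tr_square_power_le[where I = "{0::nat}" and A = "\<lambda>_. H" and X = B and r = m' and n = n] H B
      by (simp add: b_def)
  qed
  have "(\<Sum>l<2 * m - 1. tr n (emb n H * emb n B ^ l * emb n H * emb n B ^ (2 * m - 2 - l)))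
     \<le> (\<Sum>l<2 * m - 1. 2 * ((op_norm n H)\<^sup>2 * b))"
  proof (rule sum_mono)
    fix l assume "l \<in> {..<2 * m - 1}"
    then have "l \<le> 2 * m'" by (simp add: m')
    then show "tr n (emb n H * emb n B ^ l * emb n H * emb n B ^ (2 * m - 2 - l)) \<le> 2 * ((op_norm n H)\<^sup>2 * b)"
      using tr_interpolation[OF adj_emb[OF H] adj_emb[OF B] adj_emb[OF B], of "2 * m'" l] HH by (simp add: m')
  qed
  also have "\<dots> = (real (2 * m - 1) * 2) * ((op_norm n H)\<^sup>2 * b)" by simp
  also have "\<dots> \<le> (8 * ln (real n)) * ((op_norm n H)\<^sup>2 * (3 * t powr (1 - 1 / real m)))"
  proof (rule mult_mono)
    show "real (2 * m - 1) * 2 \<le> 8 * ln (real n)" using m by linarith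
    show "(op_norm n H)\<^sup>2 * b \<le> (op_norm n H)\<^sup>2 * (3 * t powr (1 - 1 / real m))"
      using \<open>b \<le> _\<close> by (intro mult_left_mono) auto
  qed (use m b0 in auto)
  finally show ?thesis by (simp add: t_def)
qed

text \<open>Second-order Taylor expansion along the segment from \<open>A\<close> to
  \<open>A + H\<close>. The second derivative is at most \<open>48 * ln n * (op_norm n H)^2\<close>
  on the whole segment, uniformly in \<open>A\<close> and \<open>\<kappa>\<close>; half of it is the
  remainder.\<close>

theorem smooth_fn_le:
  assumes n: "3 \<le> n" and A: "symm n A" and H: "symm n H" and \<kappa>: "0 < \<kappa>"
  defines "m \<equiv> nat \<lceil>ln (real n)\<rceil>"
  shows "smooth_fn n m \<kappa> (\<lambda>i j. A i j + H i j) \<le>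
    smooth_fn n m \<kappa> A + (\<Sum>i<n. \<Sum>j<n. smooth_grad n m \<kappa> A i j * H i j) + 24 * ln (real n) * (op_norm n H)\<^sup>2"
proof -
  note m = exponent_props[OF n, folded m_def]
  define a h where "a = emb n A" and "h = emb n H"
  define p where "p = 1 / real m"
  define B where "B s = (\<lambda>i j. A i j + s * H i j)" for s
  have embB: "emb n (B s) = a + s *\<^sub>R h" for s
    by (simp only: B_def a_def h_def emb_simps)
  have symB: "symm n (B s)" for s using A H by (auto simp: symm_def B_def)
  define \<phi> where "\<phi> s = tr n ((a + s *\<^sub>R h) ^ (2 * m)) + \<kappa>" for s
  define \<phi>1 where "\<phi>1 s = real (2 * m) * tr n (h * (a + s *\<^sub>R h) ^ (2 * m - 1))" for s
  define \<phi>2 where "\<phi>2 s = real (2 * m) * (\<Sum>l<2 * m - 1. tr n (h * (a + s *\<^sub>R h) ^ l * h * (a + s *\<^sub>R h) ^ (2 * m - 2 - l)))" for s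
  have pr: "pres n a" "pres n h" by (simp_all add: a_def h_def)
  have \<phi>pos: "\<phi> s > 0" for s
    using tr_even_power_nonneg[OF symB[of s], of m] \<kappa> by (simp add: \<phi>_def embB)
  have d1: "(\<phi> has_real_derivative \<phi>1 s) (at s)" for s
    unfolding \<phi>_def[abs_def] \<phi>1_def using has_derivative_tr_power[OF pr] by (auto intro!: derivative_eq_intros)
  have d2: "(\<phi>1 has_real_derivative \<phi>2 s) (at s)" for s
    unfolding \<phi>1_def[abs_def] \<phi>2_def using has_derivative_tr_mult_power[OF pr, of "2 * m - 1" s]
    by (intro DERIV_cmult) (simp add: numeral_2_eq_2)
  define \<psi> where "\<psi> s = \<phi> s powr p" for s
  define \<psi>1 where "\<psi>1 s = p * \<phi> s powr (p - 1) * \<phi>1 s" for s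
  define \<psi>2 where "\<psi>2 s = p * ((p - 1) * \<phi> s powr (p - 1 - 1) * \<phi>1 s) * \<phi>1 s + p * \<phi> s powr (p - 1) * \<phi>2 s" for s
  have e1: "(\<psi> has_real_derivative \<psi>1 s) (at s)" for s
    unfolding \<psi>_def[abs_def] \<psi>1_def using DERIV_fun_powr[OF d1 \<phi>pos, of p s] by simp
  have e2: "(\<psi>1 has_real_derivative \<psi>2 s) (at s)" for s
  proof -
    have "((\<lambda>s. \<phi> s powr (p - 1)) has_real_derivative (p - 1) * \<phi> s powr (p - 1 - 1) * \<phi>1 s) (at s)"
      using DERIV_fun_powr[OF d1 \<phi>pos, of "p - 1" s] by simp
    from DERIV_mult[OF DERIV_cmult[OF this, of p] d2[of s]] show ?thesis
      unfolding \<psi>1_def[abs_def] \<psi>2_def by (simp add: mult.commute[of "\<phi>2 s"])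
  qed
  have p: "0 < p" "p \<le> 1" using m by (auto simp: p_def)
  have bound: "\<psi>2 s \<le> 48 * ln (real n) * (op_norm n H)\<^sup>2" for s
  proof -
    \<comment> \<open>The part with the squared first derivative is nonpositive because
      \<open>p = 1 / m\<close> is at most 1. In the other part \<open>\<phi> s powr (p - 1)\<close>
      cancels the power \<open>1 - p\<close> from the previous lemma.\<close>
    have "p * ((p - 1) * \<phi> s powr (p - 1 - 1) * \<phi>1 s) * \<phi>1 s = - (p * (1 - p) * \<phi> s powr (p - 1 - 1) * (\<phi>1 s)\<^sup>2)"
      by (simp add: power2_eq_square algebra_simps)
    also have "\<dots> \<le> 0" using p by simp
    finally have "\<psi>2 s \<le> p * \<phi> s powr (p - 1) * \<phi>2 s" by (simp add: \<psi>2_def)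
    also have "\<phi>2 s \<le> real (2 * m) * (24 * ln (real n) * (op_norm n H)\<^sup>2 * \<phi> s powr (1 - p))"
      using tr_second_derivative_le[OF n symB H \<kappa>, of s]
      unfolding \<phi>2_def \<phi>_def p_def h_def[symmetric] embB m_def[symmetric] by (intro mult_left_mono) auto
    also have "p * \<phi> s powr (p - 1) * (real (2 * m) * (24 * ln (real n) * (op_norm n H)\<^sup>2 * \<phi> s powr (1 - p)))
       = (\<phi> s powr (p - 1) * \<phi> s powr (1 - p)) * (p * real m) * (48 * ln (real n) * (op_norm n H)\<^sup>2)"
      by simp
    also have "\<phi> s powr (p - 1) * \<phi> s powr (1 - p) = 1" using \<phi>pos[of s] by (simp add: powr_add[symmetric])
    also have "p * real m = 1" using m by (simp add: p_def)
    finally show ?thesis using p by (simp add: mult_left_mono)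
  qed
  have "\<exists>t. 0 < t \<and> t \<le> 1 \<and> \<psi> 1 = (\<Sum>m<2. (\<lambda>m. if m = 0 then \<psi> else if m = 1 then \<psi>1 else \<psi>2) m 0 / fact m * 1 ^ m)
      + (\<lambda>m. if m = 0 then \<psi> else if m = 1 then \<psi>1 else \<psi>2) (2::nat) t / fact 2 * 1 ^ 2"
    by (rule Maclaurin2) (use e1 e2 in \<open>auto simp: less_2_cases_iff\<close>)
  then obtain t where "\<psi> 1 = \<psi> 0 + \<psi>1 0 + \<psi>2 t / 2" by (auto simp: numeral_2_eq_2)
  then have "\<psi> 1 \<le> \<psi> 0 + \<psi>1 0 + 24 * ln (real n) * (op_norm n H)\<^sup>2" using bound[of t] by simp
  moreover have "\<psi> 1 = smooth_fn n m \<kappa> (\<lambda>i j. A i j + H i j)"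
    unfolding \<psi>_def \<phi>_def smooth_fn_def p_def embB[symmetric] B_def by simp
  moreover have "\<psi> 0 = smooth_fn n m \<kappa> A"
    unfolding \<psi>_def \<phi>_def smooth_fn_def p_def a_def by simp
  moreover have "\<psi>1 0 = (\<Sum>i<n. \<Sum>j<n. smooth_grad n m \<kappa> A i j * H i j)"
  proof -
    have "\<psi>1 0 = 2 * \<phi> 0 powr (p - 1) * tr n (h * a ^ (2 * m - 1))"
      using m by (simp add: \<psi>1_def \<phi>1_def p_def)
    also have "tr n (h * a ^ (2 * m - 1)) = (\<Sum>i<n. \<Sum>j<n. H i j * ent (a ^ (2 * m - 1)) j i)"
      using pr by (simp add: tr_mult) (simp add: h_def ent_emb)
    finally show ?thesis
      unfolding smooth_grad_def \<phi>_def p_def a_def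
      by (simp add: sum_distrib_left mult_ac)
  qed
  ultimately show ?thesis by simp
qed

section \<open>Moments of the data\<close>

lemma (in prob_space) sigma_finite_subalgebraI: "subalgebra M F \<Longrightarrow> sigma_finite_subalgebra M F"
proof -
  assume "subalgebra M F"
  then interpret finite_measure_subalgebra M F by unfold_locales
  show ?thesis by unfold_locales
qed

lemma (in prob_space) real_cond_exp_charact':
  assumes "subalgebra M F" "integrable M f" "integrable M g" "g \<in> borel_measurable F"
    and "\<And>A. A \<in> sets F \<Longrightarrow> (\<integral>\<omega>. indicator A \<omega> * f \<omega> \<partial>M) = (\<integral>\<omega>. indicator A \<omega> * g \<omega> \<partial>M)"
  shows "AE \<omega> in M. real_cond_exp M F f \<omega> = g \<omega>"
proof -
  interpret sigma_finite_subalgebra M F by (rule sigma_finite_subalgebraI[OF assms(1)])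
  show ?thesis by (rule real_cond_exp_charact) (use assms in \<open>auto simp: set_lebesgue_integral_def\<close>)
qed

lemma (in prob_space) integrable_indicator_mult:
  fixes f :: "'a \<Rightarrow> real"
  shows "A \<in> sets M \<Longrightarrow> integrable M f \<Longrightarrow> integrable M (\<lambda>\<omega>. indicator A \<omega> * f \<omega>)"
  using integrable_mult_indicator[of A M f] by simp

text \<open>The inequality is tested on the set where the conditional expectation exceeds
  \<open>g\<close>, which lies in \<open>F\<close> since both functions are
  \<open>F\<close>-measurable.\<close>

lemma (in prob_space) real_cond_exp_leI:
  assumes F: "subalgebra M F" and f: "integrable M f" and g: "integrable M g" "g \<in> borel_measurable F"
    and le: "\<And>A. A \<in> sets F \<Longrightarrow> (\<integral>\<omega>. indicator A \<omega> * f \<omega> \<partial>M) \<le> (\<integral>\<omega>. indicator A \<omega> * g \<omega> \<partial>M)"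
  shows "AE \<omega> in M. real_cond_exp M F f \<omega> \<le> g \<omega>"
proof -
  interpret sigma_finite_subalgebra M F by (rule sigma_finite_subalgebraI[OF F])
  define h where "h = real_cond_exp M F f"
  have h: "integrable M h" "h \<in> borel_measurable F" unfolding h_def using f by auto
  have sp: "space F = space M" "sets F \<subseteq> sets M" using F by (auto simp: subalgebra_def)
  define A where "A = {\<omega> \<in> space M. g \<omega> < h \<omega>}"
  have A: "A \<in> sets F" unfolding A_def sp(1)[symmetric] using g h by measurable
  then have AM: "A \<in> sets M" using sp by auto
  have "(\<integral>\<omega>. indicator A \<omega> * h \<omega> \<partial>M) = (\<integral>\<omega>. indicator A \<omega> * f \<omega> \<partial>M)"
    unfolding h_def by (rule real_cond_exp_intg(2)) (use A f integrable_indicator_mult[OF AM f] in auto)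
  also have "\<dots> \<le> (\<integral>\<omega>. indicator A \<omega> * g \<omega> \<partial>M)" by (rule le[OF A])
  finally have "(\<integral>\<omega>. indicator A \<omega> * (h \<omega> - g \<omega>) \<partial>M) \<le> 0"
    using integrable_indicator_mult[OF AM h(1)] integrable_indicator_mult[OF AM g(1)]
    by (simp add: right_diff_distrib)
  moreover have nn: "0 \<le> indicator A \<omega> * (h \<omega> - g \<omega>)" for \<omega> by (auto simp: A_def split: split_indicator)
  ultimately have "(\<integral>\<omega>. indicator A \<omega> * (h \<omega> - g \<omega>) \<partial>M) = 0"
    by (intro antisym integral_nonneg_AE) auto
  then have "AE \<omega> in M. indicator A \<omega> * (h \<omega> - g \<omega>) = 0"
    using integral_nonneg_eq_0_iff_AE[of M "\<lambda>\<omega>. indicator A \<omega> * (h \<omega> - g \<omega>)"] nn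
      integrable_indicator_mult[OF AM Bochner_Integration.integrable_diff[OF h(1) g(1)]] by auto
  then show ?thesis using AE_space by eventually_elim (auto simp: A_def h_def split: split_indicator_asm)
qed

lemma gen_sigma_sets: "sets (gen_sigma M S I Z) = sigma_sets (space M) {Z i -` B \<inter> space M | i B. i \<in> I \<and> B \<in> sets S}"
  and gen_sigma_space [simp]: "space (gen_sigma M S I Z) = space M"
proof -
  have "{Z i -` B \<inter> space M | i B. i \<in> I \<and> B \<in> sets S} \<subseteq> Pow (space M)" by auto
  then show "sets (gen_sigma M S I Z) = sigma_sets (space M) {Z i -` B \<inter> space M | i B. i \<in> I \<and> B \<in> sets S}"
    and "space (gen_sigma M S I Z) = space M"
    unfolding gen_sigma_def by (simp_all add: sets_measure_of space_measure_of)
qed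

lemma gen_sigma_subalgebra:
  assumes "\<And>i. i \<in> I \<Longrightarrow> Z i \<in> M \<rightarrow>\<^sub>M S"
  shows "subalgebra M (gen_sigma M S I Z)"
  unfolding subalgebra_def gen_sigma_sets
  using assms by (auto intro!: sets.sigma_sets_subset)

lemma gen_sigma_measurable:
  assumes "i \<in> I" "Z i \<in> M \<rightarrow>\<^sub>M S"
  shows "Z i \<in> gen_sigma M S I Z \<rightarrow>\<^sub>M S"
  using assms by (intro measurableI) (auto simp: gen_sigma_sets dest: measurable_space intro!: sigma_sets.Basic)

lemma gen_sigma_mono:
  assumes "I \<subseteq> J"
  shows "sets (gen_sigma M S I Z) \<subseteq> sets (gen_sigma M S J Z)"
  unfolding gen_sigma_sets using assms by (intro sigma_sets_mono') auto

section \<open>Moments from the sub-Gaussian norm\<close>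

lemma abs_mult_le_squares: "\<bar>x * y\<bar> \<le> x\<^sup>2 + (y::real)\<^sup>2"
proof -
  have "2 * (\<bar>x\<bar> * \<bar>y\<bar>) \<le> x\<^sup>2 + y\<^sup>2" using sum_squares_bound[of "\<bar>x\<bar>" "\<bar>y\<bar>"] by (simp add: mult.assoc)
  moreover have "0 \<le> \<bar>x\<bar> * \<bar>y\<bar>" by simp
  ultimately show ?thesis unfolding abs_mult by linarith
qed

lemma abs_mult4_le: "\<bar>a * b * c * d\<bar> \<le> a ^ 4 + b ^ 4 + c ^ 4 + (d::real) ^ 4"
proof -
  have sq2: "(\<bar>x * y\<bar>)\<^sup>2 \<le> (x ^ 4 + y ^ 4) / 2" for x y :: real
    using sum_squares_bound[of "x\<^sup>2" "y\<^sup>2"] by (simp add: power_mult_distrib)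
  have "\<bar>a * b * c * d\<bar> = \<bar>\<bar>a * b\<bar> * \<bar>c * d\<bar>\<bar>" by (simp add: abs_mult)
  also have "\<dots> \<le> \<bar>a * b\<bar>\<^sup>2 + \<bar>c * d\<bar>\<^sup>2" by (rule abs_mult_le_squares)
  also have "\<dots> \<le> (a ^ 4 + b ^ 4) / 2 + (c ^ 4 + d ^ 4) / 2" by (intro add_mono sq2)
  also have "\<dots> \<le> a ^ 4 + b ^ 4 + c ^ 4 + d ^ 4"
  proof -
    have "0 \<le> a ^ 4" "0 \<le> b ^ 4" "0 \<le> c ^ 4" "0 \<le> d ^ 4" by simp_all
    moreover have "(p + q) / 2 + (r + s) / 2 \<le> p + q + r + s" if "0 \<le> p" "0 \<le> q" "0 \<le> r" "0 \<le> s" for p q r s :: real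
      using that by (simp add: field_simps)
    ultimately show ?thesis by blast
  qed
  finally show ?thesis .
qed

lemma fourth_le_exp:
  assumes "0 < b"
  shows "z ^ 4 \<le> 2 * b\<^sup>2 * exp (\<bar>z\<bar>\<^sup>2 / (b::real))"
proof -
  define y where "y = z\<^sup>2 / b"
  have y: "y \<ge> 0" "z\<^sup>2 = b * y" using assms by (auto simp: y_def)
  have "y\<^sup>2 \<le> 2 * exp y" using exp_lower_Taylor_quadratic[of y] y by simp
  then have "b\<^sup>2 * y\<^sup>2 \<le> b\<^sup>2 * (2 * exp y)" by (intro mult_left_mono) auto
  moreover have "z ^ 4 = b\<^sup>2 * y\<^sup>2"
  proof -
    have "z ^ 4 = (z\<^sup>2)\<^sup>2" by simp
    also have "\<dots> = (b * y)\<^sup>2" by (simp only: y(2))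
    finally show ?thesis by (simp add: power_mult_distrib)
  qed
  ultimately show ?thesis by (simp add: y_def)
qed

text \<open>The infimum in \<open>psi2_norm\<close> need not be attained. Its square is at most
  \<open>s / c\<^sub>0\<close>, so twice this value leaves room for an admissible \<open>u\<close>
  with \<open>u\<^sup>2 < 2 * s / c\<^sub>0\<close>.\<close>

lemma (in prob_space) psi2_norm_exp_bound:
  assumes z: "z \<in> borel_measurable M" and "0 < c\<^sub>0" "0 < s"
    and le: "ennreal c\<^sub>0 * (psi2_norm M z)\<^sup>2 \<le> ennreal s"
  shows "(\<integral>\<^sup>+\<omega>. ennreal (exp (\<bar>z \<omega>\<bar>\<^sup>2 / (2 * s / c\<^sub>0))) \<partial>M) \<le> 2"
proof -
  define b where "b = 2 * s / c\<^sub>0"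
  have b: "b > 0" using assms by (simp add: b_def)
  have "\<exists>u. 0 < u \<and> (\<integral>\<^sup>+\<omega>. ennreal (exp (\<bar>z \<omega>\<bar>\<^sup>2 / u\<^sup>2)) \<partial>M) \<le> 2 \<and> u\<^sup>2 < b"
  proof (rule ccontr)
    assume no: "\<not> ?thesis"
    have "ennreal (sqrt b) \<le> psi2_norm M z"
      unfolding psi2_norm_def
    proof (rule INF_greatest)
      fix u assume "u \<in> {u. 0 < u \<and> (\<integral>\<^sup>+\<omega>. ennreal (exp (\<bar>z \<omega>\<bar>\<^sup>2 / u\<^sup>2)) \<partial>M) \<le> 2}"
      then have "b \<le> u\<^sup>2" "0 < u" using no by auto
      then show "ennreal (sqrt b) \<le> ennreal u" by (intro ennreal_leI real_le_lsqrt) (use b in auto)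
    qed
    then have "ennreal c\<^sub>0 * (ennreal (sqrt b))\<^sup>2 \<le> ennreal c\<^sub>0 * (psi2_norm M z)\<^sup>2"
      by (intro mult_left_mono power_mono) auto
    also have "ennreal c\<^sub>0 * (ennreal (sqrt b))\<^sup>2 = ennreal (c\<^sub>0 * b)"
      using b assms by (simp add: ennreal_power ennreal_mult)
    finally have "ennreal (c\<^sub>0 * b) \<le> ennreal s" using le by (rule order_trans)
    then show False using assms by (simp add: b_def)
  qed
  then obtain u where u: "0 < u" "(\<integral>\<^sup>+\<omega>. ennreal (exp (\<bar>z \<omega>\<bar>\<^sup>2 / u\<^sup>2)) \<partial>M) \<le> 2" "u\<^sup>2 < b" by auto
  have "(\<integral>\<^sup>+\<omega>. ennreal (exp (\<bar>z \<omega>\<bar>\<^sup>2 / b)) \<partial>M) \<le> (\<integral>\<^sup>+\<omega>. ennreal (exp (\<bar>z \<omega>\<bar>\<^sup>2 / u\<^sup>2)) \<partial>M)"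
    using u b by (intro nn_integral_mono ennreal_leI) (simp add: divide_left_mono)
  then show ?thesis using u(2) unfolding b_def by (rule order_trans)
qed

lemma (in prob_space) nn_integral_le_imp_integrable:
  fixes f :: "'a \<Rightarrow> real"
  assumes "f \<in> borel_measurable M" "\<And>\<omega>. 0 \<le> f \<omega>" "0 \<le> c" "(\<integral>\<^sup>+\<omega>. ennreal (f \<omega>) \<partial>M) \<le> ennreal c"
  shows "integrable M f" "(\<integral>\<omega>. f \<omega> \<partial>M) \<le> c"
proof -
  have "(\<integral>\<^sup>+\<omega>. ennreal (f \<omega>) \<partial>M) < \<infinity>" using assms(4) by (rule le_less_trans) simp
  then show i: "integrable M f" using assms by (intro integrableI_nonneg) auto
  show "(\<integral>\<omega>. f \<omega> \<partial>M) \<le> c" using nn_integral_eq_integral[OF i] assms by simp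
qed

lemma (in prob_space) sub_gaussian_exp_moment:
  assumes z: "z \<in> borel_measurable M" and "0 < c\<^sub>0" "0 < s"
    and le: "ennreal c\<^sub>0 * (psi2_norm M z)\<^sup>2 \<le> ennreal s"
  shows "integrable M (\<lambda>\<omega>. exp (\<bar>z \<omega>\<bar>\<^sup>2 / (2 * s / c\<^sub>0)))" "(\<integral>\<omega>. exp (\<bar>z \<omega>\<bar>\<^sup>2 / (2 * s / c\<^sub>0)) \<partial>M) \<le> 2"
  using nn_integral_le_imp_integrable[of "\<lambda>\<omega>. exp (\<bar>z \<omega>\<bar>\<^sup>2 / (2 * s / c\<^sub>0))" 2] z
    psi2_norm_exp_bound[OF assms] by auto

text \<open>With \<open>b = 2 * s / c\<^sub>0\<close> the fourth power is at most
  \<open>2 * b\<^sup>2\<close> times an exponential of mean at most 2, and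
  \<open>4 * b\<^sup>2 = 16 * s\<^sup>2 / c\<^sub>0\<^sup>2\<close>. If \<open>s = 0\<close> the
  variable vanishes almost surely.\<close>

lemma (in prob_space) sub_gaussian_fourth_moment:
  assumes z: "z \<in> borel_measurable M" and c0: "0 < c\<^sub>0" and sq: "integrable M (\<lambda>\<omega>. (z \<omega>)\<^sup>2)"
    and le: "ennreal c\<^sub>0 * (psi2_norm M z)\<^sup>2 \<le> ennreal (\<integral>\<omega>. (z \<omega>)\<^sup>2 \<partial>M)"
  shows "integrable M (\<lambda>\<omega>. (z \<omega>) ^ 4)" "(\<integral>\<omega>. (z \<omega>) ^ 4 \<partial>M) \<le> 16 / c\<^sub>0\<^sup>2 * (\<integral>\<omega>. (z \<omega>)\<^sup>2 \<partial>M)\<^sup>2"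
proof -
  define s where "s = (\<integral>\<omega>. (z \<omega>)\<^sup>2 \<partial>M)"
  have "0 \<le> s" unfolding s_def by simp
  have "integrable M (\<lambda>\<omega>. (z \<omega>) ^ 4) \<and> (\<integral>\<omega>. (z \<omega>) ^ 4 \<partial>M) \<le> 16 / c\<^sub>0\<^sup>2 * s\<^sup>2"
  proof (cases "s = 0")
    case True
    then have "AE \<omega> in M. (z \<omega>)\<^sup>2 = 0" using sq unfolding s_def by (subst (asm) integral_nonneg_eq_0_iff_AE) auto
    then have ae: "AE \<omega> in M. (z \<omega>) ^ 4 = 0" by eventually_elim simp
    have "integrable M (\<lambda>\<omega>. (z \<omega>) ^ 4) \<longleftrightarrow> integrable M (\<lambda>\<omega>. 0 :: real)"
      by (rule integrable_cong_AE) (use z ae in auto)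
    moreover have "(\<integral>\<omega>. (z \<omega>) ^ 4 \<partial>M) = (\<integral>\<omega>. 0 \<partial>M)" by (rule integral_cong_AE) (use z ae in auto)
    ultimately show ?thesis by simp
  next
    case False
    then have s: "0 < s" using \<open>0 \<le> s\<close> by simp
    define b where "b = 2 * s / c\<^sub>0"
    have b: "0 < b" using s c0 by (simp add: b_def)
    note e = sub_gaussian_exp_moment[OF z c0 s le[folded s_def], folded b_def]
    have i: "integrable M (\<lambda>\<omega>. (z \<omega>) ^ 4)"
      by (rule Bochner_Integration.integrable_bound[where f = "\<lambda>\<omega>. 2 * b\<^sup>2 * exp (\<bar>z \<omega>\<bar>\<^sup>2 / b)"])
         (use e z fourth_le_exp[OF b] in auto)
    have "(\<integral>\<omega>. (z \<omega>) ^ 4 \<partial>M) \<le> (\<integral>\<omega>. 2 * b\<^sup>2 * exp (\<bar>z \<omega>\<bar>\<^sup>2 / b) \<partial>M)"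
      by (intro integral_mono i integrable_mult_right e fourth_le_exp b)
    also have "\<dots> = 2 * b\<^sup>2 * (\<integral>\<omega>. exp (\<bar>z \<omega>\<bar>\<^sup>2 / b) \<partial>M)" by simp
    also have "\<dots> \<le> 2 * b\<^sup>2 * 2" by (intro mult_left_mono e) auto
    finally show ?thesis using i by (simp add: b_def power_divide power_mult_distrib)
  qed
  then show "integrable M (\<lambda>\<omega>. (z \<omega>) ^ 4)" "(\<integral>\<omega>. (z \<omega>) ^ 4 \<partial>M) \<le> 16 / c\<^sub>0\<^sup>2 * (\<integral>\<omega>. (z \<omega>)\<^sup>2 \<partial>M)\<^sup>2"
    by (simp_all add: s_def)
qed

text \<open>Collects the distributional hypotheses. \<alpha> makes the inverse probabilities bounded
  and hence all weights integrable; it does not enter the constants, which are functions of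
  \<open>c\<^sub>0\<close>.\<close>

locale cmcar_sg = cmcar M n N x X \<delta> P
  for M :: "'w measure" and n N x X \<delta> P +
  fixes c\<^sub>0 \<alpha> :: real
  assumes c0_pos: "0 < c\<^sub>0" and alpha_pos: "0 < \<alpha>"
    and P_ge: "\<And>t i j. 1 \<le> t \<Longrightarrow> i < n \<Longrightarrow> j < n \<Longrightarrow> (AE \<omega> in M. \<alpha> \<le> P t \<omega> i j)"
    and sg: "sub_gaussian_assm M n x c\<^sub>0" and n3: "3 \<le> n"
begin

abbreviation "S \<equiv> cov_mat M x"

definition K4 :: real where "K4 = 16 / c\<^sub>0\<^sup>2"

lemma n_pos: "0 < n" using n3 by simp

lemma K4_pos: "0 < K4" using c0_pos by (simp add: K4_def)

lemma x_component_measurable [measurable]: "i < n \<Longrightarrow> (\<lambda>\<omega>. x \<omega> i) \<in> borel_measurable M"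
  using measurable_component_singleton'[OF x_rv measurable_ident, of i] by simp

lemma x_mult_integrable: "i < n \<Longrightarrow> j < n \<Longrightarrow> integrable M (\<lambda>\<omega>. x \<omega> i * x \<omega> j)"
proof (rule Bochner_Integration.integrable_bound[where f = "\<lambda>\<omega>. (x \<omega> i)\<^sup>2 + (x \<omega> j)\<^sup>2"])
  assume ij: "i < n" "j < n"
  show "AE \<omega> in M. norm (x \<omega> i * x \<omega> j) \<le> norm ((x \<omega> i)\<^sup>2 + (x \<omega> j)\<^sup>2)"
    using abs_mult_le_squares by simp
qed (auto intro!: x_square_integrable)

lemma inner_sq: "(inner_vec n w (x \<omega>))\<^sup>2 = (\<Sum>i<n. \<Sum>j<n. (w i * w j) * (x \<omega> i * x \<omega> j))"
  unfolding inner_vec_def power2_eq_square sum_product by (simp add: mult_ac)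

lemma inner_sq_integrable: "integrable M (\<lambda>\<omega>. (inner_vec n w (x \<omega>))\<^sup>2)"
  unfolding inner_sq by (intro Bochner_Integration.integrable_sum integrable_mult_right x_mult_integrable) auto

lemma inner_sq_integral: "(\<integral>\<omega>. (inner_vec n w (x \<omega>))\<^sup>2 \<partial>M) = bil n S w w"
proof -
  have "(\<integral>\<omega>. (inner_vec n w (x \<omega>))\<^sup>2 \<partial>M) = (\<Sum>i<n. \<integral>\<omega>. (\<Sum>j<n. (w i * w j) * (x \<omega> i * x \<omega> j)) \<partial>M)"
    unfolding inner_sq
    by (intro Bochner_Integration.integral_sum Bochner_Integration.integrable_sum integrable_mult_right x_mult_integrable) auto
  also have "\<dots> = (\<Sum>i<n. \<Sum>j<n. \<integral>\<omega>. (w i * w j) * (x \<omega> i * x \<omega> j) \<partial>M)"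
    by (intro sum.cong refl Bochner_Integration.integral_sum integrable_mult_right x_mult_integrable) auto
  finally show ?thesis by (simp add: bil_def cov_mat_def mult.commute)
qed

lemma bil_S_le: "bil n S w w \<le> op_norm n S * (\<Sum>i<n. (w i)\<^sup>2)"
  using bil_le_op_norm[of n S w w] L2_set_sq[of "{..<n}" w] by (simp add: power2_eq_square mult.assoc)

lemma inner_measurable [measurable]: "(\<lambda>\<omega>. inner_vec n w (x \<omega>)) \<in> borel_measurable M"
  unfolding inner_vec_def by (intro borel_measurable_sum borel_measurable_times) auto

lemma sg_psi2: "ennreal c\<^sub>0 * (psi2_norm M (\<lambda>\<omega>. inner_vec n w (x \<omega>)))\<^sup>2 \<le> ennreal (\<integral>\<omega>. (inner_vec n w (x \<omega>))\<^sup>2 \<partial>M)"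
  using sg by (simp add: sub_gaussian_assm_def)

lemma inner_fourth:
  "integrable M (\<lambda>\<omega>. (inner_vec n w (x \<omega>)) ^ 4)"
  "(\<integral>\<omega>. (inner_vec n w (x \<omega>)) ^ 4 \<partial>M) \<le> K4 * (bil n S w w)\<^sup>2"
  using sub_gaussian_fourth_moment[OF inner_measurable c0_pos inner_sq_integrable sg_psi2, of w]
  by (auto simp: K4_def inner_sq_integral)

lemma inner_unit: "i < n \<Longrightarrow> inner_vec n (\<lambda>k. if k = i then 1 else 0) (x \<omega>) = x \<omega> i"
  unfolding inner_vec_def by (subst sum.remove[of _ i]) (auto intro!: sum.neutral)

lemma bil_unit: "i < n \<Longrightarrow> bil n A (\<lambda>k. if k = i then 1 else 0) (\<lambda>k. if k = i then 1 else 0) = A i i"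
  unfolding bil_def
  by (subst sum.remove[of _ i], simp, simp, subst sum.remove[of _ i]) (auto intro!: sum.neutral)

lemma x_fourth:
  assumes "i < n"
  shows "integrable M (\<lambda>\<omega>. (x \<omega> i) ^ 4)" "(\<integral>\<omega>. (x \<omega> i) ^ 4 \<partial>M) \<le> K4 * (S i i)\<^sup>2"
  using inner_fourth[of "\<lambda>k. if k = i then 1 else 0"] by (simp_all only: inner_unit[OF assms] bil_unit[OF assms])

lemma x_prod4_integrable:
  assumes "i < n" "j < n" "k < n" "l < n"
  shows "integrable M (\<lambda>\<omega>. x \<omega> i * x \<omega> j * x \<omega> k * x \<omega> l)"
proof (rule Bochner_Integration.integrable_bound[where f = "\<lambda>\<omega>. (x \<omega> i) ^ 4 + (x \<omega> j) ^ 4 + (x \<omega> k) ^ 4 + (x \<omega> l) ^ 4"])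
  show "AE \<omega> in M. norm (x \<omega> i * x \<omega> j * x \<omega> k * x \<omega> l) \<le> norm ((x \<omega> i) ^ 4 + (x \<omega> j) ^ 4 + (x \<omega> k) ^ 4 + (x \<omega> l) ^ 4)"
    by (intro AE_I2) (use abs_mult4_le in \<open>fastforce simp: abs_mult\<close>)
qed (use assms in \<open>auto intro!: x_fourth Bochner_Integration.integrable_add\<close>)

lemma S_diag_nonneg: "0 \<le> S i i"
  by (auto simp: cov_mat_def intro!: integral_nonneg)

lemma S_symm: "symm n S"
  by (simp add: symm_def cov_mat_def mult.commute)

lemma bil_S_nonneg: "0 \<le> bil n S w w"
  unfolding inner_sq_integral[symmetric] by simp

lemma op_norm_S_pos: "0 < op_norm n S"
proof -
  obtain i j where ij: "i < n" "j < n" "S i j \<noteq> 0" using cov_nonzero by auto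
  have "bil n S (\<lambda>k. if k = i then 1 else 0) (\<lambda>k. if k = j then 1 else 0) = S i j"
    unfolding bil_def using ij
    by (subst sum.remove[of _ i], simp, simp, subst sum.remove[of _ j]) (auto intro!: sum.neutral)
  then have "op_norm n S \<noteq> 0"
    using bil_le_op_norm[of n S "\<lambda>k. if k = i then 1 else 0" "\<lambda>k. if k = j then 1 else 0"] ij by auto
  then show ?thesis using op_norm_nonneg[OF n_pos, of S] by simp
qed

text \<open>Cauchy-Schwarz for two fourth moments, carried out as a weighted AM-GM inequality under
  the integral.\<close>

lemma mixed_fourth:
  assumes l: "l < n"
  shows "integrable M (\<lambda>\<omega>. (x \<omega> l)\<^sup>2 * (inner_vec n w (x \<omega>))\<^sup>2)"
    and "(\<integral>\<omega>. (x \<omega> l)\<^sup>2 * (inner_vec n w (x \<omega>))\<^sup>2 \<partial>M) \<le> K4 * S l l * bil n S w w"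
proof -
  let ?z = "\<lambda>\<omega>. inner_vec n w (x \<omega>)"
  define a where "a = S l l"
  define b where "b = bil n S w w"
  have ab: "0 \<le> a" "0 \<le> b" by (auto simp: a_def b_def S_diag_nonneg bil_S_nonneg)
  have amgm: "p\<^sup>2 * q\<^sup>2 \<le> (r * p ^ 4 + q ^ 4 / r) / 2" if "r > 0" for p q r :: real
  proof -
    have "2 * (sqrt r * p\<^sup>2) * (q\<^sup>2 / sqrt r) \<le> (sqrt r * p\<^sup>2)\<^sup>2 + (q\<^sup>2 / sqrt r)\<^sup>2" by (rule sum_squares_bound)
    then show ?thesis using that by (simp add: power_mult_distrib power_divide field_simps)
  qed
  show i: "integrable M (\<lambda>\<omega>. (x \<omega> l)\<^sup>2 * (?z \<omega>)\<^sup>2)"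
  proof (rule Bochner_Integration.integrable_bound[where f = "\<lambda>\<omega>. (1 * (x \<omega> l) ^ 4 + (?z \<omega>) ^ 4 / 1) / 2"])
    show "AE \<omega> in M. norm ((x \<omega> l)\<^sup>2 * (?z \<omega>)\<^sup>2) \<le> norm ((1 * (x \<omega> l) ^ 4 + (?z \<omega>) ^ 4 / 1) / 2)"
      using amgm[of 1] by (intro AE_I2) (simp add: abs_mult)
  qed (use x_fourth[OF l] inner_fourth[of w] l in auto)
  show "(\<integral>\<omega>. (x \<omega> l)\<^sup>2 * (?z \<omega>)\<^sup>2 \<partial>M) \<le> K4 * S l l * bil n S w w"
  proof (cases "a = 0 \<or> b = 0")
    case True
    have "AE \<omega> in M. (x \<omega> l)\<^sup>2 * (?z \<omega>)\<^sup>2 = 0"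
    proof (cases "a = 0")
      case True
      then have "AE \<omega> in M. (x \<omega> l)\<^sup>2 = 0"
        using x_square_integrable[OF l] integral_nonneg_eq_0_iff_AE[of M "\<lambda>\<omega>. (x \<omega> l)\<^sup>2"]
        by (simp add: a_def cov_mat_def power2_eq_square)
      then show ?thesis by eventually_elim simp
    next
      case False
      then have "(\<integral>\<omega>. (?z \<omega>)\<^sup>2 \<partial>M) = 0" using True by (simp add: inner_sq_integral b_def)
      then have "AE \<omega> in M. (?z \<omega>)\<^sup>2 = 0"
        using inner_sq_integrable[of w] by (subst (asm) integral_nonneg_eq_0_iff_AE) auto
      then show ?thesis by eventually_elim simp
    qed
    then have "(\<integral>\<omega>. (x \<omega> l)\<^sup>2 * (?z \<omega>)\<^sup>2 \<partial>M) = 0" by (rule integral_eq_zero_AE)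
    then show ?thesis using ab K4_pos by (simp add: a_def b_def)
  next
    case False
    then have p: "0 < a" "0 < b" using ab by auto
    \<comment> \<open>This weight makes the two terms equal, so that AM-GM loses nothing; it needs
      \<open>a\<close> and \<open>b\<close> positive, and otherwise the integrand vanishes almost
      surely.\<close>
    define r where "r = b / a"
    have r: "r > 0" using p by (simp add: r_def)
    have "(\<integral>\<omega>. (x \<omega> l)\<^sup>2 * (?z \<omega>)\<^sup>2 \<partial>M) \<le> (\<integral>\<omega>. (r * (x \<omega> l) ^ 4 + (?z \<omega>) ^ 4 / r) / 2 \<partial>M)"
      by (intro integral_mono i amgm r) (use x_fourth[OF l] inner_fourth[of w] in auto)
    also have "\<dots> = (r * (\<integral>\<omega>. (x \<omega> l) ^ 4 \<partial>M) + (\<integral>\<omega>. (?z \<omega>) ^ 4 \<partial>M) / r) / 2"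
      using x_fourth[OF l] inner_fourth[of w] by simp
    also have "\<dots> \<le> (r * (K4 * a\<^sup>2) + (K4 * b\<^sup>2) / r) / 2"
      using x_fourth[OF l] inner_fourth[of w] r unfolding a_def b_def
      by (intro divide_right_mono add_mono mult_left_mono) auto
    also have "\<dots> = K4 * a * b" using p by (simp add: r_def power2_eq_square field_simps)
    finally show ?thesis by (simp add: a_def b_def)
  qed
qed

end

section \<open>Conditioning on the past\<close>

lemma (in prob_space) integrable_indicator_real: "A \<in> sets M \<Longrightarrow> integrable M (indicat_real A)"
  by (rule integrable_const_bound[where B = 1]) (auto split: split_indicator)

context cmcar_sg
begin

abbreviation "Y \<equiv> observed n \<delta> X"
abbreviation "F \<equiv> past M n N Y"
abbreviation "GD t \<equiv> gen_sigma M (vec_borel n) {..<N t} (\<delta> t)"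
abbreviation "GX t \<equiv> gen_sigma M (vec_borel n) {..<N t} (X t)"

section \<open>The past, the masks and the data of a batch\<close>

lemma Y_measurable [measurable]:
  assumes "1 \<le> t" "k < N t"
  shows "Y t k \<in> M \<rightarrow>\<^sub>M vec_borel n"
proof -
  have [measurable]: "(\<lambda>\<omega>. \<delta> t k \<omega> i) \<in> borel_measurable M" "(\<lambda>\<omega>. X t k \<omega> i) \<in> borel_measurable M" if "i < n" for i
    using measurable_component_singleton'[OF mask_rv[OF assms] measurable_ident, of i]
      measurable_component_singleton'[OF X_rv[OF assms] measurable_ident, of i] that by simp_all
  have "Y t k = (\<lambda>\<omega>. \<lambda>i\<in>{..<n}. \<delta> t k \<omega> i * X t k \<omega> i)" by (simp add: observed_def fun_eq_iff)
  moreover have "(\<lambda>\<omega>. \<lambda>i\<in>{..<n}. \<delta> t k \<omega> i * X t k \<omega> i) \<in> M \<rightarrow>\<^sub>M vec_borel n"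
    by (intro measurable_restrict) simp
  ultimately show ?thesis by simp
qed

lemma F_subalgebra: "subalgebra M (F t)"
  unfolding past_def by (intro gen_sigma_subalgebra) (auto intro: Y_measurable)

lemma F_space [simp]: "space (F t) = space M" by (simp add: past_def gen_sigma_space)

lemma F_mono: "s \<le> t \<Longrightarrow> subalgebra (F t) (F s)"
  unfolding subalgebra_def F_space past_def by (intro conjI gen_sigma_mono refl) auto

lemma F_sets_M: "A \<in> sets (F t) \<Longrightarrow> A \<in> sets M"
  using F_subalgebra by (auto simp: subalgebra_def)

lemma Y_F: "1 \<le> \<tau> \<Longrightarrow> \<tau> < t \<Longrightarrow> k < N \<tau> \<Longrightarrow> Y \<tau> k \<in> F t \<rightarrow>\<^sub>M vec_borel n"
  unfolding past_def
  using gen_sigma_measurable[of "(\<tau>, k)" "{(\<tau>, k). 1 \<le> \<tau> \<and> \<tau> < t \<and> k < N \<tau>}" "\<lambda>(\<tau>, k). Y \<tau> k" M "vec_borel n"]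
  by (auto intro: Y_measurable)

lemma GD_subalgebra: "1 \<le> t \<Longrightarrow> subalgebra M (GD t)"
  by (intro gen_sigma_subalgebra) (auto intro: mask_rv)

lemma GX_subalgebra: "1 \<le> t \<Longrightarrow> subalgebra M (GX t)"
  by (intro gen_sigma_subalgebra) (auto intro: X_rv)

lemma mask_GD: "1 \<le> t \<Longrightarrow> k < N t \<Longrightarrow> i < n \<Longrightarrow> (\<lambda>\<omega>. \<delta> t k \<omega> i) \<in> borel_measurable (GD t)"
proof -
  assume *: "1 \<le> t" "k < N t" "i < n"
  have "\<delta> t k \<in> GD t \<rightarrow>\<^sub>M vec_borel n" by (rule gen_sigma_measurable) (use * mask_rv in auto)
  from measurable_component_singleton'[OF this measurable_ident, of i] * show ?thesis by simp
qed

lemma X_GX: "1 \<le> t \<Longrightarrow> k < N t \<Longrightarrow> i < n \<Longrightarrow> (\<lambda>\<omega>. X t k \<omega> i) \<in> borel_measurable (GX t)"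
proof -
  assume *: "1 \<le> t" "k < N t" "i < n"
  have "X t k \<in> GX t \<rightarrow>\<^sub>M vec_borel n" by (rule gen_sigma_measurable) (use * X_rv in auto)
  from measurable_component_singleton'[OF this measurable_ident, of i] * show ?thesis by simp
qed

text \<open>Generated by the past and the masks of batch \<open>t\<close> together. The
  intersections \<open>C \<inter> A\<close> form a generator stable under intersection, as needed
  for independence proofs.\<close>

definition "H t = sigma (space M) {C \<inter> A | C A. C \<in> sets (F t) \<and> A \<in> sets (GD t)}"

lemma H_gen_subset: "{C \<inter> A | C A. C \<in> sets (F t) \<and> A \<in> sets (GD t)} \<subseteq> Pow (space M)"
  using sets.sets_into_space[of _ "F t"] by auto

lemma H_space [simp]: "space (H t) = space M"
  unfolding H_def using H_gen_subset by (rule space_measure_of)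

lemma H_sets: "sets (H t) = sigma_sets (space M) {C \<inter> A | C A. C \<in> sets (F t) \<and> A \<in> sets (GD t)}"
  unfolding H_def using H_gen_subset by (rule sets_measure_of)

lemma H_F: "subalgebra (H t) (F t)"
proof -
  have "A \<in> sets (H t)" if "A \<in> sets (F t)" for A
    unfolding H_sets using that sets.top[of "GD t"] sets.sets_into_space[OF that]
    by (intro sigma_sets.Basic CollectI exI[of _ A] exI[of _ "space M"]) auto
  then show ?thesis by (auto simp: subalgebra_def)
qed

lemma H_GD: "subalgebra (H t) (GD t)"
proof -
  have "A \<in> sets (H t)" if "A \<in> sets (GD t)" for A
    unfolding H_sets using that sets.top[of "F t"] sets.sets_into_space[OF that]
    by (intro sigma_sets.Basic CollectI exI[of _ A] exI[of _ "space M"]) auto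
  then show ?thesis by (auto simp: subalgebra_def)
qed

lemma H_subalgebra: "1 \<le> t \<Longrightarrow> subalgebra M (H t)"
  unfolding subalgebra_def H_space H_sets
  using F_sets_M GD_subalgebra by (auto simp: subalgebra_def intro!: sets.sigma_sets_subset sets.Int dest: subsetD)

lemma cond_pr_integral:
  assumes "a \<in> borel_measurable (F t)" "A \<in> sets M" "\<And>\<omega>. \<bar>a \<omega>\<bar> \<le> B"
  shows "(\<integral>\<omega>. a \<omega> * cond_pr M (F t) A \<omega> \<partial>M) = (\<integral>\<omega>. a \<omega> * indicator A \<omega> \<partial>M)"
    and "integrable M (\<lambda>\<omega>. a \<omega> * cond_pr M (F t) A \<omega>)"
proof -
  interpret Fs: sigma_finite_subalgebra M "F t" by (rule sigma_finite_subalgebraI[OF F_subalgebra])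
  have [measurable]: "a \<in> borel_measurable M" by (rule measurable_from_subalg[OF F_subalgebra assms(1)])
  have i: "integrable M (\<lambda>\<omega>. a \<omega> * indicator A \<omega>)"
    by (rule integrable_const_bound[where B = B])
       (use assms in \<open>auto split: split_indicator intro: order_trans[OF abs_ge_zero]\<close>)
  show "(\<integral>\<omega>. a \<omega> * cond_pr M (F t) A \<omega> \<partial>M) = (\<integral>\<omega>. a \<omega> * indicator A \<omega> \<partial>M)"
    "integrable M (\<lambda>\<omega>. a \<omega> * cond_pr M (F t) A \<omega>)"
    unfolding cond_pr_def using i assms by (auto intro!: Fs.real_cond_exp_intg)
qed

text \<open>Combines two assumptions: conditionally on the past an event of the masks and an event
  \<open>B\<close> of the data are independent, and the conditional probability of \<open>B\<close>
  is the constant \<open>prob B\<close> because the data are independent of the past. Hence the data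
  can be integrated with past and masks held fixed.\<close>

lemma indep_mask_data:
  assumes t: "1 \<le> t"
  shows "indep_set (sets (H t)) (sets (GX t))"
proof -
  let ?P = "{C \<inter> A | C A. C \<in> sets (F t) \<and> A \<in> sets (GD t)}"
  interpret Fs: sigma_finite_subalgebra M "F t" by (rule sigma_finite_subalgebraI[OF F_subalgebra])
  have GXM: "B \<in> sets M" if "B \<in> sets (GX t)" for B using GX_subalgebra[OF t] that by (auto simp: subalgebra_def)
  have GDM: "B \<in> sets M" if "B \<in> sets (GD t)" for B using GD_subalgebra[OF t] that by (auto simp: subalgebra_def)
  have cB: "AE \<omega> in M. cond_pr M (F t) B \<omega> = prob B" if B: "B \<in> sets (GX t)" for B
    unfolding cond_pr_def
  proof (rule real_cond_exp_charact'[OF F_subalgebra])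
    fix A assume A: "A \<in> sets (F t)"
    have "prob (B \<inter> A) = prob B * prob A"
      using X_indep_past[OF t] A B by (auto simp: indep_sets2_eq)
    then show "(\<integral>\<omega>. indicator A \<omega> * indicat_real B \<omega> \<partial>M) = (\<integral>\<omega>. indicator A \<omega> * prob B \<partial>M)"
      using F_sets_M[OF A] GXM[OF B] by (simp add: indicator_inter_arith[symmetric] Int_commute mult.commute)
  qed (use GXM[OF B] in \<open>auto intro: integrable_indicator_real\<close>)
  have "indep_set ?P (sets (GX t))"
    unfolding indep_sets2_eq
  proof (intro conjI ballI)
    show "?P \<subseteq> events" using F_sets_M GDM by auto
    show "sets (GX t) \<subseteq> events" using GXM by auto
    fix a B assume "a \<in> ?P" and B: "B \<in> sets (GX t)"
    then obtain C A where a: "a = C \<inter> A" and C: "C \<in> sets (F t)" and A: "A \<in> sets (GD t)" by auto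
    note CM = F_sets_M[OF C] and AM = GDM[OF A] and BM = GXM[OF B]
    have "prob (a \<inter> B) = (\<integral>\<omega>. indicator C \<omega> * indicator (A \<inter> B) \<omega> \<partial>M)"
      using CM AM BM by (simp add: a indicator_inter_arith[symmetric] Int_assoc)
    also have "\<dots> = (\<integral>\<omega>. indicator C \<omega> * cond_pr M (F t) (A \<inter> B) \<omega> \<partial>M)"
      by (rule cond_pr_integral(1)[symmetric, where B = 1]) (use C AM BM in auto)
    also have "\<dots> = (\<integral>\<omega>. prob B * (indicator C \<omega> * cond_pr M (F t) A \<omega>) \<partial>M)"
    proof (rule integral_cong_AE)
      have "AE \<omega> in M. cond_pr M (F t) (A \<inter> B) \<omega> = cond_pr M (F t) A \<omega> * cond_pr M (F t) B \<omega>"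
        using mask_cond_indep_X[OF t] A B unfolding cond_indep_sigma_def by blast
      then show "AE \<omega> in M. indicator C \<omega> * cond_pr M (F t) (A \<inter> B) \<omega> = prob B * (indicator C \<omega> * cond_pr M (F t) A \<omega>)"
        using cB[OF B] by eventually_elim simp
    qed (use CM in \<open>auto simp: cond_pr_def\<close>)
    also have "\<dots> = prob B * (\<integral>\<omega>. indicator C \<omega> * cond_pr M (F t) A \<omega> \<partial>M)" by simp
    also have "(\<integral>\<omega>. indicator C \<omega> * cond_pr M (F t) A \<omega> \<partial>M) = (\<integral>\<omega>. indicator C \<omega> * indicator A \<omega> \<partial>M)"
      by (rule cond_pr_integral(1)[where B = 1]) (use C AM in auto)
    also have "\<dots> = prob a" using CM AM by (simp add: a indicator_inter_arith[symmetric])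
    finally show "prob (a \<inter> B) = prob a * prob B" by simp
  qed
  then have "indep_set (sigma_sets (space M) ?P) (sigma_sets (space M) (sets (GX t)))"
  proof (rule indep_set_sigma_sets)
    show "Int_stable ?P"
    proof (rule Int_stableI)
      fix a b assume "a \<in> ?P" "b \<in> ?P"
      then obtain C A C' A' where "a = C \<inter> A" "b = C' \<inter> A'" "C \<in> sets (F t)" "A \<in> sets (GD t)" "C' \<in> sets (F t)" "A' \<in> sets (GD t)"
        by blast
      then show "a \<inter> b \<in> ?P" by (intro CollectI exI[of _ "C \<inter> C'"] exI[of _ "A \<inter> A'"]) auto
    qed
    show "Int_stable (sets (GX t))" by (rule sets.Int_stable)
  qed
  then show ?thesis using sets.sigma_sets_eq[of "GX t"] by (simp add: H_sets gen_sigma_space)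
qed

lemma indep_HX:
  assumes t: "1 \<le> t" and a: "a \<in> borel_measurable (H t)" and b: "b \<in> borel_measurable (GX t)"
    and ia: "integrable M a" and ib: "integrable M b"
  shows "integrable M (\<lambda>\<omega>. a \<omega> * b \<omega>)" "(\<integral>\<omega>. a \<omega> * b \<omega> \<partial>M) = (\<integral>\<omega>. a \<omega> \<partial>M) * (\<integral>\<omega>. b \<omega> \<partial>M :: real)"
proof -
  have "indep_var borel a borel b"
    unfolding indep_var_eq
  proof (intro conjI)
    show "a \<in> borel_measurable M" "b \<in> borel_measurable M" using ia ib by auto
    have "sigma_sets (space M) {a -` A \<inter> space M |A. A \<in> sets borel} \<subseteq> sets (H t)"
    proof -
      have "{a -` A \<inter> space M |A. A \<in> sets borel} \<subseteq> sets (H t)"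
        using measurable_sets[OF a] by (auto simp: gen_sigma_space)
      from sets.sigma_sets_subset[OF this] show ?thesis by (simp add: gen_sigma_space)
    qed
    moreover have "sigma_sets (space M) {b -` A \<inter> space M |A. A \<in> sets borel} \<subseteq> sets (GX t)"
    proof -
      have "{b -` A \<inter> space M |A. A \<in> sets borel} \<subseteq> sets (GX t)"
        using measurable_sets[OF b] by (auto simp: gen_sigma_space)
      from sets.sigma_sets_subset[OF this] show ?thesis by (simp add: gen_sigma_space)
    qed
    ultimately show "indep_set (sigma_sets (space M) {a -` A \<inter> space M |A. A \<in> sets borel})
        (sigma_sets (space M) {b -` A \<inter> space M |A. A \<in> sets borel})"
      using indep_mask_data[OF t] unfolding indep_sets2_eq by blast
  qed
  from indep_var_integrable[OF this ia ib] indep_var_lebesgue_integral[OF this ia ib]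
  show "integrable M (\<lambda>\<omega>. a \<omega> * b \<omega>)" "(\<integral>\<omega>. a \<omega> * b \<omega> \<partial>M) = (\<integral>\<omega>. a \<omega> \<partial>M) * (\<integral>\<omega>. b \<omega> \<partial>M)" by auto
qed

lemma X_integral_eq:
  assumes "1 \<le> t" "k < N t" "h \<in> borel_measurable (vec_borel n)"
  shows "integrable M (\<lambda>\<omega>. h (X t k \<omega>)) \<longleftrightarrow> integrable M (\<lambda>\<omega>. h (x \<omega>) :: real)"
    and "(\<integral>\<omega>. h (X t k \<omega>) \<partial>M) = (\<integral>\<omega>. h (x \<omega>) \<partial>M)"
  using integrable_distr_eq[OF X_rv[OF assms(1,2)] assms(3)] integrable_distr_eq[OF x_rv assms(3)]
    integral_distr[OF X_rv[OF assms(1,2)] assms(3)] integral_distr[OF x_rv assms(3)]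
  by (simp_all add: X_copy[OF assms(1,2)])

text \<open>The entries of \<open>\<Gamma>\<^sub>t\<close>, symmetrized and clipped on a null set so that symmetry and the bounds
  \<open>1 \<le> \<Gamma> \<le> 1 / \<alpha>\<close> hold everywhere.\<close>

definition gam :: "nat \<Rightarrow> 'w \<Rightarrow> rmat" where
  "gam t \<omega> i j = max 1 (min (1 / \<alpha>) (1 / P t \<omega> (min i j) (max i j)))"

definition gB :: real where "gB = max 1 (1 / \<alpha>)"

lemma gam_bounds: "1 \<le> gam t \<omega> i j" "gam t \<omega> i j \<le> gB"
  by (auto simp: gam_def gB_def)

lemma gam_abs: "\<bar>gam t \<omega> i j\<bar> \<le> gB" "0 \<le> gam t \<omega> i j"
  using gam_bounds[of t \<omega> i j] by auto

lemma gam_symm: "gam t \<omega> i j = gam t \<omega> j i"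
  by (simp add: gam_def min.commute max.commute)

lemma gam_F: "1 \<le> t \<Longrightarrow> i < n \<Longrightarrow> j < n \<Longrightarrow> (\<lambda>\<omega>. gam t \<omega> i j) \<in> borel_measurable (F t)"
  unfolding gam_def using P_past_measurable[of t "min i j" "max i j"]
  by (intro borel_measurable_max borel_measurable_min borel_measurable_divide) auto

text \<open>\<open>P\<close> agrees only almost surely with a conditional probability, so symmetry
  and the upper bound 1 hold up to null sets. Sample 0 exists in every batch.\<close>

lemma P_AE:
  assumes t: "1 \<le> t" and ij: "i < n" "j < n"
  shows "AE \<omega> in M. \<alpha> \<le> P t \<omega> i j \<and> P t \<omega> i j \<le> 1 \<and> P t \<omega> i j = P t \<omega> j i"
proof -
  interpret Fs: sigma_finite_subalgebra M "F t" by (rule sigma_finite_subalgebraI[OF F_subalgebra])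
  have k: "0 < N t" using N_pos[OF t] by simp
  have [measurable]: "(\<lambda>\<omega>. \<delta> t 0 \<omega> i) \<in> borel_measurable M" if "i < n" for i
    using measurable_from_subalg[OF GD_subalgebra[OF t] mask_GD[OF t k that]] .
  have m: "{\<omega>'\<in>space M. \<delta> t 0 \<omega>' i = 1 \<and> \<delta> t 0 \<omega>' j = 1} \<in> sets M"
    using ij by measurable
  then have le1: "AE \<omega> in M. cond_pr M (F t) {\<omega>'\<in>space M. \<delta> t 0 \<omega>' i = 1 \<and> \<delta> t 0 \<omega>' j = 1} \<omega> \<le> 1"
    unfolding cond_pr_def by (intro Fs.real_cond_exp_le_c integrable_indicator_real) (auto split: split_indicator)
  have comm: "{\<omega>'\<in>space M. \<delta> t 0 \<omega>' j = 1 \<and> \<delta> t 0 \<omega>' i = 1} = {\<omega>'\<in>space M. \<delta> t 0 \<omega>' i = 1 \<and> \<delta> t 0 \<omega>' j = 1}" by auto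
  show ?thesis
    using le1 P_cond_prob[OF t k ij] P_cond_prob[OF t k ij(2) ij(1)] P_ge[OF t ij] unfolding comm by eventually_elim simp
qed

lemma gam_eq: "1 \<le> t \<Longrightarrow> AE \<omega> in M. \<forall>i\<in>{..<n}. \<forall>j\<in>{..<n}. gam t \<omega> i j = 1 / P t \<omega> i j"
proof -
  assume t: "1 \<le> t"
  have "AE \<omega> in M. gam t \<omega> i j = 1 / P t \<omega> i j" if "i < n" "j < n" for i j
    using P_AE[OF t that] P_AE[OF t that(2) that(1)]
  proof eventually_elim
    case (elim \<omega>)
    have p: "P t \<omega> (min i j) (max i j) = P t \<omega> i j" using elim by (auto simp: min_def max_def)
    have "1 \<le> 1 / P t \<omega> i j" "1 / P t \<omega> i j \<le> 1 / \<alpha>"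
      using elim alpha_pos by (auto intro!: divide_left_mono simp: le_divide_eq)
    then show ?case unfolding gam_def p by simp
  qed
  then show ?thesis by (intro AE_finite_allI) auto
qed

lemma bounded_integrable:
  "a \<in> borel_measurable M \<Longrightarrow> (\<And>\<omega>. \<omega> \<in> space M \<Longrightarrow> \<bar>a \<omega>\<bar> \<le> B) \<Longrightarrow> integrable M (a :: _ \<Rightarrow> real)"
  by (rule integrable_const_bound[where B = B]) auto

text \<open>Inverse probability weighting: given the past, the product of two masks has conditional
  mean \<open>P t \<omega> i j\<close>, which the factor \<open>gam t \<omega> i j\<close>
  cancels.\<close>

lemma mask_integral:
  assumes t: "1 \<le> t" and k: "k < N t" and ij: "i < n" "j < n"
    and a: "a \<in> borel_measurable (F t)" "\<And>\<omega>. \<bar>a \<omega>\<bar> \<le> B"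
  shows "(\<integral>\<omega>. a \<omega> * gam t \<omega> i j * (\<delta> t k \<omega> i * \<delta> t k \<omega> j) \<partial>M) = (\<integral>\<omega>. a \<omega> \<partial>M)"
proof -
  let ?A = "{\<omega>'\<in>space M. \<delta> t k \<omega>' i = 1 \<and> \<delta> t k \<omega>' j = 1}"
  have [measurable]: "(\<lambda>\<omega>. \<delta> t k \<omega> i) \<in> borel_measurable M" if "i < n" for i
    using measurable_from_subalg[OF GD_subalgebra[OF t] mask_GD[OF t k that]] .
  have ag: "(\<lambda>\<omega>. a \<omega> * gam t \<omega> i j) \<in> borel_measurable (F t)" using a gam_F[OF t ij] by simp
  have agM [measurable]: "(\<lambda>\<omega>. a \<omega> * gam t \<omega> i j) \<in> borel_measurable M" by (rule measurable_from_subalg[OF F_subalgebra ag])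
  have aM [measurable]: "a \<in> borel_measurable M" by (rule measurable_from_subalg[OF F_subalgebra a(1)])
  have [measurable]: "?A \<in> sets M" using ij by measurable
  have B: "0 \<le> B" using a(2) abs_ge_zero order_trans by blast
  have "(\<integral>\<omega>. a \<omega> * gam t \<omega> i j * (\<delta> t k \<omega> i * \<delta> t k \<omega> j) \<partial>M) = (\<integral>\<omega>. (a \<omega> * gam t \<omega> i j) * indicator ?A \<omega> \<partial>M)"
    using mask_01[OF t k _ ij(1)] mask_01[OF t k _ ij(2)]
    by (intro Bochner_Integration.integral_cong refl) (fastforce split: split_indicator)
  also have "\<dots> = (\<integral>\<omega>. (a \<omega> * gam t \<omega> i j) * cond_pr M (F t) ?A \<omega> \<partial>M)"
    by (rule cond_pr_integral(1)[symmetric, where B = "B * gB"])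
       (use ag a gam_abs B in \<open>auto simp: abs_mult intro!: mult_mono\<close>)
  also have "\<dots> = (\<integral>\<omega>. a \<omega> \<partial>M)"
  proof (rule integral_cong_AE)
    show "AE \<omega> in M. (a \<omega> * gam t \<omega> i j) * cond_pr M (F t) ?A \<omega> = a \<omega>"
      using P_cond_prob[OF t k ij] gam_eq[OF t] P_AE[OF t ij]
      by eventually_elim (use ij alpha_pos in auto)
  qed (auto simp: cond_pr_def)
  finally show ?thesis .
qed

text \<open>The contribution of a single observation to \<open>Z_mat\<close>, with
  \<open>gam\<close> in place of the inverse probabilities.\<close>

definition U :: "nat \<Rightarrow> nat \<Rightarrow> 'w \<Rightarrow> rmat" where
  "U t k \<omega> i j = Y t k \<omega> i * Y t k \<omega> j * gam t \<omega> i j"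

lemma Y_component: "i < n \<Longrightarrow> Y t k \<omega> i = \<delta> t k \<omega> i * X t k \<omega> i"
  by (simp add: observed_def)

lemma Y_component_measurable [measurable]:
  "1 \<le> t \<Longrightarrow> k < N t \<Longrightarrow> i < n \<Longrightarrow> (\<lambda>\<omega>. Y t k \<omega> i) \<in> borel_measurable M"
  using measurable_component_singleton'[OF Y_measurable measurable_ident, of t k i] by simp

lemma gam_measurable [measurable]: "1 \<le> t \<Longrightarrow> i < n \<Longrightarrow> j < n \<Longrightarrow> (\<lambda>\<omega>. gam t \<omega> i j) \<in> borel_measurable M"
  by (rule measurable_from_subalg[OF F_subalgebra gam_F])

lemma U_measurable [measurable]: "1 \<le> t \<Longrightarrow> k < N t \<Longrightarrow> i < n \<Longrightarrow> j < n \<Longrightarrow> (\<lambda>\<omega>. U t k \<omega> i j) \<in> borel_measurable M"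
  unfolding U_def by measurable

lemma U_symm: "symm n (U t k \<omega>)"
  by (auto simp: symm_def U_def gam_symm mult.commute)

text \<open>Bounded weights depending on past and masks factor out of the moments of the data.
  Products of observations take this form once their masks are moved into the weight.\<close>

lemma mask_X_prod2:
  assumes t: "1 \<le> t" "k < N t" and a: "a \<in> borel_measurable (H t)" "\<And>\<omega>. \<omega> \<in> space M \<Longrightarrow> \<bar>a \<omega>\<bar> \<le> B" and i: "i < n" "j < n"
  shows "integrable M (\<lambda>\<omega>. a \<omega> * (X t k \<omega> i * X t k \<omega> j))"
    "(\<integral>\<omega>. a \<omega> * (X t k \<omega> i * X t k \<omega> j) \<partial>M) = (\<integral>\<omega>. a \<omega> \<partial>M) * S i j"
proof -
  have m: "(\<lambda>z. z i * z j) \<in> borel_measurable (vec_borel n)"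
    using i by (intro borel_measurable_times measurable_component_singleton) auto
  have ib: "integrable M (\<lambda>\<omega>. X t k \<omega> i * X t k \<omega> j)" "(\<integral>\<omega>. X t k \<omega> i * X t k \<omega> j \<partial>M) = S i j"
    using X_integral_eq[OF t m] x_mult_integrable[OF i] by (auto simp: cov_mat_def)
  have ia: "integrable M a"
    by (rule bounded_integrable[OF measurable_from_subalg[OF H_subalgebra[OF t(1)] a(1)] a(2)])
  have mb: "(\<lambda>\<omega>. X t k \<omega> i * X t k \<omega> j) \<in> borel_measurable (GX t)"
    using X_GX[OF t] i by simp
  show "integrable M (\<lambda>\<omega>. a \<omega> * (X t k \<omega> i * X t k \<omega> j))"
    "(\<integral>\<omega>. a \<omega> * (X t k \<omega> i * X t k \<omega> j) \<partial>M) = (\<integral>\<omega>. a \<omega> \<partial>M) * S i j"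
    using indep_HX[OF t(1) a(1) mb ia ib(1)] ib(2) by auto
qed

lemma mask_X_prod4:
  assumes t: "1 \<le> t" "k < N t" and a: "a \<in> borel_measurable (H t)" "\<And>\<omega>. \<omega> \<in> space M \<Longrightarrow> \<bar>a \<omega>\<bar> \<le> B"
    and i: "i < n" "j < n" "l < n" "r < n"
  shows "integrable M (\<lambda>\<omega>. a \<omega> * (X t k \<omega> i * X t k \<omega> j * X t k \<omega> l * X t k \<omega> r))"
    "(\<integral>\<omega>. a \<omega> * (X t k \<omega> i * X t k \<omega> j * X t k \<omega> l * X t k \<omega> r) \<partial>M)
       = (\<integral>\<omega>. a \<omega> \<partial>M) * (\<integral>\<omega>. x \<omega> i * x \<omega> j * x \<omega> l * x \<omega> r \<partial>M)"
proof -
  have m: "(\<lambda>z. z i * z j * z l * z r) \<in> borel_measurable (vec_borel n)"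
    using i by (intro borel_measurable_times measurable_component_singleton) auto
  have ib: "integrable M (\<lambda>\<omega>. X t k \<omega> i * X t k \<omega> j * X t k \<omega> l * X t k \<omega> r)"
    "(\<integral>\<omega>. X t k \<omega> i * X t k \<omega> j * X t k \<omega> l * X t k \<omega> r \<partial>M) = (\<integral>\<omega>. x \<omega> i * x \<omega> j * x \<omega> l * x \<omega> r \<partial>M)"
    using X_integral_eq[OF t m] x_prod4_integrable[OF i] by auto
  have ia: "integrable M a"
    by (rule bounded_integrable[OF measurable_from_subalg[OF H_subalgebra[OF t(1)] a(1)] a(2)])
  have mb: "(\<lambda>\<omega>. X t k \<omega> i * X t k \<omega> j * X t k \<omega> l * X t k \<omega> r) \<in> borel_measurable (GX t)"
    using X_GX[OF t] i by simp
  show "integrable M (\<lambda>\<omega>. a \<omega> * (X t k \<omega> i * X t k \<omega> j * X t k \<omega> l * X t k \<omega> r))"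
    "(\<integral>\<omega>. a \<omega> * (X t k \<omega> i * X t k \<omega> j * X t k \<omega> l * X t k \<omega> r) \<partial>M)
       = (\<integral>\<omega>. a \<omega> \<partial>M) * (\<integral>\<omega>. x \<omega> i * x \<omega> j * x \<omega> l * x \<omega> r \<partial>M)"
    using indep_HX[OF t(1) a(1) mb ia ib(1)] ib(2) by auto
qed

lemma F_to_H: "a \<in> borel_measurable (F t) \<Longrightarrow> a \<in> borel_measurable (H t)"
  by (rule measurable_from_subalg[OF H_F])

lemma mask_H: "1 \<le> t \<Longrightarrow> k < N t \<Longrightarrow> i < n \<Longrightarrow> (\<lambda>\<omega>. \<delta> t k \<omega> i) \<in> borel_measurable (H t)"
  by (rule measurable_from_subalg[OF H_GD mask_GD])

lemma gB_pos: "1 \<le> gB" by (simp add: gB_def)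

lemma mask_abs: "1 \<le> t \<Longrightarrow> k < N t \<Longrightarrow> \<omega> \<in> space M \<Longrightarrow> i < n \<Longrightarrow> \<bar>\<delta> t k \<omega> i\<bar> \<le> 1"
  using mask_01[of t k \<omega> i] by auto

text \<open>Unbiasedness of one summand given the past: the data are integrated first and give
  \<open>S i j\<close>, then \<open>mask_integral\<close> removes the masks together with
  \<open>gam\<close>.\<close>

lemma U_cond_exp:
  assumes t: "1 \<le> t" "k < N t" and ij: "i < n" "j < n"
  shows "integrable M (\<lambda>\<omega>. U t k \<omega> i j)" "AE \<omega> in M. real_cond_exp M (F t) (\<lambda>\<omega>. U t k \<omega> i j) \<omega> = S i j"
proof -
  define a where "a A \<omega> = indicator A \<omega> * gam t \<omega> i j * (\<delta> t k \<omega> i * \<delta> t k \<omega> j)" for A \<omega>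
  have aH: "a A \<in> borel_measurable (H t)" if "A \<in> sets (F t)" for A
  proof -
    have "indicat_real A \<in> borel_measurable (F t)" using that by simp
    then have [measurable]: "indicat_real A \<in> borel_measurable (H t)" by (rule F_to_H)
    note [measurable] = F_to_H[OF gam_F[OF t(1) ij]] mask_H[OF t ij(1)] mask_H[OF t ij(2)]
    show ?thesis unfolding a_def by measurable
  qed
  have aB: "\<bar>a A \<omega>\<bar> \<le> gB" if "\<omega> \<in> space M" for A \<omega>
  proof -
    have "\<bar>a A \<omega>\<bar> \<le> (1 * gB) * (1 * 1)"
      unfolding a_def abs_mult
      using gam_abs mask_abs[OF t that] ij gB_pos by (intro mult_mono) (auto split: split_indicator)
    then show ?thesis by simp
  qed
  have eq: "indicator A \<omega> * U t k \<omega> i j = a A \<omega> * (X t k \<omega> i * X t k \<omega> j)" for A \<omega>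
    unfolding a_def U_def using ij by (simp add: Y_component)
  have F1: "space M \<in> sets (F t)" using sets.top[of "F t"] by simp
  have "integrable M (\<lambda>\<omega>. indicator (space M) \<omega> * U t k \<omega> i j)"
    unfolding eq by (rule mask_X_prod2(1)[OF t aH[OF F1] aB ij])
  then show i: "integrable M (\<lambda>\<omega>. U t k \<omega> i j)"
    by (rule Bochner_Integration.integrable_cong[THEN iffD1, rotated -1]) auto
  show "AE \<omega> in M. real_cond_exp M (F t) (\<lambda>\<omega>. U t k \<omega> i j) \<omega> = S i j"
  proof (rule real_cond_exp_charact'[OF F_subalgebra i])
    fix A assume A: "A \<in> sets (F t)"
    have "(\<integral>\<omega>. indicator A \<omega> * U t k \<omega> i j \<partial>M) = (\<integral>\<omega>. a A \<omega> \<partial>M) * S i j"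
      unfolding eq by (rule mask_X_prod2(2)[OF t aH[OF A] aB ij])
    also have "(\<integral>\<omega>. a A \<omega> \<partial>M) = (\<integral>\<omega>. indicator A \<omega> \<partial>M)"
      unfolding a_def by (rule mask_integral[OF t ij, where B = 1]) (use A in auto)
    finally show "(\<integral>\<omega>. indicator A \<omega> * U t k \<omega> i j \<partial>M) = (\<integral>\<omega>. indicator A \<omega> * S i j \<partial>M)" by simp
  qed auto
qed

text \<open>Almost surely \<open>rho t = \<parallel>\<Sigma>\<parallel> r\<^sub>m\<^sub>i\<^sub>n(\<Sigma>, P\<^sub>t)\<close>.\<close>

definition rho :: "nat \<Rightarrow> 'w \<Rightarrow> real" where
  "rho t \<omega> = Max ((\<lambda>j. \<Sum>i<n. S i i * gam t \<omega> i j) ` {..<n})"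

lemma rho_F: "1 \<le> t \<Longrightarrow> rho t \<in> borel_measurable (F t)"
  unfolding rho_def
  by (intro borel_measurable_Max borel_measurable_sum borel_measurable_times gam_F) auto

lemma rho_measurable [measurable]: "1 \<le> t \<Longrightarrow> rho t \<in> borel_measurable M"
  by (rule measurable_from_subalg[OF F_subalgebra rho_F])

lemma rho_ge: "j < n \<Longrightarrow> (\<Sum>i<n. S i i * gam t \<omega> i j) \<le> rho t \<omega>"
  unfolding rho_def by (intro Max_ge) auto

lemma rho_nonneg: "0 \<le> rho t \<omega>"
  using rho_ge[OF n_pos, of t \<omega>] sum_nonneg[of "{..<n}" "\<lambda>i. S i i * gam t \<omega> i 0"]
  by (simp add: S_diag_nonneg gam_abs)

lemma rho_le: "rho t \<omega> \<le> (\<Sum>i<n. S i i * gB)"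
  unfolding rho_def using n_pos
  by (intro Max.boundedI) (auto intro!: sum_mono mult_left_mono S_diag_nonneg gam_bounds)

lemma rho_integrable: "1 \<le> t \<Longrightarrow> integrable M (rho t)"
  by (rule bounded_integrable[where B = "\<Sum>i<n. S i i * gB"]) (use rho_nonneg rho_le in auto)

section \<open>The variance of one observation\<close>

lemma mv_U: "l < n \<Longrightarrow> mv n (U t k \<omega>) u l = \<delta> t k \<omega> l * X t k \<omega> l * (\<Sum>j<n. \<delta> t k \<omega> j * gam t \<omega> l j * u j * X t k \<omega> j)"
  by (simp add: mv_def U_def Y_component sum_distrib_left mult_ac)

lemma mask_idem: "1 \<le> t \<Longrightarrow> k < N t \<Longrightarrow> \<omega> \<in> space M \<Longrightarrow> i < n \<Longrightarrow> \<delta> t k \<omega> i * \<delta> t k \<omega> i = \<delta> t k \<omega> i"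
  using mask_01[of t k \<omega> i] by auto

lemma UU_integrable:
  assumes t: "1 \<le> t" "k < N t" and "i < n" "j < n" "l < n" "r < n"
  shows "integrable M (\<lambda>\<omega>. U t k \<omega> i j * U t k \<omega> l r)"
proof -
  define a where "a \<omega> = \<delta> t k \<omega> i * \<delta> t k \<omega> j * \<delta> t k \<omega> l * \<delta> t k \<omega> r * gam t \<omega> i j * gam t \<omega> l r" for \<omega>
  have "a \<in> borel_measurable (H t)"
  proof -
    note [measurable] = F_to_H[OF gam_F] mask_H
    show ?thesis unfolding a_def using assms by measurable
  qed
  moreover have "\<bar>a \<omega>\<bar> \<le> 1 * 1 * 1 * 1 * gB * gB" if "\<omega> \<in> space M" for \<omega>
    unfolding a_def abs_mult
    using gam_abs mask_abs[OF t that] assms gB_pos by (intro mult_mono) auto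
  ultimately have "integrable M (\<lambda>\<omega>. a \<omega> * (X t k \<omega> i * X t k \<omega> j * X t k \<omega> l * X t k \<omega> r))"
    using assms by (intro mask_X_prod4(1)[OF t]) auto
  then show ?thesis unfolding a_def U_def using assms by (simp add: Y_component mult_ac)
qed

text \<open>For frozen past and masks, row \<open>l\<close> gives the mixed moment of
  \<open>x l\<close> and the linear form with coefficients
  \<open>w l \<omega> j = \<delta> j * gam l j * u j\<close>, bounded by
  \<open>K4 * S l l * op_norm n S\<close> times the sum of the squares of \<open>w\<close>. As masks
  are idempotent, only \<open>\<delta> l * \<delta> j * (gam l j)^2\<close> remains: a pair of
  masks, whose probability cancels one factor \<open>gam\<close>. The sum over \<open>l\<close> of
  \<open>S l l * gam l j\<close> is at most \<open>rho\<close>.\<close>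

lemma quad_U_integral_le:
  assumes t: "1 \<le> t" "k < N t" and A: "A \<in> sets (F t)"
  shows "(\<integral>\<omega>. indicator A \<omega> * (\<Sum>l<n. (mv n (U t k \<omega>) u l)\<^sup>2) \<partial>M)
    \<le> (\<integral>\<omega>. indicator A \<omega> * (K4 * op_norm n S * (\<Sum>j<n. (u j)\<^sup>2) * rho t \<omega>) \<partial>M)"
proof -
  define w where "w l \<omega> j = \<delta> t k \<omega> j * gam t \<omega> l j * u j" for l \<omega> j
  define a where "a l i j \<omega> = indicator A \<omega> * \<delta> t k \<omega> l * (w l \<omega> i * w l \<omega> j)" for l i j \<omega>
  define E where "E l i j = (\<integral>\<omega>. x \<omega> l * x \<omega> l * x \<omega> i * x \<omega> j \<partial>M)" for l i j
  have AM: "A \<in> sets M" by (rule F_sets_M[OF A])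
  have aH: "a l i j \<in> borel_measurable (H t)" if "l < n" "i < n" "j < n" for l i j
  proof -
    have "indicat_real A \<in> borel_measurable (F t)" using A by simp
    then have [measurable]: "indicat_real A \<in> borel_measurable (H t)" by (rule F_to_H)
    note [measurable] = F_to_H[OF gam_F] mask_H
    show ?thesis unfolding a_def w_def using that t by measurable
  qed
  have wB: "\<bar>w l \<omega> j\<bar> \<le> gB * \<bar>u j\<bar>" if "\<omega> \<in> space M" "j < n" for l \<omega> j
  proof -
    have "\<bar>w l \<omega> j\<bar> \<le> 1 * gB * \<bar>u j\<bar>" unfolding w_def abs_mult
      using gam_abs mask_abs[OF t that] gB_pos by (intro mult_mono) auto
    then show ?thesis by simp
  qed
  have aB: "\<bar>a l i j \<omega>\<bar> \<le> 1 * 1 * ((gB * \<bar>u i\<bar>) * (gB * \<bar>u j\<bar>))" if "\<omega> \<in> space M" "l < n" "i < n" "j < n" for l i j \<omega>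
    unfolding a_def abs_mult
    using wB mask_abs[OF t] gB_pos that by (intro mult_mono) (auto split: split_indicator)
  have ai: "integrable M (a l i j)" if "l < n" "i < n" "j < n" for l i j
    by (rule bounded_integrable[OF measurable_from_subalg[OF H_subalgebra[OF t(1)] aH[OF that]] aB]) (use that in auto)
  have sq: "indicator A \<omega> * (mv n (U t k \<omega>) u l)\<^sup>2
      = (\<Sum>i<n. \<Sum>j<n. a l i j \<omega> * (X t k \<omega> l * X t k \<omega> l * X t k \<omega> i * X t k \<omega> j))"
    if "\<omega> \<in> space M" "l < n" for l \<omega>
  proof -
    let ?s = "\<Sum>j<n. w l \<omega> j * X t k \<omega> j"
    have "indicator A \<omega> * (mv n (U t k \<omega>) u l)\<^sup>2 = indicator A \<omega> * (\<delta> t k \<omega> l * \<delta> t k \<omega> l) * (X t k \<omega> l * X t k \<omega> l) * (?s * ?s)"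
      using that by (simp add: mv_U w_def power2_eq_square mult_ac)
    also have "\<dots> = indicator A \<omega> * \<delta> t k \<omega> l * (X t k \<omega> l * X t k \<omega> l) * (?s * ?s)"
      by (simp only: mask_idem[OF t that])
    finally show ?thesis
      unfolding a_def sum_product by (simp add: sum_distrib_left mult_ac)
  qed
  have int1: "integrable M (\<lambda>\<omega>. a l i j \<omega> * (X t k \<omega> l * X t k \<omega> l * X t k \<omega> i * X t k \<omega> j))"
    if "l < n" "i < n" "j < n" for l i j
    by (rule mask_X_prod4(1)[OF t aH[OF that] aB]) (use that in auto)
  have one: "(\<integral>\<omega>. indicator A \<omega> * (mv n (U t k \<omega>) u l)\<^sup>2 \<partial>M)
      \<le> K4 * op_norm n S * S l l * (\<Sum>j<n. (u j)\<^sup>2 * (\<integral>\<omega>. indicator A \<omega> * gam t \<omega> l j \<partial>M))"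
    if l: "l < n" for l
  proof -
    have ggi: "integrable M (\<lambda>\<omega>. indicator A \<omega> * gam t \<omega> l j * gam t \<omega> l j * (\<delta> t k \<omega> l * \<delta> t k \<omega> j))" if "j < n" for j
    proof (rule bounded_integrable[where B = "1 * gB * gB * (1 * 1)"])
      note [measurable] = measurable_from_subalg[OF GD_subalgebra[OF t(1)] mask_GD[OF t]]
      show "(\<lambda>\<omega>. indicator A \<omega> * gam t \<omega> l j * gam t \<omega> l j * (\<delta> t k \<omega> l * \<delta> t k \<omega> j)) \<in> borel_measurable M"
        using AM t that l by measurable
      show "\<bar>indicator A \<omega> * gam t \<omega> l j * gam t \<omega> l j * (\<delta> t k \<omega> l * \<delta> t k \<omega> j)\<bar> \<le> 1 * gB * gB * (1 * 1)" if "\<omega> \<in> space M" for \<omega>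
        unfolding abs_mult
        using gam_abs mask_abs[OF t that] l \<open>j < n\<close> gB_pos by (intro mult_mono) (auto split: split_indicator)
    qed
    have "(\<integral>\<omega>. indicator A \<omega> * (mv n (U t k \<omega>) u l)\<^sup>2 \<partial>M)
      = (\<integral>\<omega>. (\<Sum>i<n. \<Sum>j<n. a l i j \<omega> * (X t k \<omega> l * X t k \<omega> l * X t k \<omega> i * X t k \<omega> j)) \<partial>M)"
      by (intro Bochner_Integration.integral_cong refl sq l)
    also have "\<dots> = (\<Sum>i<n. \<integral>\<omega>. (\<Sum>j<n. a l i j \<omega> * (X t k \<omega> l * X t k \<omega> l * X t k \<omega> i * X t k \<omega> j)) \<partial>M)"
      by (intro Bochner_Integration.integral_sum Bochner_Integration.integrable_sum int1 l) auto
    also have "\<dots> = (\<Sum>i<n. \<Sum>j<n. \<integral>\<omega>. a l i j \<omega> * (X t k \<omega> l * X t k \<omega> l * X t k \<omega> i * X t k \<omega> j) \<partial>M)"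
      by (intro sum.cong refl Bochner_Integration.integral_sum int1 l) auto
    also have "\<dots> = (\<Sum>i<n. \<Sum>j<n. \<integral>\<omega>. a l i j \<omega> * E l i j \<partial>M)"
    proof (intro sum.cong refl)
      fix i j assume "i \<in> {..<n}" "j \<in> {..<n}"
      then have ij: "i < n" "j < n" by auto
      show "(\<integral>\<omega>. a l i j \<omega> * (X t k \<omega> l * X t k \<omega> l * X t k \<omega> i * X t k \<omega> j) \<partial>M) = (\<integral>\<omega>. a l i j \<omega> * E l i j \<partial>M)"
        using mask_X_prod4(2)[OF t aH[OF l ij] aB l l ij] l ij by (simp add: E_def)
    qed
    also have "\<dots> = (\<Sum>i<n. \<integral>\<omega>. (\<Sum>j<n. a l i j \<omega> * E l i j) \<partial>M)"
      by (intro sum.cong refl Bochner_Integration.integral_sum[symmetric] integrable_mult_left ai l) auto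
    also have "\<dots> = (\<integral>\<omega>. (\<Sum>i<n. \<Sum>j<n. a l i j \<omega> * E l i j) \<partial>M)"
      by (intro Bochner_Integration.integral_sum[symmetric] Bochner_Integration.integrable_sum integrable_mult_left ai l) auto
    \<comment> \<open>The data moments are now numbers \<open>E l i j\<close>. Back under the
      integral, for each fixed \<open>\<omega>\<close> the double sum is the fourth-order moment of
      a deterministic form, so \<open>mixed_fourth\<close> applies although \<open>w\<close> is
      random.\<close>
    also have "\<dots> \<le> (\<integral>\<omega>. K4 * op_norm n S * S l l * (\<Sum>j<n. (u j)\<^sup>2 * (indicator A \<omega> * gam t \<omega> l j * gam t \<omega> l j * (\<delta> t k \<omega> l * \<delta> t k \<omega> j))) \<partial>M)"
    proof (rule integral_mono)
      show "integrable M (\<lambda>\<omega>. \<Sum>i<n. \<Sum>j<n. a l i j \<omega> * E l i j)"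
        by (intro Bochner_Integration.integrable_sum integrable_mult_left ai l) auto
      from ggi show "integrable M (\<lambda>\<omega>. K4 * op_norm n S * S l l * (\<Sum>j<n. (u j)\<^sup>2 * (indicator A \<omega> * gam t \<omega> l j * gam t \<omega> l j * (\<delta> t k \<omega> l * \<delta> t k \<omega> j))))"
        by (intro integrable_mult_right Bochner_Integration.integrable_sum) auto
      fix \<omega> assume \<omega>: "\<omega> \<in> space M"
      have "(\<Sum>i<n. \<Sum>j<n. w l \<omega> i * w l \<omega> j * E l i j) = (\<integral>\<xi>. (x \<xi> l)\<^sup>2 * (inner_vec n (w l \<omega>) (x \<xi>))\<^sup>2 \<partial>M)"
      proof -
        have "(\<integral>\<xi>. (x \<xi> l)\<^sup>2 * (inner_vec n (w l \<omega>) (x \<xi>))\<^sup>2 \<partial>M)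
           = (\<integral>\<xi>. (\<Sum>i<n. \<Sum>j<n. (w l \<omega> i * w l \<omega> j) * (x \<xi> l * x \<xi> l * x \<xi> i * x \<xi> j)) \<partial>M)"
          unfolding inner_sq by (simp add: sum_distrib_left power2_eq_square mult_ac)
        also have "\<dots> = (\<Sum>i<n. \<integral>\<xi>. (\<Sum>j<n. (w l \<omega> i * w l \<omega> j) * (x \<xi> l * x \<xi> l * x \<xi> i * x \<xi> j)) \<partial>M)"
          by (intro Bochner_Integration.integral_sum Bochner_Integration.integrable_sum integrable_mult_right x_prod4_integrable l) auto
        also have "\<dots> = (\<Sum>i<n. \<Sum>j<n. \<integral>\<xi>. (w l \<omega> i * w l \<omega> j) * (x \<xi> l * x \<xi> l * x \<xi> i * x \<xi> j) \<partial>M)"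
          by (intro sum.cong refl Bochner_Integration.integral_sum integrable_mult_right x_prod4_integrable l) auto
        finally show ?thesis by (simp add: E_def)
      qed
      also have "\<dots> \<le> K4 * S l l * bil n S (w l \<omega>) (w l \<omega>)" by (rule mixed_fourth(2)[OF l])
      also have "\<dots> \<le> K4 * S l l * (op_norm n S * (\<Sum>j<n. (w l \<omega> j)\<^sup>2))"
        using K4_pos S_diag_nonneg[of l] by (intro mult_left_mono bil_S_le) auto
      finally have le: "(\<Sum>i<n. \<Sum>j<n. w l \<omega> i * w l \<omega> j * E l i j) \<le> K4 * op_norm n S * S l l * (\<Sum>j<n. (w l \<omega> j)\<^sup>2)"
        by (simp add: mult_ac)
      have d0: "0 \<le> \<delta> t k \<omega> l" using mask_01[OF t \<omega> l] by auto
      have "(\<Sum>i<n. \<Sum>j<n. a l i j \<omega> * E l i j) = (indicator A \<omega> * \<delta> t k \<omega> l) * (\<Sum>i<n. \<Sum>j<n. w l \<omega> i * w l \<omega> j * E l i j)"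
        by (simp add: a_def sum_distrib_left mult_ac)
      also have "\<dots> \<le> (indicator A \<omega> * \<delta> t k \<omega> l) * (K4 * op_norm n S * S l l * (\<Sum>j<n. (w l \<omega> j)\<^sup>2))"
        using d0 by (intro mult_left_mono le) auto
      also have "\<dots> = K4 * op_norm n S * S l l * (\<Sum>j<n. indicator A \<omega> * \<delta> t k \<omega> l * (w l \<omega> j)\<^sup>2)"
        by (simp only: sum_distrib_left mult_ac)
      also have "(\<Sum>j<n. indicator A \<omega> * \<delta> t k \<omega> l * (w l \<omega> j)\<^sup>2)
         = (\<Sum>j<n. (u j)\<^sup>2 * (indicator A \<omega> * gam t \<omega> l j * gam t \<omega> l j * (\<delta> t k \<omega> l * (\<delta> t k \<omega> j * \<delta> t k \<omega> j))))"
        by (simp add: w_def power2_eq_square mult_ac)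
      also have "\<dots> = (\<Sum>j<n. (u j)\<^sup>2 * (indicator A \<omega> * gam t \<omega> l j * gam t \<omega> l j * (\<delta> t k \<omega> l * \<delta> t k \<omega> j)))"
        by (intro sum.cong refl) (use mask_idem[OF t \<omega>] in simp)
      finally show "(\<Sum>i<n. \<Sum>j<n. a l i j \<omega> * E l i j)
         \<le> K4 * op_norm n S * S l l * (\<Sum>j<n. (u j)\<^sup>2 * (indicator A \<omega> * gam t \<omega> l j * gam t \<omega> l j * (\<delta> t k \<omega> l * \<delta> t k \<omega> j)))" .
    qed
    also have "\<dots> = K4 * op_norm n S * S l l * (\<Sum>j<n. (u j)\<^sup>2 * (\<integral>\<omega>. indicator A \<omega> * gam t \<omega> l j * gam t \<omega> l j * (\<delta> t k \<omega> l * \<delta> t k \<omega> j) \<partial>M))"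
    proof -
      from ggi show ?thesis by (subst integral_mult_right_zero, subst Bochner_Integration.integral_sum) auto
    qed
    also have "(\<Sum>j<n. (u j)\<^sup>2 * (\<integral>\<omega>. indicator A \<omega> * gam t \<omega> l j * gam t \<omega> l j * (\<delta> t k \<omega> l * \<delta> t k \<omega> j) \<partial>M))
       = (\<Sum>j<n. (u j)\<^sup>2 * (\<integral>\<omega>. indicator A \<omega> * gam t \<omega> l j \<partial>M))"
    proof (intro sum.cong refl)
      fix j assume "j \<in> {..<n}"
      then have j: "j < n" by simp
      \<comment> \<open>One factor \<open>gam\<close> is cancelled by the pair of masks; the other
        is part of the past-measurable weight and survives.\<close>
      have "(\<integral>\<omega>. (indicator A \<omega> * gam t \<omega> l j) * gam t \<omega> l j * (\<delta> t k \<omega> l * \<delta> t k \<omega> j) \<partial>M) = (\<integral>\<omega>. indicator A \<omega> * gam t \<omega> l j \<partial>M)"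
        by (rule mask_integral[OF t l j, where B = "gB"])
           (use A gam_F[OF t(1) l j] gam_abs gB_pos in \<open>auto split: split_indicator intro: order_trans[OF _ gB_pos]\<close>)
      then show "(u j)\<^sup>2 * (\<integral>\<omega>. indicator A \<omega> * gam t \<omega> l j * gam t \<omega> l j * (\<delta> t k \<omega> l * \<delta> t k \<omega> j) \<partial>M)
         = (u j)\<^sup>2 * (\<integral>\<omega>. indicator A \<omega> * gam t \<omega> l j \<partial>M)" by simp
    qed
    finally show ?thesis .
  qed
  have intl: "integrable M (\<lambda>\<omega>. indicator A \<omega> * (mv n (U t k \<omega>) u l)\<^sup>2)" if "l < n" for l
  proof -
    have "integrable M (\<lambda>\<omega>. (\<Sum>i<n. \<Sum>j<n. a l i j \<omega> * (X t k \<omega> l * X t k \<omega> l * X t k \<omega> i * X t k \<omega> j)))"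
      by (intro Bochner_Integration.integrable_sum int1 that) auto
    then show ?thesis by (rule Bochner_Integration.integrable_cong[THEN iffD1, rotated -1]) (auto simp: sq that)
  qed
  have gi: "integrable M (\<lambda>\<omega>. indicator A \<omega> * gam t \<omega> l j)" if "l < n" "j < n" for l j
    using AM gam_abs t that gB_pos
    by (intro bounded_integrable[where B = gB]) (auto split: split_indicator intro: order_trans[OF _ gB_pos])
  have "(\<integral>\<omega>. indicator A \<omega> * (\<Sum>l<n. (mv n (U t k \<omega>) u l)\<^sup>2) \<partial>M) = (\<Sum>l<n. \<integral>\<omega>. indicator A \<omega> * (mv n (U t k \<omega>) u l)\<^sup>2 \<partial>M)"
    unfolding sum_distrib_left by (intro Bochner_Integration.integral_sum intl) auto
  also have "\<dots> \<le> (\<Sum>l<n. K4 * op_norm n S * S l l * (\<Sum>j<n. (u j)\<^sup>2 * (\<integral>\<omega>. indicator A \<omega> * gam t \<omega> l j \<partial>M)))"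
    by (intro sum_mono one) auto
  also have "\<dots> = (\<Sum>l<n. \<Sum>j<n. \<integral>\<omega>. K4 * op_norm n S * (u j)\<^sup>2 * (S l l * (indicator A \<omega> * gam t \<omega> l j)) \<partial>M)"
    by (simp only: integral_mult_right_zero sum_distrib_left) (simp only: mult_ac)
  also have "\<dots> = (\<Sum>l<n. \<integral>\<omega>. (\<Sum>j<n. K4 * op_norm n S * (u j)\<^sup>2 * (S l l * (indicator A \<omega> * gam t \<omega> l j))) \<partial>M)"
    by (intro sum.cong refl Bochner_Integration.integral_sum[symmetric] integrable_mult_right gi) auto
  also have "\<dots> = (\<integral>\<omega>. (\<Sum>l<n. \<Sum>j<n. K4 * op_norm n S * (u j)\<^sup>2 * (S l l * (indicator A \<omega> * gam t \<omega> l j))) \<partial>M)"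
    by (intro Bochner_Integration.integral_sum[symmetric] Bochner_Integration.integrable_sum integrable_mult_right gi) auto
  also have "\<dots> \<le> (\<integral>\<omega>. indicator A \<omega> * (K4 * op_norm n S * (\<Sum>j<n. (u j)\<^sup>2) * rho t \<omega>) \<partial>M)"
  proof (rule integral_mono)
    show "integrable M (\<lambda>\<omega>. (\<Sum>l<n. \<Sum>j<n. K4 * op_norm n S * (u j)\<^sup>2 * (S l l * (indicator A \<omega> * gam t \<omega> l j))))"
      by (intro Bochner_Integration.integrable_sum integrable_mult_right gi) auto
    show "integrable M (\<lambda>\<omega>. indicator A \<omega> * (K4 * op_norm n S * (\<Sum>j<n. (u j)\<^sup>2) * rho t \<omega>))"
      by (intro integrable_indicator_mult AM integrable_mult_right rho_integrable t)
    fix \<omega>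
    have "(\<Sum>l<n. \<Sum>j<n. K4 * op_norm n S * (u j)\<^sup>2 * (S l l * (indicator A \<omega> * gam t \<omega> l j)))
       = indicator A \<omega> * (K4 * op_norm n S * (\<Sum>j<n. (u j)\<^sup>2 * (\<Sum>l<n. S l l * gam t \<omega> l j)))"
      unfolding sum_distrib_left by (subst sum.swap) (simp add: mult_ac)
    also have "\<dots> \<le> indicator A \<omega> * (K4 * op_norm n S * (\<Sum>j<n. (u j)\<^sup>2 * rho t \<omega>))"
      using K4_pos op_norm_S_pos by (intro mult_left_mono sum_mono rho_ge) auto
    finally show "(\<Sum>l<n. \<Sum>j<n. K4 * op_norm n S * (u j)\<^sup>2 * (S l l * (indicator A \<omega> * gam t \<omega> l j)))
       \<le> indicator A \<omega> * (K4 * op_norm n S * (\<Sum>j<n. (u j)\<^sup>2) * rho t \<omega>)"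
      by (simp add: sum_distrib_right sum_distrib_left mult_ac)
  qed
  finally show ?thesis .
qed

end

section \<open>Conditional independence and exchangeability\<close>

text \<open>Induction over the sigma-algebra generated by an intersection-stable family.
  \<open>eq1\<close> serves the complements, since the whole space need not belong to
  \<open>E\<close>.\<close>

lemma (in prob_space) integral_eq_on_generator:
  fixes f g :: "'a \<Rightarrow> real"
  assumes f: "integrable M f" and g: "integrable M g" and eq1: "(\<integral>\<omega>. f \<omega> \<partial>M) = (\<integral>\<omega>. g \<omega> \<partial>M)"
    and E: "Int_stable E" "E \<subseteq> sets M"
    and eq: "\<And>A. A \<in> E \<Longrightarrow> (\<integral>\<omega>. indicator A \<omega> * f \<omega> \<partial>M) = (\<integral>\<omega>. indicator A \<omega> * g \<omega> \<partial>M)"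
    and A: "A \<in> sigma_sets (space M) E"
  shows "(\<integral>\<omega>. indicator A \<omega> * f \<omega> \<partial>M) = (\<integral>\<omega>. indicator A \<omega> * g \<omega> \<partial>M)"
proof -
  have sub: "sigma_sets (space M) E \<subseteq> sets M" using E(2) by (rule sets.sigma_sets_subset)
  have Pow: "E \<subseteq> Pow (space M)" using E(2) sets.sets_into_space by auto
  show ?thesis
    using E(1) Pow A
  proof (induction rule: sigma_sets_induct_disjoint)
    case (basic A)
    then show ?case by (rule eq)
  next
    case empty
    show ?case by simp
  next
    case (compl A)
    then have AM: "A \<in> sets M" using sub by auto
    have "(\<integral>\<omega>. indicator (space M - A) \<omega> * h \<omega> \<partial>M) = (\<integral>\<omega>. h \<omega> \<partial>M) - (\<integral>\<omega>. indicator A \<omega> * h \<omega> \<partial>M)"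
      if h: "integrable M h" for h :: "'a \<Rightarrow> real"
    proof -
      have "(\<integral>\<omega>. indicator (space M - A) \<omega> * h \<omega> \<partial>M) = (\<integral>\<omega>. h \<omega> - indicator A \<omega> * h \<omega> \<partial>M)"
        by (intro Bochner_Integration.integral_cong refl) (auto split: split_indicator)
      then show ?thesis using h integrable_indicator_mult[OF AM h] by simp
    qed
    then show ?case using f g compl.IH eq1 by simp
  next
    case (union A)
    then have AM: "A i \<in> sets M" for i using sub by auto
    have "(\<integral>\<omega>. indicator (\<Union>i. A i) \<omega> * h \<omega> \<partial>M) = (\<Sum>i. \<integral>\<omega>. indicator (A i) \<omega> * h \<omega> \<partial>M)"
      if h: "integrable M h" for h :: "'a \<Rightarrow> real"
      using lebesgue_integral_countable_add[of A M h] AM union.hyps(1) h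
        integrable_mult_indicator[of "\<Union>i. A i" M h]
      by (auto simp: set_lebesgue_integral_def set_integrable_def disjoint_family_on_def)
    then show ?case using f g union.IH by simp
  qed
qed

context cmcar_sg
begin

section \<open>Conditional independence inside a batch\<close>

abbreviation "V \<equiv> vec_borel n"

definition joint :: "nat \<Rightarrow> nat set \<Rightarrow> (nat \<Rightarrow> (nat \<Rightarrow> real) set) \<Rightarrow> 'w set" where
  "joint t J B = {\<omega>\<in>space M. \<forall>j\<in>J. Y t j \<omega> \<in> B j}"

lemma joint_sets:
  assumes "1 \<le> t" "J \<subseteq> {..<N t}" "\<And>j. j \<in> J \<Longrightarrow> B j \<in> sets V"
  shows "joint t J B \<in> sets M"
proof -
  have "finite J" using assms(2) finite_subset by auto
  have "{\<omega>\<in>space M. Y t j \<omega> \<in> B j} \<in> sets M" if "j \<in> J" for j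
    using measurable_sets[OF Y_measurable assms(3)[OF that], of t] assms that
    by (auto simp: vimage_def Int_def conj_commute)
  then show ?thesis unfolding joint_def using \<open>finite J\<close> by (rule sets.sets_Collect_finite_All)
qed

text \<open>Intersection-stable generator of the sigma-algebra \<open>G t J\<close> of the past
  together with the observations of batch \<open>t\<close> whose index lies in
  \<open>J\<close>.\<close>

definition G_gen :: "nat \<Rightarrow> nat set \<Rightarrow> 'w set set" where
  "G_gen t J = {C \<inter> joint t J B | C B. C \<in> sets (F t) \<and> (\<forall>j\<in>J. B j \<in> sets V)}"

definition "G t J = sigma (space M) (G_gen t J)"

lemma G_gen_subset: "G_gen t J \<subseteq> Pow (space M)"
  by (auto simp: G_gen_def joint_def)

lemma G_space [simp]: "space (G t J) = space M"
  unfolding G_def using G_gen_subset by (rule space_measure_of)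

lemma G_sets: "sets (G t J) = sigma_sets (space M) (G_gen t J)"
  unfolding G_def using G_gen_subset by (rule sets_measure_of)

lemma G_gen_sets: "1 \<le> t \<Longrightarrow> J \<subseteq> {..<N t} \<Longrightarrow> G_gen t J \<subseteq> sets M"
proof
  fix A assume "1 \<le> t" "J \<subseteq> {..<N t}" "A \<in> G_gen t J"
  then obtain C B where *: "A = C \<inter> joint t J B" "C \<in> sets (F t)" "\<forall>j\<in>J. B j \<in> sets V"
    unfolding G_gen_def by blast
  have "joint t J B \<in> sets M" using * \<open>1 \<le> t\<close> \<open>J \<subseteq> {..<N t}\<close> by (intro joint_sets) auto
  then show "A \<in> sets M" using F_sets_M[OF *(2)] *(1) by auto
qed

lemma G_subalgebra: "1 \<le> t \<Longrightarrow> J \<subseteq> {..<N t} \<Longrightarrow> subalgebra M (G t J)"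
  unfolding subalgebra_def G_space G_sets using sets.sigma_sets_subset[OF G_gen_sets] by simp

lemma Y_in_V: "1 \<le> t \<Longrightarrow> j < N t \<Longrightarrow> \<omega> \<in> space M \<Longrightarrow> Y t j \<omega> \<in> space V"
  by (rule measurable_space[OF Y_measurable])

lemma G_F:
  assumes "1 \<le> t" "J \<subseteq> {..<N t}"
  shows "subalgebra (G t J) (F t)"
proof -
  have "A \<in> sets (G t J)" if A: "A \<in> sets (F t)" for A
  proof -
    have "A = A \<inter> joint t J (\<lambda>_. space V)"
      using sets.sets_into_space[OF A] assms by (auto simp: joint_def simp del: space_PiM intro!: Y_in_V)
    then have "A \<in> G_gen t J" unfolding G_gen_def using A sets.top[of V] by blast
    then show ?thesis unfolding G_sets by (rule sigma_sets.Basic)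
  qed
  then show ?thesis by (auto simp: subalgebra_def)
qed

lemma Y_G:
  assumes "1 \<le> t" "J \<subseteq> {..<N t}" "k \<in> J"
  shows "Y t k \<in> G t J \<rightarrow>\<^sub>M V"
proof (rule measurableI)
  have kt: "k < N t" using assms(2,3) by blast
  have V: "Y t j \<omega> \<in> space V" if "j \<in> J" "\<omega> \<in> space M" for j \<omega>
    by (rule Y_in_V[OF assms(1) _ that(2)]) (use assms(2) that(1) in blast)
  show "Y t k \<omega> \<in> space V" if "\<omega> \<in> space (G t J)" for \<omega>
    using that unfolding G_space by (rule V[OF assms(3)])
  fix B assume B: "B \<in> sets V"
  define B' where "B' j = (if j = k then B else space V)" for j
  have "Y t k -` B \<inter> space (G t J) = space M \<inter> joint t J B'"
    unfolding G_space joint_def B'_def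
  proof (intro set_eqI iffI)
    fix \<omega> assume "\<omega> \<in> Y t k -` B \<inter> space M"
    then have \<omega>: "\<omega> \<in> space M" "Y t k \<omega> \<in> B" by blast+
    have "Y t j \<omega> \<in> (if j = k then B else space V)" if "j \<in> J" for j
    proof (cases "j = k")
      case True
      then show ?thesis using \<omega>(2) by (simp only: if_True refl)
    next
      case False
      then show ?thesis using V[OF that \<omega>(1)] by (simp only: if_False)
    qed
    then show "\<omega> \<in> space M \<inter> {\<omega> \<in> space M. \<forall>j\<in>J. Y t j \<omega> \<in> (if j = k then B else space V)}"
      using \<omega>(1) by blast
  next
    fix \<omega> assume "\<omega> \<in> space M \<inter> {\<omega> \<in> space M. \<forall>j\<in>J. Y t j \<omega> \<in> (if j = k then B else space V)}"
    then have "\<omega> \<in> space M" "Y t k \<omega> \<in> (if k = k then B else space V)" using assms(3) by blast+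
    then show "\<omega> \<in> Y t k -` B \<inter> space M" by simp
  qed
  moreover have "space M \<inter> joint t J B' \<in> G_gen t J"
  proof -
    have "\<forall>j\<in>J. B' j \<in> sets V" using B sets.top[of V] by (metis B'_def)
    moreover have "space M \<in> sets (F t)" using sets.top[of "F t"] by (simp only: F_space)
    ultimately show ?thesis unfolding G_gen_def by blast
  qed
  ultimately show "Y t k -` B \<inter> space (G t J) \<in> sets (G t J)"
    by (simp only: G_sets sigma_sets.Basic)
qed

lemma G_gen_Int_stable: "Int_stable (G_gen t J)"
proof (rule Int_stableI)
  fix a b assume "a \<in> G_gen t J" "b \<in> G_gen t J"
  then obtain C B C' B' where *: "a = C \<inter> joint t J B" "b = C' \<inter> joint t J B'" "C \<in> sets (F t)" "C' \<in> sets (F t)"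
    "\<forall>j\<in>J. B j \<in> sets V" "\<forall>j\<in>J. B' j \<in> sets V"
    unfolding G_gen_def by blast
  have "a \<inter> b = (C \<inter> C') \<inter> joint t J (\<lambda>j. B j \<inter> B' j)" using * by (auto simp: joint_def)
  then show "a \<inter> b \<in> G_gen t J" unfolding G_gen_def using * by blast
qed

lemma cond_pr_joint:
  assumes "1 \<le> t" "J \<subseteq> {..<N t}" "\<And>j. j \<in> J \<Longrightarrow> B j \<in> sets V"
  shows "AE \<omega> in M. cond_pr M (F t) (joint t J B) \<omega> = (\<Prod>j\<in>J. cond_pr M (F t) (joint t {j} B) \<omega>)"
  using Y_cond_iid[OF assms(1)] assms finite_subset[OF assms(2)]
  unfolding cond_iid_vars_def cond_indep_vars_def joint_def by simp

lemma cond_pr_bounds: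
  assumes "A \<in> sets M"
  shows "AE \<omega> in M. 0 \<le> cond_pr M (F t) A \<omega> \<and> cond_pr M (F t) A \<omega> \<le> 1"
proof -
  interpret Fs: sigma_finite_subalgebra M "F t" by (rule sigma_finite_subalgebraI[OF F_subalgebra])
  have "AE \<omega> in M. cond_pr M (F t) A \<omega> \<le> 1" "AE \<omega> in M. 0 \<le> cond_pr M (F t) A \<omega>"
    unfolding cond_pr_def
    by (intro Fs.real_cond_exp_le_c Fs.real_cond_exp_ge_c integrable_indicator_real assms; auto split: split_indicator)+
  then show ?thesis by eventually_elim simp
qed

lemma cond_pr_F [measurable]: "cond_pr M (F t) A \<in> borel_measurable (F t)"
  unfolding cond_pr_def by (rule borel_measurable_cond_exp)

text \<open>The event on the samples in \<open>J\<close> is replaced by its conditional probability.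
  Both sides are integrals of \<open>h\<close> against laws of \<open>Y t k\<close> under two
  densities; conditional independence shows that these laws agree on all sets, hence for every
  \<open>h\<close>. Clipping to the unit interval makes the second density nonnegative and bounded
  everywhere.\<close>

lemma indicator_joint_integral:
  assumes t: "1 \<le> t" and J: "J \<subseteq> {..<N t}" and k: "k < N t" "k \<notin> J"
    and C: "C \<in> sets (F t)" and B: "\<And>j. j \<in> J \<Longrightarrow> B j \<in> sets V"
    and h: "h \<in> borel_measurable V"
  shows "(\<integral>\<omega>. indicator (C \<inter> joint t J B) \<omega> * h (Y t k \<omega>) \<partial>M)
    = (\<integral>\<omega>. indicator C \<omega> * max 0 (min 1 (cond_pr M (F t) (joint t J B) \<omega>)) * h (Y t k \<omega>) \<partial>M :: real)"
proof -
  define b where "b \<omega> = max 0 (min 1 (cond_pr M (F t) (joint t J B) \<omega>))" for \<omega>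
  define f1 where "f1 \<omega> = indicat_real (C \<inter> joint t J B) \<omega>" for \<omega>
  define f2 where "f2 \<omega> = indicator C \<omega> * b \<omega>" for \<omega>
  have JM: "joint t J B \<in> sets M" by (rule joint_sets[OF t J B])
  have CM: "C \<in> sets M" by (rule F_sets_M[OF C])
  have bF: "b \<in> borel_measurable (F t)" unfolding b_def by measurable
  then have bM [measurable]: "b \<in> borel_measurable M" by (rule measurable_from_subalg[OF F_subalgebra])
  have b01: "0 \<le> b \<omega>" "b \<omega> \<le> 1" for \<omega> by (auto simp: b_def)
  have f2F: "f2 \<in> borel_measurable (F t)" unfolding f2_def using bF C by simp
  have m [measurable]: "f1 \<in> borel_measurable M" "f2 \<in> borel_measurable M"
    unfolding f1_def f2_def using JM CM by measurable
  have nn: "0 \<le> f1 \<omega>" "0 \<le> f2 \<omega>" for \<omega> using b01 by (auto simp: f1_def f2_def)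
  have le1: "f1 \<omega> \<le> 1" "f2 \<omega> \<le> 1" for \<omega> using b01 by (auto simp: f1_def f2_def split: split_indicator)
  note [measurable] = Y_measurable[OF t k(1)]
  have bAE: "AE \<omega> in M. cond_pr M (F t) (joint t J B) \<omega> = b \<omega>"
    using cond_pr_bounds[OF JM, of t] by eventually_elim (auto simp: b_def)
  have sets_eq: "(\<integral>\<omega>. f1 \<omega> * indicator (Y t k -` D \<inter> space M) \<omega> \<partial>M) = (\<integral>\<omega>. f2 \<omega> * indicator (Y t k -` D \<inter> space M) \<omega> \<partial>M)"
    if D: "D \<in> sets V" for D
  proof -
    define B' where "B' = B(k := D)"
    have B': "B' j \<in> sets V" if "j \<in> insert k J" for j using that B D by (auto simp: B'_def)
    have jJ: "joint t J B' = joint t J B" using k by (auto simp: joint_def B'_def)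
    have jk: "joint t {k} B' = Y t k -` D \<inter> space M" by (auto simp: joint_def B'_def)
    have ins: "insert k J \<subseteq> {..<N t}" using J k by auto
    have jM: "joint t (insert k J) B' \<in> sets M" "joint t {k} B' \<in> sets M"
      by (rule joint_sets[OF t ins B'], simp, rule joint_sets[OF t], use k B' in auto)
    have prod: "AE \<omega> in M. cond_pr M (F t) (joint t (insert k J) B') \<omega> = b \<omega> * cond_pr M (F t) (joint t {k} B') \<omega>"
    proof -
      have "AE \<omega> in M. cond_pr M (F t) (joint t (insert k J) B') \<omega> = (\<Prod>j\<in>insert k J. cond_pr M (F t) (joint t {j} B') \<omega>)"
        by (rule cond_pr_joint[OF t ins B'])
      moreover have "AE \<omega> in M. cond_pr M (F t) (joint t J B') \<omega> = (\<Prod>j\<in>J. cond_pr M (F t) (joint t {j} B') \<omega>)"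
        by (rule cond_pr_joint[OF t J B']) simp
      ultimately show ?thesis using bAE
    proof eventually_elim
      case (elim \<omega>)
      then show ?case using k finite_subset[OF J] by (simp add: jJ mult.commute)
    qed
    qed
    have "(\<integral>\<omega>. f1 \<omega> * indicator (Y t k -` D \<inter> space M) \<omega> \<partial>M) = (\<integral>\<omega>. indicator C \<omega> * indicator (joint t (insert k J) B') \<omega> \<partial>M)"
      using jk jJ by (intro Bochner_Integration.integral_cong refl) (auto simp: f1_def joint_def split: split_indicator)
    also have "\<dots> = (\<integral>\<omega>. indicator C \<omega> * cond_pr M (F t) (joint t (insert k J) B') \<omega> \<partial>M)"
      by (rule cond_pr_integral(1)[symmetric, where B = 1]) (use C jM in \<open>auto split: split_indicator\<close>)
    also have "\<dots> = (\<integral>\<omega>. f2 \<omega> * cond_pr M (F t) (joint t {k} B') \<omega> \<partial>M)"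
    proof (rule integral_cong_AE)
      show "AE \<omega> in M. indicator C \<omega> * cond_pr M (F t) (joint t (insert k J) B') \<omega> = f2 \<omega> * cond_pr M (F t) (joint t {k} B') \<omega>"
        using prod by eventually_elim (simp add: f2_def)
    qed (use CM in \<open>auto simp: cond_pr_def\<close>)
    also have "\<dots> = (\<integral>\<omega>. f2 \<omega> * indicator (joint t {k} B') \<omega> \<partial>M)"
      by (rule cond_pr_integral(1)[where B = 1]) (use f2F jM nn le1 in auto)
    finally show ?thesis by (simp add: jk)
  qed
  have "distr (density M f1) V (Y t k) = distr (density M f2) V (Y t k)"
  proof (rule measure_eqI)
    fix D assume "D \<in> sets (distr (density M f1) V (Y t k))"
    then have D: "D \<in> sets V" by simp
    have DM: "Y t k -` D \<inter> space M \<in> sets M" using D by measurable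
    have e: "emeasure (distr (density M f) V (Y t k)) D = ennreal (\<integral>\<omega>. f \<omega> * indicator (Y t k -` D \<inter> space M) \<omega> \<partial>M)"
      if f: "f \<in> borel_measurable M" "\<And>\<omega>. 0 \<le> f \<omega>" "\<And>\<omega>. f \<omega> \<le> 1" for f :: "'w \<Rightarrow> real"
    proof -
      have i: "integrable M (\<lambda>\<omega>. f \<omega> * indicator (Y t k -` D \<inter> space M) \<omega>)"
        by (rule bounded_integrable[where B = 1]) (use f DM in \<open>auto split: split_indicator\<close>)
      have "emeasure (distr (density M f) V (Y t k)) D = (\<integral>\<^sup>+\<omega>. ennreal (f \<omega>) * indicator (Y t k -` D \<inter> space M) \<omega> \<partial>M)"
        using f D DM by (simp add: emeasure_distr emeasure_density)
      also have "\<dots> = (\<integral>\<^sup>+\<omega>. ennreal (f \<omega> * indicator (Y t k -` D \<inter> space M) \<omega>) \<partial>M)"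
        by (intro nn_integral_cong) (auto split: split_indicator)
      also have "\<dots> = ennreal (\<integral>\<omega>. f \<omega> * indicator (Y t k -` D \<inter> space M) \<omega> \<partial>M)"
        by (rule nn_integral_eq_integral[OF i]) (use f in auto)
      finally show ?thesis .
    qed
    show "emeasure (distr (density M f1) V (Y t k)) D = emeasure (distr (density M f2) V (Y t k)) D"
      by (simp add: e m nn le1 sets_eq[OF D])
  qed simp
  then have "(\<integral>z. h z \<partial>distr (density M f1) V (Y t k)) = (\<integral>z. h z \<partial>distr (density M f2) V (Y t k))" by simp
  moreover have "(\<integral>z. h z \<partial>distr (density M f) V (Y t k)) = (\<integral>\<omega>. f \<omega> * h (Y t k \<omega>) \<partial>M)"
    if "f \<in> borel_measurable M" "\<And>\<omega>. 0 \<le> f \<omega>" for f :: "'w \<Rightarrow> real"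
    using that h by (simp add: integral_distr integral_density)
  ultimately show ?thesis using m nn by (simp add: f1_def[abs_def] f2_def[abs_def] b_def)
qed

text \<open>On a generator of \<open>G t J\<close> the event of the samples in \<open>J\<close> is
  first replaced by its conditional probability, then \<open>h (Y t k \<omega>)\<close> by its
  conditional mean given \<open>F t\<close>, and finally the event is restored, the other factors
  now being functions of the past.\<close>

lemma cond_exp_other_sample:
  assumes t: "1 \<le> t" and J: "J \<subseteq> {..<N t}" and k: "k < N t" "k \<notin> J"
    and h: "h \<in> borel_measurable V" and hi: "integrable M (\<lambda>\<omega>. h (Y t k \<omega>) :: real)"
  shows "AE \<omega> in M. real_cond_exp M (G t J) (\<lambda>\<omega>. h (Y t k \<omega>)) \<omega> = real_cond_exp M (F t) (\<lambda>\<omega>. h (Y t k \<omega>)) \<omega>"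
proof (rule real_cond_exp_charact'[OF G_subalgebra[OF t J] hi])
  interpret Fs: sigma_finite_subalgebra M "F t" by (rule sigma_finite_subalgebraI[OF F_subalgebra])
  let ?f = "\<lambda>\<omega>. h (Y t k \<omega>)"
  let ?c = "real_cond_exp M (F t) ?f"
  show ci: "integrable M ?c" using hi by (rule Fs.real_cond_exp_int(1))
  have cF: "?c \<in> borel_measurable (F t)" by simp
  then show "?c \<in> borel_measurable (G t J)" by (rule measurable_from_subalg[OF G_F[OF t J]])
  fix A assume "A \<in> sets (G t J)"
  then have A: "A \<in> sigma_sets (space M) (G_gen t J)" by (simp add: G_sets)
  show "(\<integral>\<omega>. indicator A \<omega> * ?f \<omega> \<partial>M) = (\<integral>\<omega>. indicator A \<omega> * ?c \<omega> \<partial>M)"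
  proof (rule integral_eq_on_generator[OF hi ci _ G_gen_Int_stable G_gen_sets[OF t J] _ A])
    show "(\<integral>\<omega>. ?f \<omega> \<partial>M) = (\<integral>\<omega>. ?c \<omega> \<partial>M)" using Fs.real_cond_exp_int(2)[OF hi] by simp
    fix A assume "A \<in> G_gen t J"
    then obtain C B where A: "A = C \<inter> joint t J B" and C: "C \<in> sets (F t)" and B: "\<And>j. j \<in> J \<Longrightarrow> B j \<in> sets V"
      unfolding G_gen_def by blast
    have JM: "joint t J B \<in> sets M" by (rule joint_sets[OF t J B])
    have CM: "C \<in> sets M" by (rule F_sets_M[OF C])
    define b where "b \<omega> = max 0 (min 1 (cond_pr M (F t) (joint t J B) \<omega>))" for \<omega>
    have bF: "b \<in> borel_measurable (F t)" unfolding b_def by measurable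
    then have bM [measurable]: "b \<in> borel_measurable M" by (rule measurable_from_subalg[OF F_subalgebra])
    have b01: "0 \<le> b \<omega>" "b \<omega> \<le> 1" for \<omega> by (auto simp: b_def)
    have bAE: "AE \<omega> in M. cond_pr M (F t) (joint t J B) \<omega> = b \<omega>"
      using cond_pr_bounds[OF JM, of t] by eventually_elim (auto simp: b_def)
    have "(\<integral>\<omega>. indicator A \<omega> * ?f \<omega> \<partial>M) = (\<integral>\<omega>. (indicator C \<omega> * b \<omega>) * ?f \<omega> \<partial>M)"
      unfolding A b_def by (rule indicator_joint_integral[OF t J k C B h])
    also have "\<dots> = (\<integral>\<omega>. (indicator C \<omega> * b \<omega>) * ?c \<omega> \<partial>M)"
    proof (rule Fs.real_cond_exp_intg(2)[symmetric])
      show "integrable M (\<lambda>\<omega>. (indicator C \<omega> * b \<omega>) * ?f \<omega>)"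
      proof (rule Bochner_Integration.integrable_bound[OF hi])
        show "AE \<omega> in M. norm ((indicator C \<omega> * b \<omega>) * ?f \<omega>) \<le> norm (?f \<omega>)"
          using b01 by (intro AE_I2) (auto simp: abs_mult mult_left_le_one_le split: split_indicator)
      qed (use CM hi in measurable)
      show "(\<lambda>\<omega>. indicator C \<omega> * b \<omega>) \<in> borel_measurable (F t)" using C bF by simp
    qed (use hi in auto)
    also have "\<dots> = (\<integral>\<omega>. (indicator C \<omega> * ?c \<omega>) * cond_pr M (F t) (joint t J B) \<omega> \<partial>M)"
    proof (rule integral_cong_AE)
      show "AE \<omega> in M. (indicator C \<omega> * b \<omega>) * ?c \<omega> = (indicator C \<omega> * ?c \<omega>) * cond_pr M (F t) (joint t J B) \<omega>"
        using bAE by eventually_elim simp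
    qed (use CM ci in \<open>auto simp: cond_pr_def\<close>)
    also have "\<dots> = (\<integral>\<omega>. (indicator C \<omega> * ?c \<omega>) * indicator (joint t J B) \<omega> \<partial>M)"
      unfolding cond_pr_def
    proof (rule Fs.real_cond_exp_intg(2))
      show "integrable M (\<lambda>\<omega>. (indicator C \<omega> * ?c \<omega>) * indicat_real (joint t J B) \<omega>)"
        using integrable_indicator_mult[OF JM integrable_indicator_mult[OF CM ci]] by (simp add: mult.commute)
      show "(\<lambda>\<omega>. indicator C \<omega> * ?c \<omega>) \<in> borel_measurable (F t)" using C cF by simp
    qed (use JM in auto)
    also have "\<dots> = (\<integral>\<omega>. indicator A \<omega> * ?c \<omega> \<partial>M)"
      by (intro Bochner_Integration.integral_cong refl) (auto simp: A split: split_indicator)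
    finally show "(\<integral>\<omega>. indicator A \<omega> * ?f \<omega> \<partial>M) = (\<integral>\<omega>. indicator A \<omega> * ?c \<omega> \<partial>M)" .
  qed
qed

section \<open>Exchangeability of a batch jointly with the past\<close>

definition Yv :: "nat \<Rightarrow> (nat \<Rightarrow> nat) \<Rightarrow> 'w \<Rightarrow> nat \<Rightarrow> nat \<Rightarrow> real" where
  "Yv t \<pi> \<omega> = (\<lambda>k\<in>{..<N t}. Y t (\<pi> k) \<omega>)"

abbreviation "VN t \<equiv> Pi\<^sub>M {..<N t} (\<lambda>_. V)"

lemma Yv_measurable:
  assumes "1 \<le> t" "\<pi> permutes {..<N t}"
  shows "Yv t \<pi> \<in> M \<rightarrow>\<^sub>M VN t"
  unfolding Yv_def using permutes_in_image[OF assms(2)] assms(1)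
  by (intro measurable_restrict Y_measurable) auto

text \<open>Given the past, the probability of a rectangle is a product of conditional
  probabilities, and these do not depend on the sample; reindexing the product absorbs the
  permutation. \<open>B'\<close> transports the sets by the inverse permutation to the unpermuted
  samples.\<close>

lemma joint_prob_permute:
  assumes t: "1 \<le> t" and \<pi>: "\<pi> permutes {..<N t}" and C: "C \<in> sets (F t)"
    and B: "\<And>j. j < N t \<Longrightarrow> B j \<in> sets V"
  shows "prob (C \<inter> {\<omega>\<in>space M. \<forall>k<N t. Y t (\<pi> k) \<omega> \<in> B k}) = prob (C \<inter> joint t {..<N t} B)"
proof -
  let ?I = "{..<N t}"
  have inv: "inv \<pi> permutes ?I" by (rule permutes_inv[OF \<pi>])
  have inv_lt: "inv \<pi> j < N t" if "j < N t" for j using permutes_in_image[OF inv, of j] that by simp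
  have pi_lt: "\<pi> j < N t" if "j < N t" for j using permutes_in_image[OF \<pi>, of j] that by simp
  define B' where "B' = (\<lambda>j. B (inv \<pi> j))"
  have B': "B' j \<in> sets V" if "j \<in> ?I" for j using that inv_lt B by (auto simp: B'_def)
  have CM: "C \<in> sets M" by (rule F_sets_M[OF C])
  have set_eq: "{\<omega>\<in>space M. \<forall>k<N t. Y t (\<pi> k) \<omega> \<in> B k} = joint t ?I B'"
  proof -
    have "(\<forall>k<N t. Y t (\<pi> k) \<omega> \<in> B k) \<longleftrightarrow> (\<forall>j<N t. Y t j \<omega> \<in> B (inv \<pi> j))" for \<omega>
      using inv_lt pi_lt permutes_inverses[OF \<pi>] by metis
    then show ?thesis by (auto simp: joint_def B'_def)
  qed
  have p: "prob (C \<inter> joint t ?I D) = (\<integral>\<omega>. indicator C \<omega> * (\<Prod>j\<in>?I. cond_pr M (F t) (joint t {j} D) \<omega>) \<partial>M)"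
    if D: "\<And>j. j \<in> ?I \<Longrightarrow> D j \<in> sets V" for D
  proof -
    have jM: "joint t ?I D \<in> sets M" by (rule joint_sets[OF t _ D]) auto
    have "prob (C \<inter> joint t ?I D) = (\<integral>\<omega>. indicator C \<omega> * indicator (joint t ?I D) \<omega> \<partial>M)"
      using CM jM by (simp add: indicator_inter_arith[symmetric])
    also have "\<dots> = (\<integral>\<omega>. indicator C \<omega> * cond_pr M (F t) (joint t ?I D) \<omega> \<partial>M)"
      by (rule cond_pr_integral(1)[symmetric, where B = 1]) (use C jM in \<open>auto split: split_indicator\<close>)
    also have "\<dots> = (\<integral>\<omega>. indicator C \<omega> * (\<Prod>j\<in>?I. cond_pr M (F t) (joint t {j} D) \<omega>) \<partial>M)"
    proof (rule integral_cong_AE)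
      show "AE \<omega> in M. indicator C \<omega> * cond_pr M (F t) (joint t ?I D) \<omega> = indicator C \<omega> * (\<Prod>j\<in>?I. cond_pr M (F t) (joint t {j} D) \<omega>)"
      proof -
        have "AE \<omega> in M. cond_pr M (F t) (joint t ?I D) \<omega> = (\<Prod>j\<in>?I. cond_pr M (F t) (joint t {j} D) \<omega>)"
          by (rule cond_pr_joint[OF t subset_refl D])
        then show ?thesis by eventually_elim simp
      qed
    qed (use CM in \<open>auto simp: cond_pr_def intro!: borel_measurable_prod\<close>)
    finally show ?thesis .
  qed
  have "AE \<omega> in M. \<forall>k\<in>?I. cond_pr M (F t) (joint t {\<pi> k} B') \<omega> = cond_pr M (F t) (joint t {k} B) \<omega>"
  proof (intro AE_finite_allI)
    fix k assume k: "k \<in> ?I"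
    have "AE \<omega> in M. cond_pr M (F t) {\<omega>'\<in>space M. Y t (\<pi> k) \<omega>' \<in> B k} \<omega> = cond_pr M (F t) {\<omega>'\<in>space M. Y t k \<omega>' \<in> B k} \<omega>"
      using Y_cond_iid[OF t] B[of k] k pi_lt[of k] unfolding cond_iid_vars_def by blast
    moreover have "joint t {\<pi> k} B' = {\<omega>'\<in>space M. Y t (\<pi> k) \<omega>' \<in> B k}" "joint t {k} B = {\<omega>'\<in>space M. Y t k \<omega>' \<in> B k}"
      using permutes_inverses[OF \<pi>] by (auto simp: joint_def B'_def)
    ultimately show "AE \<omega> in M. cond_pr M (F t) (joint t {\<pi> k} B') \<omega> = cond_pr M (F t) (joint t {k} B) \<omega>" by simp
  qed simp
  then have "AE \<omega> in M. indicator C \<omega> * (\<Prod>j\<in>?I. cond_pr M (F t) (joint t {j} B') \<omega>)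
      = indicator C \<omega> * (\<Prod>j\<in>?I. cond_pr M (F t) (joint t {j} B) \<omega>)"
  proof eventually_elim
    case (elim \<omega>)
    have "(\<Prod>j\<in>?I. cond_pr M (F t) (joint t {j} B') \<omega>) = (\<Prod>j\<in>?I. cond_pr M (F t) (joint t {\<pi> j} B') \<omega>)"
      using prod.permute[OF \<pi>, of "\<lambda>j. cond_pr M (F t) (joint t {j} B') \<omega>"] by simp
    also have "\<dots> = (\<Prod>j\<in>?I. cond_pr M (F t) (joint t {j} B) \<omega>)" using elim by (intro prod.cong) auto
    finally show ?case by simp
  qed
  then have "(\<integral>\<omega>. indicator C \<omega> * (\<Prod>j\<in>?I. cond_pr M (F t) (joint t {j} B') \<omega>) \<partial>M)
      = (\<integral>\<omega>. indicator C \<omega> * (\<Prod>j\<in>?I. cond_pr M (F t) (joint t {j} B) \<omega>) \<partial>M)"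
    by (intro integral_cong_AE) (use CM in \<open>auto simp: cond_pr_def intro!: borel_measurable_prod\<close>)
  then show ?thesis unfolding set_eq using p[of B'] p[of B] B' B by auto
qed

text \<open>Restricting \<open>M\<close> to the event \<open>C\<close> by a density gives finite
  measures on the product space, which are determined by their values on rectangles.\<close>

lemma Yv_law_permute:
  assumes t: "1 \<le> t" and \<pi>: "\<pi> permutes {..<N t}" and C: "C \<in> sets (F t)" and E: "E \<in> sets (VN t)"
  shows "emeasure M (C \<inter> (Yv t \<pi> -` E \<inter> space M)) = emeasure M (C \<inter> (Yv t id -` E \<inter> space M))"
proof -
  have CM: "C \<in> sets M" by (rule F_sets_M[OF C])
  define Q where "Q \<sigma> = distr (density M (indicator C)) (VN t) (Yv t \<sigma>)" for \<sigma>
  have Q: "emeasure (Q \<sigma>) D = emeasure M (C \<inter> (Yv t \<sigma> -` D \<inter> space M))"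
    if \<sigma>: "\<sigma> permutes {..<N t}" and D: "D \<in> sets (VN t)" for \<sigma> D
  proof -
    have "emeasure (Q \<sigma>) D = emeasure (density M (indicator C)) (Yv t \<sigma> -` D \<inter> space M)"
      unfolding Q_def using emeasure_distr[of "Yv t \<sigma>" "density M (indicator C)" "VN t" D] Yv_measurable[OF t \<sigma>] D
      by (simp only: measurable_density_eq1 space_density)
    also have "\<dots> = (\<integral>\<^sup>+\<omega>. indicator C \<omega> * indicator (Yv t \<sigma> -` D \<inter> space M) \<omega> \<partial>M)"
      by (intro emeasure_density borel_measurable_indicator CM measurable_sets[OF Yv_measurable[OF t \<sigma>] D])
    also have "\<dots> = (\<integral>\<^sup>+\<omega>. indicator (C \<inter> (Yv t \<sigma> -` D \<inter> space M)) \<omega> \<partial>M)"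
      by (intro nn_integral_cong) (auto split: split_indicator)
    also have "\<dots> = emeasure M (C \<inter> (Yv t \<sigma> -` D \<inter> space M))"
      using CM measurable_sets[OF Yv_measurable[OF t \<sigma>] D] by (intro nn_integral_indicator) auto
    finally show ?thesis .
  qed
  have "Q \<pi> = Q id"
  proof (rule measure_eqI_PiM_finite[where I = "{..<N t}" and M = "\<lambda>_. V"])
    fix A :: "nat \<Rightarrow> (nat \<Rightarrow> real) set" assume "\<And>i. i \<in> {..<N t} \<Longrightarrow> A i \<in> sets V"
    then have A: "\<And>j. j < N t \<Longrightarrow> A j \<in> sets V" by auto
    have PiE: "Pi\<^sub>E {..<N t} A \<in> sets (VN t)" using A by (intro sets_PiM_I_finite) auto
    have pre: "Yv t \<sigma> -` (Pi\<^sub>E {..<N t} A) \<inter> space M = {\<omega>\<in>space M. \<forall>k<N t. Y t (\<sigma> k) \<omega> \<in> A k}" for \<sigma>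
      by (rule set_eqI) (simp only: Yv_def vimage_eq Int_iff mem_Collect_eq restrict_PiE_iff Ball_def lessThan_iff conj_commute)
    have "prob (C \<inter> {\<omega>\<in>space M. \<forall>k<N t. Y t (\<pi> k) \<omega> \<in> A k}) = prob (C \<inter> {\<omega>\<in>space M. \<forall>k<N t. Y t (id k) \<omega> \<in> A k})"
      using joint_prob_permute[OF t \<pi> C A] by (simp only: joint_def id_apply lessThan_iff Ball_def)
    then show "emeasure (Q \<pi>) (Pi\<^sub>E {..<N t} A) = emeasure (Q id) (Pi\<^sub>E {..<N t} A)"
      unfolding Q[OF \<pi> PiE] Q[OF permutes_id PiE] pre emeasure_eq_measure by simp
  next
    have "Pi\<^sub>E {..<N t} (\<lambda>_. space V) \<in> prod_algebra {..<N t} (\<lambda>_. V)"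
      by (intro prod_algebraI_finite ballI sets.top) simp
    then show "range (\<lambda>i::nat. Pi\<^sub>E {..<N t} (\<lambda>_. space V)) \<subseteq> prod_algebra {..<N t} (\<lambda>_. V)"
      by blast
    have sp: "Pi\<^sub>E {..<N t} (\<lambda>_. space V) = space (VN t)" by (rule space_PiM[symmetric])
    show "(\<Union>i::nat. Pi\<^sub>E {..<N t} (\<lambda>_. space V)) = space (VN t)" unfolding sp by blast
    show "emeasure (Q \<pi>) (Pi\<^sub>E {..<N t} (\<lambda>_. space V)) \<noteq> \<infinity>" for i :: nat
      unfolding sp Q[OF \<pi> sets.top] by (simp only: emeasure_eq_measure infinity_ennreal_def ennreal_neq_top not_False_eq_True)
  qed (simp_all only: Q_def sets_distr finite_lessThan)
  then show ?thesis using Q[OF \<pi> E] Q[OF permutes_id E] by simp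
qed

text \<open>\<open>F t\<close> is a sigma-algebra on the same space, so the identity into
  \<open>F t\<close> is the random element that records the whole past.\<close>

lemma ident_measurable_F: "(\<lambda>\<omega>. \<omega>) \<in> M \<rightarrow>\<^sub>M F t"
  using F_sets_M by (intro measurableI) (auto intro: sets.Int)

lemma pair_measurable:
  assumes "1 \<le> t" "\<pi> permutes {..<N t}"
  shows "(\<lambda>\<omega>. (\<omega>, Yv t \<pi> \<omega>)) \<in> M \<rightarrow>\<^sub>M F t \<Otimes>\<^sub>M VN t"
  by (intro measurable_Pair ident_measurable_F Yv_measurable assms)

text \<open>Keeping \<open>\<omega>\<close> itself as the first component, seen through
  \<open>F t\<close>, permits functionals with random weights such as \<open>gam\<close> as long as
  they belong to the past.\<close>

lemma exchangeable:
  assumes t: "1 \<le> t" and \<pi>: "\<pi> permutes {..<N t}"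
  shows "distr M (F t \<Otimes>\<^sub>M VN t) (\<lambda>\<omega>. (\<omega>, Yv t \<pi> \<omega>)) = distr M (F t \<Otimes>\<^sub>M VN t) (\<lambda>\<omega>. (\<omega>, Yv t id \<omega>))"
    (is "?L = ?R")
proof (rule measure_eqI_generator_eq[OF Int_stable_pair_measure_generator[of "F t" "VN t"]])
  let ?E = "{a \<times> b |a b. a \<in> sets (F t) \<and> b \<in> sets (VN t)}"
  let ?P = "F t \<Otimes>\<^sub>M VN t"
  show "?E \<subseteq> Pow (space ?P)"
    using sets.space_closed[of "F t"] sets.space_closed[of "VN t"] by (auto simp: space_pair_measure)
  show "sets ?L = sigma_sets (space ?P) ?E" by (simp add: sets_pair_measure space_pair_measure)
  show "sets ?R = sigma_sets (space ?P) ?E" by (simp add: sets_pair_measure space_pair_measure)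
  show "range (\<lambda>i::nat. space (F t) \<times> space (VN t)) \<subseteq> ?E" using sets.top by blast
  show "(\<Union>i::nat. space (F t) \<times> space (VN t)) = space ?P" by (simp add: space_pair_measure)
  show "emeasure ?L (space (F t) \<times> space (VN t)) \<noteq> \<infinity>" for i :: nat
    using finite_measure.emeasure_finite[OF prob_space.finite_measure[OF prob_space_distr[OF pair_measurable[OF t \<pi>]]]]
    by simp
  fix X assume "X \<in> ?E"
  then obtain C D where X: "X = C \<times> D" and C: "C \<in> sets (F t)" and D: "D \<in> sets (VN t)" by auto
  have e: "emeasure (distr M ?P (\<lambda>\<omega>. (\<omega>, Yv t \<sigma> \<omega>))) X = emeasure M (C \<inter> (Yv t \<sigma> -` D \<inter> space M))"
    if "\<sigma> permutes {..<N t}" for \<sigma>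
  proof -
    have "emeasure (distr M ?P (\<lambda>\<omega>. (\<omega>, Yv t \<sigma> \<omega>))) X = emeasure M ((\<lambda>\<omega>. (\<omega>, Yv t \<sigma> \<omega>)) -` X \<inter> space M)"
      using pair_measurable[OF t that] C D by (intro emeasure_distr) (auto simp: X)
    also have "(\<lambda>\<omega>. (\<omega>, Yv t \<sigma> \<omega>)) -` X \<inter> space M = C \<inter> (Yv t \<sigma> -` D \<inter> space M)"
      by (auto simp: X)
    finally show ?thesis .
  qed
  show "emeasure ?L X = emeasure ?R X"
    unfolding e[OF \<pi>] e[OF permutes_id] by (rule Yv_law_permute[OF t \<pi> C D])
qed

lemma exchangeable_integral:
  assumes t: "1 \<le> t" and \<pi>: "\<pi> permutes {..<N t}"
    and \<Phi>: "(\<lambda>(\<omega>, y). \<Phi> \<omega> y) \<in> borel_measurable (F t \<Otimes>\<^sub>M VN t)"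
  shows "(\<integral>\<omega>. \<Phi> \<omega> (Yv t \<pi> \<omega>) \<partial>M) = (\<integral>\<omega>. \<Phi> \<omega> (Yv t id \<omega>) \<partial>M :: real)"
    and "integrable M (\<lambda>\<omega>. \<Phi> \<omega> (Yv t \<pi> \<omega>)) \<longleftrightarrow> integrable M (\<lambda>\<omega>. \<Phi> \<omega> (Yv t id \<omega>) :: real)"
  using integral_distr[OF pair_measurable[OF t \<pi>] \<Phi>] integral_distr[OF pair_measurable[OF t permutes_id] \<Phi>]
    integrable_distr_eq[OF pair_measurable[OF t \<pi>] \<Phi>] integrable_distr_eq[OF pair_measurable[OF t permutes_id] \<Phi>]
  by (simp_all add: exchangeable[OF t \<pi>])

end

section \<open>Symmetrization\<close>

lemma op_norm_le_sum_abs: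
  assumes "0 < n"
  shows "op_norm n A \<le> (\<Sum>i<n. \<Sum>j<n. \<bar>A i j\<bar>)"
proof -
  have "op_norm n A \<le> L2_set (\<lambda>(i, j). A i j) ({..<n} \<times> {..<n})"
    using op_norm_le_frob[OF assms, of A] by (simp add: L2_set_def sum.cartesian_product case_prod_unfold)
  also have "\<dots> \<le> (\<Sum>(i, j)\<in>{..<n} \<times> {..<n}. \<bar>A i j\<bar>)"
    using L2_set_le_sum_abs[of "\<lambda>(i, j). A i j" "{..<n} \<times> {..<n}"] by (simp add: case_prod_unfold)
  finally show ?thesis by (simp add: sum.cartesian_product)
qed

lemma op_norm_integrable:
  assumes "0 < n" "\<And>i j. i < n \<Longrightarrow> j < n \<Longrightarrow> integrable M (\<lambda>\<omega>. A \<omega> i j)"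
  shows "integrable M (\<lambda>\<omega>. op_norm n (A \<omega>))"
proof (rule Bochner_Integration.integrable_bound[where f = "\<lambda>\<omega>. \<Sum>i<n. \<Sum>j<n. \<bar>A \<omega> i j\<bar>"])
  show "integrable M (\<lambda>\<omega>. \<Sum>i<n. \<Sum>j<n. \<bar>A \<omega> i j\<bar>)"
    by (intro Bochner_Integration.integrable_sum integrable_abs assms(2)) auto
  show "(\<lambda>\<omega>. op_norm n (A \<omega>)) \<in> borel_measurable M"
    by (intro op_norm_measurable assms(1) borel_measurable_integrable assms(2))
  show "AE \<omega> in M. norm (op_norm n (A \<omega>)) \<le> norm (\<Sum>i<n. \<Sum>j<n. \<bar>A \<omega> i j\<bar>)"
    using op_norm_le_sum_abs[OF assms(1)] op_norm_nonneg[OF assms(1)] by (auto intro: order_trans[OF _ abs_ge_self])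
qed

lemma op_norm_sq_integrable:
  assumes "0 < n" "\<And>i j. i < n \<Longrightarrow> j < n \<Longrightarrow> (\<lambda>\<omega>. A \<omega> i j) \<in> borel_measurable M"
    "\<And>i j. i < n \<Longrightarrow> j < n \<Longrightarrow> integrable M (\<lambda>\<omega>. (A \<omega> i j)\<^sup>2)"
  shows "integrable M (\<lambda>\<omega>. (op_norm n (A \<omega>))\<^sup>2)"
proof (rule Bochner_Integration.integrable_bound[where f = "\<lambda>\<omega>. \<Sum>i<n. \<Sum>j<n. (A \<omega> i j)\<^sup>2"])
  show "integrable M (\<lambda>\<omega>. \<Sum>i<n. \<Sum>j<n. (A \<omega> i j)\<^sup>2)"
    by (intro Bochner_Integration.integrable_sum assms(3)) auto
  show "(\<lambda>\<omega>. (op_norm n (A \<omega>))\<^sup>2) \<in> borel_measurable M"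
    by (intro borel_measurable_power op_norm_measurable assms(1,2))
  show "AE \<omega> in M. norm ((op_norm n (A \<omega>))\<^sup>2) \<le> norm (\<Sum>i<n. \<Sum>j<n. (A \<omega> i j)\<^sup>2)"
    using op_norm_sq_le_frob[OF assms(1)] by (auto simp: sum_nonneg)
qed

text \<open>\<open>B\<close> is known given \<open>G\<close>, so each bilinear form of
  \<open>B\<close> is that of the conditional mean of \<open>B - \<xi>\<close> plus a form at most
  \<open>r\<close>. The exceptional null set depends on the two vectors, hence the passage to
  countably many. In the applications the second half of the batch plays the role of
  \<open>\<xi>\<close>.\<close>

lemma (in prob_space) jensen_op_norm:
  assumes G: "subalgebra M G" and n: "0 < n"
    and B: "\<And>i j. i < n \<Longrightarrow> j < n \<Longrightarrow> (\<lambda>\<omega>. B \<omega> i j) \<in> borel_measurable G"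
      "\<And>i j. i < n \<Longrightarrow> j < n \<Longrightarrow> integrable M (\<lambda>\<omega>. B \<omega> i j)"
    and \<xi>: "\<And>i j. i < n \<Longrightarrow> j < n \<Longrightarrow> integrable M (\<lambda>\<omega>. \<xi> \<omega> i j)"
    and le: "\<And>u v. AE \<omega> in M. real_cond_exp M G (\<lambda>\<omega>. bil n (\<xi> \<omega>) u v) \<omega> \<le> r \<omega> * L2_set u {..<n} * L2_set v {..<n}"
  shows "AE \<omega> in M. op_norm n (B \<omega>) \<le> r \<omega> + real_cond_exp M G (\<lambda>\<omega>. op_norm n (\<lambda>i j. B \<omega> i j - \<xi> \<omega> i j)) \<omega>"
proof -
  interpret Gs: sigma_finite_subalgebra M G by (rule sigma_finite_subalgebraI[OF G])
  define D where "D \<omega> = op_norm n (\<lambda>i j. B \<omega> i j - \<xi> \<omega> i j)" for \<omega>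
  have D: "integrable M D" unfolding D_def
    by (intro op_norm_integrable n Bochner_Integration.integrable_diff B \<xi>)
  have "AE \<omega> in M. bil n (B \<omega>) u v \<le> (r \<omega> + real_cond_exp M G D \<omega>) * L2_set u {..<n} * L2_set v {..<n}" for u v
  proof -
    let ?c = "L2_set u {..<n} * L2_set v {..<n}"
    have Bi: "integrable M (\<lambda>\<omega>. bil n (B \<omega>) u v)" unfolding bil_def
      by (intro Bochner_Integration.integrable_sum integrable_mult_left B) auto
    have Bm: "(\<lambda>\<omega>. bil n (B \<omega>) u v) \<in> borel_measurable G" unfolding bil_def
      by (intro borel_measurable_sum borel_measurable_times B) auto
    have xi: "integrable M (\<lambda>\<omega>. bil n (\<xi> \<omega>) u v)" unfolding bil_def
      by (intro Bochner_Integration.integrable_sum integrable_mult_left \<xi>) auto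
    have cD: "integrable M (\<lambda>\<omega>. ?c * D \<omega>)" using D by simp
    have pw: "bil n (B \<omega>) u v \<le> ?c * D \<omega> + bil n (\<xi> \<omega>) u v" for \<omega>
      using bil_le_op_norm[of n "\<lambda>i j. B \<omega> i j - \<xi> \<omega> i j" u v] unfolding bil_diff D_def by (simp add: mult_ac)
    have "AE \<omega> in M. real_cond_exp M G (\<lambda>\<omega>. bil n (B \<omega>) u v) \<omega> \<le> real_cond_exp M G (\<lambda>\<omega>. ?c * D \<omega> + bil n (\<xi> \<omega>) u v) \<omega>"
      by (intro Gs.real_cond_exp_mono Bi Bochner_Integration.integrable_add cD xi AE_I2 pw)
    moreover have "AE \<omega> in M. real_cond_exp M G (\<lambda>\<omega>. bil n (B \<omega>) u v) \<omega> = bil n (B \<omega>) u v"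
      by (rule Gs.real_cond_exp_F_meas[OF Bi Bm])
    moreover have "AE \<omega> in M. real_cond_exp M G (\<lambda>\<omega>. ?c * D \<omega> + bil n (\<xi> \<omega>) u v) \<omega>
        = real_cond_exp M G (\<lambda>\<omega>. ?c * D \<omega>) \<omega> + real_cond_exp M G (\<lambda>\<omega>. bil n (\<xi> \<omega>) u v) \<omega>"
      by (rule Gs.real_cond_exp_add[OF cD xi])
    moreover have "AE \<omega> in M. real_cond_exp M G (\<lambda>\<omega>. ?c * D \<omega>) \<omega> = ?c * real_cond_exp M G D \<omega>"
      by (rule Gs.real_cond_exp_cmult[OF D])
    ultimately show ?thesis using le[of u v]
      by eventually_elim (simp add: ring_distribs mult_ac)
  qed
  then have "AE \<omega> in M. \<forall>xs ys. bil n (B \<omega>) (rvec xs) (rvec ys)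
      \<le> (r \<omega> + real_cond_exp M G D \<omega>) * L2_set (rvec xs) {..<n} * L2_set (rvec ys) {..<n}"
    by (simp add: AE_all_countable)
  then show ?thesis
  proof eventually_elim
    case (elim \<omega>)
    then have "op_norm n (B \<omega>) \<le> r \<omega> + real_cond_exp M G D \<omega>" by (intro op_norm_leI_rvec n) auto
    then show ?case by (simp add: D_def[abs_def])
  qed
qed

text \<open>Exchanges \<open>k\<close> and \<open>h + k\<close> for \<open>k\<close> in
  \<open>E\<close> and fixes everything else, including the unpaired last sample of an odd
  batch.\<close>

definition swap_half :: "nat \<Rightarrow> nat set \<Rightarrow> nat \<Rightarrow> nat" where
  "swap_half h E k = (if k < h \<and> k \<in> E then h + k else if h \<le> k \<and> k < 2 * h \<and> k - h \<in> E then k - h else k)"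

lemma swap_half_permutes:
  assumes "2 * h \<le> m"
  shows "swap_half h E permutes {..<m}"
proof -
  have invol: "swap_half h E (swap_half h E k) = k" for k
    by (auto simp: swap_half_def)
  show ?thesis
  proof (rule bij_imp_permutes)
    show "bij_betw (swap_half h E) {..<m} {..<m}"
      by (rule bij_betw_byWitness[where f' = "swap_half h E"]) (use assms in \<open>(auto simp: invol)[2]\<close>, use assms in \<open>auto simp: swap_half_def\<close>)
    show "swap_half h E k = k" if "k \<notin> {..<m}" for k
      using that assms by (auto simp: swap_half_def)
  qed
qed

context cmcar_sg
begin

abbreviation "half t \<equiv> N t div 2"

definition hdiff :: "nat \<Rightarrow> ('w \<Rightarrow> (nat \<Rightarrow> real) \<Rightarrow> rmat) \<Rightarrow> 'w \<Rightarrow> (nat \<Rightarrow> nat \<Rightarrow> real) \<Rightarrow> rmat" where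
  "hdiff t T \<omega> y = (\<lambda>i j. \<Sum>k<half t. T \<omega> (y k) i j - T \<omega> (y (half t + k)) i j)"

lemma component_pair_measurable:
  assumes "(\<lambda>(\<omega>, y). T \<omega> y i j) \<in> borel_measurable (F t \<Otimes>\<^sub>M V)" "k < N t"
  shows "(\<lambda>(\<omega>, y). T \<omega> (y k) i j :: real) \<in> borel_measurable (F t \<Otimes>\<^sub>M VN t)"
proof -
  have "(\<lambda>z. (fst z, snd z k)) \<in> F t \<Otimes>\<^sub>M VN t \<rightarrow>\<^sub>M F t \<Otimes>\<^sub>M V"
    using assms(2) by (intro measurable_Pair measurable_fst measurable_compose[OF measurable_snd measurable_component_singleton]) auto
  from measurable_compose[OF this assms(1)] show ?thesis by (simp add: case_prod_unfold)
qed

lemma Yv_id: "k < N t \<Longrightarrow> Yv t id \<omega> k = Y t k \<omega>"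
  by (simp add: Yv_def)

text \<open>Exchanging the partners \<open>k\<close> and \<open>half t + k\<close> negates the
  \<open>k\<close>-th difference: the permutation acts as a sign vector.\<close>

lemma hdiff_swap:
  assumes "E \<subseteq> {..<half t}"
  shows "hdiff t T \<omega> (Yv t (swap_half (half t) E) \<omega>)
    = (\<lambda>i j. \<Sum>k<half t. flip E k * (T \<omega> (Y t k \<omega>) i j - T \<omega> (Y t (half t + k) \<omega>) i j))"
proof -
  have "T \<omega> (Yv t (swap_half (half t) E) \<omega> k) i j - T \<omega> (Yv t (swap_half (half t) E) \<omega> (half t + k)) i j
     = flip E k * (T \<omega> (Y t k \<omega>) i j - T \<omega> (Y t (half t + k) \<omega>) i j)" if "k < half t" for k i j
  proof -
    have "k < N t" "half t + k < N t" using that by auto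
    then show ?thesis using that by (auto simp: Yv_def swap_half_def flip_def)
  qed
  then show ?thesis unfolding hdiff_def by (intro ext sum.cong) auto
qed

lemma hdiff_measurable:
  assumes T: "\<And>i j. i < n \<Longrightarrow> j < n \<Longrightarrow> (\<lambda>(\<omega>, y). T \<omega> y i j) \<in> borel_measurable (F t \<Otimes>\<^sub>M V)"
  shows "(\<lambda>(\<omega>, y). op_norm n (hdiff t T \<omega> y)) \<in> borel_measurable (F t \<Otimes>\<^sub>M VN t)"
proof -
  have m: "(\<lambda>z. T (fst z) (snd z k) i j) \<in> borel_measurable (F t \<Otimes>\<^sub>M VN t)" if "k < N t" "i < n" "j < n" for k i j
    using component_pair_measurable[where T = T and i = i and j = j and k = k, OF T[OF that(2,3)] that(1)] by (simp add: case_prod_unfold)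
  show ?thesis unfolding case_prod_unfold hdiff_def
    by (intro op_norm_measurable n_pos borel_measurable_sum borel_measurable_diff m) auto
qed

text \<open>By exchangeability all the swaps give the same integral, so the integral equals its
  average over the \<open>2 ^ half t\<close> sign patterns; the bound is then needed only for the
  average at a fixed \<open>\<omega>\<close>.\<close>

lemma symmetrize:
  assumes t: "1 \<le> t"
    and T: "\<And>i j. i < n \<Longrightarrow> j < n \<Longrightarrow> (\<lambda>(\<omega>, y). T \<omega> y i j) \<in> borel_measurable (F t \<Otimes>\<^sub>M V)"
    and p: "p \<le> 2"
    and int: "integrable M (\<lambda>\<omega>. (op_norm n (hdiff t T \<omega> (Yv t id \<omega>))) ^ p)"
    and d: "integrable M d"
    and le: "AE \<omega> in M. (\<Sum>E\<in>Pow {..<half t}. (op_norm n (\<lambda>i j. \<Sum>k<half t. flip E k * (T \<omega> (Y t k \<omega>) i j - T \<omega> (Y t (half t + k) \<omega>) i j))) ^ p)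
       \<le> 2 ^ half t * d \<omega>"
  shows "(\<integral>\<omega>. (op_norm n (hdiff t T \<omega> (Yv t id \<omega>))) ^ p \<partial>M) \<le> (\<integral>\<omega>. d \<omega> \<partial>M)"
proof -
  define \<Phi> where "\<Phi> \<omega> y = (op_norm n (hdiff t T \<omega> y)) ^ p" for \<omega> y
  have \<Phi>m: "(\<lambda>(\<omega>, y). \<Phi> \<omega> y) \<in> borel_measurable (F t \<Otimes>\<^sub>M VN t)"
    unfolding \<Phi>_def case_prod_unfold using hdiff_measurable[OF T] by (intro borel_measurable_power) (auto simp: case_prod_unfold)
  let ?\<pi> = "swap_half (half t)"
  have \<pi>: "?\<pi> E permutes {..<N t}" for E by (rule swap_half_permutes) auto
  have inti: "integrable M (\<lambda>\<omega>. \<Phi> \<omega> (Yv t (?\<pi> E) \<omega>))" for E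
    using exchangeable_integral(2)[OF t \<pi> \<Phi>m] int by (simp add: \<Phi>_def)
  have "2 ^ half t * (\<integral>\<omega>. \<Phi> \<omega> (Yv t id \<omega>) \<partial>M) = (\<Sum>E\<in>Pow {..<half t}. \<integral>\<omega>. \<Phi> \<omega> (Yv t id \<omega>) \<partial>M)"
    by (simp add: card_Pow)
  also have "\<dots> = (\<Sum>E\<in>Pow {..<half t}. \<integral>\<omega>. \<Phi> \<omega> (Yv t (?\<pi> E) \<omega>) \<partial>M)"
    by (intro sum.cong refl exchangeable_integral(1)[symmetric] t \<pi> \<Phi>m)
  also have "\<dots> = (\<integral>\<omega>. (\<Sum>E\<in>Pow {..<half t}. \<Phi> \<omega> (Yv t (?\<pi> E) \<omega>)) \<partial>M)"
    by (intro Bochner_Integration.integral_sum[symmetric] inti)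
  also have "\<dots> \<le> (\<integral>\<omega>. 2 ^ half t * d \<omega> \<partial>M)"
  proof (rule integral_mono_AE)
    show "integrable M (\<lambda>\<omega>. \<Sum>E\<in>Pow {..<half t}. \<Phi> \<omega> (Yv t (?\<pi> E) \<omega>))" by (intro Bochner_Integration.integrable_sum inti)
    show "integrable M (\<lambda>\<omega>. 2 ^ half t * d \<omega>)" using d by simp
    show "AE \<omega> in M. (\<Sum>E\<in>Pow {..<half t}. \<Phi> \<omega> (Yv t (?\<pi> E) \<omega>)) \<le> 2 ^ half t * d \<omega>"
      using le
    proof eventually_elim
      case (elim \<omega>)
      have "(\<Sum>E\<in>Pow {..<half t}. \<Phi> \<omega> (Yv t (?\<pi> E) \<omega>)) = (\<Sum>E\<in>Pow {..<half t}. (op_norm n (\<lambda>i j. \<Sum>k<half t. flip E k * (T \<omega> (Y t k \<omega>) i j - T \<omega> (Y t (half t + k) \<omega>) i j))) ^ p)"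
        unfolding \<Phi>_def by (intro sum.cong refl) (simp add: hdiff_swap)
      with elim show ?case by simp
    qed
  qed
  finally show ?thesis by (simp add: \<Phi>_def)
qed

lemma symmetrized_second_moment:
  assumes t: "1 \<le> t"
    and T: "\<And>i j. i < n \<Longrightarrow> j < n \<Longrightarrow> (\<lambda>(\<omega>, y). T \<omega> y i j) \<in> borel_measurable (F t \<Otimes>\<^sub>M V)"
    and Ts: "\<And>\<omega> y. symm n (T \<omega> y)"
    and int: "integrable M (\<lambda>\<omega>. (op_norm n (hdiff t T \<omega> (Yv t id \<omega>)))\<^sup>2)"
    and c: "integrable M c"
    and le: "AE \<omega> in M. \<forall>u. L2_set u {..<n} = 1 \<longrightarrow>
       (\<Sum>k<half t. (L2_set (mv n (\<lambda>i j. T \<omega> (Y t k \<omega>) i j - T \<omega> (Y t (half t + k) \<omega>) i j) u) {..<n})\<^sup>2) \<le> c \<omega>"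
  shows "(\<integral>\<omega>. (op_norm n (hdiff t T \<omega> (Yv t id \<omega>)))\<^sup>2 \<partial>M) \<le> 48 * ln (real n) * (\<integral>\<omega>. c \<omega> \<partial>M)"
proof -
  have "(\<integral>\<omega>. (op_norm n (hdiff t T \<omega> (Yv t id \<omega>)))\<^sup>2 \<partial>M) \<le> (\<integral>\<omega>. 48 * ln (real n) * c \<omega> \<partial>M)"
  proof (rule symmetrize[OF t T _ int])
    show "AE \<omega> in M. (\<Sum>E\<in>Pow {..<half t}. (op_norm n (\<lambda>i j. \<Sum>k<half t. flip E k * (T \<omega> (Y t k \<omega>) i j - T \<omega> (Y t (half t + k) \<omega>) i j)))\<^sup>2)
       \<le> 2 ^ half t * (48 * ln (real n) * c \<omega>)"
      using le
    proof eventually_elim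
      case (elim \<omega>)
      have s: "symm n (\<lambda>i j. T \<omega> (Y t k \<omega>) i j - T \<omega> (Y t (half t + k) \<omega>) i j)" for k
        using Ts by (simp add: symm_def)
      show ?case
        using matrix_khintchine[OF n3, where I = "{..<half t}" and A = "\<lambda>k i j. T \<omega> (Y t k \<omega>) i j - T \<omega> (Y t (half t + k) \<omega>) i j" and c = "c \<omega>"]
          s elim by simp
    qed
  qed (use c in auto)
  then show ?thesis by simp
qed

text \<open>Khintchine bounds the mean square over the signs, and Cauchy-Schwarz passes to the mean.
  Its root is dominated by an integrable \<open>d\<close>, which allows a product of random
  variables inside \<open>c\<close> to be split linearly.\<close>

lemma symmetrized_first_moment:
  assumes t: "1 \<le> t"
    and T: "\<And>i j. i < n \<Longrightarrow> j < n \<Longrightarrow> (\<lambda>(\<omega>, y). T \<omega> y i j) \<in> borel_measurable (F t \<Otimes>\<^sub>M V)"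
    and Ts: "\<And>\<omega> y. symm n (T \<omega> y)"
    and int: "integrable M (\<lambda>\<omega>. op_norm n (hdiff t T \<omega> (Yv t id \<omega>)))"
    and d: "integrable M d"
    and le: "AE \<omega> in M. 0 \<le> d \<omega> \<and> (\<exists>c. 48 * ln (real n) * c \<le> (d \<omega>)\<^sup>2 \<and> (\<forall>u. L2_set u {..<n} = 1 \<longrightarrow>
       (\<Sum>k<half t. (L2_set (mv n (\<lambda>i j. T \<omega> (Y t k \<omega>) i j - T \<omega> (Y t (half t + k) \<omega>) i j) u) {..<n})\<^sup>2) \<le> c))"
  shows "(\<integral>\<omega>. op_norm n (hdiff t T \<omega> (Yv t id \<omega>)) \<partial>M) \<le> (\<integral>\<omega>. d \<omega> \<partial>M)"
proof -
  have "(\<integral>\<omega>. (op_norm n (hdiff t T \<omega> (Yv t id \<omega>))) ^ 1 \<partial>M) \<le> (\<integral>\<omega>. d \<omega> \<partial>M)"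
  proof (rule symmetrize[OF t T])
    show "AE \<omega> in M. (\<Sum>E\<in>Pow {..<half t}. (op_norm n (\<lambda>i j. \<Sum>k<half t. flip E k * (T \<omega> (Y t k \<omega>) i j - T \<omega> (Y t (half t + k) \<omega>) i j))) ^ 1)
       \<le> 2 ^ half t * d \<omega>"
      using le
    proof eventually_elim
      case (elim \<omega>)
      then obtain c where d0: "0 \<le> d \<omega>" and c: "48 * ln (real n) * c \<le> (d \<omega>)\<^sup>2"
        and cu: "\<And>u. L2_set u {..<n} = 1 \<Longrightarrow> (\<Sum>k<half t. (L2_set (mv n (\<lambda>i j. T \<omega> (Y t k \<omega>) i j - T \<omega> (Y t (half t + k) \<omega>) i j) u) {..<n})\<^sup>2) \<le> c"
        by blast
      let ?o = "\<lambda>E. op_norm n (\<lambda>i j. \<Sum>k<half t. flip E k * (T \<omega> (Y t k \<omega>) i j - T \<omega> (Y t (half t + k) \<omega>) i j))"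
      have s: "symm n (\<lambda>i j. T \<omega> (Y t k \<omega>) i j - T \<omega> (Y t (half t + k) \<omega>) i j)" for k
        using Ts by (simp add: symm_def)
      have "(\<Sum>E\<in>Pow {..<half t}. (?o E)\<^sup>2) \<le> 2 ^ half t * (48 * ln (real n) * c)"
        using matrix_khintchine[OF n3, where I = "{..<half t}" and A = "\<lambda>k i j. T \<omega> (Y t k \<omega>) i j - T \<omega> (Y t (half t + k) \<omega>) i j" and c = c]
          s cu by simp
      also have "\<dots> \<le> 2 ^ half t * (d \<omega>)\<^sup>2" using c by (intro mult_left_mono) auto
      finally have sq: "(\<Sum>E\<in>Pow {..<half t}. (?o E)\<^sup>2) \<le> 2 ^ half t * (d \<omega>)\<^sup>2" .
      have "(\<Sum>E\<in>Pow {..<half t}. 1 * ?o E)\<^sup>2 \<le> (\<Sum>E\<in>Pow {..<half t}. 1\<^sup>2) * (\<Sum>E\<in>Pow {..<half t}. (?o E)\<^sup>2)"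
        by (rule Cauchy_Schwarz_ineq_sum)
      also have "(\<Sum>E\<in>Pow {..<half t}. 1\<^sup>2) * (\<Sum>E\<in>Pow {..<half t}. (?o E)\<^sup>2) \<le> 2 ^ half t * (2 ^ half t * (d \<omega>)\<^sup>2)"
        using mult_left_mono[OF sq, of "2 ^ half t"] by (simp add: card_Pow)
      also have "\<dots> = (2 ^ half t * d \<omega>)\<^sup>2" by (simp add: power2_eq_square mult_ac)
      finally have "(\<Sum>E\<in>Pow {..<half t}. 1 * ?o E) \<le> 2 ^ half t * d \<omega>"
        by (rule power2_le_imp_le) (use d0 in auto)
      then show ?case by simp
    qed
  qed (use int d in auto)
  then show ?thesis by simp
qed

end

section \<open>The largest observation of a batch\<close>

text \<open>For \<open>v > 2 * l\<close> the square is at most \<open>8 * exp (v / 2)\<close>, and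
  \<open>v / 2 \<le> v - l\<close>. With \<open>l = ln N\<close> the factor \<open>exp (- l)\<close>
  is \<open>1 / N\<close>, so summing the exponentials over a batch of size \<open>N\<close> keeps a
  bounded mean while the maximum costs only \<open>l\<close> squared.\<close>

lemma sq_le_exp_bound:
  assumes "0 \<le> (v::real)" "0 \<le> l"
  shows "v\<^sup>2 \<le> 4 * l\<^sup>2 + 8 * (exp v * exp (- l))"
proof (cases "v \<le> 2 * l")
  case True
  then have "v\<^sup>2 \<le> (2 * l)\<^sup>2" using assms by (intro power_mono) auto
  then show ?thesis by (simp add: power_mult_distrib add_increasing2)
next
  case False
  have "1 + v / 2 + (v / 2)\<^sup>2 / 2 \<le> exp (v / 2)" by (rule exp_lower_Taylor_quadratic) (use assms in simp)
  then have "v\<^sup>2 / 8 \<le> exp (v / 2)" using assms by (simp add: power_divide)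
  also have "\<dots> \<le> exp (v - l)" using False by simp
  also have "\<dots> = exp v * exp (- l)" by (simp add: exp_add[symmetric])
  finally have "v\<^sup>2 \<le> 8 * (exp v * exp (- l))" by simp
  then show ?thesis by (simp add: add_increasing)
qed

context cmcar_sg
begin

definition exp_sq :: "nat \<Rightarrow> nat \<Rightarrow> 'w \<Rightarrow> nat \<Rightarrow> real" where
  "exp_sq t k \<omega> i = exp (\<bar>X t k \<omega> i\<bar>\<^sup>2 / (2 * S i i / c\<^sub>0))"

text \<open>A random majorant of the fourth power of \<open>X t k \<omega> i\<close> divided by
  \<open>S i i\<close> squared, common to all samples of the batch. The factor
  \<open>4 / c\<^sub>0\<^sup>2\<close> is the square of the scale \<open>2 / c\<^sub>0\<close> in
  \<open>exp_sq\<close>.\<close>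

definition eta :: "nat \<Rightarrow> 'w \<Rightarrow> nat \<Rightarrow> real" where
  "eta t \<omega> i = 4 / c\<^sub>0\<^sup>2 * (4 * (ln (real (N t)))\<^sup>2 + 8 / real (N t) * (\<Sum>k<N t. exp_sq t k \<omega> i))"

lemma exp_sq_moment:
  assumes t: "1 \<le> t" "k < N t" and i: "i < n"
  shows "integrable M (\<lambda>\<omega>. exp_sq t k \<omega> i)" "(\<integral>\<omega>. exp_sq t k \<omega> i \<partial>M) \<le> 2"
proof -
  define h where "h z = exp (\<bar>z i\<bar>\<^sup>2 / (2 * S i i / c\<^sub>0))" for z :: "nat \<Rightarrow> real"
  have hm: "h \<in> borel_measurable V"
  proof -
    have [measurable]: "(\<lambda>z. z i) \<in> borel_measurable V" using i by (intro measurable_component_singleton) auto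
    show ?thesis unfolding h_def by measurable
  qed
  have sq: "(\<integral>\<omega>. (x \<omega> i)\<^sup>2 \<partial>M) = S i i" by (simp add: cov_mat_def power2_eq_square)
  have "integrable M (\<lambda>\<omega>. h (x \<omega>)) \<and> (\<integral>\<omega>. h (x \<omega>) \<partial>M) \<le> 2"
  \<comment> \<open>For zero variance the quotient in \<open>h\<close> is 0 by the convention on
    division by zero, so \<open>h\<close> is constantly 1.\<close>
  proof (cases "S i i = 0")
    case False
    then have s: "0 < S i i" using S_diag_nonneg[of i] by simp
    have "ennreal c\<^sub>0 * (psi2_norm M (\<lambda>\<omega>. x \<omega> i))\<^sup>2 \<le> ennreal (S i i)"
      using sg_psi2[of "\<lambda>k. if k = i then 1 else 0"] by (simp only: inner_unit[OF i] sq)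
    from sub_gaussian_exp_moment[OF x_component_measurable[OF i] c0_pos s this]
    show ?thesis by (simp add: h_def)
  qed (simp add: h_def prob_space)
  then show "integrable M (\<lambda>\<omega>. exp_sq t k \<omega> i)" "(\<integral>\<omega>. exp_sq t k \<omega> i \<partial>M) \<le> 2"
    using X_integral_eq[OF t hm] by (simp_all add: exp_sq_def h_def)
qed

lemma eta_nonneg: "0 \<le> eta t \<omega> i"
  unfolding eta_def by (intro mult_nonneg_nonneg add_nonneg_nonneg sum_nonneg) (auto simp: exp_sq_def)

lemma eta_integrable: "1 \<le> t \<Longrightarrow> i < n \<Longrightarrow> integrable M (\<lambda>\<omega>. eta t \<omega> i)"
  unfolding eta_def
  by (intro integrable_mult_right Bochner_Integration.integrable_add Bochner_Integration.integrable_sum exp_sq_moment) auto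

lemma eta_GX: "1 \<le> t \<Longrightarrow> i < n \<Longrightarrow> (\<lambda>\<omega>. eta t \<omega> i) \<in> borel_measurable (GX t)"
proof -
  assume "1 \<le> t" "i < n"
  then have [measurable]: "k < N t \<Longrightarrow> (\<lambda>\<omega>. X t k \<omega> i) \<in> borel_measurable (GX t)" for k by (intro X_GX)
  have [measurable]: "k < N t \<Longrightarrow> (\<lambda>\<omega>. exp_sq t k \<omega> i) \<in> borel_measurable (GX t)" for k
    unfolding exp_sq_def by measurable
  show ?thesis unfolding eta_def
    by (intro borel_measurable_times borel_measurable_add borel_measurable_const borel_measurable_sum) auto
qed

definition Keta :: real where "Keta = 272 / c\<^sub>0\<^sup>2"

lemma ln_ge_half: "2 \<le> m \<Longrightarrow> 1 / 2 \<le> ln (real m)"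
proof -
  assume "2 \<le> m"
  have "exp (1 / 2 :: real) \<le> 1 + 1 / 2 + (1 / 2)\<^sup>2" by (rule exp_bound) auto
  also have "\<dots> \<le> real m" using \<open>2 \<le> m\<close> by (simp add: power2_eq_square)
  finally show ?thesis using \<open>2 \<le> m\<close> by (subst ln_ge_iff) auto
qed

lemma eta_expectation:
  assumes t: "1 \<le> t" "2 \<le> N t" and i: "i < n"
  shows "(\<integral>\<omega>. eta t \<omega> i \<partial>M) \<le> Keta * (ln (real (N t)))\<^sup>2"
proof -
  define l where "l = ln (real (N t))"
  have l: "1 / 2 \<le> l" using ln_ge_half[OF t(2)] by (simp add: l_def)
  have "(1 / 2)\<^sup>2 \<le> l\<^sup>2" by (rule power_mono[OF l]) simp
  then have l2: "1 / 4 \<le> l\<^sup>2" by (simp add: power2_eq_square)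
  have "(\<integral>\<omega>. (\<Sum>k<N t. exp_sq t k \<omega> i) \<partial>M) = (\<Sum>k<N t. \<integral>\<omega>. exp_sq t k \<omega> i \<partial>M)"
    by (intro Bochner_Integration.integral_sum exp_sq_moment) (use t i in auto)
  also have "\<dots> \<le> (\<Sum>k<N t. 2)" by (intro sum_mono exp_sq_moment) (use t i in auto)
  finally have s: "(\<integral>\<omega>. (\<Sum>k<N t. exp_sq t k \<omega> i) \<partial>M) \<le> 2 * real (N t)" by simp
  have si: "integrable M (\<lambda>\<omega>. \<Sum>k<N t. exp_sq t k \<omega> i)"
    by (intro Bochner_Integration.integrable_sum exp_sq_moment) (use t i in auto)
  have "(\<integral>\<omega>. eta t \<omega> i \<partial>M) = 4 / c\<^sub>0\<^sup>2 * (4 * l\<^sup>2 + 8 / real (N t) * (\<integral>\<omega>. (\<Sum>k<N t. exp_sq t k \<omega> i) \<partial>M))"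
    unfolding eta_def l_def[symmetric] using si by (simp add: prob_space del: Bochner_Integration.integral_sum)
  also have "\<dots> \<le> 4 / c\<^sub>0\<^sup>2 * (4 * l\<^sup>2 + 8 / real (N t) * (2 * real (N t)))"
    by (intro mult_left_mono add_left_mono s) auto
  also have "\<dots> = 4 / c\<^sub>0\<^sup>2 * (4 * l\<^sup>2 + 16)" using t by simp
  \<comment> \<open>A batch of size at least 2 has \<open>l \<ge> 1 / 2\<close>, hence
    \<open>16 \<le> 64 * l\<^sup>2\<close>; this yields \<open>4 * 68 = 272\<close> in
    \<open>Keta\<close>.\<close>
  also have "\<dots> \<le> 4 / c\<^sub>0\<^sup>2 * (68 * l\<^sup>2)" using l2 by (intro mult_left_mono) auto
  finally show ?thesis by (simp add: Keta_def l_def)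
qed

lemma X_fourth_le:
  assumes t: "1 \<le> t" "k < N t" and i: "i < n"
  shows "AE \<omega> in M. (X t k \<omega> i) ^ 4 \<le> (S i i)\<^sup>2 * eta t \<omega> i"
proof (cases "S i i = 0")
  case True
  have m: "(\<lambda>z. (z i)\<^sup>2) \<in> borel_measurable V" using i by (intro borel_measurable_power measurable_component_singleton) auto
  have "integrable M (\<lambda>\<omega>. (X t k \<omega> i)\<^sup>2)" "(\<integral>\<omega>. (X t k \<omega> i)\<^sup>2 \<partial>M) = 0"
    using X_integral_eq[OF t m] x_square_integrable[OF i] True by (simp_all add: cov_mat_def power2_eq_square)
  then have "AE \<omega> in M. (X t k \<omega> i)\<^sup>2 = 0"
    using integral_nonneg_eq_0_iff_AE[of M "\<lambda>\<omega>. (X t k \<omega> i)\<^sup>2"] by simp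
  then show ?thesis by eventually_elim (simp add: True)
next
  case False
  then have s: "0 < S i i" using S_diag_nonneg[of i] by simp
  define b where "b = 2 * S i i / c\<^sub>0"
  define l where "l = ln (real (N t))"
  have b: "0 < b" using s c0_pos by (simp add: b_def)
  have N: "0 < N t" using t by simp
  have l: "0 \<le> l" using N by (simp add: l_def)
  show ?thesis
  proof (rule AE_I2)
    fix \<omega>
    define v where "v = (X t k \<omega> i)\<^sup>2 / b"
    have v: "0 \<le> v" "(X t k \<omega> i)\<^sup>2 = b * v" using b by (auto simp: v_def)
    have "exp v = exp_sq t k \<omega> i" by (simp add: exp_sq_def v_def b_def)
    also have "\<dots> \<le> (\<Sum>k<N t. exp_sq t k \<omega> i)"
      by (rule member_le_sum) (use t in \<open>auto simp: exp_sq_def\<close>)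
    finally have e: "exp v * exp (- l) \<le> (\<Sum>k<N t. exp_sq t k \<omega> i) * exp (- l)" by (rule mult_right_mono) simp
    have el: "exp (- l) = 1 / real (N t)" using N by (simp add: l_def exp_minus inverse_eq_divide)
    have "(X t k \<omega> i) ^ 4 = ((X t k \<omega> i)\<^sup>2)\<^sup>2" by simp
    also have "\<dots> = b\<^sup>2 * v\<^sup>2" by (simp only: v(2) power_mult_distrib)
    also have "\<dots> \<le> b\<^sup>2 * (4 * l\<^sup>2 + 8 * (exp v * exp (- l)))"
      by (intro mult_left_mono sq_le_exp_bound v l) simp
    also have "\<dots> \<le> b\<^sup>2 * (4 * l\<^sup>2 + 8 * ((\<Sum>k<N t. exp_sq t k \<omega> i) * exp (- l)))"
      by (intro mult_left_mono add_left_mono e) auto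
    also have "\<dots> = (S i i)\<^sup>2 * eta t \<omega> i"
      by (simp add: eta_def l_def[symmetric] el b_def power_divide power_mult_distrib)
    finally show "(X t k \<omega> i) ^ 4 \<le> (S i i)\<^sup>2 * eta t \<omega> i" .
  qed
qed

text \<open>Almost surely \<open>R2 t = \<parallel>\<Sigma>\<parallel>\<^sup>2 r\<^sub>2(\<Sigma>, P\<^sub>t)\<^sup>2\<close>, and \<open>mu t\<close> bounds all \<open>\<parallel>y y\<^sup>T \<odot> \<Gamma>\<^sub>t\<parallel>\<^sup>2\<close> of the batch.\<close>

definition R2 :: "nat \<Rightarrow> 'w \<Rightarrow> real" where
  "R2 t \<omega> = (\<Sum>i<n. \<Sum>j<n. S i i * S j j * (gam t \<omega> i j)\<^sup>2)"

definition mu :: "nat \<Rightarrow> 'w \<Rightarrow> real" where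
  "mu t \<omega> = (\<Sum>i<n. \<Sum>j<n. S i i * S j j * ((gam t \<omega> i j)\<^sup>2 * eta t \<omega> i + (gam t \<omega> i j)\<^sup>2 * eta t \<omega> j) / 2)"

text \<open>\<open>gam\<close> belongs to the past and \<open>eta\<close> to the data of the batch,
  which are independent. For this reason \<open>eta\<close> is built from the complete data and not
  from the observations.\<close>

lemma gam_sq_eta:
  assumes t: "1 \<le> t" and ij: "i < n" "j < n" "l < n"
  shows "integrable M (\<lambda>\<omega>. (gam t \<omega> i j)\<^sup>2 * eta t \<omega> l)"
    "(\<integral>\<omega>. (gam t \<omega> i j)\<^sup>2 * eta t \<omega> l \<partial>M) = (\<integral>\<omega>. (gam t \<omega> i j)\<^sup>2 \<partial>M) * (\<integral>\<omega>. eta t \<omega> l \<partial>M)"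
proof -
  have "(\<lambda>\<omega>. (gam t \<omega> i j)\<^sup>2) \<in> borel_measurable (H t)"
    by (intro borel_measurable_power F_to_H gam_F t ij)
  moreover have "integrable M (\<lambda>\<omega>. (gam t \<omega> i j)\<^sup>2)"
    by (rule bounded_integrable[where B = "gB\<^sup>2"])
      (use t ij gam_bounds gam_abs in \<open>auto intro!: power_mono\<close>)
  ultimately show "integrable M (\<lambda>\<omega>. (gam t \<omega> i j)\<^sup>2 * eta t \<omega> l)"
    "(\<integral>\<omega>. (gam t \<omega> i j)\<^sup>2 * eta t \<omega> l \<partial>M) = (\<integral>\<omega>. (gam t \<omega> i j)\<^sup>2 \<partial>M) * (\<integral>\<omega>. eta t \<omega> l \<partial>M)"
    using indep_HX[OF t _ eta_GX[OF t ij(3)] _ eta_integrable[OF t ij(3)]] by auto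
qed

lemma gam_sq_integrable: "1 \<le> t \<Longrightarrow> i < n \<Longrightarrow> j < n \<Longrightarrow> integrable M (\<lambda>\<omega>. (gam t \<omega> i j)\<^sup>2)"
  by (rule bounded_integrable[where B = "gB\<^sup>2"]) (use gam_bounds gam_abs in \<open>auto intro!: power_mono\<close>)

lemma R2_integrable: "1 \<le> t \<Longrightarrow> integrable M (R2 t)"
  unfolding R2_def by (intro Bochner_Integration.integrable_sum integrable_mult_right gam_sq_integrable) auto

lemma R2_nonneg: "0 \<le> R2 t \<omega>"
  unfolding R2_def by (intro sum_nonneg mult_nonneg_nonneg S_diag_nonneg) auto

lemma mu_nonneg: "0 \<le> mu t \<omega>"
  unfolding mu_def
  by (intro sum_nonneg mult_nonneg_nonneg divide_nonneg_nonneg add_nonneg_nonneg S_diag_nonneg eta_nonneg) auto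

lemma mu_integrable: "1 \<le> t \<Longrightarrow> integrable M (mu t)"
  unfolding mu_def
  by (intro Bochner_Integration.integrable_sum integrable_divide integrable_mult_right
      Bochner_Integration.integrable_add gam_sq_eta) auto

lemma mu_expectation:
  assumes t: "1 \<le> t" "2 \<le> N t"
  shows "(\<integral>\<omega>. mu t \<omega> \<partial>M) \<le> Keta * (ln (real (N t)))\<^sup>2 * (\<integral>\<omega>. R2 t \<omega> \<partial>M)"
proof -
  let ?K = "Keta * (ln (real (N t)))\<^sup>2"
  have "(\<integral>\<omega>. mu t \<omega> \<partial>M) = (\<Sum>i<n. \<Sum>j<n. \<integral>\<omega>. S i i * S j j * ((gam t \<omega> i j)\<^sup>2 * eta t \<omega> i + (gam t \<omega> i j)\<^sup>2 * eta t \<omega> j) / 2 \<partial>M)"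
    unfolding mu_def
    by (subst Bochner_Integration.integral_sum, (intro Bochner_Integration.integrable_sum integrable_divide integrable_mult_right
        Bochner_Integration.integrable_add gam_sq_eta t; simp),
        intro sum.cong refl Bochner_Integration.integral_sum integrable_divide integrable_mult_right
        Bochner_Integration.integrable_add gam_sq_eta t; simp)
  also have "\<dots> \<le> (\<Sum>i<n. \<Sum>j<n. ?K * (S i i * S j j * (\<integral>\<omega>. (gam t \<omega> i j)\<^sup>2 \<partial>M)))"
  proof (intro sum_mono)
    fix i j assume "i \<in> {..<n}" "j \<in> {..<n}"
    then have ij: "i < n" "j < n" by auto
    let ?g = "\<integral>\<omega>. (gam t \<omega> i j)\<^sup>2 \<partial>M"
    have g: "0 \<le> ?g" by simp
    have ss: "0 \<le> S i i * S j j" by (simp add: S_diag_nonneg)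
    have "(\<integral>\<omega>. S i i * S j j * ((gam t \<omega> i j)\<^sup>2 * eta t \<omega> i + (gam t \<omega> i j)\<^sup>2 * eta t \<omega> j) / 2 \<partial>M)
      = S i i * S j j * (?g * (\<integral>\<omega>. eta t \<omega> i \<partial>M) + ?g * (\<integral>\<omega>. eta t \<omega> j \<partial>M)) / 2"
      using gam_sq_eta[OF t(1) ij ij(1)] gam_sq_eta[OF t(1) ij ij(2)] by simp
    also have "\<dots> \<le> S i i * S j j * (?g * ?K + ?g * ?K) / 2"
      by (intro divide_right_mono mult_left_mono add_mono eta_expectation t ij g ss) simp
    finally show "(\<integral>\<omega>. S i i * S j j * ((gam t \<omega> i j)\<^sup>2 * eta t \<omega> i + (gam t \<omega> i j)\<^sup>2 * eta t \<omega> j) / 2 \<partial>M)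
      \<le> ?K * (S i i * S j j * ?g)" by (simp add: mult_ac)
  qed
  also have "\<dots> = ?K * (\<Sum>i<n. \<Sum>j<n. \<integral>\<omega>. S i i * S j j * (gam t \<omega> i j)\<^sup>2 \<partial>M)"
    by (simp add: sum_distrib_left)
  also have "(\<Sum>i<n. \<Sum>j<n. \<integral>\<omega>. S i i * S j j * (gam t \<omega> i j)\<^sup>2 \<partial>M) = (\<integral>\<omega>. R2 t \<omega> \<partial>M)"
    unfolding R2_def
    by (subst Bochner_Integration.integral_sum, (intro Bochner_Integration.integrable_sum integrable_mult_right gam_sq_integrable t; simp),
        intro sum.cong refl Bochner_Integration.integral_sum[symmetric] integrable_mult_right gam_sq_integrable t; simp)
  finally show ?thesis .
qed

text \<open>Discarding the masks only increases the squares. The geometric mean of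
  \<open>eta\<close> at \<open>i\<close> and \<open>j\<close> is replaced by the arithmetic mean,
  which makes \<open>mu\<close> linear in \<open>eta\<close> and its expectation computable entry by
  entry.\<close>

lemma U_frob_le_mu:
  assumes t: "1 \<le> t"
  shows "AE \<omega> in M. \<forall>k\<in>{..<N t}. (\<Sum>i<n. \<Sum>j<n. (U t k \<omega> i j)\<^sup>2) \<le> mu t \<omega>"
proof (intro AE_finite_allI)
  fix k assume "k \<in> {..<N t}"
  then have k: "k < N t" by simp
  have "AE \<omega> in M. \<forall>i\<in>{..<n}. (X t k \<omega> i) ^ 4 \<le> (S i i)\<^sup>2 * eta t \<omega> i"
    by (intro AE_finite_allI X_fourth_le t k) auto
  then show "AE \<omega> in M. (\<Sum>i<n. \<Sum>j<n. (U t k \<omega> i j)\<^sup>2) \<le> mu t \<omega>"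
    using AE_space
  proof eventually_elim
    case (elim \<omega>)
    have sq: "(Y t k \<omega> i)\<^sup>2 \<le> S i i * sqrt (eta t \<omega> i)" if i: "i < n" for i
    proof -
      have "(Y t k \<omega> i)\<^sup>2 \<le> (X t k \<omega> i)\<^sup>2"
        using mask_01[OF t k elim(2) i] by (auto simp: Y_component[OF i])
      also have "\<dots> = sqrt ((X t k \<omega> i) ^ 4)" by (rule real_sqrt_unique[symmetric]) auto
      also have "\<dots> \<le> sqrt ((S i i)\<^sup>2 * eta t \<omega> i)" using elim(1) i by simp
      also have "\<dots> = S i i * sqrt (eta t \<omega> i)" using S_diag_nonneg[of i] by (simp add: real_sqrt_mult)
      finally show ?thesis .
    qed
    show ?case unfolding mu_def
    proof (intro sum_mono)
      fix i j assume "i \<in> {..<n}" "j \<in> {..<n}"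
      then have ij: "i < n" "j < n" by auto
      have "(Y t k \<omega> i)\<^sup>2 * (Y t k \<omega> j)\<^sup>2 \<le> (S i i * sqrt (eta t \<omega> i)) * (S j j * sqrt (eta t \<omega> j))"
        using S_diag_nonneg eta_nonneg by (intro mult_mono sq ij) auto
      also have "\<dots> = S i i * S j j * sqrt (eta t \<omega> i * eta t \<omega> j)" by (simp add: real_sqrt_mult)
      also have "\<dots> \<le> S i i * S j j * ((eta t \<omega> i + eta t \<omega> j) / 2)"
        by (intro mult_left_mono arith_geo_mean_sqrt eta_nonneg mult_nonneg_nonneg S_diag_nonneg)
      finally have "(Y t k \<omega> i)\<^sup>2 * (Y t k \<omega> j)\<^sup>2 * (gam t \<omega> i j)\<^sup>2 \<le> S i i * S j j * ((eta t \<omega> i + eta t \<omega> j) / 2) * (gam t \<omega> i j)\<^sup>2"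
        by (rule mult_right_mono) simp
      then show "(U t k \<omega> i j)\<^sup>2 \<le> S i i * S j j * ((gam t \<omega> i j)\<^sup>2 * eta t \<omega> i + (gam t \<omega> i j)\<^sup>2 * eta t \<omega> j) / 2"
        by (simp add: U_def power_mult_distrib algebra_simps)
    qed
  qed
qed simp

end

section \<open>Second moment of a batch\<close>

context prob_space
begin

definition sq_int :: "('a \<Rightarrow> real) \<Rightarrow> bool" where
  "sq_int f \<longleftrightarrow> f \<in> borel_measurable M \<and> integrable M (\<lambda>\<omega>. (f \<omega>)\<^sup>2)"

lemma sq_int_measurable: "sq_int f \<Longrightarrow> f \<in> borel_measurable M"
  by (simp add: sq_int_def)

lemma sq_int_mult: "sq_int f \<Longrightarrow> sq_int g \<Longrightarrow> integrable M (\<lambda>\<omega>. f \<omega> * g \<omega>)"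
proof (rule Bochner_Integration.integrable_bound[where f = "\<lambda>\<omega>. (f \<omega>)\<^sup>2 + (g \<omega>)\<^sup>2"])
  show "AE \<omega> in M. norm (f \<omega> * g \<omega>) \<le> norm ((f \<omega>)\<^sup>2 + (g \<omega>)\<^sup>2)"
    using abs_mult_le_squares by simp
qed (auto simp: sq_int_def)

lemma sq_int_const: "sq_int (\<lambda>_. c)"
  by (simp add: sq_int_def)

lemma sq_int_integrable: "sq_int f \<Longrightarrow> integrable M f"
  using sq_int_mult[OF _ sq_int_const[of 1]] by simp

lemma sq_int_add: "sq_int f \<Longrightarrow> sq_int g \<Longrightarrow> sq_int (\<lambda>\<omega>. f \<omega> + g \<omega>)"
proof -
  assume fg: "sq_int f" "sq_int g"
  have "integrable M (\<lambda>\<omega>. (f \<omega>)\<^sup>2 + 2 * (f \<omega> * g \<omega>) + (g \<omega>)\<^sup>2)"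
    using fg sq_int_mult[OF fg] by (intro Bochner_Integration.integrable_add integrable_mult_right) (auto simp: sq_int_def)
  then show ?thesis using fg by (auto simp: sq_int_def power2_sum algebra_simps)
qed

lemma sq_int_cmult: "sq_int f \<Longrightarrow> sq_int (\<lambda>\<omega>. c * f \<omega>)"
  by (auto simp: sq_int_def power_mult_distrib)

lemma sq_int_diff: "sq_int f \<Longrightarrow> sq_int g \<Longrightarrow> sq_int (\<lambda>\<omega>. f \<omega> - g \<omega>)"
  using sq_int_add[OF _ sq_int_cmult[of g "- 1"]] by simp

lemma sq_int_sum: "(\<And>i. i \<in> I \<Longrightarrow> sq_int (f i)) \<Longrightarrow> sq_int (\<lambda>\<omega>. \<Sum>i\<in>I. f i \<omega>)"
  by (induction I rule: infinite_finite_induct) (auto intro: sq_int_add sq_int_const)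

lemma sq_int_op_norm:
  assumes "0 < n" "\<And>i j. i < n \<Longrightarrow> j < n \<Longrightarrow> sq_int (\<lambda>\<omega>. A \<omega> i j)"
  shows "sq_int (\<lambda>\<omega>. op_norm n (A \<omega>))"
  using assms unfolding sq_int_def by (auto intro!: op_norm_measurable op_norm_sq_integrable)

end

context cmcar_sg
begin

definition W2 :: "nat \<Rightarrow> nat \<Rightarrow> 'w \<Rightarrow> rmat" where
  "W2 t k \<omega> i j = (\<Sum>l<n. U t k \<omega> i l * U t k \<omega> l j)"

lemma mv_W2: "mv n (W2 t k \<omega>) u = mv n (U t k \<omega>) (mv n (U t k \<omega>) u)"
proof
  fix i
  have "mv n (W2 t k \<omega>) u i = (\<Sum>j<n. \<Sum>l<n. U t k \<omega> i l * (U t k \<omega> l j * u j))"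
    by (simp add: mv_def W2_def sum_distrib_right mult.assoc)
  also have "\<dots> = (\<Sum>l<n. \<Sum>j<n. U t k \<omega> i l * (U t k \<omega> l j * u j))" by (rule sum.swap)
  finally show "mv n (W2 t k \<omega>) u i = mv n (U t k \<omega>) (mv n (U t k \<omega>) u) i"
    by (simp add: mv_def sum_distrib_left)
qed

lemma bil_W2: "bil n (W2 t k \<omega>) u v = (\<Sum>l<n. mv n (U t k \<omega>) u l * mv n (U t k \<omega>) v l)"
  unfolding bil_eq mv_W2 using mv_symm[OF U_symm] by simp

lemma U_sq_int: "1 \<le> t \<Longrightarrow> k < N t \<Longrightarrow> i < n \<Longrightarrow> j < n \<Longrightarrow> sq_int (\<lambda>\<omega>. U t k \<omega> i j)"
  using UU_integrable[of t k i j i j] by (simp add: sq_int_def power2_eq_square)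

lemma W2_integrable: "1 \<le> t \<Longrightarrow> k < N t \<Longrightarrow> i < n \<Longrightarrow> j < n \<Longrightarrow> integrable M (\<lambda>\<omega>. W2 t k \<omega> i j)"
  unfolding W2_def by (intro Bochner_Integration.integrable_sum UU_integrable) auto

text \<open>Given the past, the observations in \<open>J\<close> carry no information on the mean of \<open>f\<close>.\<close>

definition same_cond_exp :: "nat \<Rightarrow> nat set \<Rightarrow> ('w \<Rightarrow> real) \<Rightarrow> bool" where
  "same_cond_exp t J f \<longleftrightarrow> integrable M f \<and> (AE \<omega> in M. real_cond_exp M (G t J) f \<omega> = real_cond_exp M (F t) f \<omega>)"

lemma F_sigma_finite: "sigma_finite_subalgebra M (F t)"
  by (rule sigma_finite_subalgebraI[OF F_subalgebra])

lemma G_sigma_finite: "1 \<le> t \<Longrightarrow> J \<subseteq> {..<N t} \<Longrightarrow> sigma_finite_subalgebra M (G t J)"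
  by (rule sigma_finite_subalgebraI[OF G_subalgebra])

lemma same_cond_exp_add:
  assumes t: "1 \<le> t" "J \<subseteq> {..<N t}" and f: "same_cond_exp t J f" and g: "same_cond_exp t J g"
  shows "same_cond_exp t J (\<lambda>\<omega>. f \<omega> + g \<omega>)"
proof -
  have i: "integrable M f" "integrable M g" using f g by (auto simp: same_cond_exp_def)
  show ?thesis
    using sigma_finite_subalgebra.real_cond_exp_add[OF F_sigma_finite[of t] i]
      sigma_finite_subalgebra.real_cond_exp_add[OF G_sigma_finite[OF t] i] f g
    unfolding same_cond_exp_def by (auto elim!: eventually_elim2 eventually_rev_mp)
qed

lemma same_cond_exp_zero:
  assumes t: "1 \<le> t" "J \<subseteq> {..<N t}"
  shows "same_cond_exp t J (\<lambda>_. 0)"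
proof -
  have i: "integrable M (\<lambda>_. 0 :: real)" by simp
  have "AE \<omega> in M. real_cond_exp M (F t) (\<lambda>_. 0) \<omega> = 0" "AE \<omega> in M. real_cond_exp M (G t J) (\<lambda>_. 0) \<omega> = 0"
    using sigma_finite_subalgebra.real_cond_exp_F_meas[OF F_sigma_finite[of t] i]
      sigma_finite_subalgebra.real_cond_exp_F_meas[OF G_sigma_finite[OF t] i] by auto
  then show ?thesis unfolding same_cond_exp_def using i by (auto elim!: eventually_elim2)
qed

lemma same_cond_exp_sum:
  assumes t: "1 \<le> t" "J \<subseteq> {..<N t}" and f: "\<And>i. i \<in> I \<Longrightarrow> same_cond_exp t J (f i)"
  shows "same_cond_exp t J (\<lambda>\<omega>. \<Sum>i\<in>I. f i \<omega>)"
  using f by (induction I rule: infinite_finite_induct) (auto intro: same_cond_exp_add[OF t] same_cond_exp_zero[OF t])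

lemma same_cond_exp_weighted:
  assumes t: "1 \<le> t" "J \<subseteq> {..<N t}" and f: "same_cond_exp t J f"
    and a: "a \<in> borel_measurable (F t)" "\<And>\<omega>. \<bar>a \<omega>\<bar> \<le> B"
  shows "same_cond_exp t J (\<lambda>\<omega>. a \<omega> * f \<omega>)"
proof -
  have fi: "integrable M f" using f by (simp add: same_cond_exp_def)
  have aM [measurable]: "a \<in> borel_measurable M" by (rule measurable_from_subalg[OF F_subalgebra a(1)])
  have aG: "a \<in> borel_measurable (G t J)" by (rule measurable_from_subalg[OF G_F[OF t] a(1)])
  have i: "integrable M (\<lambda>\<omega>. a \<omega> * f \<omega>)"
  proof (rule Bochner_Integration.integrable_bound[where f = "\<lambda>\<omega>. B * f \<omega>"])
    show "integrable M (\<lambda>\<omega>. B * f \<omega>)" using fi by simp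
    show "AE \<omega> in M. norm (a \<omega> * f \<omega>) \<le> norm (B * f \<omega>)"
      unfolding real_norm_def abs_mult
      by (intro AE_I2 mult_right_mono[OF order_trans[OF a(2) abs_ge_self]]) simp
  qed (use fi in measurable)
  have fM: "f \<in> borel_measurable M" using fi by simp
  show ?thesis
    using sigma_finite_subalgebra.real_cond_exp_mult[OF F_sigma_finite[of t] a(1) fM i]
      sigma_finite_subalgebra.real_cond_exp_mult[OF G_sigma_finite[OF t] aG fM i] f i
    unfolding same_cond_exp_def by (auto elim!: eventually_elim2 eventually_rev_mp)
qed

lemma same_cond_exp_cmult: "1 \<le> t \<Longrightarrow> J \<subseteq> {..<N t} \<Longrightarrow> same_cond_exp t J f \<Longrightarrow> same_cond_exp t J (\<lambda>\<omega>. f \<omega> * c)"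
  using same_cond_exp_weighted[of t J f "\<lambda>_. c" "\<bar>c\<bar>"] by (simp add: mult.commute)

lemma same_cond_exp_sample:
  assumes "1 \<le> t" "J \<subseteq> {..<N t}" "k < N t" "k \<notin> J" "h \<in> borel_measurable V" "integrable M (\<lambda>\<omega>. h (Y t k \<omega>))"
  shows "same_cond_exp t J (\<lambda>\<omega>. h (Y t k \<omega>))"
  unfolding same_cond_exp_def using cond_exp_other_sample[OF assms] assms(6) by simp

lemma Y2_integrable:
  assumes t: "1 \<le> t" "k < N t" and i: "i < n" "j < n"
  shows "integrable M (\<lambda>\<omega>. Y t k \<omega> i * Y t k \<omega> j)"
proof -
  have "integrable M (\<lambda>\<omega>. (\<delta> t k \<omega> i * \<delta> t k \<omega> j) * (X t k \<omega> i * X t k \<omega> j))"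
  proof (rule mask_X_prod2(1)[OF t _ _ i, where B = "1 * 1"])
    show "(\<lambda>\<omega>. \<delta> t k \<omega> i * \<delta> t k \<omega> j) \<in> borel_measurable (H t)" by (intro borel_measurable_times mask_H t i)
    show "\<bar>\<delta> t k \<omega> i * \<delta> t k \<omega> j\<bar> \<le> 1 * 1" if "\<omega> \<in> space M" for \<omega>
      unfolding abs_mult by (intro mult_mono mask_abs[OF t that] i) auto
  qed
  then show ?thesis using i by (simp add: Y_component mult_ac)
qed

lemma Y4_integrable:
  assumes t: "1 \<le> t" "k < N t" and i: "i < n" "j < n" "l < n" "r < n"
  shows "integrable M (\<lambda>\<omega>. Y t k \<omega> i * Y t k \<omega> j * Y t k \<omega> l * Y t k \<omega> r)"
proof -
  have "integrable M (\<lambda>\<omega>. (\<delta> t k \<omega> i * \<delta> t k \<omega> j * \<delta> t k \<omega> l * \<delta> t k \<omega> r) * (X t k \<omega> i * X t k \<omega> j * X t k \<omega> l * X t k \<omega> r))"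
  proof (rule mask_X_prod4(1)[OF t _ _ i, where B = "1 * 1 * 1 * 1"])
    show "(\<lambda>\<omega>. \<delta> t k \<omega> i * \<delta> t k \<omega> j * \<delta> t k \<omega> l * \<delta> t k \<omega> r) \<in> borel_measurable (H t)"
      by (intro borel_measurable_times mask_H t i)
    show "\<bar>\<delta> t k \<omega> i * \<delta> t k \<omega> j * \<delta> t k \<omega> l * \<delta> t k \<omega> r\<bar> \<le> 1 * 1 * 1 * 1" if "\<omega> \<in> space M" for \<omega>
      unfolding abs_mult by (intro mult_mono mask_abs[OF t that] i) auto
  qed
  then show ?thesis using i by (simp add: Y_component mult_ac)
qed

lemma same_cond_exp_U:
  assumes t: "1 \<le> t" "J \<subseteq> {..<N t}" "k < N t" "k \<notin> J" and ij: "i < n" "j < n"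
  shows "same_cond_exp t J (\<lambda>\<omega>. U t k \<omega> i j)"
proof -
  have "same_cond_exp t J (\<lambda>\<omega>. Y t k \<omega> i * Y t k \<omega> j)"
    by (rule same_cond_exp_sample[OF t, where h = "\<lambda>z. z i * z j"])
      (use ij Y2_integrable[OF t(1,3) ij] in \<open>auto intro!: borel_measurable_times measurable_component_singleton\<close>)
  from same_cond_exp_weighted[OF t(1,2) this gam_F[OF t(1) ij] gam_abs(1)] show ?thesis
    by (simp add: U_def mult.commute)
qed

lemma same_cond_exp_W2:
  assumes t: "1 \<le> t" "J \<subseteq> {..<N t}" "k < N t" "k \<notin> J" and ij: "i < n" "j < n"
  shows "same_cond_exp t J (\<lambda>\<omega>. W2 t k \<omega> i j)"
  unfolding W2_def
proof (rule same_cond_exp_sum[OF t(1,2)])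
  fix l assume "l \<in> {..<n}"
  then have l: "l < n" by simp
  have "same_cond_exp t J (\<lambda>\<omega>. Y t k \<omega> i * Y t k \<omega> l * Y t k \<omega> l * Y t k \<omega> j)"
    by (rule same_cond_exp_sample[OF t, where h = "\<lambda>z. z i * z l * z l * z j"])
      (use ij l Y4_integrable[OF t(1,3) ij(1) l l ij(2)] in \<open>auto intro!: borel_measurable_times measurable_component_singleton\<close>)
  moreover have "(\<lambda>\<omega>. gam t \<omega> i l * gam t \<omega> l j) \<in> borel_measurable (F t)"
    by (intro borel_measurable_times gam_F t ij l)
  moreover have "\<bar>gam t \<omega> i l * gam t \<omega> l j\<bar> \<le> gB * gB" for \<omega>
    unfolding abs_mult by (intro mult_mono gam_abs) (use gB_pos in auto)
  ultimately have "same_cond_exp t J (\<lambda>\<omega>. (gam t \<omega> i l * gam t \<omega> l j) * (Y t k \<omega> i * Y t k \<omega> l * Y t k \<omega> l * Y t k \<omega> j))"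
    by (rule same_cond_exp_weighted[OF t(1,2)])
  then show "same_cond_exp t J (\<lambda>\<omega>. U t k \<omega> i l * U t k \<omega> l j)"
    by (simp add: U_def mult_ac)
qed

text \<open>The form of a squared matrix at \<open>u\<close>, \<open>v\<close> is the inner product
  of the two images, so AM-GM reduces it to the quadratic case.\<close>

lemma bil_W2_cond_exp_le:
  assumes t: "1 \<le> t" "k < N t"
  shows "AE \<omega> in M. real_cond_exp M (F t) (\<lambda>\<omega>. bil n (W2 t k \<omega>) u v) \<omega>
    \<le> K4 * op_norm n S * L2_set u {..<n} * L2_set v {..<n} * rho t \<omega>"
proof -
  let ?a = "L2_set u {..<n}" and ?b = "L2_set v {..<n}"
  have int: "integrable M (\<lambda>\<omega>. bil n (W2 t k \<omega>) u v)" for u v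
    unfolding bil_def by (intro Bochner_Integration.integrable_sum integrable_mult_left W2_integrable t) auto
  have gi: "integrable M (\<lambda>\<omega>. c * rho t \<omega>)" and gF: "(\<lambda>\<omega>. c * rho t \<omega>) \<in> borel_measurable (F t)" for c
    using rho_integrable[OF t(1)] rho_F[OF t(1)] by auto
  show ?thesis
  proof (rule real_cond_exp_leI[OF F_subalgebra int gi gF])
    fix A assume A: "A \<in> sets (F t)"
    have AM: "A \<in> sets M" by (rule F_sets_M[OF A])
    show "(\<integral>\<omega>. indicator A \<omega> * bil n (W2 t k \<omega>) u v \<partial>M)
       \<le> (\<integral>\<omega>. indicator A \<omega> * (K4 * op_norm n S * ?a * ?b * rho t \<omega>) \<partial>M)"
    proof (cases "?a = 0 \<or> ?b = 0")
      case True
      then have "(\<forall>i<n. u i = 0) \<or> (\<forall>i<n. v i = 0)" by (auto simp: L2_set_eq_0_iff)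
      then have "bil n (W2 t k \<omega>) u v = 0" for \<omega> by (auto simp: bil_def)
      then show ?thesis using True by auto
    next
      case False
      then have ab: "0 < ?a" "0 < ?b" by (simp_all add: less_le)
      \<comment> \<open>The ratio of the norms balances the two quadratic terms, so that the product
        of the norms of \<open>u\<close> and \<open>v\<close> comes out.\<close>
      define \<kappa> where "\<kappa> = ?b / ?a"
      have \<kappa>: "0 < \<kappa>" using ab by (simp add: \<kappa>_def)
      define q where "q w \<omega> = (\<Sum>l<n. (mv n (U t k \<omega>) w l)\<^sup>2)" for w \<omega>
      have qeq: "q w \<omega> = bil n (W2 t k \<omega>) w w" for w \<omega> by (simp add: q_def bil_W2 power2_eq_square)
      have qi: "integrable M (\<lambda>\<omega>. indicator A \<omega> * q w \<omega>)" for w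
        unfolding qeq by (rule integrable_indicator_mult[OF AM int])
      have amgm: "p * r \<le> (\<kappa> * p\<^sup>2 + r\<^sup>2 / \<kappa>) / 2" for p r :: real
      proof -
        have "2 * (sqrt \<kappa> * p) * (r / sqrt \<kappa>) \<le> (sqrt \<kappa> * p)\<^sup>2 + (r / sqrt \<kappa>)\<^sup>2" by (rule sum_squares_bound)
        then show ?thesis using \<kappa> by (simp add: power_mult_distrib power_divide)
      qed
      have pw: "bil n (W2 t k \<omega>) u v \<le> (\<kappa> * q u \<omega> + q v \<omega> / \<kappa>) / 2" for \<omega>
      proof -
        have "bil n (W2 t k \<omega>) u v \<le> (\<Sum>l<n. (\<kappa> * (mv n (U t k \<omega>) u l)\<^sup>2 + (mv n (U t k \<omega>) v l)\<^sup>2 / \<kappa>) / 2)"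
          unfolding bil_W2 by (intro sum_mono amgm)
        also have "\<dots> = (\<kappa> * q u \<omega> + q v \<omega> / \<kappa>) / 2"
          by (simp add: q_def sum.distrib sum_distrib_left sum_divide_distrib add_divide_distrib)
        finally show ?thesis .
      qed
      have "(\<integral>\<omega>. indicator A \<omega> * bil n (W2 t k \<omega>) u v \<partial>M)
         \<le> (\<integral>\<omega>. \<kappa> / 2 * (indicator A \<omega> * q u \<omega>) + 1 / (2 * \<kappa>) * (indicator A \<omega> * q v \<omega>) \<partial>M)"
      proof (rule integral_mono)
        show "integrable M (\<lambda>\<omega>. indicator A \<omega> * bil n (W2 t k \<omega>) u v)" by (rule integrable_indicator_mult[OF AM int])
        show "integrable M (\<lambda>\<omega>. \<kappa> / 2 * (indicator A \<omega> * q u \<omega>) + 1 / (2 * \<kappa>) * (indicator A \<omega> * q v \<omega>))"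
          by (intro Bochner_Integration.integrable_add integrable_mult_right qi)
        fix \<omega>
        show "indicator A \<omega> * bil n (W2 t k \<omega>) u v \<le> \<kappa> / 2 * (indicator A \<omega> * q u \<omega>) + 1 / (2 * \<kappa>) * (indicator A \<omega> * q v \<omega>)"
          using pw[of \<omega>] by (auto simp: add_divide_distrib mult.commute split: split_indicator)
      qed
      also have "\<dots> = \<kappa> / 2 * (\<integral>\<omega>. indicator A \<omega> * q u \<omega> \<partial>M) + 1 / (2 * \<kappa>) * (\<integral>\<omega>. indicator A \<omega> * q v \<omega> \<partial>M)"
        using qi by simp
      also have "\<dots> \<le> \<kappa> / 2 * (\<integral>\<omega>. indicator A \<omega> * (K4 * op_norm n S * (\<Sum>j<n. (u j)\<^sup>2) * rho t \<omega>) \<partial>M)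
          + 1 / (2 * \<kappa>) * (\<integral>\<omega>. indicator A \<omega> * (K4 * op_norm n S * (\<Sum>j<n. (v j)\<^sup>2) * rho t \<omega>) \<partial>M)"
        unfolding q_def using \<kappa> by (intro add_mono mult_left_mono quad_U_integral_le t A) auto
      also have "\<dots> = (\<integral>\<omega>. indicator A \<omega> * (K4 * op_norm n S * ?a * ?b * rho t \<omega>) \<partial>M)"
      proof -
        define I where "I = (\<integral>\<omega>. indicator A \<omega> * rho t \<omega> \<partial>M)"
        have *: "(\<integral>\<omega>. indicator A \<omega> * (c * rho t \<omega>) \<partial>M) = c * I" for c
          unfolding I_def by (simp only: mult.left_commute integral_mult_right_zero)
        have s: "(\<Sum>j<n. (u j)\<^sup>2) = ?a\<^sup>2" "(\<Sum>j<n. (v j)\<^sup>2) = ?b\<^sup>2" by (simp_all add: L2_set_sq)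
        show ?thesis unfolding * s using ab by (simp add: \<kappa>_def power2_eq_square field_simps)
      qed
      finally show ?thesis .
    qed
  qed
qed

text \<open>\<open>U\<close> and, in \<open>T2\<close>, its square \<open>W2\<close>, as functions
  of the past and of a free value \<open>y\<close> of the observation: the form in which
  exchangeability can be applied.\<close>

definition T1 :: "nat \<Rightarrow> 'w \<Rightarrow> (nat \<Rightarrow> real) \<Rightarrow> rmat" where
  "T1 t \<omega> y i j = y i * y j * gam t \<omega> i j"

definition T2 :: "nat \<Rightarrow> 'w \<Rightarrow> (nat \<Rightarrow> real) \<Rightarrow> rmat" where
  "T2 t \<omega> y i j = (\<Sum>l<n. T1 t \<omega> y i l * T1 t \<omega> y l j)"

lemma T1_Y: "T1 t \<omega> (Y t k \<omega>) = U t k \<omega>"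
  by (simp add: T1_def U_def fun_eq_iff)

lemma T2_Y: "T2 t \<omega> (Y t k \<omega>) = W2 t k \<omega>"
  by (simp add: T2_def W2_def T1_Y fun_eq_iff)

lemma T1_symm: "symm n (T1 t \<omega> y)"
  by (simp add: symm_def T1_def gam_symm mult_ac)

lemma T2_symm: "symm n (T2 t \<omega> y)"
  by (auto simp: symm_def T2_def T1_def gam_symm mult_ac)

lemma T1_measurable:
  assumes "1 \<le> t" "i < n" "j < n"
  shows "(\<lambda>(\<omega>, y). T1 t \<omega> y i j) \<in> borel_measurable (F t \<Otimes>\<^sub>M V)"
proof -
  have "(\<lambda>z. snd z i) \<in> borel_measurable (F t \<Otimes>\<^sub>M V)" if "i < n" for i
    using that by (intro measurable_compose[OF measurable_snd measurable_component_singleton]) auto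
  moreover have "(\<lambda>z. gam t (fst z) i j) \<in> borel_measurable (F t \<Otimes>\<^sub>M V)"
    by (rule measurable_compose[OF measurable_fst gam_F[OF assms]])
  ultimately show ?thesis using assms unfolding T1_def case_prod_unfold by (intro borel_measurable_times) auto
qed

lemma T2_measurable:
  assumes "1 \<le> t" "i < n" "j < n"
  shows "(\<lambda>(\<omega>, y). T2 t \<omega> y i j) \<in> borel_measurable (F t \<Otimes>\<^sub>M V)"
  using T1_measurable[OF assms(1)] assms unfolding T2_def case_prod_unfold
  by (intro borel_measurable_sum borel_measurable_times) auto

text \<open>Swapping all pairs interchanges the two halves. \<open>C\<close> is a deterministic
  centring of each summand.\<close>

lemma half_exchange:
  assumes t: "1 \<le> t"
    and T: "\<And>i j. i < n \<Longrightarrow> j < n \<Longrightarrow> (\<lambda>(\<omega>, y). T \<omega> y i j) \<in> borel_measurable (F t \<Otimes>\<^sub>M V)"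
  shows "(\<integral>\<omega>. (op_norm n (\<lambda>i j. \<Sum>k<half t. T \<omega> (Y t (half t + k) \<omega>) i j - C i j)) ^ p \<partial>M)
       = (\<integral>\<omega>. (op_norm n (\<lambda>i j. \<Sum>k<half t. T \<omega> (Y t k \<omega>) i j - C i j)) ^ p \<partial>M)"
proof -
  define \<Phi> where "\<Phi> \<omega> y = (op_norm n (\<lambda>i j. \<Sum>k<half t. T \<omega> (y k) i j - C i j)) ^ p" for \<omega> y
  have m: "(\<lambda>z. T (fst z) (snd z k) i j) \<in> borel_measurable (F t \<Otimes>\<^sub>M VN t)" if "k < N t" "i < n" "j < n" for k i j
    using component_pair_measurable[where T = T and i = i and j = j and k = k, OF T[OF that(2,3)] that(1)]
    by (simp add: case_prod_unfold)
  have \<Phi>m: "(\<lambda>(\<omega>, y). \<Phi> \<omega> y) \<in> borel_measurable (F t \<Otimes>\<^sub>M VN t)"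
    unfolding \<Phi>_def case_prod_unfold
    by (intro borel_measurable_power op_norm_measurable n_pos borel_measurable_sum borel_measurable_diff m) auto
  have \<pi>: "swap_half (half t) {..<half t} permutes {..<N t}" by (rule swap_half_permutes) auto
  have "Yv t (swap_half (half t) {..<half t}) \<omega> k = Y t (half t + k) \<omega>" "Yv t id \<omega> k = Y t k \<omega>" if "k < half t" for k \<omega>
    using that by (auto simp: Yv_def swap_half_def)
  then have "\<Phi> \<omega> (Yv t (swap_half (half t) {..<half t}) \<omega>) = (op_norm n (\<lambda>i j. \<Sum>k<half t. T \<omega> (Y t (half t + k) \<omega>) i j - C i j)) ^ p"
    "\<Phi> \<omega> (Yv t id \<omega>) = (op_norm n (\<lambda>i j. \<Sum>k<half t. T \<omega> (Y t k \<omega>) i j - C i j)) ^ p" for \<omega>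
    unfolding \<Phi>_def by simp_all
  with exchangeable_integral(1)[OF t \<pi> \<Phi>m] show ?thesis by simp
qed

lemma hdiff_Y: "hdiff t T \<omega> (Yv t id \<omega>) = (\<lambda>i j. (\<Sum>k<half t. T \<omega> (Y t k \<omega>) i j) - (\<Sum>k<half t. T \<omega> (Y t (half t + k) \<omega>) i j))"
  unfolding hdiff_def sum_subtractf[symmetric] by (intro ext sum.cong refl) (simp add: Yv_id)

end

lemma sum_lessThan_add: "(\<Sum>k<m + p. f k) = (\<Sum>k<m. f k) + (\<Sum>k<p. f (m + k :: nat) :: 'a :: comm_monoid_add)"
  by (induction p) (simp_all add: add.assoc)

lemma L2_mv_diff_sq:
  "(L2_set (mv n (\<lambda>i j. A i j - B i j) u) {..<n})\<^sup>2
     \<le> 2 * (L2_set (mv n A u) {..<n})\<^sup>2 + 2 * (L2_set (mv n B u) {..<n})\<^sup>2"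
proof -
  have "(a - b)\<^sup>2 \<le> 2 * a\<^sup>2 + 2 * b\<^sup>2" for a b :: real
    using zero_le_power2[of "a + b"] by (simp add: power2_diff power2_sum)
  moreover have "mv n (\<lambda>i j. A i j - B i j) u i = mv n A u i - mv n B u i" for i
    by (simp add: mv_def left_diff_distrib sum_subtractf)
  ultimately show ?thesis
    by (simp add: L2_set_sq sum_distrib_left sum.distrib[symmetric] sum_mono)
qed

lemma bil_sum: "bil n (\<lambda>i j. \<Sum>k\<in>K. A k i j) u v = (\<Sum>k\<in>K. bil n (A k) u v)"
  by (induction K rule: infinite_finite_induct) (simp_all add: bil_add, simp_all add: bil_def)

context cmcar_sg
begin

lemma cond_exp_sum_le:
  assumes "finite I" "\<And>i. i \<in> I \<Longrightarrow> integrable M (f i)"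
    and "\<And>i. i \<in> I \<Longrightarrow> AE \<omega> in M. real_cond_exp M (F t) (f i) \<omega> \<le> g \<omega>"
  shows "AE \<omega> in M. real_cond_exp M (F t) (\<lambda>\<omega>. \<Sum>i\<in>I. f i \<omega>) \<omega> \<le> real (card I) * g \<omega>"
  using assms
proof (induction I rule: finite_induct)
  case empty
  have "AE \<omega> in M. real_cond_exp M (F t) (\<lambda>_. 0) \<omega> = 0"
    by (rule sigma_finite_subalgebra.real_cond_exp_F_meas[OF F_sigma_finite]) auto
  then show ?case by eventually_elim simp
next
  case (insert i I)
  have i: "integrable M (f i)" "integrable M (\<lambda>\<omega>. \<Sum>i\<in>I. f i \<omega>)" using insert.prems by auto
  have "AE \<omega> in M. real_cond_exp M (F t) (\<lambda>\<omega>. \<Sum>i\<in>I. f i \<omega>) \<omega> \<le> real (card I) * g \<omega>"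
    using insert.prems by (intro insert.IH) auto
  moreover have "AE \<omega> in M. real_cond_exp M (F t) (f i) \<omega> \<le> g \<omega>" using insert.prems by auto
  moreover note sigma_finite_subalgebra.real_cond_exp_add[OF F_sigma_finite i, of t]
  ultimately show ?case
    by eventually_elim (use insert.hyps in \<open>simp add: ring_distribs\<close>)
qed

lemma U_G:
  assumes "1 \<le> t" "J \<subseteq> {..<N t}" "k \<in> J" "i < n" "j < n"
  shows "(\<lambda>\<omega>. U t k \<omega> i j) \<in> borel_measurable (G t J)"
proof -
  have "(\<lambda>\<omega>. Y t k \<omega> i) \<in> borel_measurable (G t J)" if "i < n" for i
    using measurable_compose[OF Y_G[OF assms(1-3)] measurable_component_singleton, of i] that by auto
  moreover have "(\<lambda>\<omega>. gam t \<omega> i j) \<in> borel_measurable (G t J)"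
    by (rule measurable_from_subalg[OF G_F[OF assms(1,2)] gam_F[OF assms(1,4,5)]])
  ultimately show ?thesis unfolding U_def using assms by (intro borel_measurable_times) auto
qed

text \<open>The random variance in Khintchine's inequality, taken over the paired samples; the last
  sample of an odd batch has no partner.\<close>

definition sum_sq_norm :: "nat \<Rightarrow> 'w \<Rightarrow> real" where
  "sum_sq_norm t \<omega> = op_norm n (\<lambda>i j. \<Sum>k<2 * half t. W2 t k \<omega> i j)"

lemma sum_sq_norm_integrable: "1 \<le> t \<Longrightarrow> integrable M (sum_sq_norm t)"
  unfolding sum_sq_norm_def by (intro op_norm_integrable n_pos Bochner_Integration.integrable_sum W2_integrable) auto

lemma sum_sq_norm_nonneg: "0 \<le> sum_sq_norm t \<omega>"
  unfolding sum_sq_norm_def by (rule op_norm_nonneg[OF n_pos])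

lemma sum_sq_U_le:
  assumes "L2_set u {..<n} = 1"
  shows "(\<Sum>k<2 * half t. (L2_set (mv n (U t k \<omega>) u) {..<n})\<^sup>2) \<le> sum_sq_norm t \<omega>"
proof -
  have "(\<Sum>k<2 * half t. (L2_set (mv n (U t k \<omega>) u) {..<n})\<^sup>2) = (\<Sum>k<2 * half t. bil n (W2 t k \<omega>) u u)"
    unfolding L2_set_sq[OF finite_lessThan] bil_W2 by (simp only: power2_eq_square)
  also have "\<dots> = bil n (\<lambda>i j. \<Sum>k<2 * half t. W2 t k \<omega> i j) u u"
    by (rule bil_sum[symmetric])
  also have "\<dots> \<le> sum_sq_norm t \<omega>"
    using bil_le_op_norm[of n "\<lambda>i j. \<Sum>k<2 * half t. W2 t k \<omega> i j" u u] assms by (simp add: sum_sq_norm_def)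
  finally show ?thesis .
qed

lemma sum_sq_U_diff_le:
  assumes "L2_set u {..<n} = 1"
  shows "(\<Sum>k<half t. (L2_set (mv n (\<lambda>i j. U t k \<omega> i j - U t (half t + k) \<omega> i j) u) {..<n})\<^sup>2) \<le> 2 * sum_sq_norm t \<omega>"
proof -
  have "(\<Sum>k<half t. (L2_set (mv n (\<lambda>i j. U t k \<omega> i j - U t (half t + k) \<omega> i j) u) {..<n})\<^sup>2)
     \<le> (\<Sum>k<half t. 2 * (L2_set (mv n (U t k \<omega>) u) {..<n})\<^sup>2 + 2 * (L2_set (mv n (U t (half t + k) \<omega>) u) {..<n})\<^sup>2)"
    by (intro sum_mono L2_mv_diff_sq)
  also have "\<dots> = 2 * (\<Sum>k<2 * half t. (L2_set (mv n (U t k \<omega>) u) {..<n})\<^sup>2)"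
    unfolding mult_2[of "half t"] sum_lessThan_add by (simp add: sum.distrib sum_distrib_left)
  also have "\<dots> \<le> 2 * sum_sq_norm t \<omega>" by (intro mult_left_mono sum_sq_U_le assms) simp
  finally show ?thesis .
qed

text \<open>The second application of Khintchine concerns the squares \<open>W2\<close>, whose own
  squares are fourth powers of \<open>U\<close>; one factor \<open>U\<close> squared is bounded by
  \<open>mu\<close>, the other is summed again by \<open>sum_sq_norm\<close>.\<close>

lemma sum_sq_W2_diff_le:
  assumes mu: "\<forall>k\<in>{..<N t}. (\<Sum>i<n. \<Sum>j<n. (U t k \<omega> i j)\<^sup>2) \<le> mu t \<omega>" and u: "L2_set u {..<n} = 1"
  shows "(\<Sum>k<half t. (L2_set (mv n (\<lambda>i j. W2 t k \<omega> i j - W2 t (half t + k) \<omega> i j) u) {..<n})\<^sup>2) \<le> 2 * mu t \<omega> * sum_sq_norm t \<omega>"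
proof -
  have W: "(L2_set (mv n (W2 t k \<omega>) u) {..<n})\<^sup>2 \<le> mu t \<omega> * (L2_set (mv n (U t k \<omega>) u) {..<n})\<^sup>2" if "k < N t" for k
  proof -
    have "(L2_set (mv n (W2 t k \<omega>) u) {..<n})\<^sup>2 \<le> (sqrt (\<Sum>i<n. \<Sum>j<n. (U t k \<omega> i j)\<^sup>2) * L2_set (mv n (U t k \<omega>) u) {..<n})\<^sup>2"
      unfolding mv_W2 by (intro power_mono L2_set_mv_le) simp
    also have "\<dots> = (\<Sum>i<n. \<Sum>j<n. (U t k \<omega> i j)\<^sup>2) * (L2_set (mv n (U t k \<omega>) u) {..<n})\<^sup>2"
      by (simp add: power_mult_distrib sum_nonneg)
    also have "\<dots> \<le> mu t \<omega> * (L2_set (mv n (U t k \<omega>) u) {..<n})\<^sup>2"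
      using mu that by (intro mult_right_mono) auto
    finally show ?thesis .
  qed
  have "(\<Sum>k<half t. (L2_set (mv n (\<lambda>i j. W2 t k \<omega> i j - W2 t (half t + k) \<omega> i j) u) {..<n})\<^sup>2)
     \<le> (\<Sum>k<half t. 2 * (L2_set (mv n (W2 t k \<omega>) u) {..<n})\<^sup>2 + 2 * (L2_set (mv n (W2 t (half t + k) \<omega>) u) {..<n})\<^sup>2)"
    by (intro sum_mono L2_mv_diff_sq)
  also have "\<dots> = 2 * (\<Sum>k<2 * half t. (L2_set (mv n (W2 t k \<omega>) u) {..<n})\<^sup>2)"
    unfolding mult_2[of "half t"] sum_lessThan_add by (simp add: sum.distrib sum_distrib_left)
  also have "\<dots> \<le> 2 * (\<Sum>k<2 * half t. mu t \<omega> * (L2_set (mv n (U t k \<omega>) u) {..<n})\<^sup>2)"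
    by (intro mult_left_mono sum_mono W) auto
  also have "\<dots> \<le> 2 * (mu t \<omega> * sum_sq_norm t \<omega>)"
    unfolding sum_distrib_left[symmetric] by (intro mult_left_mono sum_sq_U_le u mu_nonneg) simp
  finally show ?thesis by (simp add: mult_ac)
qed

lemma half_lt: "k < half t \<Longrightarrow> k < N t" "k < half t \<Longrightarrow> half t + k < N t" "k < 2 * half t \<Longrightarrow> k < N t"
  by auto

text \<open>\<open>jensen_op_norm\<close> with the first half as \<open>B\<close> and the second
  half as \<open>\<xi>\<close>: given the past and the first half, the forms of the second half have
  conditional mean controlled by \<open>rho\<close>, and the difference of the halves is ready for
  symmetrization.\<close>

lemma first_half_sq_integral_le:
  assumes t: "1 \<le> t"
  shows "(\<integral>\<omega>. op_norm n (\<lambda>i j. \<Sum>k<half t. W2 t k \<omega> i j) \<partial>M)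
    \<le> real (half t) * K4 * op_norm n S * (\<integral>\<omega>. rho t \<omega> \<partial>M) + (\<integral>\<omega>. op_norm n (hdiff t (T2 t) \<omega> (Yv t id \<omega>)) \<partial>M)"
proof -
  let ?J = "{..<half t}"
  have J: "?J \<subseteq> {..<N t}" by auto
  define B where "B \<omega> = (\<lambda>i j. \<Sum>k<half t. W2 t k \<omega> i j)" for \<omega>
  define \<xi> where "\<xi> \<omega> = (\<lambda>i j. \<Sum>k<half t. W2 t (half t + k) \<omega> i j)" for \<omega>
  define r where "r \<omega> = real (half t) * (K4 * op_norm n S * rho t \<omega>)" for \<omega>
  have ri: "integrable M r" unfolding r_def using rho_integrable[OF t] by simp
  have Bi: "integrable M (\<lambda>\<omega>. B \<omega> i j)" "integrable M (\<lambda>\<omega>. \<xi> \<omega> i j)" if "i < n" "j < n" for i j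
    unfolding B_def \<xi>_def using that t by (auto intro!: Bochner_Integration.integrable_sum W2_integrable)
  have BG: "(\<lambda>\<omega>. B \<omega> i j) \<in> borel_measurable (G t ?J)" if "i < n" "j < n" for i j
    unfolding B_def W2_def using that
    by (intro borel_measurable_sum borel_measurable_times U_G[OF t J]) auto
  have le: "AE \<omega> in M. real_cond_exp M (G t ?J) (\<lambda>\<omega>. bil n (\<xi> \<omega>) u v) \<omega> \<le> r \<omega> * L2_set u {..<n} * L2_set v {..<n}" for u v
  proof -
    have eq: "bil n (\<xi> \<omega>) u v = (\<Sum>k<half t. bil n (W2 t (half t + k) \<omega>) u v)" for \<omega>
      unfolding \<xi>_def by (rule bil_sum)
    have sck: "same_cond_exp t ?J (\<lambda>\<omega>. bil n (W2 t (half t + k) \<omega>) u v)" if k: "k < half t" for k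
      unfolding bil_def using half_lt(2)[OF k]
      by (intro same_cond_exp_sum[OF t J] same_cond_exp_cmult[OF t J] same_cond_exp_W2[OF t J]) auto
    then have s: "same_cond_exp t ?J (\<lambda>\<omega>. bil n (\<xi> \<omega>) u v)" unfolding eq by (intro same_cond_exp_sum[OF t J]) auto
    have "AE \<omega> in M. real_cond_exp M (F t) (\<lambda>\<omega>. bil n (\<xi> \<omega>) u v) \<omega>
       \<le> real (card ?J) * (K4 * op_norm n S * L2_set u {..<n} * L2_set v {..<n} * rho t \<omega>)"
      unfolding eq
      using sck by (intro cond_exp_sum_le bil_W2_cond_exp_le[OF t] half_lt) (auto simp: same_cond_exp_def)
    moreover have "AE \<omega> in M. real_cond_exp M (G t ?J) (\<lambda>\<omega>. bil n (\<xi> \<omega>) u v) \<omega> = real_cond_exp M (F t) (\<lambda>\<omega>. bil n (\<xi> \<omega>) u v) \<omega>"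
      using s by (simp add: same_cond_exp_def)
    ultimately show ?thesis by eventually_elim (simp add: r_def mult_ac)
  qed
  define D where "D \<omega> = op_norm n (\<lambda>i j. B \<omega> i j - \<xi> \<omega> i j)" for \<omega>
  have Di: "integrable M D" unfolding D_def
    by (intro op_norm_integrable n_pos Bochner_Integration.integrable_diff Bi)
  have Deq: "D \<omega> = op_norm n (hdiff t (T2 t) \<omega> (Yv t id \<omega>))" for \<omega>
    by (simp add: D_def hdiff_Y T2_Y B_def \<xi>_def)
  have "AE \<omega> in M. op_norm n (B \<omega>) \<le> r \<omega> + real_cond_exp M (G t ?J) D \<omega>"
    using jensen_op_norm[OF G_subalgebra[OF t J] n_pos BG Bi(1) Bi(2) le] by (simp add: D_def[abs_def])
  then have "(\<integral>\<omega>. op_norm n (B \<omega>) \<partial>M) \<le> (\<integral>\<omega>. r \<omega> + real_cond_exp M (G t ?J) D \<omega> \<partial>M)"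
    by (intro integral_mono_AE op_norm_integrable n_pos Bi Bochner_Integration.integrable_add ri
        sigma_finite_subalgebra.real_cond_exp_int(1)[OF G_sigma_finite[OF t J] Di])
  also have "\<dots> = (\<integral>\<omega>. r \<omega> \<partial>M) + (\<integral>\<omega>. D \<omega> \<partial>M)"
    using ri sigma_finite_subalgebra.real_cond_exp_int[OF G_sigma_finite[OF t J] Di] by simp
  finally show ?thesis by (simp add: r_def Deq B_def mult.assoc)
qed

text \<open>A self-bounding argument in the manner of Rudelson: the fluctuation of the sum of
  squares is estimated by the geometric mean of that sum and \<open>mu\<close>, and a fraction of
  the sum is absorbed on the left.\<close>

lemma sum_sq_norm_expectation:
  assumes t: "1 \<le> t"
  shows "(\<integral>\<omega>. sum_sq_norm t \<omega> \<partial>M) \<le> 2 * real (N t) * K4 * op_norm n S * (\<integral>\<omega>. rho t \<omega> \<partial>M) + 384 * ln (real n) * (\<integral>\<omega>. mu t \<omega> \<partial>M)"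
proof -
  define q1 where "q1 \<omega> = op_norm n (\<lambda>i j. \<Sum>k<half t. W2 t k \<omega> i j)" for \<omega>
  define q2 where "q2 \<omega> = op_norm n (\<lambda>i j. \<Sum>k<half t. W2 t (half t + k) \<omega> i j)" for \<omega>
  \<comment> \<open>AM-GM with weights chosen so that \<open>d\<close> squared is at least four
    times the product of its terms, \<open>96 * ln n * mu * sum_sq_norm\<close>, while the
    coefficient \<open>1 / 4\<close> is small enough for the absorption.\<close>
  define d where "d \<omega> = sum_sq_norm t \<omega> / 4 + 96 * ln (real n) * mu t \<omega>" for \<omega>
  have qi: "integrable M q1" "integrable M q2" unfolding q1_def q2_def
    using t by (auto intro!: op_norm_integrable n_pos Bochner_Integration.integrable_sum W2_integrable)
  have ln: "1 \<le> ln (real n)" by (rule exponent_props(1)[OF n3])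
  have di: "integrable M d" unfolding d_def using sum_sq_norm_integrable[OF t] mu_integrable[OF t] by simp
  have half: "(\<integral>\<omega>. q2 \<omega> \<partial>M) = (\<integral>\<omega>. q1 \<omega> \<partial>M)"
    using half_exchange[OF t T2_measurable[OF t], where C = "\<lambda>_ _. 0" and p = 1]
    by (simp add: q1_def q2_def T2_Y)
  have "(\<integral>\<omega>. op_norm n (hdiff t (T2 t) \<omega> (Yv t id \<omega>)) \<partial>M) \<le> (\<integral>\<omega>. d \<omega> \<partial>M)"
  proof (rule symmetrized_first_moment[OF t T2_measurable[OF t] T2_symm _ di])
    show "integrable M (\<lambda>\<omega>. op_norm n (hdiff t (T2 t) \<omega> (Yv t id \<omega>)))"
      unfolding hdiff_Y T2_Y using t
      by (auto intro!: op_norm_integrable n_pos Bochner_Integration.integrable_diff Bochner_Integration.integrable_sum W2_integrable)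
    show "AE \<omega> in M. 0 \<le> d \<omega> \<and> (\<exists>c. 48 * ln (real n) * c \<le> (d \<omega>)\<^sup>2 \<and> (\<forall>u. L2_set u {..<n} = 1 \<longrightarrow>
       (\<Sum>k<half t. (L2_set (mv n (\<lambda>i j. T2 t \<omega> (Y t k \<omega>) i j - T2 t \<omega> (Y t (half t + k) \<omega>) i j) u) {..<n})\<^sup>2) \<le> c))"
      using U_frob_le_mu[OF t]
    proof eventually_elim
      case (elim \<omega>)
      have "48 * ln (real n) * (2 * mu t \<omega> * sum_sq_norm t \<omega>) \<le> (d \<omega>)\<^sup>2"
        using zero_le_power2[of "sum_sq_norm t \<omega> / 4 - 96 * ln (real n) * mu t \<omega>"]
        by (simp add: d_def power2_sum power2_diff)
      moreover have "0 \<le> d \<omega>" using sum_sq_norm_nonneg mu_nonneg ln by (auto simp: d_def)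
      ultimately show ?case unfolding T2_Y using sum_sq_W2_diff_le[OF elim] by blast
    qed
  qed
  then have q1le: "(\<integral>\<omega>. q1 \<omega> \<partial>M) \<le> real (half t) * K4 * op_norm n S * (\<integral>\<omega>. rho t \<omega> \<partial>M)
      + ((\<integral>\<omega>. sum_sq_norm t \<omega> \<partial>M) / 4 + 96 * ln (real n) * (\<integral>\<omega>. mu t \<omega> \<partial>M))"
    using first_half_sq_integral_le[OF t] sum_sq_norm_integrable[OF t] mu_integrable[OF t] by (simp add: q1_def d_def)
  have "(\<integral>\<omega>. sum_sq_norm t \<omega> \<partial>M) \<le> (\<integral>\<omega>. q1 \<omega> + q2 \<omega> \<partial>M)"
  proof (rule integral_mono[OF sum_sq_norm_integrable[OF t]])
    show "integrable M (\<lambda>\<omega>. q1 \<omega> + q2 \<omega>)" using qi by simp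
    show "sum_sq_norm t \<omega> \<le> q1 \<omega> + q2 \<omega>" for \<omega>
      unfolding sum_sq_norm_def q1_def q2_def mult_2[of "half t"] sum_lessThan_add by (rule op_norm_triangle[OF n_pos])
  qed
  also have "\<dots> = 2 * (\<integral>\<omega>. q1 \<omega> \<partial>M)" using qi half by simp
  \<comment> \<open>The two halves together return half of the left-hand side; moving it over
    doubles the other terms, so \<open>2 * 2 * 96 = 384\<close>.\<close>
  finally have "(\<integral>\<omega>. sum_sq_norm t \<omega> \<partial>M) \<le> 4 * (real (half t) * K4 * op_norm n S * (\<integral>\<omega>. rho t \<omega> \<partial>M)) + 384 * ln (real n) * (\<integral>\<omega>. mu t \<omega> \<partial>M)"
    using q1le by simp
  also have "4 * (real (half t) * K4 * op_norm n S * (\<integral>\<omega>. rho t \<omega> \<partial>M)) = (4 * real (half t)) * (K4 * op_norm n S * (\<integral>\<omega>. rho t \<omega> \<partial>M))"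
    by simp
  also have "\<dots> \<le> (2 * real (N t)) * (K4 * op_norm n S * (\<integral>\<omega>. rho t \<omega> \<partial>M))"
  proof (rule mult_right_mono)
    have "2 * half t \<le> N t" by simp
    then have "real (2 * half t) \<le> real (N t)" by (rule of_nat_mono)
    then show "4 * real (half t) \<le> 2 * real (N t)" by simp
    show "0 \<le> K4 * op_norm n S * (\<integral>\<omega>. rho t \<omega> \<partial>M)"
      using K4_pos op_norm_S_pos rho_nonneg by (intro mult_nonneg_nonneg integral_nonneg_AE) auto
  qed
  finally show ?thesis by (simp add: mult_ac)
qed

section \<open>The centred batch sums\<close>

definition dev :: "nat \<Rightarrow> 'w \<Rightarrow> rmat" where
  "dev t \<omega> i j = (\<Sum>k<N t. U t k \<omega> i j - S i j)"

lemma U_centered_sq_int: "1 \<le> t \<Longrightarrow> k < N t \<Longrightarrow> i < n \<Longrightarrow> j < n \<Longrightarrow> sq_int (\<lambda>\<omega>. U t k \<omega> i j - S i j)"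
  by (intro sq_int_diff U_sq_int sq_int_const)

text \<open>Given the first half, the second half is centred, so \<open>b \<le> E[D | G]\<close>.
  The squared version follows by multiplying with \<open>b\<close>, which is
  \<open>G\<close>-measurable and may be moved under the conditional expectation, and by absorbing
  half of its square after AM-GM on \<open>b * D\<close>.\<close>

lemma first_half_dev_le:
  assumes t: "1 \<le> t"
  shows "(\<integral>\<omega>. (op_norm n (\<lambda>i j. \<Sum>k<half t. U t k \<omega> i j - S i j))\<^sup>2 \<partial>M)
    \<le> (\<integral>\<omega>. (op_norm n (hdiff t (T1 t) \<omega> (Yv t id \<omega>)))\<^sup>2 \<partial>M)"
proof -
  let ?J = "{..<half t}"
  have J: "?J \<subseteq> {..<N t}" by auto
  define B where "B \<omega> = (\<lambda>i j. \<Sum>k<half t. U t k \<omega> i j - S i j)" for \<omega>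
  define \<xi> where "\<xi> \<omega> = (\<lambda>i j. \<Sum>k<half t. U t (half t + k) \<omega> i j - S i j)" for \<omega>
  have Bs: "sq_int (\<lambda>\<omega>. B \<omega> i j)" "sq_int (\<lambda>\<omega>. \<xi> \<omega> i j)" if "i < n" "j < n" for i j
    unfolding B_def \<xi>_def using that t by (auto intro!: sq_int_sum U_centered_sq_int)
  note Bi = Bs[THEN sq_int_integrable]
  have BG: "(\<lambda>\<omega>. B \<omega> i j) \<in> borel_measurable (G t ?J)" if "i < n" "j < n" for i j
    unfolding B_def using that by (intro borel_measurable_sum borel_measurable_diff U_G[OF t J]) auto
  have zero: "AE \<omega> in M. real_cond_exp M (G t ?J) (\<lambda>\<omega>. U t k \<omega> i j - S i j) \<omega> = 0"
    if "k < N t" "k \<notin> ?J" "i < n" "j < n" for i j k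
  proof -
    have Ui: "integrable M (\<lambda>\<omega>. U t k \<omega> i j)" by (rule U_cond_exp(1)[OF t that(1,3,4)])
    have Si: "integrable M (\<lambda>\<omega>. S i j)" by simp
    have "AE \<omega> in M. real_cond_exp M (G t ?J) (\<lambda>\<omega>. S i j) \<omega> = S i j"
      by (rule sigma_finite_subalgebra.real_cond_exp_F_meas[OF G_sigma_finite[OF t J] Si]) simp
    moreover have "AE \<omega> in M. real_cond_exp M (G t ?J) (\<lambda>\<omega>. U t k \<omega> i j) \<omega> = real_cond_exp M (F t) (\<lambda>\<omega>. U t k \<omega> i j) \<omega>"
      using same_cond_exp_U[OF t J that] by (simp add: same_cond_exp_def)
    moreover note U_cond_exp(2)[OF t that(1,3,4)]
      sigma_finite_subalgebra.real_cond_exp_diff[OF G_sigma_finite[OF t J] Ui Si]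
    ultimately show ?thesis by eventually_elim simp
  qed
  have ceN: "AE \<omega> in M. real_cond_exp M (G t ?J) (\<lambda>\<omega>. \<Sum>i\<in>I. f i \<omega> * c i) \<omega> = 0"
    if "finite I" "\<And>i. i \<in> I \<Longrightarrow> integrable M (f i)" "\<And>i. i \<in> I \<Longrightarrow> AE \<omega> in M. real_cond_exp M (G t ?J) (f i) \<omega> = 0"
    for I :: "'z set" and f :: "'z \<Rightarrow> 'w \<Rightarrow> real" and c :: "'z \<Rightarrow> real"
    using that
  proof (induction I rule: finite_induct)
    case empty
    show ?case using sigma_finite_subalgebra.real_cond_exp_F_meas[OF G_sigma_finite[OF t J], of "\<lambda>_. 0"] by simp
  next
    case (insert i I)
    have i: "integrable M (\<lambda>\<omega>. f i \<omega> * c i)" "integrable M (\<lambda>\<omega>. \<Sum>i\<in>I. f i \<omega> * c i)" using insert.prems by auto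
    have "AE \<omega> in M. real_cond_exp M (G t ?J) (\<lambda>\<omega>. c i * f i \<omega>) \<omega> = c i * real_cond_exp M (G t ?J) (f i) \<omega>"
      using insert.prems by (intro sigma_finite_subalgebra.real_cond_exp_cmult[OF G_sigma_finite[OF t J]]) auto
    moreover have "AE \<omega> in M. real_cond_exp M (G t ?J) (\<lambda>\<omega>. \<Sum>i\<in>I. f i \<omega> * c i) \<omega> = 0"
      using insert.prems by (intro insert.IH) auto
    moreover have "AE \<omega> in M. real_cond_exp M (G t ?J) (f i) \<omega> = 0" using insert.prems by auto
    moreover note sigma_finite_subalgebra.real_cond_exp_add[OF G_sigma_finite[OF t J] i]
    ultimately show ?case by eventually_elim (use insert.hyps in \<open>simp add: mult.commute\<close>)
  qed
  have le: "AE \<omega> in M. real_cond_exp M (G t ?J) (\<lambda>\<omega>. bil n (\<xi> \<omega>) u v) \<omega> \<le> 0 * L2_set u {..<n} * L2_set v {..<n}" for u v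
  proof -
    let ?I = "{..<n} \<times> {..<n} \<times> {..<half t}"
    have eq: "bil n (\<xi> \<omega>) u v = (\<Sum>p\<in>?I. (\<lambda>(i, j, k) \<omega>. U t (half t + k) \<omega> i j - S i j) p \<omega> * (\<lambda>(i, j, k). u i * v j) p)" for \<omega>
      unfolding bil_def \<xi>_def sum_distrib_right by (simp add: sum.cartesian_product case_prod_unfold)
    have "AE \<omega> in M. real_cond_exp M (G t ?J) (\<lambda>\<omega>. bil n (\<xi> \<omega>) u v) \<omega> = 0"
      unfolding eq using t by (intro ceN) (auto intro!: zero sq_int_integrable U_centered_sq_int)
    then show ?thesis by eventually_elim simp
  qed
  define D where "D \<omega> = op_norm n (\<lambda>i j. B \<omega> i j - \<xi> \<omega> i j)" for \<omega>
  define b where "b \<omega> = op_norm n (B \<omega>)" for \<omega>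
  have Ds: "sq_int D" and bs: "sq_int b" unfolding D_def b_def
    by (intro sq_int_op_norm n_pos sq_int_diff Bs; assumption)+
  have Deq: "D \<omega> = op_norm n (hdiff t (T1 t) \<omega> (Yv t id \<omega>))" for \<omega>
    unfolding D_def hdiff_Y T1_Y B_def \<xi>_def by (simp add: sum_subtractf)
  have bG: "b \<in> borel_measurable (G t ?J)" unfolding b_def by (intro op_norm_measurable n_pos BG)
  have AEb: "AE \<omega> in M. b \<omega> \<le> real_cond_exp M (G t ?J) D \<omega>"
    using jensen_op_norm[where r = "\<lambda>_. 0", OF G_subalgebra[OF t J] n_pos BG Bi(1) Bi(2) le]
    by (simp add: D_def[abs_def] b_def)
  have bD: "integrable M (\<lambda>\<omega>. b \<omega> * D \<omega>)" by (rule sq_int_mult[OF bs Ds])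
  have Dm: "D \<in> borel_measurable M" by (rule sq_int_measurable[OF Ds])
  note bce = sigma_finite_subalgebra.real_cond_exp_intg[OF G_sigma_finite[OF t J] bD bG Dm]
  have b2: "integrable M (\<lambda>\<omega>. (b \<omega>)\<^sup>2)" and D2: "integrable M (\<lambda>\<omega>. (D \<omega>)\<^sup>2)" using bs Ds by (auto simp: sq_int_def)
  have "(\<integral>\<omega>. (b \<omega>)\<^sup>2 \<partial>M) \<le> (\<integral>\<omega>. b \<omega> * real_cond_exp M (G t ?J) D \<omega> \<partial>M)"
  proof (rule integral_mono_AE[OF b2 bce(1)])
    show "AE \<omega> in M. (b \<omega>)\<^sup>2 \<le> b \<omega> * real_cond_exp M (G t ?J) D \<omega>"
      using AEb
    proof eventually_elim
      case (elim \<omega>)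
      have "0 \<le> b \<omega>" unfolding b_def by (rule op_norm_nonneg[OF n_pos])
      then show ?case unfolding power2_eq_square by (intro mult_left_mono elim)
    qed
  qed
  also have "\<dots> = (\<integral>\<omega>. b \<omega> * D \<omega> \<partial>M)" by (rule bce(2))
  also have "\<dots> \<le> (\<integral>\<omega>. ((b \<omega>)\<^sup>2 + (D \<omega>)\<^sup>2) / 2 \<partial>M)"
  proof (rule integral_mono)
    show "b \<omega> * D \<omega> \<le> ((b \<omega>)\<^sup>2 + (D \<omega>)\<^sup>2) / 2" for \<omega>
      using sum_squares_bound[of "b \<omega>" "D \<omega>"] by (simp add: mult.assoc)
  qed (use bD b2 D2 in auto)
  also have "\<dots> = ((\<integral>\<omega>. (b \<omega>)\<^sup>2 \<partial>M) + (\<integral>\<omega>. (D \<omega>)\<^sup>2 \<partial>M)) / 2" using b2 D2 by simp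
  finally have "(\<integral>\<omega>. (b \<omega>)\<^sup>2 \<partial>M) \<le> (\<integral>\<omega>. (D \<omega>)\<^sup>2 \<partial>M)" by simp
  then show ?thesis by (simp add: b_def B_def Deq)
qed

text \<open>For the unpaired sample of an odd batch: entrywise the variance is at most the second
  moment, and the Frobenius norm is bounded by \<open>mu\<close>.\<close>

lemma single_dev_le:
  assumes t: "1 \<le> t" and k: "k < N t"
  shows "(\<integral>\<omega>. (op_norm n (\<lambda>i j. U t k \<omega> i j - S i j))\<^sup>2 \<partial>M) \<le> (\<integral>\<omega>. mu t \<omega> \<partial>M)"
proof -
  have s: "sq_int (\<lambda>\<omega>. U t k \<omega> i j)" "sq_int (\<lambda>\<omega>. U t k \<omega> i j - S i j)" if "i < n" "j < n" for i j
    using U_sq_int[OF t k that] U_centered_sq_int[OF t k that] by auto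
  have int2: "integrable M (\<lambda>\<omega>. (U t k \<omega> i j)\<^sup>2)" "integrable M (\<lambda>\<omega>. (U t k \<omega> i j - S i j)\<^sup>2)" if "i < n" "j < n" for i j
    using s[OF that] by (auto simp: sq_int_def)
  have one: "(\<integral>\<omega>. (U t k \<omega> i j - S i j)\<^sup>2 \<partial>M) \<le> (\<integral>\<omega>. (U t k \<omega> i j)\<^sup>2 \<partial>M)" if ij: "i < n" "j < n" for i j
  proof -
    note U = U_cond_exp[OF t k ij]
    have "(\<integral>\<omega>. U t k \<omega> i j \<partial>M) = (\<integral>\<omega>. real_cond_exp M (F t) (\<lambda>\<omega>. U t k \<omega> i j) \<omega> \<partial>M)"
      using sigma_finite_subalgebra.real_cond_exp_int(2)[OF F_sigma_finite U(1), of t] by simp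
    also have "\<dots> = (\<integral>\<omega>. S i j \<partial>M)" by (rule integral_cong_AE) (use U(2) in auto)
    finally have m: "(\<integral>\<omega>. U t k \<omega> i j \<partial>M) = S i j" by (simp add: prob_space)
    have "(\<integral>\<omega>. (U t k \<omega> i j - S i j)\<^sup>2 \<partial>M) = (\<integral>\<omega>. (U t k \<omega> i j)\<^sup>2 - 2 * S i j * U t k \<omega> i j + (S i j)\<^sup>2 \<partial>M)"
      by (intro Bochner_Integration.integral_cong refl) (simp add: power2_diff algebra_simps)
    also have "\<dots> = (\<integral>\<omega>. (U t k \<omega> i j)\<^sup>2 \<partial>M) - 2 * S i j * (\<integral>\<omega>. U t k \<omega> i j \<partial>M) + (S i j)\<^sup>2"
      using U(1) int2[OF ij] by (simp add: prob_space)
    also have "\<dots> \<le> (\<integral>\<omega>. (U t k \<omega> i j)\<^sup>2 \<partial>M)" unfolding m by (simp add: power2_eq_square)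
    finally show ?thesis .
  qed
  have "(\<integral>\<omega>. (op_norm n (\<lambda>i j. U t k \<omega> i j - S i j))\<^sup>2 \<partial>M) \<le> (\<integral>\<omega>. (\<Sum>i<n. \<Sum>j<n. (U t k \<omega> i j - S i j)\<^sup>2) \<partial>M)"
    using sq_int_op_norm[OF n_pos s(2)] op_norm_sq_le_frob[OF n_pos]
    by (intro integral_mono Bochner_Integration.integrable_sum int2) (auto simp: sq_int_def)
  also have "\<dots> = (\<Sum>i<n. \<integral>\<omega>. (\<Sum>j<n. (U t k \<omega> i j - S i j)\<^sup>2) \<partial>M)"
    by (intro Bochner_Integration.integral_sum Bochner_Integration.integrable_sum int2) auto
  also have "\<dots> = (\<Sum>i<n. \<Sum>j<n. \<integral>\<omega>. (U t k \<omega> i j - S i j)\<^sup>2 \<partial>M)"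
    by (intro sum.cong refl Bochner_Integration.integral_sum int2) auto
  also have "\<dots> \<le> (\<Sum>i<n. \<Sum>j<n. \<integral>\<omega>. (U t k \<omega> i j)\<^sup>2 \<partial>M)" by (intro sum_mono one) auto
  also have "\<dots> = (\<Sum>i<n. \<integral>\<omega>. (\<Sum>j<n. (U t k \<omega> i j)\<^sup>2) \<partial>M)"
    by (intro sum.cong refl Bochner_Integration.integral_sum[symmetric] int2) auto
  also have "\<dots> = (\<integral>\<omega>. (\<Sum>i<n. \<Sum>j<n. (U t k \<omega> i j)\<^sup>2) \<partial>M)"
    by (intro Bochner_Integration.integral_sum[symmetric] Bochner_Integration.integrable_sum int2) auto
  also have "\<dots> \<le> (\<integral>\<omega>. mu t \<omega> \<partial>M)"
  proof (rule integral_mono_AE)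
    show "AE \<omega> in M. (\<Sum>i<n. \<Sum>j<n. (U t k \<omega> i j)\<^sup>2) \<le> mu t \<omega>"
      using U_frob_le_mu[OF t] by eventually_elim (use k in auto)
  qed (intro Bochner_Integration.integrable_sum int2 mu_integrable t; simp)+
  finally show ?thesis .
qed

end

section \<open>The martingale step\<close>

lemma sq_sum3_le: "(a + b + c)\<^sup>2 \<le> 3 * (a\<^sup>2 + b\<^sup>2 + (c::real)\<^sup>2)"
proof -
  have "0 \<le> (a - b)\<^sup>2 + (b - c)\<^sup>2 + (a - c)\<^sup>2" by simp
  then show ?thesis by (simp add: power2_eq_square algebra_simps)
qed

lemma op_norm_sq_le_smooth_fn:
  assumes "0 < n" "symm n A" "0 < m" "0 < \<kappa>"
  shows "(op_norm n A)\<^sup>2 \<le> smooth_fn n m \<kappa> A"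
proof (cases "op_norm n A = 0")
  case False
  then have o: "0 < op_norm n A" using op_norm_nonneg[OF assms(1), of A] by simp
  have "(op_norm n A)\<^sup>2 = (op_norm n A ^ (2 * m)) powr (1 / real m)"
  proof -
    have "(op_norm n A ^ (2 * m)) powr (1 / real m) = op_norm n A powr (real (2 * m) * (1 / real m))"
      by (simp only: powr_realpow[OF o, symmetric] powr_powr)
    also have "real (2 * m) * (1 / real m) = real 2" using assms(3) by simp
    finally show ?thesis by (simp only: powr_realpow[OF o])
  qed
  also have "\<dots> \<le> smooth_fn n m \<kappa> A"
    unfolding smooth_fn_def using op_norm_power_le_tr[OF assms(1-3)] assms(4)
    by (intro powr_mono2) auto
  finally show ?thesis .
qed (simp add: smooth_fn_def)

text \<open>Makes the gradient square integrable. The base is at least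
  \<open>op_norm n A ^ (2 * m)\<close> and is raised to a nonpositive power, so the exponents
  \<open>2 - 2 * m\<close> and \<open>2 * m - 1\<close> of the operator norm add up to 1, uniformly
  in \<open>\<kappa>\<close>.\<close>

lemma abs_smooth_grad_le:
  assumes "0 < n" "symm n A" "0 < m" "0 < \<kappa>" "i < n" "j < n"
  shows "\<bar>smooth_grad n m \<kappa> A i j\<bar> \<le> 2 * op_norm n A"
proof -
  let ?t = "tr n (emb n A ^ (2 * m)) + \<kappa>" and ?o = "op_norm n A"
  have e: "\<bar>ent (emb n A ^ (2 * m - 1)) j i\<bar> \<le> ?o ^ (2 * m - 1)"
    by (rule abs_ent_power_le) (use assms in auto)
  have "?t powr (1 / real m - 1) * \<bar>ent (emb n A ^ (2 * m - 1)) j i\<bar> \<le> ?o"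
  proof (cases "?o = 0")
    case True
    moreover have "0 < 2 * m - 1" using assms(3) by simp
    then have "(0::real) ^ (2 * m - 1) = 0" by (simp only: power_eq_0_iff)
    ultimately have "ent (emb n A ^ (2 * m - 1)) j i = 0" using e by (simp only: abs_le_zero_iff)
    then show ?thesis using op_norm_nonneg[OF assms(1)] by simp
  next
    case False
    then have o: "0 < ?o" using op_norm_nonneg[OF assms(1), of A] by simp
    have "?t powr (1 / real m - 1) \<le> (?o ^ (2 * m)) powr (1 / real m - 1)"
      using op_norm_power_le_tr[OF assms(1-3)] assms o by (intro powr_mono2') auto
    also have "\<dots> = ?o powr (real (2 * m) * (1 / real m - 1))"
      by (simp only: powr_realpow[OF o, symmetric] powr_powr)
    also have "real (2 * m) * (1 / real m - 1) = 1 - real (2 * m - 1)"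
    proof -
      have "real (2 * m - 1) = 2 * real m - 1" using assms(3) by (simp add: of_nat_diff)
      moreover have "real (2 * m) * (1 / real m - 1) = 2 - 2 * real m" using assms(3) by (simp add: right_diff_distrib)
      ultimately show ?thesis by simp
    qed
    finally have "?t powr (1 / real m - 1) * \<bar>ent (emb n A ^ (2 * m - 1)) j i\<bar> \<le> ?o powr (1 - real (2 * m - 1)) * ?o ^ (2 * m - 1)"
      by (intro mult_mono e) auto
    also have "\<dots> = ?o powr (1 - real (2 * m - 1)) * ?o powr (real (2 * m - 1))"
      using o by (simp only: powr_realpow)
    also have "\<dots> = ?o powr (1 - real (2 * m - 1) + real (2 * m - 1))" by (rule powr_add[symmetric])
    also have "\<dots> = ?o" using o by simp
    finally show ?thesis .
  qed
  then show ?thesis by (simp add: smooth_grad_def abs_mult mult.assoc)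
qed

lemma ent_power_measurable:
  assumes A: "\<And>i j. i < n \<Longrightarrow> j < n \<Longrightarrow> (\<lambda>\<omega>. A \<omega> i j) \<in> borel_measurable M" and "i < n" "j < n"
  shows "(\<lambda>\<omega>. ent (emb n (A \<omega>) ^ k) i j) \<in> borel_measurable M"
  using assms(2,3)
proof (induction k arbitrary: i j)
  case (Suc k)
  have "(\<lambda>\<omega>. \<Sum>l<n. A \<omega> i l * ent (emb n (A \<omega>) ^ k) l j) \<in> borel_measurable M"
    using Suc A by (intro borel_measurable_sum borel_measurable_times) auto
  then show ?case using Suc.prems by (simp add: ent_mult[where n = n] ent_emb)
qed simp

lemma smooth_measurable:
  assumes A: "\<And>i j. i < n \<Longrightarrow> j < n \<Longrightarrow> (\<lambda>\<omega>. A \<omega> i j) \<in> borel_measurable M"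
  shows "(\<lambda>\<omega>. smooth_fn n m \<kappa> (A \<omega>)) \<in> borel_measurable M"
    and "i < n \<Longrightarrow> j < n \<Longrightarrow> (\<lambda>\<omega>. smooth_grad n m \<kappa> (A \<omega>) i j) \<in> borel_measurable M"
proof -
  have [measurable]: "(\<lambda>\<omega>. tr n (emb n (A \<omega>) ^ k)) \<in> borel_measurable M" for k
    unfolding tr_def by (intro borel_measurable_sum ent_power_measurable A) auto
  show "(\<lambda>\<omega>. smooth_fn n m \<kappa> (A \<omega>)) \<in> borel_measurable M"
    unfolding smooth_fn_def by measurable
  assume "i < n" "j < n"
  then have [measurable]: "(\<lambda>\<omega>. ent (emb n (A \<omega>) ^ k) j i) \<in> borel_measurable M" for k
    by (intro ent_power_measurable A)
  show "(\<lambda>\<omega>. smooth_grad n m \<kappa> (A \<omega>) i j) \<in> borel_measurable M"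
    unfolding smooth_grad_def by measurable
qed

context cmcar_sg
begin

text \<open>From \<open>batch_dev\<close>: \<open>1152 = 6 * 96 * 2\<close> and
  \<open>221187 = 6 * 96 * 384 + 3\<close>, where the 3 is the share of an unpaired sample.\<close>

definition CB :: real where "CB = 1152 * K4 + 221187 * Keta"

lemma Keta_pos: "0 < Keta" using c0_pos by (simp add: Keta_def)

lemma dev_sq_int: "1 \<le> t \<Longrightarrow> i < n \<Longrightarrow> j < n \<Longrightarrow> sq_int (\<lambda>\<omega>. dev t \<omega> i j)"
  unfolding dev_def by (intro sq_int_sum U_centered_sq_int) auto

lemma dev_norm_sq_int: "1 \<le> t \<Longrightarrow> sq_int (\<lambda>\<omega>. op_norm n (dev t \<omega>))"
  by (intro sq_int_op_norm n_pos dev_sq_int)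

text \<open>The batch is cut into two halves and at most one leftover sample. The halves have equal
  second moments by exchangeability, and the first is symmetrized with the second as its
  copy.\<close>

lemma batch_dev:
  assumes t: "1 \<le> t" "2 \<le> N t"
  shows "(\<integral>\<omega>. (op_norm n (dev t \<omega>))\<^sup>2 \<partial>M) \<le> CB * (ln (real n) * real (N t) * op_norm n S * (\<integral>\<omega>. rho t \<omega> \<partial>M)
     + (ln (real n))\<^sup>2 * (ln (real (N t)))\<^sup>2 * (\<integral>\<omega>. R2 t \<omega> \<partial>M))"
proof -
  define l where "l = ln (real n)"
  have l1: "1 \<le> l" unfolding l_def by (rule exponent_props(1)[OF n3])
  define d1 where "d1 \<omega> = op_norm n (\<lambda>i j. \<Sum>k<half t. U t k \<omega> i j - S i j)" for \<omega>
  define d2 where "d2 \<omega> = op_norm n (\<lambda>i j. \<Sum>k<half t. U t (half t + k) \<omega> i j - S i j)" for \<omega>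
  define d3 where "d3 \<omega> = op_norm n (\<lambda>i j. \<Sum>k<N t - 2 * half t. U t (2 * half t + k) \<omega> i j - S i j)" for \<omega>
  define I where "I = (\<integral>\<omega>. mu t \<omega> \<partial>M)"
  have I0: "0 \<le> I" unfolding I_def by (intro integral_nonneg_AE) (simp add: mu_nonneg)
  have s: "sq_int d1" "sq_int d2" "sq_int d3" unfolding d1_def d2_def d3_def
    using t by (auto intro!: sq_int_op_norm n_pos sq_int_sum U_centered_sq_int)
  have dev_le: "op_norm n (dev t \<omega>) \<le> d1 \<omega> + d2 \<omega> + d3 \<omega>" for \<omega>
  proof -
    have Nt: "N t = (half t + half t) + (N t - 2 * half t)" by simp
    have "dev t \<omega> = (\<lambda>i j. ((\<Sum>k<half t. U t k \<omega> i j - S i j) + (\<Sum>k<half t. U t (half t + k) \<omega> i j - S i j))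
        + (\<Sum>k<N t - 2 * half t. U t (2 * half t + k) \<omega> i j - S i j))"
    proof (intro ext)
      fix i j
      have "dev t \<omega> i j = (\<Sum>k<(half t + half t) + (N t - 2 * half t). U t k \<omega> i j - S i j)"
        unfolding dev_def using Nt by simp
      also have "\<dots> = ((\<Sum>k<half t. U t k \<omega> i j - S i j) + (\<Sum>k<half t. U t (half t + k) \<omega> i j - S i j))
        + (\<Sum>k<N t - 2 * half t. U t (2 * half t + k) \<omega> i j - S i j)"
        by (simp only: sum_lessThan_add mult_2)
      finally show "dev t \<omega> i j = ((\<Sum>k<half t. U t k \<omega> i j - S i j) + (\<Sum>k<half t. U t (half t + k) \<omega> i j - S i j))
        + (\<Sum>k<N t - 2 * half t. U t (2 * half t + k) \<omega> i j - S i j)" .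
    qed
    then have "op_norm n (dev t \<omega>) \<le> op_norm n (\<lambda>i j. (\<Sum>k<half t. U t k \<omega> i j - S i j) + (\<Sum>k<half t. U t (half t + k) \<omega> i j - S i j)) + d3 \<omega>"
      unfolding d3_def by (simp only: op_norm_triangle[OF n_pos])
    also have "op_norm n (\<lambda>i j. (\<Sum>k<half t. U t k \<omega> i j - S i j) + (\<Sum>k<half t. U t (half t + k) \<omega> i j - S i j)) \<le> d1 \<omega> + d2 \<omega>"
      unfolding d1_def d2_def by (rule op_norm_triangle[OF n_pos])
    finally show ?thesis by simp
  qed
  have "(\<integral>\<omega>. (op_norm n (dev t \<omega>))\<^sup>2 \<partial>M) \<le> (\<integral>\<omega>. 3 * ((d1 \<omega>)\<^sup>2 + (d2 \<omega>)\<^sup>2 + (d3 \<omega>)\<^sup>2) \<partial>M)"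
  proof (rule integral_mono)
    show "(op_norm n (dev t \<omega>))\<^sup>2 \<le> 3 * ((d1 \<omega>)\<^sup>2 + (d2 \<omega>)\<^sup>2 + (d3 \<omega>)\<^sup>2)" for \<omega>
      using power_mono[OF dev_le op_norm_nonneg[OF n_pos], of \<omega> 2] sq_sum3_le[of "d1 \<omega>" "d2 \<omega>" "d3 \<omega>"] by linarith
  qed (use s dev_norm_sq_int[OF t(1)] in \<open>auto simp: sq_int_def\<close>)
  also have "\<dots> = 3 * ((\<integral>\<omega>. (d1 \<omega>)\<^sup>2 \<partial>M) + (\<integral>\<omega>. (d2 \<omega>)\<^sup>2 \<partial>M) + (\<integral>\<omega>. (d3 \<omega>)\<^sup>2 \<partial>M))"
    using s by (simp add: sq_int_def)
  also have "(\<integral>\<omega>. (d2 \<omega>)\<^sup>2 \<partial>M) = (\<integral>\<omega>. (d1 \<omega>)\<^sup>2 \<partial>M)"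
    using half_exchange[OF t(1) T1_measurable[OF t(1)], where C = S and p = 2] by (simp add: d1_def d2_def T1_Y)
  also have "3 * ((\<integral>\<omega>. (d1 \<omega>)\<^sup>2 \<partial>M) + (\<integral>\<omega>. (d1 \<omega>)\<^sup>2 \<partial>M) + (\<integral>\<omega>. (d3 \<omega>)\<^sup>2 \<partial>M))
     \<le> 6 * (96 * l * (\<integral>\<omega>. sum_sq_norm t \<omega> \<partial>M)) + 3 * I"
  proof -
    have "(\<integral>\<omega>. (op_norm n (hdiff t (T1 t) \<omega> (Yv t id \<omega>)))\<^sup>2 \<partial>M) \<le> 48 * ln (real n) * (\<integral>\<omega>. 2 * sum_sq_norm t \<omega> \<partial>M)"
    proof (rule symmetrized_second_moment[OF t(1) T1_measurable[OF t(1)] T1_symm])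
      have "sq_int (\<lambda>\<omega>. op_norm n (hdiff t (T1 t) \<omega> (Yv t id \<omega>)))"
        unfolding hdiff_Y T1_Y using t by (auto intro!: sq_int_op_norm n_pos sq_int_diff sq_int_sum U_sq_int)
      then show "integrable M (\<lambda>\<omega>. (op_norm n (hdiff t (T1 t) \<omega> (Yv t id \<omega>)))\<^sup>2)" by (simp add: sq_int_def)
      show "integrable M (\<lambda>\<omega>. 2 * sum_sq_norm t \<omega>)" using sum_sq_norm_integrable[OF t(1)] by simp
      show "AE \<omega> in M. \<forall>u. L2_set u {..<n} = 1 \<longrightarrow>
         (\<Sum>k<half t. (L2_set (mv n (\<lambda>i j. T1 t \<omega> (Y t k \<omega>) i j - T1 t \<omega> (Y t (half t + k) \<omega>) i j) u) {..<n})\<^sup>2) \<le> 2 * sum_sq_norm t \<omega>"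
        unfolding T1_Y using sum_sq_U_diff_le by (intro AE_I2) blast
    qed
    then have "(\<integral>\<omega>. (d1 \<omega>)\<^sup>2 \<partial>M) \<le> 96 * l * (\<integral>\<omega>. sum_sq_norm t \<omega> \<partial>M)"
      using first_half_dev_le[OF t(1)] by (simp add: d1_def l_def)
    \<comment> \<open>\<open>d3\<close> collects \<open>N t - 2 * half t\<close> samples: none for
      an even batch, one for an odd batch.\<close>
    moreover have "(\<integral>\<omega>. (d3 \<omega>)\<^sup>2 \<partial>M) \<le> I"
    proof (cases "even (N t)")
      case True
      then have "N t - 2 * half t = 0" by simp
      then have "d3 \<omega> = 0" for \<omega>
        using op_norm_sq_le_frob[OF n_pos, of "\<lambda>i j. 0"] by (simp add: d3_def)
      then show ?thesis using I0 by simp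
    next
      case False
      then have "N t - 2 * half t = 1" by presburger
      moreover have "2 * half t < N t" using False by presburger
      ultimately show ?thesis using single_dev_le[OF t(1), of "2 * half t"] by (simp add: d3_def I_def)
    qed
    moreover have "3 * (a + a + b) \<le> 6 * u + 3 * v" if "a \<le> u" "b \<le> v" for a b u v :: real
      using that by simp
    ultimately show ?thesis by blast
  qed
  also have "\<dots> \<le> 6 * (96 * l * (2 * real (N t) * K4 * op_norm n S * (\<integral>\<omega>. rho t \<omega> \<partial>M) + 384 * l * I)) + 3 * I"
    using sum_sq_norm_expectation[OF t(1)] l1 unfolding I_def l_def
    by (intro add_right_mono mult_left_mono) auto
  also have "\<dots> = 1152 * K4 * (l * real (N t) * op_norm n S * (\<integral>\<omega>. rho t \<omega> \<partial>M)) + (221184 * l\<^sup>2 + 3) * I"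
    by (simp add: power2_eq_square algebra_simps)
  also have "\<dots> \<le> 1152 * K4 * (l * real (N t) * op_norm n S * (\<integral>\<omega>. rho t \<omega> \<partial>M)) + (221187 * l\<^sup>2) * (Keta * (ln (real (N t)))\<^sup>2 * (\<integral>\<omega>. R2 t \<omega> \<partial>M))"
  proof (intro add_left_mono mult_mono)
    have "1 \<le> l\<^sup>2" using l1 by (rule one_le_power)
    then show "221184 * l\<^sup>2 + 3 \<le> 221187 * l\<^sup>2" by simp
    show "I \<le> Keta * (ln (real (N t)))\<^sup>2 * (\<integral>\<omega>. R2 t \<omega> \<partial>M)" unfolding I_def by (rule mu_expectation[OF t])
  qed (use I0 in auto)
  also have "\<dots> \<le> CB * (l * real (N t) * op_norm n S * (\<integral>\<omega>. rho t \<omega> \<partial>M))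
      + CB * (l\<^sup>2 * (ln (real (N t)))\<^sup>2 * (\<integral>\<omega>. R2 t \<omega> \<partial>M))"
  proof -
    have a: "0 \<le> l * real (N t) * op_norm n S * (\<integral>\<omega>. rho t \<omega> \<partial>M)"
      using l1 op_norm_S_pos rho_nonneg by (intro mult_nonneg_nonneg integral_nonneg_AE) auto
    have b: "0 \<le> l\<^sup>2 * (ln (real (N t)))\<^sup>2 * (\<integral>\<omega>. R2 t \<omega> \<partial>M)"
      using R2_nonneg by (intro mult_nonneg_nonneg integral_nonneg_AE) auto
    have "1152 * K4 \<le> CB" "221187 * Keta \<le> CB" using K4_pos Keta_pos by (auto simp: CB_def)
    from mult_right_mono[OF this(1) a] mult_right_mono[OF this(2) b] show ?thesis by (simp add: mult_ac)
  qed
  finally show ?thesis by (simp add: l_def ring_distribs)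
qed

section \<open>The martingale of centred batch sums\<close>

lemma dev_symm: "symm n (dev t \<omega>)"
  using U_symm[of t _ \<omega>] S_symm unfolding symm_def dev_def by (intro allI impI sum.cong refl) simp

lemma U_F_next:
  assumes "1 \<le> t" "t < s" "k < N t" "i < n" "j < n"
  shows "(\<lambda>\<omega>. U t k \<omega> i j) \<in> borel_measurable (F s)"
proof -
  have "(\<lambda>\<omega>. Y t k \<omega> i) \<in> borel_measurable (F s)" if "i < n" for i
    using measurable_compose[OF Y_F[OF assms(1-3)] measurable_component_singleton, of i] that by auto
  moreover have "(\<lambda>\<omega>. gam t \<omega> i j) \<in> borel_measurable (F s)"
    by (rule measurable_from_subalg[OF F_mono gam_F]) (use assms in auto)
  ultimately show ?thesis unfolding U_def using assms by (intro borel_measurable_times) auto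
qed

lemma dev_F_next: "1 \<le> t \<Longrightarrow> t < s \<Longrightarrow> i < n \<Longrightarrow> j < n \<Longrightarrow> (\<lambda>\<omega>. dev t \<omega> i j) \<in> borel_measurable (F s)"
  unfolding dev_def by (intro borel_measurable_sum borel_measurable_diff U_F_next) auto

text \<open>Martingale difference property in the form in which it cancels the first-order term of
  the Taylor bound: \<open>g\<close> will be an entry of the gradient at the previous partial
  sum.\<close>

lemma dev_orthogonal:
  assumes t: "1 \<le> t" and ij: "i < n" "j < n" and g: "g \<in> borel_measurable (F t)" "sq_int g"
  shows "(\<integral>\<omega>. g \<omega> * dev t \<omega> i j \<partial>M) = 0"
proof -
  have "(\<integral>\<omega>. g \<omega> * (U t k \<omega> i j - S i j) \<partial>M) = 0" if k: "k < N t" for k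
  proof -
    note Us = U_centered_sq_int[OF t k ij] and U = U_cond_exp[OF t k ij]
    have Si: "integrable M (\<lambda>\<omega>. S i j)" by simp
    have "(\<integral>\<omega>. g \<omega> * (U t k \<omega> i j - S i j) \<partial>M) = (\<integral>\<omega>. g \<omega> * real_cond_exp M (F t) (\<lambda>\<omega>. U t k \<omega> i j - S i j) \<omega> \<partial>M)"
      by (rule sigma_finite_subalgebra.real_cond_exp_intg(2)[OF F_sigma_finite sq_int_mult[OF g(2) Us] g(1) sq_int_measurable[OF Us], symmetric])
    also have "\<dots> = (\<integral>\<omega>. 0 \<partial>M)"
    proof (rule integral_cong_AE)
      have "AE \<omega> in M. real_cond_exp M (F t) (\<lambda>\<omega>. S i j) \<omega> = S i j"
        by (rule sigma_finite_subalgebra.real_cond_exp_F_meas[OF F_sigma_finite Si]) simp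
      moreover note U(2) sigma_finite_subalgebra.real_cond_exp_diff[OF F_sigma_finite U(1) Si, of t]
      ultimately show "AE \<omega> in M. g \<omega> * real_cond_exp M (F t) (\<lambda>\<omega>. U t k \<omega> i j - S i j) \<omega> = 0"
        by eventually_elim simp
    qed (use sq_int_measurable[OF g(2)] in auto)
    finally show ?thesis by simp
  qed
  then have "(\<Sum>k<N t. \<integral>\<omega>. g \<omega> * (U t k \<omega> i j - S i j) \<partial>M) = 0" by simp
  moreover have "(\<integral>\<omega>. g \<omega> * dev t \<omega> i j \<partial>M) = (\<Sum>k<N t. \<integral>\<omega>. g \<omega> * (U t k \<omega> i j - S i j) \<partial>M)"
    unfolding dev_def sum_distrib_left
    by (intro Bochner_Integration.integral_sum sq_int_mult g U_centered_sq_int t ij) auto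
  ultimately show ?thesis by simp
qed

definition mart :: "nat \<Rightarrow> 'w \<Rightarrow> rmat" where
  "mart T \<omega> i j = (\<Sum>t=1..T. dev t \<omega> i j)"

lemma mart_symm: "symm n (mart T \<omega>)"
  using dev_symm[of _ \<omega>] unfolding symm_def mart_def by (intro allI impI sum.cong refl) simp

lemma mart_sq_int: "i < n \<Longrightarrow> j < n \<Longrightarrow> sq_int (\<lambda>\<omega>. mart T \<omega> i j)"
  unfolding mart_def by (intro sq_int_sum dev_sq_int) auto

lemma mart_F: "i < n \<Longrightarrow> j < n \<Longrightarrow> (\<lambda>\<omega>. mart T \<omega> i j) \<in> borel_measurable (F (Suc T))"
  unfolding mart_def by (intro borel_measurable_sum dev_F_next) auto

text \<open>The gradient at \<open>mart T\<close> is a function of the past of batch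
  \<open>Suc T\<close>, so the linear term has mean zero and only the quadratic remainders
  accumulate. Integrability is carried in the induction because it comes from the same upper
  bound.\<close>

lemma smooth_mart:
  assumes \<kappa>: "0 < \<kappa>"
  defines "m \<equiv> nat \<lceil>ln (real n)\<rceil>"
  shows "integrable M (\<lambda>\<omega>. smooth_fn n m \<kappa> (mart T \<omega>)) \<and>
    (\<integral>\<omega>. smooth_fn n m \<kappa> (mart T \<omega>) \<partial>M) \<le> \<kappa> powr (1 / real m) + 24 * ln (real n) * (\<Sum>t=1..T. \<integral>\<omega>. (op_norm n (dev t \<omega>))\<^sup>2 \<partial>M)"
proof (induction T)
  case 0
  have m: "0 < m" unfolding m_def by (rule exponent_props(2)[OF n3])
  have "mart 0 \<omega> = (\<lambda>i j. 0)" for \<omega> by (simp add: mart_def fun_eq_iff)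
  then have "smooth_fn n m \<kappa> (mart 0 \<omega>) = \<kappa> powr (1 / real m)" for \<omega>
    using m by (simp add: smooth_fn_def emb_simps power_0_left)
  then show ?case by (simp add: prob_space)
next
  case (Suc T)
  have m: "0 < m" unfolding m_def by (rule exponent_props(2)[OF n3])
  define g where "g i j \<omega> = smooth_grad n m \<kappa> (mart T \<omega>) i j" for i j \<omega>
  have gF: "g i j \<in> borel_measurable (F (Suc T))" if "i < n" "j < n" for i j
    unfolding g_def by (rule smooth_measurable(2)[OF mart_F that])
  have gs: "sq_int (g i j)" if ij: "i < n" "j < n" for i j
  proof -
    have gM: "g i j \<in> borel_measurable M" by (rule measurable_from_subalg[OF F_subalgebra gF[OF ij]])
    have on: "sq_int (\<lambda>\<omega>. 2 * op_norm n (mart T \<omega>))" by (intro sq_int_cmult sq_int_op_norm n_pos mart_sq_int)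
    have "integrable M (\<lambda>\<omega>. (g i j \<omega>)\<^sup>2)"
    proof (rule Bochner_Integration.integrable_bound[where f = "\<lambda>\<omega>. (2 * op_norm n (mart T \<omega>))\<^sup>2"])
      show "integrable M (\<lambda>\<omega>. (2 * op_norm n (mart T \<omega>))\<^sup>2)" using on by (simp add: sq_int_def)
      show "AE \<omega> in M. norm ((g i j \<omega>)\<^sup>2) \<le> norm ((2 * op_norm n (mart T \<omega>))\<^sup>2)"
      proof (rule AE_I2)
        fix \<omega>
        have "\<bar>g i j \<omega>\<bar>\<^sup>2 \<le> (2 * op_norm n (mart T \<omega>))\<^sup>2"
          unfolding g_def by (intro power_mono abs_smooth_grad_le n_pos mart_symm m \<kappa> ij) simp
        then show "norm ((g i j \<omega>)\<^sup>2) \<le> norm ((2 * op_norm n (mart T \<omega>))\<^sup>2)" by simp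
      qed
    qed (use gM in simp)
    then show ?thesis using gM by (simp add: sq_int_def)
  qed
  have t: "1 \<le> Suc T" by simp
  define r where "r \<omega> = smooth_fn n m \<kappa> (mart T \<omega>) + (\<Sum>i<n. \<Sum>j<n. g i j \<omega> * dev (Suc T) \<omega> i j)
     + 24 * ln (real n) * (op_norm n (dev (Suc T) \<omega>))\<^sup>2" for \<omega>
  have gd: "integrable M (\<lambda>\<omega>. g i j \<omega> * dev (Suc T) \<omega> i j)" if "i < n" "j < n" for i j
    by (intro sq_int_mult gs dev_sq_int that t)
  have sumi: "integrable M (\<lambda>\<omega>. \<Sum>i<n. \<Sum>j<n. g i j \<omega> * dev (Suc T) \<omega> i j)"
    by (intro Bochner_Integration.integrable_sum gd) auto
  have d2: "integrable M (\<lambda>\<omega>. (op_norm n (dev (Suc T) \<omega>))\<^sup>2)"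
    using dev_norm_sq_int[OF t] by (simp add: sq_int_def)
  have ri: "integrable M r" unfolding r_def using Suc.IH sumi d2 by simp
  have le: "smooth_fn n m \<kappa> (mart (Suc T) \<omega>) \<le> r \<omega>" for \<omega>
  proof -
    have "mart (Suc T) \<omega> = (\<lambda>i j. mart T \<omega> i j + dev (Suc T) \<omega> i j)" by (simp add: mart_def fun_eq_iff)
    then show ?thesis
      using smooth_fn_le[OF n3 mart_symm dev_symm \<kappa>, of T \<omega> "Suc T" \<omega>] unfolding m_def[symmetric] r_def g_def by simp
  qed
  have nn: "0 \<le> smooth_fn n m \<kappa> A" for A by (simp add: smooth_fn_def)
  have si: "integrable M (\<lambda>\<omega>. smooth_fn n m \<kappa> (mart (Suc T) \<omega>))"
  proof (rule Bochner_Integration.integrable_bound[OF ri])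
    show "(\<lambda>\<omega>. smooth_fn n m \<kappa> (mart (Suc T) \<omega>)) \<in> borel_measurable M"
      by (intro smooth_measurable sq_int_measurable mart_sq_int)
    show "AE \<omega> in M. norm (smooth_fn n m \<kappa> (mart (Suc T) \<omega>)) \<le> norm (r \<omega>)"
      using le nn by (intro AE_I2) (simp add: order_trans[OF le abs_ge_self])
  qed
  have "(\<integral>\<omega>. smooth_fn n m \<kappa> (mart (Suc T) \<omega>) \<partial>M) \<le> (\<integral>\<omega>. r \<omega> \<partial>M)" by (intro integral_mono si ri le)
  also have "\<dots> = (\<integral>\<omega>. smooth_fn n m \<kappa> (mart T \<omega>) \<partial>M) + (\<integral>\<omega>. (\<Sum>i<n. \<Sum>j<n. g i j \<omega> * dev (Suc T) \<omega> i j) \<partial>M)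
     + 24 * ln (real n) * (\<integral>\<omega>. (op_norm n (dev (Suc T) \<omega>))\<^sup>2 \<partial>M)"
    unfolding r_def using Suc.IH sumi d2 by simp
  also have "(\<integral>\<omega>. (\<Sum>i<n. \<Sum>j<n. g i j \<omega> * dev (Suc T) \<omega> i j) \<partial>M) = (\<Sum>i<n. \<integral>\<omega>. (\<Sum>j<n. g i j \<omega> * dev (Suc T) \<omega> i j) \<partial>M)"
    by (intro Bochner_Integration.integral_sum Bochner_Integration.integrable_sum gd) auto
  also have "\<dots> = (\<Sum>i<n. \<Sum>j<n. \<integral>\<omega>. g i j \<omega> * dev (Suc T) \<omega> i j \<partial>M)"
    by (intro sum.cong refl Bochner_Integration.integral_sum gd) auto
  also have "\<dots> = 0" by (intro sum.neutral ballI dev_orthogonal[OF t _ _ gF gs]) auto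
  finally show ?case using Suc.IH si by (simp add: ring_distribs)
qed

lemma mart_second_moment:
  "(\<integral>\<omega>. (op_norm n (mart T \<omega>))\<^sup>2 \<partial>M) \<le> 24 * ln (real n) * (\<Sum>t=1..T. \<integral>\<omega>. (op_norm n (dev t \<omega>))\<^sup>2 \<partial>M)"
proof (rule field_le_epsilon)
  fix e :: real assume e: "0 < e"
  define m where "m = nat \<lceil>ln (real n)\<rceil>"
  have m: "0 < m" unfolding m_def by (rule exponent_props(2)[OF n3])
  \<comment> \<open>Chosen so that \<open>\<kappa> powr (1 / m) = e\<close>: the regularization
    costs exactly the arbitrary error \<open>e\<close>.\<close>
  define \<kappa> where "\<kappa> = e powr real m"
  have \<kappa>: "0 < \<kappa>" using e by (simp add: \<kappa>_def)
  have \<kappa>e: "\<kappa> powr (1 / real m) = e" using e m by (simp add: \<kappa>_def powr_powr)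
  note sm = smooth_mart[OF \<kappa>, of T, folded m_def]
  have "sq_int (\<lambda>\<omega>. op_norm n (mart T \<omega>))" by (intro sq_int_op_norm n_pos mart_sq_int)
  then have "(\<integral>\<omega>. (op_norm n (mart T \<omega>))\<^sup>2 \<partial>M) \<le> (\<integral>\<omega>. smooth_fn n m \<kappa> (mart T \<omega>) \<partial>M)"
    using sm by (intro integral_mono op_norm_sq_le_smooth_fn n_pos mart_symm m \<kappa>) (auto simp: sq_int_def)
  then show "(\<integral>\<omega>. (op_norm n (mart T \<omega>))\<^sup>2 \<partial>M) \<le> 24 * ln (real n) * (\<Sum>t=1..T. \<integral>\<omega>. (op_norm n (dev t \<omega>))\<^sup>2 \<partial>M) + e"
    using sm by (simp add: \<kappa>e)
qed

section \<open>From the martingale to the estimator\<close>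

lemma P_measurable: "1 \<le> t \<Longrightarrow> i < n \<Longrightarrow> j < n \<Longrightarrow> (\<lambda>\<omega>. P t \<omega> i j) \<in> borel_measurable M"
  by (rule measurable_from_subalg[OF F_subalgebra P_past_measurable])

lemma cov_est_error_eq:
  assumes g: "\<forall>t\<in>{1..T}. \<forall>i\<in>{..<n}. \<forall>j\<in>{..<n}. gam t \<omega> i j = 1 / P t \<omega> i j"
    and pos: "0 < (\<Sum>t=1..T. N t)" and ij: "i < n" "j < n"
  shows "cov_est n N Y P T \<omega> i j - S i j = (1 / real (\<Sum>t=1..T. N t)) * mart T \<omega> i j"
proof -
  have Z: "Z_mat n N Y P t \<omega> i j = dev t \<omega> i j + real (N t) * S i j" if "t \<in> {1..T}" for t
  proof -
    have "gam t \<omega> i j = 1 / P t \<omega> i j" using g that ij by blast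
    then have "Z_mat n N Y P t \<omega> i j = (\<Sum>k<N t. U t k \<omega> i j)"
      using ij by (simp add: Z_mat_def U_def sum_divide_distrib)
    then show ?thesis by (simp add: dev_def sum_subtractf)
  qed
  have "(\<Sum>t=1..T. Z_mat n N Y P t \<omega> i j) = (\<Sum>t=1..T. dev t \<omega> i j + real (N t) * S i j)"
    by (rule sum.cong[OF refl Z])
  also have "\<dots> = mart T \<omega> i j + real (\<Sum>t=1..T. N t) * S i j"
    by (simp add: mart_def sum.distrib sum_distrib_right)
  finally have s: "(\<Sum>t=1..T. Z_mat n N Y P t \<omega> i j) = mart T \<omega> i j + real (\<Sum>t=1..T. N t) * S i j" .
  have "real (\<Sum>t=1..T. N t) > 0" using pos by (simp only: of_nat_0_less_iff)
  then show ?thesis unfolding cov_est_def s by (simp add: field_simps)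
qed

lemma gam_eq_all: "AE \<omega> in M. \<forall>t\<in>{1..T}. \<forall>i\<in>{..<n}. \<forall>j\<in>{..<n}. gam t \<omega> i j = 1 / P t \<omega> i j"
  by (intro AE_finite_allI gam_eq) auto

lemma r_min_eq:
  assumes "\<forall>i\<in>{..<n}. \<forall>j\<in>{..<n}. gam t \<omega> i j = 1 / P t \<omega> i j"
  shows "r_min n S (P t \<omega>) = rho t \<omega> / op_norm n S"
proof -
  have "(\<lambda>j. \<Sum>i<n. S i i / P t \<omega> i j) ` {..<n} = (\<lambda>j. \<Sum>i<n. S i i * gam t \<omega> i j) ` {..<n}"
    using assms by (intro image_cong refl sum.cong) simp_all
  then show ?thesis by (simp add: r_min_def rho_def)
qed

lemma r_two_sq_eq:
  assumes "\<forall>i\<in>{..<n}. \<forall>j\<in>{..<n}. gam t \<omega> i j = 1 / P t \<omega> i j"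
  shows "(r_two n S (P t \<omega>))\<^sup>2 = R2 t \<omega> / (op_norm n S)\<^sup>2"
proof -
  have "(\<Sum>i<n. \<Sum>j<n. S i i * S j j / (P t \<omega> i j)\<^sup>2) = R2 t \<omega>"
    unfolding R2_def using assms by (intro sum.cong refl) (simp add: power_divide)
  then show ?thesis using R2_nonneg[of t \<omega>] by (simp add: r_two_def power_mult_distrib power_divide)
qed

lemma eps_one_eq:
  "eps_one M n N S P T = (\<Sum>t=1..T. real (N t) * (\<integral>\<omega>. rho t \<omega> \<partial>M)) / (op_norm n S * real (\<Sum>t=1..T. N t))"
proof -
  let ?N = "real (\<Sum>t=1..T. N t)"
  have "eps_one M n N S P T = (\<integral>\<omega>. (1 / ?N) * (\<Sum>t=1..T. rho t \<omega> / op_norm n S * real (N t)) \<partial>M)"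
    unfolding eps_one_def
  proof (rule integral_cong_AE)
    have "(\<lambda>\<omega>. r_min n S (P t \<omega>)) \<in> borel_measurable M" if "1 \<le> t" for t
      unfolding r_min_def using P_measurable that
      by (intro borel_measurable_times borel_measurable_Max borel_measurable_sum borel_measurable_divide) auto
    then show "(\<lambda>\<omega>. (1 / ?N) * (\<Sum>t=1..T. r_min n S (P t \<omega>) * real (N t))) \<in> borel_measurable M"
      by (intro borel_measurable_times borel_measurable_sum) auto
    show "(\<lambda>\<omega>. (1 / ?N) * (\<Sum>t=1..T. rho t \<omega> / op_norm n S * real (N t))) \<in> borel_measurable M"
      by (intro borel_measurable_times borel_measurable_sum borel_measurable_divide rho_measurable) auto
    show "AE \<omega> in M. (1 / ?N) * (\<Sum>t=1..T. r_min n S (P t \<omega>) * real (N t)) = (1 / ?N) * (\<Sum>t=1..T. rho t \<omega> / op_norm n S * real (N t))"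
      using gam_eq_all[of T]
    proof eventually_elim
      case (elim \<omega>)
      then have "(\<Sum>t=1..T. r_min n S (P t \<omega>) * real (N t)) = (\<Sum>t=1..T. rho t \<omega> / op_norm n S * real (N t))"
        by (intro sum.cong refl) (simp add: r_min_eq)
      then show ?case by simp
    qed
  qed
  also have "\<dots> = (1 / ?N) * (\<integral>\<omega>. (\<Sum>t=1..T. rho t \<omega> / op_norm n S * real (N t)) \<partial>M)" by (rule integral_mult_right_zero)
  also have "(\<integral>\<omega>. (\<Sum>t=1..T. rho t \<omega> / op_norm n S * real (N t)) \<partial>M) = (\<Sum>t=1..T. \<integral>\<omega>. rho t \<omega> / op_norm n S * real (N t) \<partial>M)"
    by (intro Bochner_Integration.integral_sum integrable_mult_left integrable_divide rho_integrable) auto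
  also have "\<dots> = (\<Sum>t=1..T. real (N t) * (\<integral>\<omega>. rho t \<omega> \<partial>M)) / op_norm n S"
    by (simp add: sum_divide_distrib mult.commute)
  finally show ?thesis by (simp add: mult.commute)
qed

text \<open>Positivity of \<open>L_log\<close> clears the denominator; for
  \<open>L_log N T = 0\<close> the convention on division would make \<open>eps_two\<close> equal to
  0.\<close>

lemma eps_two_sq_eq:
  "(eps_two M n N S P T)\<^sup>2 * (L_log N T)\<^sup>2 * (op_norm n S)\<^sup>2 = (\<Sum>t=1..T. (ln (real (N t)))\<^sup>2 * (\<integral>\<omega>. R2 t \<omega> \<partial>M))"
  if L: "0 < L_log N T"
proof -
  let ?L = "(L_log N T)\<^sup>2" and ?a = "(op_norm n S)\<^sup>2"
  define I where "I = (\<integral>\<omega>. (1 / ?L) * (\<Sum>t=1..T. (r_two n S (P t \<omega>))\<^sup>2 * (ln (real (N t)))\<^sup>2) \<partial>M)"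
  have "I = (\<integral>\<omega>. (1 / ?L) * (\<Sum>t=1..T. R2 t \<omega> / ?a * (ln (real (N t)))\<^sup>2) \<partial>M)"
    unfolding I_def
  proof (rule integral_cong_AE)
    have "(\<lambda>\<omega>. r_two n S (P t \<omega>)) \<in> borel_measurable M" if "1 \<le> t" for t
    proof -
      have "(\<lambda>\<omega>. \<Sum>i<n. \<Sum>j<n. S i i * S j j / (P t \<omega> i j)\<^sup>2) \<in> borel_measurable M"
        using P_measurable that
        by (intro borel_measurable_sum borel_measurable_divide borel_measurable_power) auto
      then show ?thesis unfolding r_two_def by measurable
    qed
    then show "(\<lambda>\<omega>. (1 / ?L) * (\<Sum>t=1..T. (r_two n S (P t \<omega>))\<^sup>2 * (ln (real (N t)))\<^sup>2)) \<in> borel_measurable M"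
      by (intro borel_measurable_times borel_measurable_sum borel_measurable_power) auto
    have "R2 t \<in> borel_measurable M" if "1 \<le> t" for t using R2_integrable[OF that] by auto
    then show "(\<lambda>\<omega>. (1 / ?L) * (\<Sum>t=1..T. R2 t \<omega> / ?a * (ln (real (N t)))\<^sup>2)) \<in> borel_measurable M"
      by (intro borel_measurable_times borel_measurable_sum borel_measurable_divide) auto
    show "AE \<omega> in M. (1 / ?L) * (\<Sum>t=1..T. (r_two n S (P t \<omega>))\<^sup>2 * (ln (real (N t)))\<^sup>2)
        = (1 / ?L) * (\<Sum>t=1..T. R2 t \<omega> / ?a * (ln (real (N t)))\<^sup>2)"
      using gam_eq_all[of T]
    proof eventually_elim
      case (elim \<omega>)
      then have "(\<Sum>t=1..T. (r_two n S (P t \<omega>))\<^sup>2 * (ln (real (N t)))\<^sup>2) = (\<Sum>t=1..T. R2 t \<omega> / ?a * (ln (real (N t)))\<^sup>2)"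
        by (intro sum.cong refl) (simp add: r_two_sq_eq)
      then show ?case by simp
    qed
  qed
  also have "\<dots> = (1 / ?L) * (\<integral>\<omega>. (\<Sum>t=1..T. R2 t \<omega> / ?a * (ln (real (N t)))\<^sup>2) \<partial>M)" by (rule integral_mult_right_zero)
  also have "(\<integral>\<omega>. (\<Sum>t=1..T. R2 t \<omega> / ?a * (ln (real (N t)))\<^sup>2) \<partial>M) = (\<Sum>t=1..T. \<integral>\<omega>. R2 t \<omega> / ?a * (ln (real (N t)))\<^sup>2 \<partial>M)"
    by (intro Bochner_Integration.integral_sum integrable_mult_left integrable_divide R2_integrable) auto
  also have "\<dots> = (\<Sum>t=1..T. (ln (real (N t)))\<^sup>2 * (\<integral>\<omega>. R2 t \<omega> \<partial>M)) / ?a"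
    by (simp add: sum_divide_distrib mult.commute)
  finally have I: "I = (1 / ?L) * ((\<Sum>t=1..T. (ln (real (N t)))\<^sup>2 * (\<integral>\<omega>. R2 t \<omega> \<partial>M)) / ?a)" .
  have "0 \<le> I" unfolding I_def
    by (intro integral_nonneg_AE AE_I2 mult_nonneg_nonneg sum_nonneg) auto
  then have "(eps_two M n N S P T)\<^sup>2 = I" unfolding eps_two_def I_def by (rule real_sqrt_pow2)
  then show ?thesis using L op_norm_S_pos unfolding I by simp
qed

lemma eps_nonneg: "0 \<le> eps_one M n N S P T" "0 \<le> eps_two M n N S P T"
proof -
  show "0 \<le> eps_one M n N S P T"
    unfolding eps_one_eq using op_norm_S_pos rho_nonneg
    by (intro divide_nonneg_nonneg sum_nonneg mult_nonneg_nonneg integral_nonneg_AE of_nat_0_le_iff) auto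
  show "0 \<le> eps_two M n N S P T"
    unfolding eps_two_def
    by (intro real_sqrt_ge_zero integral_nonneg_AE AE_I2 mult_nonneg_nonneg sum_nonneg) auto
qed

text \<open>The smoothness bound contributes one \<open>ln n\<close>, which becomes
  \<open>sqrt (ln (n + 1))\<close> in front; the batch bounds contribute \<open>ln n\<close> and its
  square, which become the logarithms inside the bracket after the square root.\<close>

theorem cov_est_error_bound:
  assumes pos: "0 < (\<Sum>t=1..T. N t)" and N2: "\<forall>t\<in>{1..T}. 2 \<le> N t"
  defines "Ntot \<equiv> real (\<Sum>t=1..T. N t)"
    and "err \<equiv> \<lambda>\<omega>. op_norm n (\<lambda>i j. cov_est n N Y P T \<omega> i j - S i j)"
  shows "integrable M (\<lambda>\<omega>. (err \<omega>)\<^sup>2)"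
    and "sqrt (\<integral>\<omega>. (err \<omega>)\<^sup>2 \<partial>M) \<le> sqrt (24 * CB) * op_norm n S * sqrt (ln (real n + 1)) *
            (sqrt (8 * exp 1 * ln (real n) / Ntot * eps_one M n N S P T)
             + 4 * (exp 1)\<^sup>2 * ln (real n) * L_log N T / Ntot * eps_two M n N S P T)"
proof -
  have Np: "0 < Ntot" unfolding Ntot_def using pos by (simp only: of_nat_0_less_iff)
  define l where "l = ln (real n)"
  have l: "1 \<le> l" unfolding l_def by (rule exponent_props(1)[OF n3])
  have ms: "sq_int (\<lambda>\<omega>. op_norm n (mart T \<omega>))" by (intro sq_int_op_norm n_pos mart_sq_int)
  have errm: "err \<in> borel_measurable M"
    unfolding err_def
  proof (intro op_norm_measurable n_pos borel_measurable_diff borel_measurable_const)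
    fix i j assume ij: "i < n" "j < n"
    have "(\<lambda>\<omega>. Z_mat n N Y P t \<omega> i j) \<in> borel_measurable M" if "1 \<le> t" for t
    proof -
      have "(\<lambda>\<omega>. (\<Sum>k<N t. Y t k \<omega> i * Y t k \<omega> j) * (1 / P t \<omega> i j)) \<in> borel_measurable M"
        using that ij P_measurable[OF that ij]
        by (intro borel_measurable_times borel_measurable_sum borel_measurable_divide Y_component_measurable) auto
      then show ?thesis using ij by (simp add: Z_mat_def)
    qed
    then show "(\<lambda>\<omega>. cov_est n N Y P T \<omega> i j) \<in> borel_measurable M"
      unfolding cov_est_def by (intro borel_measurable_divide borel_measurable_sum) auto
  qed
  have err_le: "AE \<omega> in M. (err \<omega>)\<^sup>2 \<le> (1 / Ntot)\<^sup>2 * (op_norm n (mart T \<omega>))\<^sup>2"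
    using gam_eq_all[of T]
  proof eventually_elim
    case (elim \<omega>)
    have "err \<omega> = op_norm n (\<lambda>i j. (1 / Ntot) * mart T \<omega> i j)"
      unfolding err_def Ntot_def by (intro op_norm_cong cov_est_error_eq elim pos)
    also have "\<dots> \<le> (1 / Ntot) * op_norm n (mart T \<omega>)" using Np by (intro op_norm_scale n_pos) simp
    finally have "(err \<omega>)\<^sup>2 \<le> ((1 / Ntot) * op_norm n (mart T \<omega>))\<^sup>2"
      by (rule power_mono) (simp add: err_def op_norm_nonneg n_pos)
    then show ?case by (simp only: power_mult_distrib)
  qed
  have mi: "integrable M (\<lambda>\<omega>. (1 / Ntot)\<^sup>2 * (op_norm n (mart T \<omega>))\<^sup>2)" using ms by (simp add: sq_int_def)
  show ei: "integrable M (\<lambda>\<omega>. (err \<omega>)\<^sup>2)"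
  proof (rule Bochner_Integration.integrable_bound[OF mi])
    show "AE \<omega> in M. norm ((err \<omega>)\<^sup>2) \<le> norm ((1 / Ntot)\<^sup>2 * (op_norm n (mart T \<omega>))\<^sup>2)"
      using err_le by eventually_elim simp
  qed (use errm in simp)
  define a where "a = op_norm n S"
  define e1 where "e1 = eps_one M n N S P T"
  define e2 where "e2 = eps_two M n N S P T"
  define L where "L = L_log N T"
  have a: "0 < a" unfolding a_def by (rule op_norm_S_pos)
  have e0: "0 \<le> e1" "0 \<le> e2" unfolding e1_def e2_def by (rule eps_nonneg)+
  \<comment> \<open>All batch sizes are at least 2, so every logarithm in the sum is positive, and
    there is at least one batch because the total sample size is positive.\<close>
  have Lp: "0 < L"
  proof -
    have "{1..T} \<noteq> {}" using pos by (intro notI) simp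
    then have "0 < (\<Sum>t=1..T. (ln (real (N t)))\<^sup>2)"
      using N2 ln_ge_half by (intro sum_pos) (force intro!: zero_less_power)+
    then show ?thesis by (simp add: L_def L_log_def)
  qed
  define A1 where "A1 = (\<Sum>t=1..T. real (N t) * (\<integral>\<omega>. rho t \<omega> \<partial>M))"
  define B1 where "B1 = (\<Sum>t=1..T. (ln (real (N t)))\<^sup>2 * (\<integral>\<omega>. R2 t \<omega> \<partial>M))"
  have A1: "A1 = a * Ntot * e1"
    using a Np unfolding e1_def eps_one_eq A1_def[symmetric] a_def[symmetric] Ntot_def[symmetric] by simp
  have B1: "B1 = e2\<^sup>2 * L\<^sup>2 * a\<^sup>2"
    using eps_two_sq_eq[OF Lp[unfolded L_def]] by (simp add: B1_def e2_def L_def a_def)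
  define X where "X = sqrt (8 * exp 1 * l / Ntot * e1)"
  define Z where "Z = 4 * (exp 1)\<^sup>2 * l * L / Ntot * e2"
  have XZ: "0 \<le> X" "0 \<le> Z" using l Np Lp e0 by (auto simp: X_def Z_def)
  \<comment> \<open>The constants \<open>8 * exp 1\<close> here and
    \<open>4 * (exp 1)\<^sup>2\<close> in \<open>Z2\<close> are larger than required; the estimates
    use that they are at least 1.\<close>
  have X2: "l * e1 / Ntot \<le> X\<^sup>2"
  proof -
    have "0 \<le> l * e1 / Ntot" using l e0 Np by simp
    then have "1 * (l * e1 / Ntot) \<le> (8 * exp 1) * (l * e1 / Ntot)"
      by (intro mult_right_mono) (use exp_ge_add_one_self[of 1] in auto)
    moreover have "X\<^sup>2 = 8 * exp 1 * l / Ntot * e1" unfolding X_def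
      by (rule real_sqrt_pow2) (use l e0 Np in auto)
    ultimately show ?thesis by (simp add: mult_ac)
  qed
  have Z2: "l\<^sup>2 * L\<^sup>2 * e2\<^sup>2 / Ntot\<^sup>2 \<le> Z\<^sup>2"
  proof -
    have "1 \<le> (4 * (exp 1 :: real)\<^sup>2)\<^sup>2"
    proof (intro one_le_power)
      have "1 \<le> (exp 1 :: real)\<^sup>2" by (rule one_le_power) simp
      then show "1 \<le> 4 * (exp 1 :: real)\<^sup>2" by linarith
    qed
    then have "1 * (l * L / Ntot * e2)\<^sup>2 \<le> (4 * (exp 1)\<^sup>2)\<^sup>2 * (l * L / Ntot * e2)\<^sup>2"
      by (rule mult_right_mono) simp
    then show ?thesis by (simp add: Z_def power_mult_distrib power_divide mult_ac)
  qed
  have "(\<integral>\<omega>. (err \<omega>)\<^sup>2 \<partial>M) \<le> (\<integral>\<omega>. (1 / Ntot)\<^sup>2 * (op_norm n (mart T \<omega>))\<^sup>2 \<partial>M)"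
    by (rule integral_mono_AE[OF ei mi err_le])
  also have "\<dots> = (1 / Ntot)\<^sup>2 * (\<integral>\<omega>. (op_norm n (mart T \<omega>))\<^sup>2 \<partial>M)" by simp
  also have "\<dots> \<le> (1 / Ntot)\<^sup>2 * (24 * l * (\<Sum>t=1..T. \<integral>\<omega>. (op_norm n (dev t \<omega>))\<^sup>2 \<partial>M))"
    unfolding l_def by (intro mult_left_mono mart_second_moment) simp
  also have "\<dots> \<le> (1 / Ntot)\<^sup>2 * (24 * l * (\<Sum>t=1..T. CB * (l * real (N t) * a * (\<integral>\<omega>. rho t \<omega> \<partial>M)
     + l\<^sup>2 * (ln (real (N t)))\<^sup>2 * (\<integral>\<omega>. R2 t \<omega> \<partial>M))))"
    using N2 l unfolding l_def a_def by (intro mult_left_mono sum_mono batch_dev) auto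
  also have "(\<Sum>t=1..T. CB * (l * real (N t) * a * (\<integral>\<omega>. rho t \<omega> \<partial>M) + l\<^sup>2 * (ln (real (N t)))\<^sup>2 * (\<integral>\<omega>. R2 t \<omega> \<partial>M)))
     = CB * (l * a * A1 + l\<^sup>2 * B1)"
    by (simp add: A1_def B1_def sum_distrib_left sum.distrib[symmetric] ring_distribs mult_ac)
  also have "(1 / Ntot)\<^sup>2 * (24 * l * (CB * (l * a * A1 + l\<^sup>2 * B1)))
     = 24 * CB * l * a\<^sup>2 * (l * e1 / Ntot + l\<^sup>2 * L\<^sup>2 * e2\<^sup>2 / Ntot\<^sup>2)"
    unfolding A1 B1 using Np by (simp add: field_simps power2_eq_square)
  also have "\<dots> \<le> 24 * CB * l * a\<^sup>2 * (X + Z)\<^sup>2"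
  proof (rule mult_left_mono)
    have "X\<^sup>2 + Z\<^sup>2 \<le> (X + Z)\<^sup>2" using XZ by (simp add: power2_sum)
    then show "l * e1 / Ntot + l\<^sup>2 * L\<^sup>2 * e2\<^sup>2 / Ntot\<^sup>2 \<le> (X + Z)\<^sup>2" using X2 Z2 by linarith
    show "0 \<le> 24 * CB * l * a\<^sup>2" using K4_pos Keta_pos l by (simp add: CB_def)
  qed
  also have "\<dots> \<le> 24 * CB * ln (real n + 1) * a\<^sup>2 * (X + Z)\<^sup>2"
    using K4_pos Keta_pos n3 unfolding l_def by (intro mult_right_mono mult_left_mono) (auto simp: CB_def)
  also have "\<dots> = (sqrt (24 * CB) * a * sqrt (ln (real n + 1)) * (X + Z))\<^sup>2"
    using K4_pos Keta_pos n3 by (simp add: power_mult_distrib CB_def)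
  finally have "sqrt (\<integral>\<omega>. (err \<omega>)\<^sup>2 \<partial>M) \<le> sqrt (24 * CB) * a * sqrt (ln (real n + 1)) * (X + Z)"
    using XZ a K4_pos Keta_pos n3 by (intro real_le_lsqrt) (auto simp: CB_def intro!: mult_nonneg_nonneg)
  then show "sqrt (\<integral>\<omega>. (err \<omega>)\<^sup>2 \<partial>M) \<le> sqrt (24 * CB) * op_norm n S * sqrt (ln (real n + 1)) *
            (sqrt (8 * exp 1 * ln (real n) / Ntot * eps_one M n N S P T)
             + 4 * (exp 1)\<^sup>2 * ln (real n) * L_log N T / Ntot * eps_two M n N S P T)"
    unfolding a_def X_def Z_def l_def e1_def e2_def L_def .
qed

end

theorem theorem3:
  fixes c\<^sub>0 :: real
  assumes "0 < c\<^sub>0"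
  shows "\<exists>C>0. \<forall>(M :: 'w measure) n N x X \<delta> P f \<alpha> T.
    cmcar M n N x X \<delta> P \<longrightarrow>
    (\<forall>t\<ge>1. AE \<omega> in M. \<forall>i<n. \<forall>j<n.
       P (t + 1) \<omega> i j = f t (cov_est n N (observed n \<delta> X) P t \<omega>) i j) \<longrightarrow>
    0 < \<alpha> \<longrightarrow>
    (\<forall>t\<ge>1. \<forall>i<n. \<forall>j<n. AE \<omega> in M. \<alpha> \<le> P t \<omega> i j) \<longrightarrow>
    sub_gaussian_assm M n x c\<^sub>0 \<longrightarrow>
    3 \<le> n \<longrightarrow>
    (exp 1)\<^sup>2 \<le> real (\<Sum>t=1..T. N t) \<longrightarrow>
    (\<forall>t\<in>{1..T}. 2 \<le> N t) \<longrightarrow>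
    (let Ntot = real (\<Sum>t=1..T. N t);
         S = cov_mat M x;
         err = (\<lambda>\<omega>. op_norm n (\<lambda>i j. cov_est n N (observed n \<delta> X) P T \<omega> i j - S i j))
     in integrable M (\<lambda>\<omega>. (err \<omega>)\<^sup>2) \<and>
        sqrt (\<integral>\<omega>. (err \<omega>)\<^sup>2 \<partial>M)
          \<le> C * op_norm n S * sqrt (ln (real n + 1)) *
            (sqrt (8 * exp 1 * ln (real n) / Ntot * eps_one M n N S P T)
             + 4 * (exp 1)\<^sup>2 * ln (real n) * L_log N T / Ntot * eps_two M n N S P T))"
proof -
  \<comment> \<open>This is \<open>sqrt (24 * CB)\<close> written out: \<open>CB\<close> belongs to
    a locale that can only be entered after \<open>M\<close>, \<open>n\<close> and the other
    parameters are fixed, while \<open>C\<close> may depend on \<open>c\<^sub>0\<close>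
    alone.\<close>
  define C where "C = sqrt (24 * (1152 * (16 / c\<^sub>0\<^sup>2) + 221187 * (272 / c\<^sub>0\<^sup>2)))"
  have "0 < C" unfolding C_def using assms by (intro real_sqrt_gt_zero mult_pos_pos add_pos_pos divide_pos_pos) auto
  show ?thesis
  proof (intro exI[of _ C] conjI allI impI)
    show "0 < C" by fact
  next
    fix M :: "'w measure" and n N x X \<delta> P and f :: "nat \<Rightarrow> rmat \<Rightarrow> rmat" and \<alpha> :: real and T
    assume cm: "cmcar M n N x X \<delta> P" and al: "0 < \<alpha>"
      and P: "\<forall>t\<ge>1. \<forall>i<n. \<forall>j<n. AE \<omega> in M. \<alpha> \<le> P t \<omega> i j"
      and sg: "sub_gaussian_assm M n x c\<^sub>0" and n: "3 \<le> n"
      and NT: "(exp 1)\<^sup>2 \<le> real (\<Sum>t=1..T. N t)" and N2: "\<forall>t\<in>{1..T}. 2 \<le> N t"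
    interpret cmcar M n N x X \<delta> P by (rule cm)
    interpret cmcar_sg M n N x X \<delta> P c\<^sub>0 \<alpha>
      using assms al P sg n by unfold_locales auto
    have "0 < real (\<Sum>t=1..T. N t)" by (rule less_le_trans[OF _ NT]) simp
    then have pos: "0 < (\<Sum>t=1..T. N t)" by (simp only: of_nat_0_less_iff)
    have C: "C = sqrt (24 * CB)" by (simp only: C_def CB_def K4_def Keta_def)
    show "let Ntot = real (\<Sum>t=1..T. N t);
         S = cov_mat M x;
         err = (\<lambda>\<omega>. op_norm n (\<lambda>i j. cov_est n N (observed n \<delta> X) P T \<omega> i j - S i j))
     in integrable M (\<lambda>\<omega>. (err \<omega>)\<^sup>2) \<and>
        sqrt (\<integral>\<omega>. (err \<omega>)\<^sup>2 \<partial>M)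
          \<le> C * op_norm n S * sqrt (ln (real n + 1)) *
            (sqrt (8 * exp 1 * ln (real n) / Ntot * eps_one M n N S P T)
             + 4 * (exp 1)\<^sup>2 * ln (real n) * L_log N T / Ntot * eps_two M n N S P T)"
      unfolding Let_def C using cov_est_error_bound[OF pos N2] by blast
  qed
qed

end
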